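(* Suppose there are two different involutive symmetries at $x$ on a symmetric normal strictly pseudoconvex partially integrable almost CR-structure of hypersurface type. Then the harmonic curvature vanishes at $x$.
   Context: Let $p+q=n\ge1$, $G=PSU(p+1,q+1)$ (the quotient of $SU(p+1,q+1)$ by its center), $\mathfrak g=\mathfrak{su}(p+1,q+1)$ with the contact grading $\mathfrak g=\mathfrak g_{-2}\oplus\dots\oplus\mathfrak g_2$ given by blocks of sizes $1,n,1$; explicitly elements of $\mathfrak g$ are $$\begin{pmatrix} a & Z & iz \\ X & A & -\mathbb IZ^* \\ ix & -X^*\mathbb I & -\bar a \end{pmatrix},$$ $x,z\in\mathbb R$, $a\in\mathbb C$, $X,Z^T\in\mathbb C^n$, $A\in\mathfrak u(p,q)$, $a+\mathrm{tr}A-\bar a=0$, where $\mathbb I$ is the diagonal matrix with $p$ entries $1$ followed by $q$ entries $-1$; $\mathfrak g_{-2},\mathfrak g_{-1},\mathfrak g_0,\mathfrak g_1,\mathfrak g_2$ correspond to $x$; $X$; $(a,A)$; $Z$; $z$. Let $P$ be the classes of block upper triangular matrices, $\mathfrak p=\mathfrak g_0\oplus\mathfrak g_1\oplus\mathfrak g_2$, $\mathfrak p_+=\mathfrak g_1\oplus\mathfrak g_2$, $\mathfrak g^{-1}=\mathfrak g_{-1}\oplus\mathfrak p$. A parabolic geometry of type $(G,P)$ is a principal $P$-bundle $p:\mathcal G\to M$ with a Cartan connection $\omega\in\Omega^1(\mathcal G,\mathfrak g)$. One has $TM\simeq\mathcal G\times_P\mathfrak g/\mathfrak p$; $T^{-1}M:=\mathcal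 G\times_P\mathfrak g^{-1}/\mathfrak p$ has corank one. The geometry is regular if the Levi bracket $\mathcal L:T^{-1}M\times T^{-1}M\to TM/T^{-1}M$ induced by the Lie bracket of vector fields corresponds to $[\,,]:\mathfrak g_{-1}\times\mathfrak g_{-1}\to\mathfrak g_{-2}$. A (non-degenerate) partially integrable almost CR-structure of hypersurface type is (the structure underlying) a regular geometry of this type: a contact distribution $T^{-1}M$ with a complex structure $J$ such that $\mathcal L(J\xi,J\eta)=\mathcal L(\xi,\eta)$. The geometry is assumed oriented. It is strictly pseudoconvex if the symmetric form $\mathcal L(\,\cdot\,,J\,\cdot\,)$ (with $TM/T^{-1}M$ identified locally with $\mathbb R$) is definite, i.e. $p=0$ or $q=0$. Curvature. The curvature function $\kappa:\mathcal G\to\wedge^2(\mathfrak g/\mathfrak p)^*\otimes\mathfrak g$ represents $d\omega+\frac12[\omega,\omega]$. The geometry is normal if $\partial^*\circ\kappa=0$, where $\partial^*$ is the differential of the standard complex computing the Lie algebra homology of $\mathfrak p_+\cong(\mathfrak g/\mathfrak p)^*$ with coefficients in $\mathfrak g$; the harmonic curvature is then the composition of $\kappa$ with $\ker(\partial^* )\to\ker(\partial^* )/\mathrm{im}(\partial^* )$. Symmetries. A symmetry at $x$ is a locally defined diffeomorphism $s_x$ of $M$ with $s_x(x)=x$, $T_xs_x=-\mathrm{id}$ on $T_x^{-1}M$, which is the base map of a locally defined automorphism $\varphi$ ($P$-bundle morphism with $\varphi^*\omega=\omega$). The geometry is symmetric if there is a symmetry at each point. $s_x$ is involutive if $s_x\circ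 s_x=\mathrm{id}$. Local symmetries are considered up to restriction to smaller neighborhoods of $x$; "different" means different germs at $x$. *)

theory Defs
  imports "HOL-Analysis.Analysis" "HOL-Algebra.Coset"
begin

section \<open>Smooth manifolds\<close>

text \<open>Both predicates below are meant for open \<open>S\<close>.\<close>

primrec Ck_on :: "nat \<Rightarrow> 'a::real_normed_vector set \<Rightarrow> ('a \<Rightarrow> 'b::real_normed_vector) \<Rightarrow> bool" where
  "Ck_on 0 S f \<longleftrightarrow> continuous_on S f"
| "Ck_on (Suc k) S f \<longleftrightarrow> (\<forall>x\<in>S. f differentiable (at x)) \<and>
     (\<forall>v. Ck_on k S (\<lambda>x. frechet_derivative f (at x) v))"

definition smooth_on :: "'a::real_normed_vector set \<Rightarrow> ('a \<Rightarrow> 'b::real_normed_vector) \<Rightarrow> bool" where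
  "smooth_on S f \<longleftrightarrow> (\<forall>k. Ck_on k S f)"

text \<open>A chart is a pair of an open domain \<open>U\<close> and a map \<open>\<phi>\<close>, of which only the values on \<open>U\<close> matter.
  The manifold is the whole (Hausdorff, second countable) type \<open>'m\<close>.\<close>

type_synonym ('m, 'e) atlas = "('m set \<times> ('m \<Rightarrow> 'e)) set"

definition smooth_atlas ::
  "('m::{t2_space,second_countable_topology}, 'e::euclidean_space) atlas \<Rightarrow> bool" where
  "smooth_atlas A \<longleftrightarrow>
     (\<Union>(U, \<phi>)\<in>A. U) = UNIV \<and>
     (\<forall>(U, \<phi>)\<in>A. open U \<and> open (\<phi> ` U) \<and> homeomorphism U (\<phi> ` U) \<phi> (inv_into U \<phi>)) \<and>
     (\<forall>(U, \<phi>)\<in>A. \<forall>(V, \<psi>)\<in>A. smooth_on (\<phi> ` (U \<inter> V)) (\<psi> \<circ> inv_into U \<phi>))"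

definition eucl :: "('e::euclidean_space, 'e) atlas" where
  "eucl = {(UNIV, id)}"

definition prod_atlas :: "('m, 'e) atlas \<Rightarrow> ('n, 'f) atlas \<Rightarrow> ('m \<times> 'n, 'e \<times> 'f) atlas" where
  "prod_atlas A B = {(U \<times> V, map_prod \<phi> \<psi>) | U \<phi> V \<psi>. (U, \<phi>) \<in> A \<and> (V, \<psi>) \<in> B}"

text \<open>Smoothness on an open set \<open>W\<close>, and, for an arbitrary subset \<open>S\<close>, existence of local smooth
  extensions; on an embedded submanifold \<open>S\<close> the latter is smoothness with respect to the
  submanifold structure.\<close>

definition smooth_map :: "('m::topological_space, 'e::euclidean_space) atlas \<Rightarrow>
    ('n::topological_space, 'f::euclidean_space) atlas \<Rightarrow> 'm set \<Rightarrow> ('m \<Rightarrow> 'n) \<Rightarrow> bool" where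
  "smooth_map A B W f \<longleftrightarrow> continuous_on W f \<and>
     (\<forall>(U, \<phi>)\<in>A. \<forall>(V, \<psi>)\<in>B. smooth_on (\<phi> ` (U \<inter> W \<inter> f -` V)) (\<psi> \<circ> f \<circ> inv_into U \<phi>))"

definition smooth_map_subset :: "('m::topological_space, 'e::euclidean_space) atlas \<Rightarrow>
    ('n::topological_space, 'f::euclidean_space) atlas \<Rightarrow> 'm set \<Rightarrow> ('m \<Rightarrow> 'n) \<Rightarrow> bool" where
  "smooth_map_subset A B S f \<longleftrightarrow>
     (\<forall>x\<in>S. \<exists>W F. open W \<and> x \<in> W \<and> smooth_map A B W F \<and> (\<forall>y\<in>W \<inter> S. F y = f y))"

definition smooth_fun_at :: "('m::topological_space, 'e::euclidean_space) atlas \<Rightarrow> 'm \<Rightarrow>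
    ('m \<Rightarrow> real) \<Rightarrow> bool" where
  "smooth_fun_at A x f \<longleftrightarrow> (\<exists>W. open W \<and> x \<in> W \<and> smooth_map A eucl W f)"

text \<open>A tangent vector at \<open>x\<close> is a directional derivative in a chart around \<open>x\<close>, regarded as an
  operator on the functions that are smooth near \<open>x\<close>. Its value on all other functions is
  set to 0, so that equal tangent vectors are equal as HOL functions.\<close>

type_synonym 'm tvec = "('m \<Rightarrow> real) \<Rightarrow> real"

definition coord_vec :: "('m::topological_space, 'e::euclidean_space) atlas \<Rightarrow>
    'm set \<times> ('m \<Rightarrow> 'e) \<Rightarrow> 'm \<Rightarrow> 'e \<Rightarrow> 'm tvec" where
  "coord_vec A c x v = (\<lambda>f. if smooth_fun_at A x f
     then frechet_derivative (f \<circ> inv_into (fst c) (snd c)) (at (snd c x)) v else 0)"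

definition tangent_space :: "('m::topological_space, 'e::euclidean_space) atlas \<Rightarrow> 'm \<Rightarrow> 'm tvec set" where
  "tangent_space A x = {coord_vec A c x v | c v. c \<in> A \<and> x \<in> fst c}"

definition pushforward :: "('n::topological_space, 'f::euclidean_space) atlas \<Rightarrow>
    ('m \<Rightarrow> 'n) \<Rightarrow> 'm \<Rightarrow> 'm tvec \<Rightarrow> 'n tvec" where
  "pushforward B f x v = (\<lambda>h. if smooth_fun_at B (f x) h then v (h \<circ> f) else 0)"

definition velocity :: "('m::topological_space, 'e::euclidean_space) atlas \<Rightarrow> (real \<Rightarrow> 'm) \<Rightarrow> 'm tvec" where
  "velocity A c = (\<lambda>f. if smooth_fun_at A (c 0) f then deriv (\<lambda>t. f (c t)) 0 else 0)"

definition linear_on_tangent :: "('m::topological_space, 'e::euclidean_space) atlas \<Rightarrow> 'm \<Rightarrow>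
    ('m tvec \<Rightarrow> 'b::real_vector) \<Rightarrow> bool" where
  "linear_on_tangent A x \<theta> \<longleftrightarrow> (\<forall>v\<in>tangent_space A x. \<forall>w\<in>tangent_space A x. \<forall>a b.
     \<theta> (\<lambda>f. a * v f + b * w f) = a *\<^sub>R \<theta> v + b *\<^sub>R \<theta> w)"

definition vector_field :: "('m::topological_space, 'e::euclidean_space) atlas \<Rightarrow> 'm set \<Rightarrow>
    ('m \<Rightarrow> 'm tvec) \<Rightarrow> bool" where
  "vector_field A W \<xi> \<longleftrightarrow> open W \<and> (\<forall>y\<in>W. \<xi> y \<in> tangent_space A y) \<and>
     (\<forall>V f. open V \<and> V \<subseteq> W \<and> smooth_map A eucl V f \<longrightarrow> smooth_map A eucl V (\<lambda>y. \<xi> y f))"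

definition lie_bracket :: "('m::topological_space, 'e::euclidean_space) atlas \<Rightarrow>
    ('m \<Rightarrow> 'm tvec) \<Rightarrow> ('m \<Rightarrow> 'm tvec) \<Rightarrow> 'm \<Rightarrow> 'm tvec" where
  "lie_bracket A \<xi> \<eta> x = (\<lambda>f. if smooth_fun_at A x f
     then \<xi> x (\<lambda>y. \<eta> y f) - \<eta> x (\<lambda>y. \<xi> y f) else 0)"

definition deriv_along :: "'m tvec \<Rightarrow> ('m \<Rightarrow> 'b::euclidean_space) \<Rightarrow> 'b" where
  "deriv_along v F = (\<Sum>b\<in>Basis. v (\<lambda>y. F y \<bullet> b) *\<^sub>R b)"

definition ext_deriv :: "('m::topological_space, 'e::euclidean_space) atlas \<Rightarrow>
    ('m \<Rightarrow> 'm tvec \<Rightarrow> 'b::euclidean_space) \<Rightarrow>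
    ('m \<Rightarrow> 'm tvec) \<Rightarrow> ('m \<Rightarrow> 'm tvec) \<Rightarrow> 'm \<Rightarrow> 'b" where
  "ext_deriv A \<omega> \<xi> \<eta> x =
     deriv_along (\<xi> x) (\<lambda>y. \<omega> y (\<eta> y)) - deriv_along (\<eta> x) (\<lambda>y. \<omega> y (\<xi> y))
     - \<omega> x (lie_bracket A \<xi> \<eta> x)"


section \<open>The group PSU(p+1,q+1), its parabolic subgroup, and the contact grading\<close>

text \<open>Index type for block matrices with blocks of sizes \<open>1, n, 1\<close>, where \<open>n = CARD('n)\<close>.\<close>

datatype 'n bidx = BFst | BMid 'n | BLst

lemma UNIV_bidx: "(UNIV :: 'n bidx set) = insert BFst (insert BLst (range BMid))"
  by (auto, metis bidx.exhaust rangeI)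

instance bidx :: (finite) finite
  by standard (simp add: UNIV_bidx)

type_synonym 'n bmat = "((complex, 'n bidx) vec, 'n bidx) vec"

definition hadj :: "complex^'k^'k \<Rightarrow> complex^'k^'k" where
  "hadj A = (\<chi> i j. cnj (A $ j $ i))"

definition mbracket :: "complex^'k^'k \<Rightarrow> complex^'k^'k \<Rightarrow> complex^'k^'k" where
  "mbracket A B = A ** B - B ** A"

definition mexp :: "complex^'k^'k \<Rightarrow> complex^'k^'k" where
  "mexp A = (\<Sum>k. (1 / fact k) *\<^sub>R (((**) A) ^^ k) (mat 1))"

text \<open>The diagonal entries of the matrix with \<open>p\<close> entries \<open>1\<close> followed by \<open>q = n - p\<close> entries \<open>-1\<close>.\<close>

definition sgn_entry :: "nat \<Rightarrow> 'n::{finite,linorder} \<Rightarrow> complex" where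
  "sgn_entry p k = (if card {m. m < k} < p then 1 else -1)"

text \<open>The Hermitian form of signature \<open>(p+1,q+1)\<close> whose Lie algebra of skew endomorphisms has the
  block form recorded in \<open>su_iff_block_form\<close> below.\<close>

definition hform :: "nat \<Rightarrow> 'n::{finite,linorder} bmat" where
  "hform p = (\<chi> i j. case (i, j) of
      (BFst, BLst) \<Rightarrow> 1
    | (BLst, BFst) \<Rightarrow> 1
    | (BMid k, BMid l) \<Rightarrow> (if k = l then sgn_entry p k else 0)
    | _ \<Rightarrow> 0)"

definition su :: "nat \<Rightarrow> 'n::{finite,linorder} bmat set" where
  "su p = {X. hadj X ** hform p + hform p ** X = 0 \<and> trace X = 0}"

lemma sum_bidx:
  fixes f :: "'n::finite bidx \<Rightarrow> 'a::comm_monoid_add"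
  shows "sum f UNIV = f BFst + f BLst + (\<Sum>k\<in>UNIV. f (BMid k))"
proof -
  have "sum f UNIV = f BFst + (f BLst + sum f (range BMid))"
    unfolding UNIV_bidx by (subst sum.insert | force)+
  also have "sum f (range BMid) = (\<Sum>k\<in>UNIV. f (BMid k))"
    by (subst sum.reindex) (auto simp: inj_on_def)
  finally show ?thesis by (simp add: add.assoc)
qed

lemma all_bidx: "(\<forall>i. Q i) \<longleftrightarrow> Q BFst \<and> Q BLst \<and> (\<forall>k. Q (BMid k))"
  by (metis bidx.exhaust)

lemma su_iff_block_form:
  fixes X :: "'n::{finite,linorder} bmat"
  shows "X \<in> su p \<longleftrightarrow>
     X $ BLst $ BLst = - cnj (X $ BFst $ BFst) \<and>
     Re (X $ BFst $ BLst) = 0 \<and> Re (X $ BLst $ BFst) = 0 \<and>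
     (\<forall>k. X $ BLst $ BMid k = - cnj (X $ BMid k $ BFst) * sgn_entry p k) \<and>
     (\<forall>k. X $ BMid k $ BLst = - sgn_entry p k * cnj (X $ BFst $ BMid k)) \<and>
     (\<forall>k l. cnj (X $ BMid l $ BMid k) * sgn_entry p l + sgn_entry p k * X $ BMid k $ BMid l = 0) \<and>
     X $ BFst $ BFst + (\<Sum>k\<in>UNIV. X $ BMid k $ BMid k) - cnj (X $ BFst $ BFst) = 0"
proof -
  have s: "sgn_entry p k = 1 \<or> sgn_entry p k = -1" for k :: 'n
    by (simp add: sgn_entry_def)
  have L: "(hadj X ** hform p) $ i $ j = (case j of BFst \<Rightarrow> cnj (X $ BLst $ i)
      | BLst \<Rightarrow> cnj (X $ BFst $ i) | BMid l \<Rightarrow> cnj (X $ BMid l $ i) * sgn_entry p l)" for i j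
    by (cases j) (simp_all add: matrix_matrix_mult_def hadj_def hform_def sum_bidx if_distrib
        cong: if_cong)
  have R: "(hform p ** X) $ i $ j = (case i of BFst \<Rightarrow> X $ BLst $ j
      | BLst \<Rightarrow> X $ BFst $ j | BMid l \<Rightarrow> sgn_entry p l * X $ BMid l $ j)" for i j
    by (cases i) (simp_all add: matrix_matrix_mult_def hform_def sum_bidx if_distrib if_distribR
        cong: if_cong)
  have A: "hadj X ** hform p + hform p ** X = 0 \<longleftrightarrow>
     X $ BLst $ BLst = - cnj (X $ BFst $ BFst) \<and>
     Re (X $ BFst $ BLst) = 0 \<and> Re (X $ BLst $ BFst) = 0 \<and>
     (\<forall>k. X $ BLst $ BMid k = - cnj (X $ BMid k $ BFst) * sgn_entry p k) \<and>
     (\<forall>k. X $ BMid k $ BLst = - sgn_entry p k * cnj (X $ BFst $ BMid k)) \<and>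
     (\<forall>k l. cnj (X $ BMid l $ BMid k) * sgn_entry p l + sgn_entry p k * X $ BMid k $ BMid l = 0)"
    (is "?a \<longleftrightarrow> ?b")
  proof -
    have "?a \<longleftrightarrow> (\<forall>i j. (hadj X ** hform p) $ i $ j + (hform p ** X) $ i $ j = 0)"
      by (simp add: vec_eq_iff)
    also have "\<dots> \<longleftrightarrow>
       cnj (X $ BLst $ BFst) + X $ BLst $ BFst = 0 \<and> cnj (X $ BFst $ BLst) + X $ BFst $ BLst = 0 \<and>
       cnj (X $ BFst $ BFst) + X $ BLst $ BLst = 0 \<and> cnj (X $ BLst $ BLst) + X $ BFst $ BFst = 0 \<and>
       (\<forall>k. cnj (X $ BMid k $ BFst) * sgn_entry p k + X $ BLst $ BMid k = 0) \<and>
       (\<forall>k. cnj (X $ BMid k $ BLst) * sgn_entry p k + X $ BFst $ BMid k = 0) \<and>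
       (\<forall>k. cnj (X $ BLst $ BMid k) + sgn_entry p k * X $ BMid k $ BFst = 0) \<and>
       (\<forall>k. cnj (X $ BFst $ BMid k) + sgn_entry p k * X $ BMid k $ BLst = 0) \<and>
       (\<forall>k l. cnj (X $ BMid l $ BMid k) * sgn_entry p l + sgn_entry p k * X $ BMid k $ BMid l = 0)"
      unfolding L R all_bidx by auto
    also have "\<dots> \<longleftrightarrow> ?b"
    proof -
      have c: "cnj z + z = 0 \<longleftrightarrow> Re z = 0" for z
        by (auto simp: complex_eq_iff)
      have c1: "cnj a + b = 0 \<longleftrightarrow> b = - cnj a" for a b
        by (auto simp: complex_eq_iff)
      have c2: "cnj b + a = 0 \<longleftrightarrow> b = - cnj a" for a b
        by (auto simp: complex_eq_iff)
      have c3: "cnj a * sgn_entry p k + b = 0 \<longleftrightarrow> b = - cnj a * sgn_entry p k" for a b and k :: 'n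
        by (metis add_eq_0_iff mult_minus_left)
      have c4: "cnj b * sgn_entry p k + a = 0 \<longleftrightarrow> b = - sgn_entry p k * cnj a" for a b and k :: 'n
        using s[of k] by (auto simp: complex_eq_iff)
      have c5: "cnj b + sgn_entry p k * a = 0 \<longleftrightarrow> b = - cnj a * sgn_entry p k" for a b and k :: 'n
        using s[of k] by (auto simp: complex_eq_iff)
      have c6: "cnj a + sgn_entry p k * b = 0 \<longleftrightarrow> b = - sgn_entry p k * cnj a" for a b and k :: 'n
        using s[of k] by (auto simp: complex_eq_iff)
      show ?thesis
        unfolding c c1[of "X $ BFst $ BFst"] c2[of "X $ BLst $ BLst"] c3[of "X $ BMid _ $ BFst"]
          c4[of "X $ BMid _ $ BLst"] c5[of "X $ BLst $ BMid _"] c6[of "X $ BFst $ BMid _"]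
        by blast
    qed
    finally show ?thesis .
  qed
  have T: "trace X = X $ BFst $ BFst + X $ BLst $ BLst + (\<Sum>k\<in>UNIV. X $ BMid k $ BMid k)"
    by (simp add: trace_def sum_bidx)
  show ?thesis
    unfolding su_def mem_Collect_eq A T by (auto simp: algebra_simps)
qed

definition SU :: "nat \<Rightarrow> 'n::{finite,linorder} bmat monoid" where
  "SU p = \<lparr>carrier = {g. hadj g ** hform p ** g = hform p \<and> det g = 1}, mult = (**), one = mat 1\<rparr>"

definition centre :: "('a, 'b) monoid_scheme \<Rightarrow> 'a set" where
  "centre G = {z \<in> carrier G. \<forall>g\<in>carrier G. z \<otimes>\<^bsub>G\<^esub> g = g \<otimes>\<^bsub>G\<^esub> z}"

definition PSU :: "nat \<Rightarrow> 'n::{finite,linorder} bmat set monoid" where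
  "PSU p = SU p Mod centre (SU p)"

definition cls :: "nat \<Rightarrow> 'n::{finite,linorder} bmat \<Rightarrow> 'n bmat set" where
  "cls p g = centre (SU p) #>\<^bsub>SU p\<^esub> g"

primrec blk :: "'n bidx \<Rightarrow> int" where
  "blk BFst = 0"
| "blk (BMid k) = 1"
| "blk BLst = 2"

definition block_upper :: "'n::finite bmat \<Rightarrow> bool" where
  "block_upper g \<longleftrightarrow> (\<forall>i j. blk j < blk i \<longrightarrow> g $ i $ j = 0)"

definition Ptilde :: "nat \<Rightarrow> 'n::{finite,linorder} bmat set" where
  "Ptilde p = {g \<in> carrier (SU p). block_upper g}"

definition Pgrp :: "nat \<Rightarrow> 'n::{finite,linorder} bmat set set" where
  "Pgrp p = cls p ` Ptilde p"

text \<open>The grading components and the associated filtration; \<open>\<pp> = gfilt p 0\<close> and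
  \<open>\<pp>\<^sub>+ = gfilt p 1\<close>.\<close>

definition grad :: "nat \<Rightarrow> int \<Rightarrow> 'n::{finite,linorder} bmat set" where
  "grad p k = {X \<in> su p. \<forall>i j. X $ i $ j \<noteq> 0 \<longrightarrow> blk j - blk i = k}"

definition gfilt :: "nat \<Rightarrow> int \<Rightarrow> 'n::{finite,linorder} bmat set" where
  "gfilt p k = {X \<in> su p. \<forall>i j. X $ i $ j \<noteq> 0 \<longrightarrow> blk j - blk i \<ge> k}"

text \<open>Multiplication by \<open>\<i>\<close> on \<open>\<gg>\<^sub>-\<^sub>1 \<cong> \<complex>\<^sup>n\<close>; the lower right block \<open>-X\<^sup>*\<I>\<close> is conjugate linear in \<open>X\<close>.\<close>

definition Jmodel :: "'n::finite bmat \<Rightarrow> 'n bmat" where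
  "Jmodel X = (\<chi> i j. case (i, j) of
      (BMid k, BFst) \<Rightarrow> \<i> * X $ i $ j
    | (BLst, BMid k) \<Rightarrow> - \<i> * X $ i $ j
    | _ \<Rightarrow> 0)"


section \<open>Parabolic geometries of type (PSU(p+1,q+1), P)\<close>

record ('m, 'e, 'g, 'f, 'n) cartan_data =
  base_atlas :: "('m, 'e) atlas"
  total_atlas :: "('g, 'f) atlas"
  bproj :: "'g \<Rightarrow> 'm"
  ract :: "'g \<Rightarrow> 'n bmat set \<Rightarrow> 'g"
  conn :: "'g \<Rightarrow> 'g tvec \<Rightarrow> 'n bmat"

text \<open>Smoothness with respect to \<open>P\<close> is expressed through the finite covering of \<open>P\<close> by the closed matrix
  group \<open>Ptilde p\<close>: maps out of \<open>P\<close> are composed with the covering, maps into \<open>P\<close> are lifted locally.\<close>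

definition local_triv :: "nat \<Rightarrow>
    ('m::topological_space, 'e::euclidean_space, 'g::topological_space, 'f::euclidean_space,
     'n::{finite,linorder}) cartan_data \<Rightarrow> 'm set \<Rightarrow> ('m \<times> 'n bmat set \<Rightarrow> 'g) \<Rightarrow> bool" where
  "local_triv p \<Gamma> U \<tau> \<longleftrightarrow>
     bij_betw \<tau> (U \<times> Pgrp p) (bproj \<Gamma> -` U) \<and>
     (\<forall>y\<in>U. \<forall>C\<in>Pgrp p. bproj \<Gamma> (\<tau> (y, C)) = y \<and>
        (\<forall>D\<in>Pgrp p. ract \<Gamma> (\<tau> (y, C)) D = \<tau> (y, C \<otimes>\<^bsub>PSU p\<^esub> D))) \<and>
     smooth_map_subset (prod_atlas (base_atlas \<Gamma>) eucl) (total_atlas \<Gamma>) (U \<times> Ptilde p)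
       (\<lambda>(y, g). \<tau> (y, cls p g)) \<and>
     (\<forall>u\<in>bproj \<Gamma> -` U. \<exists>W \<gamma>. open W \<and> u \<in> W \<and> smooth_map (total_atlas \<Gamma>) eucl W \<gamma> \<and>
        (\<forall>w\<in>W \<inter> bproj \<Gamma> -` U. \<gamma> w \<in> Ptilde p \<and> \<tau> (bproj \<Gamma> w, cls p (\<gamma> w)) = w))"

definition principal_bundle :: "nat \<Rightarrow>
    ('m::{t2_space,second_countable_topology}, 'e::euclidean_space,
     'g::{t2_space,second_countable_topology}, 'f::euclidean_space,
     'n::{finite,linorder}) cartan_data \<Rightarrow> bool" where
  "principal_bundle p \<Gamma> \<longleftrightarrow>
     smooth_atlas (base_atlas \<Gamma>) \<and> smooth_atlas (total_atlas \<Gamma>) \<and>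
     smooth_map (total_atlas \<Gamma>) (base_atlas \<Gamma>) UNIV (bproj \<Gamma>) \<and>
     (\<forall>u. ract \<Gamma> u \<one>\<^bsub>PSU p\<^esub> = u) \<and>
     (\<forall>u. \<forall>C\<in>Pgrp p. \<forall>D\<in>Pgrp p. ract \<Gamma> (ract \<Gamma> u C) D = ract \<Gamma> u (C \<otimes>\<^bsub>PSU p\<^esub> D)) \<and>
     (\<forall>x. \<exists>U \<tau>. open U \<and> x \<in> U \<and> local_triv p \<Gamma> U \<tau>)"

definition cartan_connection :: "nat \<Rightarrow>
    ('m::topological_space, 'e::euclidean_space, 'g::topological_space, 'f::euclidean_space,
     'n::{finite,linorder}) cartan_data \<Rightarrow> bool" where
  "cartan_connection p \<Gamma> \<longleftrightarrow>
     (\<forall>W \<xi>. vector_field (total_atlas \<Gamma>) W \<xi> \<longrightarrow>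
        smooth_map (total_atlas \<Gamma>) eucl W (\<lambda>u. conn \<Gamma> u (\<xi> u))) \<and>
     (\<forall>u. linear_on_tangent (total_atlas \<Gamma>) u (conn \<Gamma> u) \<and>
        bij_betw (conn \<Gamma> u) (tangent_space (total_atlas \<Gamma>) u) (su p)) \<and>
     (\<forall>g\<in>Ptilde p. \<forall>u. \<forall>v\<in>tangent_space (total_atlas \<Gamma>) u.
        conn \<Gamma> (ract \<Gamma> u (cls p g))
          (pushforward (total_atlas \<Gamma>) (\<lambda>w. ract \<Gamma> w (cls p g)) u v)
        = matrix_inv g ** conn \<Gamma> u v ** g) \<and>
     (\<forall>A\<in>gfilt p 0. \<forall>u.
        conn \<Gamma> u (velocity (total_atlas \<Gamma>) (\<lambda>t. ract \<Gamma> u (cls p (mexp (t *\<^sub>R A))))) = A)"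

definition parabolic_geometry :: "nat \<Rightarrow>
    ('m::{t2_space,second_countable_topology}, 'e::euclidean_space,
     'g::{t2_space,second_countable_topology}, 'f::euclidean_space,
     'n::{finite,linorder}) cartan_data \<Rightarrow> bool" where
  "parabolic_geometry p \<Gamma> \<longleftrightarrow> principal_bundle p \<Gamma> \<and> cartan_connection p \<Gamma>"

definition const_field ::
  "('m, 'e, 'g::topological_space, 'f::euclidean_space, 'n::{finite,linorder}) cartan_data \<Rightarrow>
    'n bmat \<Rightarrow> 'g \<Rightarrow> 'g tvec" where
  "const_field \<Gamma> X u = inv_into (tangent_space (total_atlas \<Gamma>) u) (conn \<Gamma> u) X"

text \<open>The map \<open>\<gg> \<rightarrow> T\<^sub>xM\<close> determined by a point \<open>u\<close> over \<open>x\<close>, which induces \<open>TM \<cong> \<G> \<times>\<^sub>P \<gg>/\<pp>\<close>.\<close>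

definition frame :: "('m::topological_space, 'e::euclidean_space, 'g::topological_space,
     'f::euclidean_space, 'n::{finite,linorder}) cartan_data \<Rightarrow> 'g \<Rightarrow> 'n bmat \<Rightarrow> 'm tvec" where
  "frame \<Gamma> u X = pushforward (base_atlas \<Gamma>) (bproj \<Gamma>) u (const_field \<Gamma> X u)"

definition contact :: "nat \<Rightarrow> ('m::topological_space, 'e::euclidean_space, 'g::topological_space,
     'f::euclidean_space, 'n::{finite,linorder}) cartan_data \<Rightarrow> 'm \<Rightarrow> 'm tvec set" where
  "contact p \<Gamma> x = {frame \<Gamma> u X | u X. bproj \<Gamma> u = x \<and> X \<in> gfilt p (-1)}"


section \<open>Regularity and strict pseudoconvexity\<close>

text \<open>\<open>levi p \<Gamma> x v w z\<close>: the tangent vector \<open>z\<close> represents the Levi bracket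
  of \<open>v, w \<in> T\<^sup>-\<^sup>1\<^sub>xM\<close> in \<open>T\<^sub>xM / T\<^sup>-\<^sup>1\<^sub>xM\<close>.\<close>

definition levi :: "nat \<Rightarrow> ('m::topological_space, 'e::euclidean_space, 'g::topological_space,
     'f::euclidean_space, 'n::{finite,linorder}) cartan_data \<Rightarrow>
     'm \<Rightarrow> 'm tvec \<Rightarrow> 'm tvec \<Rightarrow> 'm tvec \<Rightarrow> bool" where
  "levi p \<Gamma> x v w z \<longleftrightarrow> (\<exists>W \<xi> \<eta>. x \<in> W \<and>
     vector_field (base_atlas \<Gamma>) W \<xi> \<and> vector_field (base_atlas \<Gamma>) W \<eta> \<and>
     (\<forall>y\<in>W. \<xi> y \<in> contact p \<Gamma> y \<and> \<eta> y \<in> contact p \<Gamma> y) \<and>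
     \<xi> x = v \<and> \<eta> x = w \<and> z = lie_bracket (base_atlas \<Gamma>) \<xi> \<eta> x)"

definition regular_geometry :: "nat \<Rightarrow> ('m::topological_space, 'e::euclidean_space,
     'g::topological_space, 'f::euclidean_space, 'n::{finite,linorder}) cartan_data \<Rightarrow> bool" where
  "regular_geometry p \<Gamma> \<longleftrightarrow> (\<forall>u. \<forall>X\<in>grad p (-1). \<forall>Y\<in>grad p (-1). \<forall>z.
     levi p \<Gamma> (bproj \<Gamma> u) (frame \<Gamma> u X) (frame \<Gamma> u Y) z \<longrightarrow>
     (\<exists>V\<in>gfilt p (-1). z = frame \<Gamma> u (mbracket X Y + V)))"

text \<open>The complex structure \<open>J\<close> on \<open>T\<^sup>-\<^sup>1M\<close> maps \<open>frame \<Gamma> u X\<close> to \<open>frame \<Gamma> u (Jmodel X)\<close>. The functional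
  \<open>\<theta>\<close> identifies \<open>T\<^sub>xM / T\<^sup>-\<^sup>1\<^sub>xM\<close> with the reals; since its sign is free, positivity amounts to
  definiteness.\<close>

definition strictly_pseudoconvex :: "nat \<Rightarrow> ('m::topological_space, 'e::euclidean_space,
     'g::topological_space, 'f::euclidean_space, 'n::{finite,linorder}) cartan_data \<Rightarrow> bool" where
  "strictly_pseudoconvex p \<Gamma> \<longleftrightarrow> (\<forall>x. \<exists>\<theta> :: 'm tvec \<Rightarrow> real.
     linear_on_tangent (base_atlas \<Gamma>) x \<theta> \<and>
     {v \<in> tangent_space (base_atlas \<Gamma>) x. \<theta> v = 0} = contact p \<Gamma> x \<and>
     (\<forall>u X z. bproj \<Gamma> u = x \<and> X \<in> grad p (-1) \<and> X \<noteq> 0 \<and>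
        levi p \<Gamma> x (frame \<Gamma> u X) (frame \<Gamma> u (Jmodel X)) z \<longrightarrow> \<theta> z > 0))"


section \<open>Curvature, normality and harmonic curvature\<close>

text \<open>Elements of \<open>\<Lambda>\<^sup>k(\<gg>/\<pp>)\<^sup>* \<otimes> \<gg>\<close> are alternating multilinear maps on \<open>\<gg>\<close> vanishing upon insertion of
  an element of \<open>\<pp>\<close>. As HOL functions they are defined on all matrices and are taken to be 0
  outside \<open>\<gg> = su p\<close>.\<close>

definition curvature :: "nat \<Rightarrow> ('m, 'e, 'g::topological_space, 'f::euclidean_space,
     'n::{finite,linorder}) cartan_data \<Rightarrow> 'g \<Rightarrow> 'n bmat \<Rightarrow> 'n bmat \<Rightarrow> 'n bmat" where
  "curvature p \<Gamma> u X Y = (if X \<in> su p \<and> Y \<in> su p then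
     ext_deriv (total_atlas \<Gamma>) (conn \<Gamma>) (const_field \<Gamma> X) (const_field \<Gamma> Y) u
     + mbracket (conn \<Gamma> u (const_field \<Gamma> X u)) (conn \<Gamma> u (const_field \<Gamma> Y u)) else 0)"

text \<open>The Killing form of \<open>su p\<close>, which induces \<open>\<pp>\<^sub>+ \<cong> (\<gg>/\<pp>)\<^sup>*\<close>.\<close>

definition killing :: "'n::finite bmat \<Rightarrow> 'n bmat \<Rightarrow> real" where
  "killing X Y = 2 * real CARD('n bidx) * Re (trace (X ** Y))"

text \<open>Chains in \<open>\<Lambda>\<^sup>k\<pp>\<^sub>+ \<otimes> \<gg>\<close> are represented by lists of decomposables
  \<open>Z\<^sub>1 \<and> \<dots> \<and> Z\<^sub>k \<otimes> A\<close>; \<open>form1 p\<close> and \<open>form2 p\<close> send a list to the form represented by its sum.\<close>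

definition chains2 :: "nat \<Rightarrow> ('n::{finite,linorder} bmat \<times> 'n bmat \<times> 'n bmat) list set" where
  "chains2 p = {c. set c \<subseteq> gfilt p 1 \<times> gfilt p 1 \<times> su p}"

definition chains3 :: "nat \<Rightarrow> ('n::{finite,linorder} bmat \<times> 'n bmat \<times> 'n bmat \<times> 'n bmat) list set" where
  "chains3 p = {c. set c \<subseteq> gfilt p 1 \<times> gfilt p 1 \<times> gfilt p 1 \<times> su p}"

definition form1 :: "nat \<Rightarrow> ('n::{finite,linorder} bmat \<times> 'n bmat) list \<Rightarrow> 'n bmat \<Rightarrow> 'n bmat" where
  "form1 p c X = (if X \<in> su p then (\<Sum>(Z, A)\<leftarrow>c. killing Z X *\<^sub>R A) else 0)"

definition form2 :: "nat \<Rightarrow> ('n::{finite,linorder} bmat \<times> 'n bmat \<times> 'n bmat) list \<Rightarrow>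
    'n bmat \<Rightarrow> 'n bmat \<Rightarrow> 'n bmat" where
  "form2 p c X Y = (if X \<in> su p \<and> Y \<in> su p then
     (\<Sum>(Z, W, A)\<leftarrow>c. (killing Z X * killing W Y - killing Z Y * killing W X) *\<^sub>R A) else 0)"

text \<open>The Lie algebra homology differential on decomposables:
  \<open>\<partial>\<^sup>*(Z\<^sub>1 \<and> \<dots> \<and> Z\<^sub>k \<otimes> A) = \<Sum>\<^sub>i (-1)\<^sup>i Z\<^sub>1 \<and> \<dots> (omit Z\<^sub>i) \<dots> \<and> Z\<^sub>k \<otimes> [Z\<^sub>i, A]
  + \<Sum>\<^sub>i\<^sub><\<^sub>j (-1)\<^sup>i\<^sup>+\<^sup>j [Z\<^sub>i, Z\<^sub>j] \<and> \<dots> (omit Z\<^sub>i, Z\<^sub>j) \<dots> \<and> Z\<^sub>k \<otimes> A\<close>.\<close>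

fun bd2 :: "('n::finite bmat \<times> 'n bmat \<times> 'n bmat) list \<Rightarrow> ('n bmat \<times> 'n bmat) list" where
  "bd2 [] = []"
| "bd2 ((Z1, Z2, A) # c) =
     [(Z2, - mbracket Z1 A), (Z1, mbracket Z2 A), (mbracket Z1 Z2, - A)] @ bd2 c"

fun bd3 :: "('n::finite bmat \<times> 'n bmat \<times> 'n bmat \<times> 'n bmat) list \<Rightarrow>
    ('n bmat \<times> 'n bmat \<times> 'n bmat) list" where
  "bd3 [] = []"
| "bd3 ((Z1, Z2, Z3, A) # c) =
     [(Z2, Z3, - mbracket Z1 A), (Z1, Z3, mbracket Z2 A), (Z1, Z2, - mbracket Z3 A),
      (mbracket Z1 Z2, Z3, - A), (mbracket Z1 Z3, Z2, A), (mbracket Z2 Z3, Z1, - A)] @ bd3 c"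

definition ker_codiff :: "nat \<Rightarrow> ('n::{finite,linorder} bmat \<Rightarrow> 'n bmat \<Rightarrow> 'n bmat) set" where
  "ker_codiff p = {form2 p c | c. c \<in> chains2 p \<and> form1 p (bd2 c) = (\<lambda>X. 0)}"

definition im_codiff :: "nat \<Rightarrow> ('n::{finite,linorder} bmat \<Rightarrow> 'n bmat \<Rightarrow> 'n bmat) set" where
  "im_codiff p = {form2 p (bd3 c) | c. c \<in> chains3 p}"

definition normal_geometry :: "nat \<Rightarrow> ('m, 'e, 'g::topological_space, 'f::euclidean_space,
     'n::{finite,linorder}) cartan_data \<Rightarrow> bool" where
  "normal_geometry p \<Gamma> \<longleftrightarrow> (\<forall>u. curvature p \<Gamma> u \<in> ker_codiff p)"

text \<open>The harmonic curvature at \<open>u\<close> is a coset of \<open>im_codiff p\<close> in \<open>ker_codiff p\<close>; the zero of the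
  quotient is the coset \<open>im_codiff p\<close> itself. By equivariance it vanishes at one point over \<open>x\<close>
  if and only if it vanishes at all of them.\<close>

definition harmonic_curvature :: "nat \<Rightarrow> ('m, 'e, 'g::topological_space, 'f::euclidean_space,
     'n::{finite,linorder}) cartan_data \<Rightarrow> 'g \<Rightarrow> ('n bmat \<Rightarrow> 'n bmat \<Rightarrow> 'n bmat) set" where
  "harmonic_curvature p \<Gamma> u = {(\<lambda>X Y. curvature p \<Gamma> u X Y + \<psi> X Y) | \<psi>. \<psi> \<in> im_codiff p}"

definition harmonic_curvature_vanishes_at :: "nat \<Rightarrow> ('m, 'e, 'g::topological_space,
     'f::euclidean_space, 'n::{finite,linorder}) cartan_data \<Rightarrow> 'm \<Rightarrow> bool" where
  "harmonic_curvature_vanishes_at p \<Gamma> x \<longleftrightarrow>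
     (\<forall>u. bproj \<Gamma> u = x \<longrightarrow> harmonic_curvature p \<Gamma> u = im_codiff p)"


section \<open>Symmetries\<close>

definition local_diffeo :: "('m::topological_space, 'e::euclidean_space) atlas \<Rightarrow> 'm set \<Rightarrow>
    ('m \<Rightarrow> 'm) \<Rightarrow> bool" where
  "local_diffeo A W s \<longleftrightarrow> open W \<and> open (s ` W) \<and> inj_on s W \<and>
     smooth_map A A W s \<and> smooth_map A A (s ` W) (inv_into W s)"

definition local_automorphism :: "nat \<Rightarrow> ('m::topological_space, 'e::euclidean_space,
     'g::topological_space, 'f::euclidean_space, 'n::{finite,linorder}) cartan_data \<Rightarrow>
     'm set \<Rightarrow> ('m \<Rightarrow> 'm) \<Rightarrow> ('g \<Rightarrow> 'g) \<Rightarrow> bool" where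
  "local_automorphism p \<Gamma> W s \<phi> \<longleftrightarrow>
     smooth_map (total_atlas \<Gamma>) (total_atlas \<Gamma>) (bproj \<Gamma> -` W) \<phi> \<and>
     (\<forall>u\<in>bproj \<Gamma> -` W. bproj \<Gamma> (\<phi> u) = s (bproj \<Gamma> u) \<and>
        (\<forall>C\<in>Pgrp p. \<phi> (ract \<Gamma> u C) = ract \<Gamma> (\<phi> u) C) \<and>
        (\<forall>v\<in>tangent_space (total_atlas \<Gamma>) u.
           conn \<Gamma> (\<phi> u) (pushforward (total_atlas \<Gamma>) \<phi> u v) = conn \<Gamma> u v))"

definition symmetry_at :: "nat \<Rightarrow> ('m::topological_space, 'e::euclidean_space,
     'g::topological_space, 'f::euclidean_space, 'n::{finite,linorder}) cartan_data \<Rightarrow>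
     'm \<Rightarrow> 'm set \<Rightarrow> ('m \<Rightarrow> 'm) \<Rightarrow> bool" where
  "symmetry_at p \<Gamma> x W s \<longleftrightarrow> x \<in> W \<and> local_diffeo (base_atlas \<Gamma>) W s \<and> s x = x \<and>
     (\<forall>v\<in>contact p \<Gamma> x. pushforward (base_atlas \<Gamma>) s x v = (\<lambda>f. - v f)) \<and>
     (\<exists>\<phi>. local_automorphism p \<Gamma> W s \<phi>)"

definition symmetric_geometry :: "nat \<Rightarrow> ('m::topological_space, 'e::euclidean_space,
     'g::topological_space, 'f::euclidean_space, 'n::{finite,linorder}) cartan_data \<Rightarrow> bool" where
  "symmetric_geometry p \<Gamma> \<longleftrightarrow> (\<forall>x. \<exists>W s. symmetry_at p \<Gamma> x W s)"

text \<open>Local symmetries are considered as germs at \<open>x\<close>.\<close>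

definition involutive_at :: "'m::topological_space \<Rightarrow> ('m \<Rightarrow> 'm) \<Rightarrow> bool" where
  "involutive_at x s \<longleftrightarrow> (\<forall>\<^sub>F y in nhds x. s (s y) = y)"

definition same_germ_at :: "'m::topological_space \<Rightarrow> ('m \<Rightarrow> 'm) \<Rightarrow> ('m \<Rightarrow> 'm) \<Rightarrow> bool" where
  "same_germ_at x s t \<longleftrightarrow> (\<forall>\<^sub>F y in nhds x. s y = t y)"

end

theory Submission
  imports Defs
begin

text \<open>Let \<open>u\<close> be a point over \<open>x\<close>, and let \<open>\<phi>1\<close>, \<open>\<phi>2\<close> be automorphisms covering the two symmetries. They move
  \<open>u\<close> within its fibre, by group elements that both act as \<open>-1\<close> on \<open>\<gg>\<^sup>-\<^sup>1/\<pp>\<close>. The quotient of these elements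
  acts trivially there, hence is a central element times \<open>exp W\<close> with \<open>W \<in> \<pp>\<^sub>+\<close>
  (\<open>trivial_action_decomposition\<close>). So \<open>\<phi>2 u = (\<phi>1 u) exp W\<close>. An automorphism is determined near a point by its
  value there (\<open>automorphism_rigid\<close>), and therefore \<open>W \<noteq> 0\<close> if the germs of the symmetries differ.

  Take a linear functional on two-forms that vanishes on the image of \<open>\<partial>\<^sup>*\<close>, and let \<open>F\<close> be its composition with
  the curvature function. Automorphisms preserve \<open>F\<close>. So do right translations by \<open>exp \<pp>\<^sub>+\<close>, because by a
  homotopy formula \<open>\<pp>\<^sub>+\<close> acts trivially on homology (\<open>cartan_homotopy\<close>, \<open>cj_pplus\<close>). The constant fields
  \<open>\<omega>\<^sup>-\<^sup>1(X)\<close> are preserved by automorphisms and transformed by \<open>Ad (exp W)\<close> under the translation. Comparing the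
  derivatives of \<open>F\<close> at \<open>u\<close>, \<open>\<phi>1 u\<close> and \<open>\<phi>2 u\<close> shows that, for every \<open>X \<in> \<gg>\<close>, the derivative of \<open>F\<close> at \<open>\<phi>1 u\<close>
  along the constant field of \<open>M = Ad (exp W) X - X\<close> vanishes.

  Since the Hermitian form on \<open>\<gg>\<^sub>-\<^sub>1\<close> is definite (\<open>definite_form\<close>), \<open>X\<close> can be chosen such that \<open>M\<close> is a nonzero
  multiple of the grading element \<open>E\<close> modulo \<open>\<pp>\<^sub>+\<close> (\<open>test_direction\<close>). Then \<open>M \<in> \<pp>\<close>, and the derivative of the
  equivariant function \<open>\<kappa>\<close> along its constant field is the algebraic action of \<open>- M\<close>
  (\<open>fundamental_field_curvature\<close>). As the functional was arbitrary, \<open>E\<close> annihilates the homology class of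
  \<open>\<kappa> (\<phi>1 u)\<close>, so the flow \<open>exp (t E)\<close> fixes this class. But cycles have only positive homogeneities, so the
  flow contracts them to zero as \<open>t \<rightarrow> -\<infinity>\<close> (\<open>cj_grading_tendsto_zero\<close>). Hence the class is zero
  (\<open>vanishing_criterion\<close>), and \<open>\<kappa> u = \<kappa> (\<phi>1 u)\<close>.

  The analysis behind these steps consists of the smoothness of constant fields, for which the inverses of a
  smooth family of injective linear maps are shown to be smooth; of the Lie bracket of related vector
  fields; and of a Gronwall estimate along rays in charts for rigidity.\<close>

section \<open>Calculus of smooth maps between Euclidean spaces\<close>

lemma Ck_on_SucD:
  assumes "Ck_on (Suc k) S f" "x \<in> S"
  shows "(f has_derivative frechet_derivative f (at x)) (at x)"
  using assms frechet_derivative_works by auto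

lemma Ck_on_decr: "Ck_on (Suc k) S f \<Longrightarrow> Ck_on k S f"
proof (induction k arbitrary: f)
  case 0
  then show ?case
    by (auto intro!: continuous_at_imp_continuous_on differentiable_imp_continuous_within)
next
  case (Suc k)
  then show ?case by (metis Ck_on.simps(2))
qed

lemma Ck_on_subset: "Ck_on k S f \<Longrightarrow> T \<subseteq> S \<Longrightarrow> Ck_on k T f"
  by (induction k arbitrary: f) (auto intro: continuous_on_subset)

lemma Ck_on_cong:
  assumes S: "open S" and eq: "\<And>x. x \<in> S \<Longrightarrow> f x = g x" and "Ck_on k S f"
  shows "Ck_on k S g"
  using eq assms(3)
proof (induction k arbitrary: f g)
  case 0
  then show ?case by (simp add: continuous_on_eq)
next
  case (Suc k)
  have d: "(g has_derivative frechet_derivative f (at x)) (at x)" if "x \<in> S" for x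
    by (rule has_derivative_transform_within_open[OF Ck_on_SucD[OF Suc.prems(2) that] S that])
      (simp add: Suc.prems(1))
  have "frechet_derivative f (at x) = frechet_derivative g (at x)" if "x \<in> S" for x
    using frechet_derivative_at[OF d[OF that]] .
  then have "Ck_on k S (\<lambda>x. frechet_derivative g (at x) v)" for v
    using Suc.prems(2) by (simp add: Suc.IH[of "\<lambda>x. frechet_derivative f (at x) v"])
  then show ?case using d by (auto simp: differentiable_def)
qed

lemma Ck_on_SucI:
  assumes "open S" "\<And>x. x \<in> S \<Longrightarrow> (f has_derivative f' x) (at x)" "\<And>v. Ck_on k S (\<lambda>x. f' x v)"
  shows "Ck_on (Suc k) S f"
proof -
  have "f' x = frechet_derivative f (at x)" if "x \<in> S" for x
    using assms(2)[OF that] by (rule frechet_derivative_at)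
  then have "Ck_on k S (\<lambda>x. frechet_derivative f (at x) v)" for v
    using Ck_on_cong[OF assms(1) _ assms(3)[of v], of "\<lambda>x. frechet_derivative f (at x) v"] by simp
  moreover have "f differentiable (at x)" if "x \<in> S" for x
    using assms(2)[OF that] by (rule differentiableI)
  ultimately show ?thesis by simp
qed

lemma Ck_on_local:
  assumes "\<And>x. x \<in> S \<Longrightarrow> \<exists>T. open T \<and> x \<in> T \<and> Ck_on k T f"
  shows "Ck_on k S f"
  using assms
proof (induction k arbitrary: f)
  case 0
  have "isCont f x" if "x \<in> S" for x
    using 0[OF that] by (auto simp: continuous_on_eq_continuous_at)
  then show ?case by (simp add: continuous_at_imp_continuous_on)
next
  case (Suc k)
  show ?case
    unfolding Ck_on.simps
  proof (intro conjI ballI allI)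
    fix x assume "x \<in> S"
    then show "f differentiable at x" using Suc.prems by fastforce
  next
    fix v
    show "Ck_on k S (\<lambda>x. frechet_derivative f (at x) v)"
      by (rule Suc.IH) (use Suc.prems in fastforce)
  qed
qed

lemma Ck_on_const: "open S \<Longrightarrow> Ck_on k S (\<lambda>x. c)"
  by (induction k arbitrary: c) (auto simp: frechet_derivative_const)

lemma Ck_on_bounded_linear:
  assumes "open S" "bounded_linear L" "Ck_on k S f"
  shows "Ck_on k S (\<lambda>x. L (f x))"
  using assms(3)
proof (induction k arbitrary: f)
  case 0
  then show ?case by (simp add: bounded_linear.continuous_on[OF assms(2)])
next
  case (Suc k)
  show ?case
    by (rule Ck_on_SucI[OF assms(1) bounded_linear.has_derivative[OF assms(2)
          Ck_on_SucD[OF Suc.prems]]]) (use Suc in auto)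
qed

lemma Ck_on_add:
  assumes "open S" "Ck_on k S f" "Ck_on k S g"
  shows "Ck_on k S (\<lambda>x. f x + g x)"
  using assms(2,3)
proof (induction k arbitrary: f g)
  case 0
  then show ?case by (simp add: continuous_on_add)
next
  case (Suc k)
  show ?case
    by (rule Ck_on_SucI[OF assms(1) has_derivative_add[OF Ck_on_SucD[OF Suc.prems(1)]
          Ck_on_SucD[OF Suc.prems(2)]]]) (use Suc in auto)
qed

lemma Ck_on_sum:
  assumes "open S" "finite I" "\<And>i. i \<in> I \<Longrightarrow> Ck_on k S (f i)"
  shows "Ck_on k S (\<lambda>x. \<Sum>i\<in>I. f i x)"
  using assms(2,3)
  by (induction I rule: finite_induct) (auto simp: Ck_on_const[OF assms(1)] intro!: Ck_on_add assms(1))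

lemma Ck_on_bilinear:
  assumes "open S" "bounded_bilinear B" "Ck_on k S f" "Ck_on k S g"
  shows "Ck_on k S (\<lambda>x. B (f x) (g x))"
  using assms(3,4)
proof (induction k arbitrary: f g)
  case 0
  then show ?case by (simp add: bounded_bilinear.continuous_on[OF assms(2)])
next
  case (Suc k)
  show ?case
  proof (rule Ck_on_SucI[OF assms(1) bounded_bilinear.FDERIV[OF assms(2) Ck_on_SucD[OF Suc.prems(1)]
          Ck_on_SucD[OF Suc.prems(2)]]])
    fix v
    show "Ck_on k S (\<lambda>x. B (f x) (frechet_derivative g (at x) v) + B (frechet_derivative f (at x) v) (g x))"
      using Suc.prems by (intro Ck_on_add assms(1) Suc.IH) (auto intro: Ck_on_decr)
  qed
qed

lemma linear_euclidean_expand: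
  fixes L :: "'a::euclidean_space \<Rightarrow> 'b::real_vector"
  assumes "linear L"
  shows "L w = (\<Sum>b\<in>Basis. (w \<bullet> b) *\<^sub>R L b)"
proof -
  have "L w = L (\<Sum>b\<in>Basis. (w \<bullet> b) *\<^sub>R b)" by (simp add: euclidean_representation)
  also have "\<dots> = (\<Sum>b\<in>Basis. (w \<bullet> b) *\<^sub>R L b)"
    by (simp only: linear_sum[OF assms] linear_scale[OF assms])
  finally show ?thesis .
qed

lemma Ck_on_compose:
  fixes f :: "'a::real_normed_vector \<Rightarrow> 'b::euclidean_space"
    and g :: "'b \<Rightarrow> 'c::real_normed_vector"
  assumes S: "open S" and fST: "f ` S \<subseteq> T" and "Ck_on k S f" "Ck_on k T g"
  shows "Ck_on k S (\<lambda>x. g (f x))"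
  using assms(3,4)
proof (induction k arbitrary: g)
  case 0
  then show ?case using fST by (auto intro: continuous_on_compose2)
next
  case (Suc k)
  let ?f' = "\<lambda>x. frechet_derivative f (at x)" and ?g' = "\<lambda>y. frechet_derivative g (at y)"
  have d: "((\<lambda>x. g (f x)) has_derivative (\<lambda>v. \<Sum>b\<in>Basis. (?f' x v \<bullet> b) *\<^sub>R ?g' (f x) b)) (at x)"
    if x: "x \<in> S" for x
  proof -
    have g: "(g has_derivative ?g' (f x)) (at (f x))"
      using Ck_on_SucD[OF Suc.prems(2), of "f x"] fST x by auto
    have e: "(\<lambda>v. ?g' (f x) (?f' x v)) = (\<lambda>v. \<Sum>b\<in>Basis. (?f' x v \<bullet> b) *\<^sub>R ?g' (f x) b)"
      by (rule ext, rule linear_euclidean_expand[OF has_derivative_linear[OF g]])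
    show ?thesis
      using has_derivative_compose[OF Ck_on_SucD[OF Suc.prems(1) x] g] unfolding e .
  qed
  show ?case
  proof (rule Ck_on_SucI[OF S d])
    fix v
    show "Ck_on k S (\<lambda>x. \<Sum>b\<in>Basis. (?f' x v \<bullet> b) *\<^sub>R ?g' (f x) b)"
    proof (intro Ck_on_sum S Ck_on_bilinear[OF S bounded_bilinear_scaleR])
      fix b :: 'b
      show "Ck_on k S (\<lambda>x. ?f' x v \<bullet> b)"
        using Suc.prems(1) by (intro Ck_on_bounded_linear[OF S bounded_linear_inner_left]) auto
      show "Ck_on k S (\<lambda>x. ?g' (f x) b)"
        by (rule Suc.IH[OF Ck_on_decr[OF Suc.prems(1)]]) (use Suc.prems in auto)
    qed auto
  qed
qed

lemma smooth_on_imp_Ck: "smooth_on S f \<Longrightarrow> Ck_on k S f"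
  by (simp add: smooth_on_def)

lemma smooth_on_subset: "smooth_on S f \<Longrightarrow> T \<subseteq> S \<Longrightarrow> smooth_on T f"
  unfolding smooth_on_def using Ck_on_subset by blast

lemma smooth_on_cong:
  "smooth_on S f \<Longrightarrow> open S \<Longrightarrow> (\<And>x. x \<in> S \<Longrightarrow> f x = g x) \<Longrightarrow> smooth_on S g"
  unfolding smooth_on_def using Ck_on_cong by blast

lemma smooth_on_local:
  "(\<And>x. x \<in> S \<Longrightarrow> \<exists>T. open T \<and> x \<in> T \<and> smooth_on T f) \<Longrightarrow> smooth_on S f"
  unfolding smooth_on_def by (meson Ck_on_local)

lemma smooth_on_const: "open S \<Longrightarrow> smooth_on S (\<lambda>x. c)"
  by (simp add: smooth_on_def Ck_on_const)

lemma smooth_on_bounded_linear: "smooth_on S f \<Longrightarrow> open S \<Longrightarrow> bounded_linear L \<Longrightarrow> smooth_on S (\<lambda>x. L (f x))"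
  by (simp add: smooth_on_def Ck_on_bounded_linear)

lemma smooth_on_add: "open S \<Longrightarrow> smooth_on S f \<Longrightarrow> smooth_on S g \<Longrightarrow> smooth_on S (\<lambda>x. f x + g x)"
  by (simp add: smooth_on_def Ck_on_add)

lemma smooth_on_sum:
  "open S \<Longrightarrow> finite I \<Longrightarrow> (\<And>i. i \<in> I \<Longrightarrow> smooth_on S (f i)) \<Longrightarrow> smooth_on S (\<lambda>x. \<Sum>i\<in>I. f i x)"
  by (simp add: smooth_on_def Ck_on_sum)

lemma smooth_on_bilinear:
  "open S \<Longrightarrow> bounded_bilinear B \<Longrightarrow> smooth_on S f \<Longrightarrow> smooth_on S g \<Longrightarrow> smooth_on S (\<lambda>x. B (f x) (g x))"
  by (simp add: smooth_on_def Ck_on_bilinear)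

lemma smooth_on_compose:
  fixes f :: "'a::real_normed_vector \<Rightarrow> 'b::euclidean_space"
  shows "open S \<Longrightarrow> f ` S \<subseteq> T \<Longrightarrow> smooth_on S f \<Longrightarrow> smooth_on T g \<Longrightarrow> smooth_on S (\<lambda>x. g (f x))"
  unfolding smooth_on_def using Ck_on_compose by blast

lemma smooth_on_has_derivative:
  "smooth_on S f \<Longrightarrow> x \<in> S \<Longrightarrow> (f has_derivative frechet_derivative f (at x)) (at x)"
  unfolding smooth_on_def using Ck_on_SucD by blast

lemma smooth_on_continuous: "smooth_on S f \<Longrightarrow> continuous_on S f"
  unfolding smooth_on_def using Ck_on.simps(1) by blast

lemma smooth_on_derivative: "smooth_on S f \<Longrightarrow> smooth_on S (\<lambda>x. frechet_derivative f (at x) v)"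
  unfolding smooth_on_def using Ck_on.simps(2) by blast

lemma smooth_on_linear_family:
  fixes L :: "'z::real_normed_vector \<Rightarrow> 'a::euclidean_space \<Rightarrow> 'b::real_normed_vector"
  assumes S: "open S" and "\<And>z. z \<in> S \<Longrightarrow> linear (L z)" "\<And>v. v \<in> Basis \<Longrightarrow> smooth_on S (\<lambda>z. L z v)"
    and "smooth_on S a"
  shows "smooth_on S (\<lambda>z. L z (a z))"
proof (rule smooth_on_cong[OF _ S])
  show "smooth_on S (\<lambda>z. \<Sum>b\<in>Basis. (a z \<bullet> b) *\<^sub>R L z b)"
    by (intro smooth_on_sum S smooth_on_bilinear[OF S bounded_bilinear_scaleR]
        smooth_on_bounded_linear[OF assms(4) S bounded_linear_inner_left] assms) auto
qed (rule linear_euclidean_expand[OF assms(2), symmetric])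

lemma smooth_on_directional:
  fixes f :: "'a::euclidean_space \<Rightarrow> 'b::real_normed_vector"
  assumes "open S" "smooth_on S f" "smooth_on S a"
  shows "smooth_on S (\<lambda>x. frechet_derivative f (at x) (a x))"
  by (rule smooth_on_linear_family[OF assms(1) _ smooth_on_derivative[OF assms(2)] assms(3)])
    (rule has_derivative_linear[OF smooth_on_has_derivative[OF assms(2)]])

lemma second_difference_mvt:
  fixes f :: "'a::real_normed_vector \<Rightarrow> real"
  assumes S: "\<And>s t. 0 \<le> s \<Longrightarrow> s \<le> h \<Longrightarrow> 0 \<le> t \<Longrightarrow> t \<le> h \<Longrightarrow> x + s *\<^sub>R u + t *\<^sub>R v \<in> S"
    and f: "smooth_on S f" and h: "0 < h"
  obtains s t where "0 \<le> s" "s \<le> h" "0 \<le> t" "t \<le> h"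
    "f (x + h *\<^sub>R u + h *\<^sub>R v) - f (x + h *\<^sub>R u) - f (x + h *\<^sub>R v) + f x
      = h * h * frechet_derivative (\<lambda>y. frechet_derivative f (at y) u) (at (x + s *\<^sub>R u + t *\<^sub>R v)) v"
proof -
  let ?fu = "\<lambda>y. frechet_derivative f (at y) u"
  have fu: "smooth_on S ?fu" by (rule smooth_on_derivative[OF f])
  have d1: "((\<lambda>s. f (x + s *\<^sub>R u + t *\<^sub>R v)) has_real_derivative ?fu (x + s *\<^sub>R u + t *\<^sub>R v)) (at s)"
    if "0 \<le> s" "s \<le> h" "0 \<le> t" "t \<le> h" for s t
  proof -
    note D = smooth_on_has_derivative[OF f S[OF that]]
    have "((\<lambda>s. x + s *\<^sub>R u + t *\<^sub>R v) has_derivative (\<lambda>r. r *\<^sub>R u)) (at s)"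
      by (auto intro!: derivative_eq_intros)
    from has_derivative_compose[OF this D] show ?thesis
      unfolding has_field_derivative_def
      by (simp add: linear_scale[OF has_derivative_linear[OF D]] mult.commute[of _ "?fu _"])
  qed
  have d2: "((\<lambda>t. ?fu (x + s *\<^sub>R u + t *\<^sub>R v)) has_real_derivative
      frechet_derivative ?fu (at (x + s *\<^sub>R u + t *\<^sub>R v)) v) (at t)"
    if "0 \<le> s" "s \<le> h" "0 \<le> t" "t \<le> h" for s t
  proof -
    note D = smooth_on_has_derivative[OF fu S[OF that]]
    have "((\<lambda>t. x + s *\<^sub>R u + t *\<^sub>R v) has_derivative (\<lambda>r. r *\<^sub>R v)) (at t)"
      by (auto intro!: derivative_eq_intros)
    from has_derivative_compose[OF this D] show ?thesis
      unfolding has_field_derivative_def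
      by (simp add: linear_scale[OF has_derivative_linear[OF D]] mult.commute[of _ "frechet_derivative ?fu _ _"])
  qed
  define g where "g = (\<lambda>s. f (x + s *\<^sub>R u + h *\<^sub>R v) - f (x + s *\<^sub>R u + 0 *\<^sub>R v))"
  have "\<exists>s. 0 < s \<and> s < h \<and> g h - g 0 = (h - 0) * (?fu (x + s *\<^sub>R u + h *\<^sub>R v) - ?fu (x + s *\<^sub>R u + 0 *\<^sub>R v))"
    unfolding g_def using h by (intro MVT2 DERIV_diff d1) auto
  then obtain s where s: "0 < s" "s < h"
    "g h - g 0 = h * (?fu (x + s *\<^sub>R u + h *\<^sub>R v) - ?fu (x + s *\<^sub>R u + 0 *\<^sub>R v))" by auto
  have "\<exists>t. 0 < t \<and> t < h \<and> ?fu (x + s *\<^sub>R u + h *\<^sub>R v) - ?fu (x + s *\<^sub>R u + 0 *\<^sub>R v)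
      = (h - 0) * frechet_derivative ?fu (at (x + s *\<^sub>R u + t *\<^sub>R v)) v"
    using h s by (intro MVT2 d2) auto
  then obtain t where t: "0 < t" "t < h" "?fu (x + s *\<^sub>R u + h *\<^sub>R v) - ?fu (x + s *\<^sub>R u + 0 *\<^sub>R v)
      = h * frechet_derivative ?fu (at (x + s *\<^sub>R u + t *\<^sub>R v)) v" by auto
  show ?thesis
    by (rule that[of s t]) (use s t in \<open>auto simp: g_def\<close>)
qed

text \<open>Both mixed derivatives are limits of the same second difference quotient, by the mean value theorem
  applied once in each direction. This symmetry makes the Lie bracket a first-order operator.\<close>

lemma second_derivative_symmetric:
  fixes f :: "'a::real_normed_vector \<Rightarrow> real"
  assumes S: "open S" "x \<in> S" and f: "smooth_on S f"
  shows "frechet_derivative (\<lambda>y. frechet_derivative f (at y) u) (at x) v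
       = frechet_derivative (\<lambda>y. frechet_derivative f (at y) v) (at x) u" (is "?P x = ?Q x")
proof (rule ccontr)
  assume ne: "?P x \<noteq> ?Q x"
  define e where "e = \<bar>?P x - ?Q x\<bar> / 2"
  have e: "e > 0" using ne by (simp add: e_def)
  have "isCont ?P x" "isCont ?Q x"
    using smooth_on_continuous[OF smooth_on_derivative[OF smooth_on_derivative[OF f]]] S
    by (auto simp: continuous_on_eq_continuous_at)
  then obtain d1 d2 where d: "d1 > 0" "\<And>y. dist y x < d1 \<Longrightarrow> dist (?P y) (?P x) < e"
    "d2 > 0" "\<And>y. dist y x < d2 \<Longrightarrow> dist (?Q y) (?Q x) < e"
    using e unfolding continuous_at_eps_delta by metis
  obtain d3 where d3: "d3 > 0" "ball x d3 \<subseteq> S" using S open_contains_ball by metis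
  define d where "d = min d1 (min d2 d3)"
  have d0: "d > 0" using d d3 by (simp add: d_def)
  define h where "h = d / (2 * (norm u + norm v + 1))"
  have nn: "norm u + norm v + 1 > 0" using norm_ge_zero[of u] norm_ge_zero[of v] by linarith
  have h: "h > 0" using d0 nn by (simp add: h_def)
  have near: "dist (x + s *\<^sub>R u' + t *\<^sub>R v') x < d"
    if "0 \<le> s" "s \<le> h" "0 \<le> t" "t \<le> h" "{u', v'} = {u, v}" for s t u' v'
  proof -
    have "dist (x + s *\<^sub>R u' + t *\<^sub>R v') x \<le> s * norm u' + t * norm v'"
      using norm_triangle_ineq[of "s *\<^sub>R u'" "t *\<^sub>R v'"] that(1,3) by (simp add: dist_norm add.assoc)
    also have "\<dots> \<le> h * norm u' + h * norm v'"
      using that by (intro add_mono mult_right_mono) auto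
    also have "\<dots> = h * (norm u + norm v)"
      using that(5) by (auto simp: doubleton_eq_iff algebra_simps)
    also have "\<dots> < h * (2 * (norm u + norm v + 1))"
      using h nn by (intro mult_strict_left_mono) auto
    also have "\<dots> = d" unfolding h_def using nn by simp
    finally show ?thesis .
  qed
  have inS: "y \<in> S" if "dist y x < d" for y
    using d3(2) that by (auto simp: d_def dist_commute)
  obtain s t where st: "0 \<le> s" "s \<le> h" "0 \<le> t" "t \<le> h"
    "f (x + h *\<^sub>R u + h *\<^sub>R v) - f (x + h *\<^sub>R u) - f (x + h *\<^sub>R v) + f x = h * h * ?P (x + s *\<^sub>R u + t *\<^sub>R v)"
    by (rule second_difference_mvt[of h x u v S f]) (use f h in \<open>auto intro: inS near\<close>)
  obtain s' t' where st': "0 \<le> s'" "s' \<le> h" "0 \<le> t'" "t' \<le> h"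
    "f (x + h *\<^sub>R v + h *\<^sub>R u) - f (x + h *\<^sub>R v) - f (x + h *\<^sub>R u) + f x = h * h * ?Q (x + s' *\<^sub>R v + t' *\<^sub>R u)"
    by (rule second_difference_mvt[of h x v u S f]) (use f h in \<open>auto intro!: inS near simp: insert_commute\<close>)
  have "h * h * ?P (x + s *\<^sub>R u + t *\<^sub>R v) = h * h * ?Q (x + s' *\<^sub>R v + t' *\<^sub>R u)"
    using st(5) st'(5) by (simp add: algebra_simps)
  then have eq: "?P (x + s *\<^sub>R u + t *\<^sub>R v) = ?Q (x + s' *\<^sub>R v + t' *\<^sub>R u)" using h by simp
  have "dist (?P x) (?P (x + s *\<^sub>R u + t *\<^sub>R v)) < e"
    unfolding dist_commute[of "?P x"] by (rule d(2)) (use near[of s t u v] st in \<open>simp add: d_def\<close>)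
  moreover have "dist (?Q x) (?Q (x + s' *\<^sub>R v + t' *\<^sub>R u)) < e"
    unfolding dist_commute[of "?Q x"]
    by (rule d(4)) (use near[of s' t' v u, OF st'(1-4) insert_commute] in \<open>simp add: d_def\<close>)
  ultimately have "dist (?P x) (?Q x) < e + e"
    unfolding eq by (rule dist_triangle_less_add)
  then show False by (simp add: dist_real_def e_def)
qed

lemma derivative_in_subspace:
  fixes f :: "'a::real_normed_vector \<Rightarrow> 'b::euclidean_space"
  assumes V: "subspace V" and S: "open S" "z0 \<in> S" and fV: "\<And>z. z \<in> S \<Longrightarrow> f z \<in> V"
    and f: "(f has_derivative f') (at z0)"
  shows "f' v \<in> V"
proof -
  have "((\<lambda>t. z0 + t *\<^sub>R v) has_derivative (\<lambda>t. t *\<^sub>R v)) (at (0::real))"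
    by (auto intro!: derivative_eq_intros)
  from has_derivative_compose[OF this, of f f'] f
  have "((\<lambda>t. f (z0 + t *\<^sub>R v)) has_vector_derivative f' v) (at 0)"
    by (simp add: has_vector_derivative_def linear_scale[OF has_derivative_linear[OF f]])
  then have lim: "((\<lambda>t. (f (z0 + t *\<^sub>R v) - f z0) /\<^sub>R t) \<longlongrightarrow> f' v) (at 0)"
  proof -
    assume "((\<lambda>t. f (z0 + t *\<^sub>R v)) has_vector_derivative f' v) (at 0)"
    then have lim: "((\<lambda>t. norm ((1 / norm (t - 0)) *\<^sub>R (f (z0 + t *\<^sub>R v) - (f (z0 + 0 *\<^sub>R v) + (t - 0) *\<^sub>R f' v)))) \<longlongrightarrow> 0) (at 0)"
      unfolding has_vector_derivative_def has_derivative_at2 by (rule tendsto_norm_zero[OF conjunct2])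
    have eq: "norm ((1 / norm (t - 0)) *\<^sub>R (f (z0 + t *\<^sub>R v) - (f (z0 + 0 *\<^sub>R v) + (t - 0) *\<^sub>R f' v)))
        = norm ((f (z0 + t *\<^sub>R v) - f z0) /\<^sub>R t - f' v)" if "t \<noteq> 0" for t :: real
    proof -
      have "(f (z0 + t *\<^sub>R v) - f z0) /\<^sub>R t - f' v = (1 / t) *\<^sub>R (f (z0 + t *\<^sub>R v) - (f z0 + t *\<^sub>R f' v))"
        using that by (simp add: scaleR_diff_right scaleR_add_right divide_inverse)
      then show ?thesis by simp
    qed
    have "((\<lambda>t. norm ((f (z0 + t *\<^sub>R v) - f z0) /\<^sub>R t - f' v)) \<longlongrightarrow> 0) (at 0)"
      by (rule Lim_transform_eventually[OF lim]) (use eq in \<open>auto simp: eventually_at_filter\<close>)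
    then show ?thesis by (simp add: tendsto_norm_zero_iff flip: Lim_null)
  qed
  have ev: "eventually (\<lambda>t. z0 + t *\<^sub>R v \<in> S) (at (0::real))"
  proof -
    have "((\<lambda>t. z0 + t *\<^sub>R v) \<longlongrightarrow> z0 + 0 *\<^sub>R v) (at (0::real))" by (intro tendsto_intros)
    then show ?thesis using S by (auto simp: tendsto_def)
  qed
  show ?thesis
  proof (rule Lim_in_closed_set[OF closed_subspace[OF V] _ _ lim])
    show "eventually (\<lambda>t. (f (z0 + t *\<^sub>R v) - f z0) /\<^sub>R t \<in> V) (at 0)"
      using ev by eventually_elim (intro subspace_scale[OF V] subspace_diff[OF V] fV S)
  qed simp
qed

text \<open>Continuity of \<open>z \<mapsto> L z\<close> on a basis bounds the inverses near a point, so the solutions of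
  \<open>L z a = X\<close> depend continuously on \<open>z\<close>; the derivative of the solution is again a solution of such
  an equation, which gives all higher derivatives by induction.\<close>

context
  fixes L :: "'z::real_normed_vector \<Rightarrow> 'a::euclidean_space \<Rightarrow> 'b::euclidean_space"
    and S :: "'z set" and V :: "'b set" and a :: "'b \<Rightarrow> 'z \<Rightarrow> 'a"
  assumes S: "open S"
    and lin: "\<And>z. z \<in> S \<Longrightarrow> linear (L z)" and inj: "\<And>z. z \<in> S \<Longrightarrow> inj (L z)"
    and V: "subspace V" and LV: "\<And>z v. z \<in> S \<Longrightarrow> L z v \<in> V"
    and sm: "\<And>v. smooth_on S (\<lambda>z. L z v)"
    and La: "\<And>X z. X \<in> V \<Longrightarrow> z \<in> S \<Longrightarrow> L z (a X z) = X"
begin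

lemma linear_family_uniform:
  assumes z0: "z0 \<in> S" and e: "e > 0"
  shows "eventually (\<lambda>z. \<forall>v. norm (L z v - L z0 v) \<le> e * norm v) (at z0)"
proof -
  define N where "N = real DIM('a)"
  have N: "N > 0" by (simp add: N_def)
  have "eventually (\<lambda>z. \<forall>b\<in>Basis. dist (L z b) (L z0 b) < e / N) (at z0)"
  proof (rule eventually_ball_finite)
    show "\<forall>b\<in>Basis. eventually (\<lambda>z. dist (L z b) (L z0 b) < e / N) (at z0)"
    proof
      fix b :: 'a
      have "isCont (\<lambda>z. L z b) z0"
        using smooth_on_continuous[OF sm[of b]] S z0 by (simp add: continuous_on_eq_continuous_at)
      then show "eventually (\<lambda>z. dist (L z b) (L z0 b) < e / N) (at z0)"
        using e N unfolding isCont_def tendsto_iff by simp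
    qed
  qed simp
  moreover have "eventually (\<lambda>z. z \<in> S) (at z0)"
    using S z0 by (simp add: eventually_at_topological) blast
  ultimately show ?thesis
  proof eventually_elim
    case (elim z)
    show ?case
    proof
      fix v
      have "L z v - L z0 v = (\<Sum>b\<in>Basis. (v \<bullet> b) *\<^sub>R (L z b - L z0 b))"
        by (subst linear_euclidean_expand[OF lin[OF elim(2)], of v],
            subst linear_euclidean_expand[OF lin[OF z0], of v])
          (simp add: sum_subtractf scaleR_diff_right)
      also have "norm \<dots> \<le> (\<Sum>b\<in>Basis. norm ((v \<bullet> b) *\<^sub>R (L z b - L z0 b)))" by (rule norm_sum)
      also have "\<dots> \<le> (\<Sum>b\<in>(Basis::'a set). norm v * (e / N))"
      proof (rule sum_mono)
        fix b :: 'a assume b: "b \<in> Basis"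
        have "norm ((v \<bullet> b) *\<^sub>R (L z b - L z0 b)) = \<bar>v \<bullet> b\<bar> * norm (L z b - L z0 b)" by simp
        also have "\<dots> \<le> norm v * (e / N)"
          using elim(1) b Basis_le_norm[OF b, of v] by (intro mult_mono) (auto simp: dist_norm)
        finally show "norm ((v \<bullet> b) *\<^sub>R (L z b - L z0 b)) \<le> norm v * (e / N)" .
      qed
      also have "\<dots> = e * norm v" using N by (simp add: N_def)
      finally show "norm (L z v - L z0 v) \<le> e * norm v" .
    qed
  qed
qed

lemma linear_family_lower_bound:
  assumes z0: "z0 \<in> S"
  obtains C where "C > 0" "\<And>v. norm v \<le> C * norm (L z0 v)"
    "eventually (\<lambda>z. \<forall>v. norm v \<le> C * norm (L z v)) (at z0)"
proof -
  obtain G where G: "linear G" "\<And>v. G (L z0 v) = v"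
    using linear_injective_left_inverse[OF lin[OF z0] inj[OF z0]] by (auto simp: fun_eq_iff)
  obtain K where K: "K > 0" "\<And>w. norm (G w) \<le> norm w * K"
    using bounded_linear.pos_bounded[OF G(1)[unfolded linear_conv_bounded_linear]] by blast
  have 0: "norm v \<le> K * norm (L z0 v)" for v
    using K(2)[of "L z0 v"] by (simp add: G(2) mult.commute)
  show ?thesis
  proof (rule that[of "2 * K"])
    show "norm v \<le> 2 * K * norm (L z0 v)" for v
    proof -
      have "0 \<le> K * norm (L z0 v)" using K(1) by simp
      then show ?thesis using 0[of v] by linarith
    qed
    have "1 / (2 * K) > 0" using K by simp
    from linear_family_uniform[OF z0 this]
    show "eventually (\<lambda>z. \<forall>v. norm v \<le> 2 * K * norm (L z v)) (at z0)"
    proof eventually_elim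
      case (elim z)
      show ?case
      proof
        fix v
        have "norm (L z0 v) \<le> norm (L z v) + 1 / (2 * K) * norm v"
          using elim[rule_format, of v] norm_triangle_ineq4[of "L z v" "L z v - L z0 v"] by simp
        then have "K * norm (L z0 v) \<le> K * norm (L z v) + norm v / 2"
          using K(1) mult_left_mono[of _ _ K] by (fastforce simp: algebra_simps)
        with 0[of v] show "norm v \<le> 2 * K * norm (L z v)" by linarith
      qed
    qed
  qed (use K in simp)
qed

lemma inverse_family_has_derivative:
  assumes z0: "z0 \<in> S" and X: "X \<in> V"
  shows "(a X has_derivative
    (\<lambda>v. - a (frechet_derivative (\<lambda>z. L z (a X z0)) (at z0) v) z0)) (at z0)"
proof -
  define w where "w = a X z0"
  define l' where "l' = frechet_derivative (\<lambda>z. L z w) (at z0)"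
  have l: "((\<lambda>z. L z w) has_derivative l') (at z0)"
    unfolding l'_def by (rule smooth_on_has_derivative[OF sm z0])
  have l'V: "l' v \<in> V" for v
    by (rule derivative_in_subspace[OF V S z0 LV l])
  let ?G = "\<lambda>Y. a Y z0"
  have G: "L z0 (?G Y) = Y" if "Y \<in> V" for Y
    by (rule La[OF that z0])
  obtain C where C: "C > 0" "\<And>v. norm v \<le> C * norm (L z0 v)"
    and Cz: "eventually (\<lambda>z. \<forall>v. norm v \<le> C * norm (L z v)) (at z0)"
    by (rule linear_family_lower_bound[OF z0], rule that)
  have linG: "linear (\<lambda>v. - ?G (l' v))"
  proof (rule linearI)
    note ll = has_derivative_linear[OF l]
    show "- ?G (l' (x + y)) = - ?G (l' x) + - ?G (l' y)" for x y
    proof -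
      have "L z0 (?G (l' (x + y))) = L z0 (?G (l' x) + ?G (l' y))"
        by (simp add: G l'V subspace_add[OF V] linear_add[OF lin[OF z0]] linear_add[OF ll])
      then show ?thesis using inj[OF z0] by (simp add: inj_eq)
    qed
    show "- ?G (l' (r *\<^sub>R x)) = r *\<^sub>R - ?G (l' x)" for x r
    proof -
      have "L z0 (?G (l' (r *\<^sub>R x))) = L z0 (r *\<^sub>R ?G (l' x))"
        by (simp add: G l'V subspace_scale[OF V] linear_scale[OF lin[OF z0]] linear_scale[OF ll])
      then show ?thesis using inj[OF z0] by (simp add: inj_eq)
    qed
  qed
  obtain K' where K': "K' > 0" "\<And>v. norm (l' v) \<le> norm v * K'"
    using bounded_linear.pos_bounded[OF has_derivative_bounded_linear[OF l]] by blast
  define K where "K = C * K'"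
  have K: "K > 0" "norm (- ?G (l' v)) \<le> K * norm v" for v
  proof -
    have "norm (?G (l' v)) \<le> C * norm (l' v)" using C(2)[of "?G (l' v)"] G[OF l'V] by simp
    also have "\<dots> \<le> C * (norm v * K')" using C K' by (simp add: mult_left_mono)
    finally show "norm (- ?G (l' v)) \<le> K * norm v" by (simp add: K_def mult_ac)
  qed (use C K' in \<open>simp add: K_def\<close>)
  have bl: "bounded_linear (\<lambda>v. - ?G (l' v))"
    by (rule bounded_linear_intro[of _ K])
      (use linear_add[OF linG] linear_scale[OF linG] K in \<open>auto simp: mult.commute\<close>)
  show ?thesis
    unfolding w_def[symmetric] l'_def[symmetric]
  proof (rule has_derivative_at_withinI, unfold has_derivative_at_alt, intro conjI allI impI bl)
    fix e :: real assume e: "e > 0"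
    define e1 where "e1 = e / (2 * C)"
    define e2 where "e2 = e / (2 * C * K)"
    have e12: "e1 > 0" "e2 > 0" using e C K by (simp_all add: e1_def e2_def)
    have "eventually (\<lambda>z. norm (L z w - L z0 w - l' (z - z0)) \<le> e1 * norm (z - z0)) (at z0)"
      using l e12 unfolding has_derivative_at_alt eventually_at dist_norm by metis
    moreover have "eventually (\<lambda>z. z \<in> S) (at z0)"
      using S z0 by (simp add: eventually_at_topological) blast
    ultimately have "eventually (\<lambda>z. norm (a X z - a X z0 - - ?G (l' (z - z0))) \<le> e * norm (z - z0)) (at z0)"
      using Cz linear_family_uniform[OF z0 e12(2)]
    proof eventually_elim
      case (elim z)
      let ?g = "?G (l' (z - z0))"
      \<comment> \<open>both error terms below come from \<open>L z (a X z) = X = L z0 w\<close>: the Taylor remainder of \<open>z \<mapsto> L z w\<close> and the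
        variation of \<open>L z\<close> on the linear correction\<close>
      have eq: "L z (a X z - w + ?g) = - (L z w - L z0 w - l' (z - z0)) + (L z ?g - L z0 ?g)"
        using La[OF X elim(2)] La[OF X z0] G[OF l'V, of "z - z0"]
        by (simp add: linear_add[OF lin[OF elim(2)]] linear_diff[OF lin[OF elim(2)]] w_def)
      have "norm (L z (a X z - w + ?g)) \<le> norm (L z w - L z0 w - l' (z - z0)) + norm (L z ?g - L z0 ?g)"
        unfolding eq by (metis norm_minus_cancel norm_triangle_ineq)
      also have "\<dots> \<le> e1 * norm (z - z0) + e2 * norm ?g"
        using elim(1) elim(4) by (intro add_mono) auto
      also have "\<dots> \<le> e1 * norm (z - z0) + e2 * (K * norm (z - z0))"
        using e12 K(2)[of "z - z0"] by (simp add: mult_left_mono)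
      finally have "C * norm (L z (a X z - w + ?g)) \<le> C * (e1 * norm (z - z0) + e2 * (K * norm (z - z0)))"
        using C(1) by (intro mult_left_mono) auto
      also have "\<dots> = e * norm (z - z0)" using C K by (simp add: e1_def e2_def field_simps)
      finally show ?case using elim(3)[rule_format, of "a X z - w + ?g"] by (simp add: w_def)
    qed
    then obtain d where "d > 0" and d: "\<And>z. z \<noteq> z0 \<Longrightarrow> dist z z0 < d \<Longrightarrow>
        norm (a X z - a X z0 - - ?G (l' (z - z0))) \<le> e * norm (z - z0)"
      unfolding eventually_at by auto
    have "- ?G (l' 0) = 0" using linear_0[OF linG] .
    then have "norm (a X z - a X z0 - - ?G (l' (z - z0))) \<le> e * norm (z - z0)" if "dist z z0 < d" for z
      using d[OF _ that] by (cases "z = z0") auto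
    then show "\<exists>d>0. \<forall>y. norm (y - z0) < d \<longrightarrow> norm (a X y - a X z0 - - ?G (l' (y - z0))) \<le> e * norm (y - z0)"
      using \<open>d > 0\<close> by (auto simp: dist_norm)
  qed
qed

lemma smooth_on_inverse_family:
  assumes "X \<in> V"
  shows "smooth_on S (a X)"
  unfolding smooth_on_def
proof
  fix k
  obtain B where B: "B \<subseteq> V" "pairwise orthogonal B" "\<And>x. x \<in> B \<Longrightarrow> norm x = 1"
    "independent B" "span B = V"
    by (rule orthonormal_basis_subspace[OF V]) blast
  have fB: "finite B" using B(4) by (rule independent_imp_finite)
  have scale: "a (\<Sum>i\<in>B. c i *\<^sub>R i) z = (\<Sum>i\<in>B. c i *\<^sub>R a i z)" if z: "z \<in> S" for c z
  proof -
    have "L z (a (\<Sum>i\<in>B. c i *\<^sub>R i) z) = (\<Sum>i\<in>B. c i *\<^sub>R i)"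
      using B(1) by (intro La z subspace_sum[OF V] subspace_scale[OF V]) auto
    also have "\<dots> = L z (\<Sum>i\<in>B. c i *\<^sub>R a i z)"
      using B(1) by (simp add: linear_sum[OF lin[OF z]] linear_scale[OF lin[OF z]] La z subset_iff)
    finally show ?thesis using inj[OF z] by (simp add: inj_eq)
  qed
  show "Ck_on k S (a X)"
    using assms
  proof (induction k arbitrary: X)
    case 0
    show ?case
      using has_derivative_continuous[OF inverse_family_has_derivative[OF _ 0]]
      by (simp add: continuous_at_imp_continuous_on)
  next
    case (Suc k)
    show ?case
    proof (rule Ck_on_SucI[OF S inverse_family_has_derivative[OF _ Suc.prems]])
      fix v
      let ?Y = "\<lambda>z. \<Sum>b\<in>Basis. (a X z \<bullet> b) *\<^sub>R frechet_derivative (\<lambda>z. L z b) (at z) v"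
      have D: "frechet_derivative (\<lambda>z. L z (a X z0)) (at z0) v = ?Y z0" if z0: "z0 \<in> S" for z0
      proof -
        have "((\<lambda>z. \<Sum>b\<in>Basis. (a X z0 \<bullet> b) *\<^sub>R L z b) has_derivative
            (\<lambda>v. \<Sum>b\<in>Basis. (a X z0 \<bullet> b) *\<^sub>R frechet_derivative (\<lambda>z. L z b) (at z0) v)) (at z0)"
          by (intro has_derivative_sum has_derivative_scaleR_right smooth_on_has_derivative[OF sm z0])
        then have "((\<lambda>z. L z (a X z0)) has_derivative
            (\<lambda>v. \<Sum>b\<in>Basis. (a X z0 \<bullet> b) *\<^sub>R frechet_derivative (\<lambda>z. L z b) (at z0) v)) (at z0)"
          by (rule has_derivative_transform_within_open[OF _ S z0])
            (rule linear_euclidean_expand[OF lin, symmetric])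
        then show ?thesis by (rule fun_cong[OF frechet_derivative_at, symmetric])
      qed
      have YV: "?Y z \<in> V" if "z \<in> S" for z
        by (intro subspace_sum[OF V] subspace_scale[OF V]
            derivative_in_subspace[OF V S that LV smooth_on_has_derivative[OF sm that]])
      have Yc: "Ck_on k S ?Y"
        by (intro Ck_on_sum S finite_Basis Ck_on_bilinear[OF S bounded_bilinear_scaleR]
            Ck_on_bounded_linear[OF S bounded_linear_inner_left] Suc.IH Suc.prems
            smooth_on_imp_Ck[OF smooth_on_derivative[OF sm]])
      have "Ck_on k S (\<lambda>z. - (\<Sum>i\<in>B. (?Y z \<bullet> i) *\<^sub>R a i z))"
        by (intro subsetD[OF B(1)] Ck_on_bounded_linear[OF S bounded_linear_minus[OF bounded_linear_ident]] Ck_on_sum S fB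
            Ck_on_bilinear[OF S bounded_bilinear_scaleR]
            Ck_on_bounded_linear[OF S bounded_linear_inner_left] Yc Suc.IH)
      then show "Ck_on k S (\<lambda>z0. - a (frechet_derivative (\<lambda>z. L z (a X z0)) (at z0) v) z0)"
      proof (rule Ck_on_cong[OF S, rotated])
        fix z assume z: "z \<in> S"
        have "?Y z = (\<Sum>i\<in>B. (?Y z \<bullet> i) *\<^sub>R i)"
          using orthonormal_basis_expand[OF B(2,3) _ fB, of "?Y z"] YV[OF z] B(5) by simp
        then show "- (\<Sum>i\<in>B. (?Y z \<bullet> i) *\<^sub>R a i z) =
            - a (frechet_derivative (\<lambda>z'. L z' (a X z)) (at z) v) z"
          unfolding D[OF z] using scale[OF z] by metis
      qed
    qed
  qed
qed

end

lemma smooth_on_identity: "smooth_on S (\<lambda>x :: 'a::euclidean_space. x)"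
proof (rule smooth_on_subset)
  show "smooth_on UNIV (\<lambda>x :: 'a. x)"
    unfolding smooth_on_def
  proof
    show "Ck_on k UNIV (\<lambda>x :: 'a. x)" for k
      by (cases k) (auto intro!: Ck_on_SucI[where f' = "\<lambda>x v. v"] Ck_on_const)
  qed
qed simp

section \<open>Charts, tangent vectors and vector fields\<close>

lemma smooth_atlas_chart:
  assumes "smooth_atlas A" "(U, \<phi>) \<in> A"
  shows "open U" "open (\<phi> ` U)" "homeomorphism U (\<phi> ` U) \<phi> (inv_into U \<phi>)" "inj_on \<phi> U"
    "continuous_on U \<phi>"
proof -
  show *: "open U" "open (\<phi> ` U)" "homeomorphism U (\<phi> ` U) \<phi> (inv_into U \<phi>)"
    using assms unfolding smooth_atlas_def by fast+
  show "inj_on \<phi> U" "continuous_on U \<phi>"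
    using *(3) unfolding homeomorphism_def inj_on_def by (auto, metis)
qed

lemma smooth_atlas_transition:
  "smooth_atlas A \<Longrightarrow> (U, \<phi>) \<in> A \<Longrightarrow> (V, \<psi>) \<in> A \<Longrightarrow> smooth_on (\<phi> ` (U \<inter> V)) (\<psi> \<circ> inv_into U \<phi>)"
  unfolding smooth_atlas_def by fast

lemma smooth_atlas_cover:
  assumes "smooth_atlas A" obtains U \<phi> where "(U, \<phi>) \<in> A" "x \<in> U"
proof -
  have "x \<in> (\<Union>(U, \<phi>)\<in>A. U)" using assms unfolding smooth_atlas_def by auto
  then show ?thesis using that by auto
qed

lemma chart_image_open:
  assumes "smooth_atlas A" "(U, \<phi>) \<in> A" "open N" "N \<subseteq> U"
  shows "open (\<phi> ` N)"
proof -
  note c = smooth_atlas_chart[OF assms(1,2)]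
  have "openin (top_of_set (\<phi> ` U)) (\<phi> ` N)"
    using homeomorphism_imp_open_map[OF c(3), of N] assms(3,4) c(1)
    by (simp add: openin_open_eq)
  then show ?thesis using c(2) openin_open_trans by blast
qed

lemma chart_preimage_open:
  assumes "smooth_atlas A" "(U, \<phi>) \<in> A" "open N"
  shows "open (U \<inter> \<phi> -` N)"
  using smooth_atlas_chart(1,5)[OF assms(1,2)] assms(3) by (simp add: continuous_open_preimage)

lemma smooth_mapI:
  assumes "continuous_on W f"
    and "\<And>U \<phi> V \<psi>. (U, \<phi>) \<in> A \<Longrightarrow> (V, \<psi>) \<in> B \<Longrightarrow>
      smooth_on (\<phi> ` (U \<inter> W \<inter> f -` V)) (\<psi> \<circ> f \<circ> inv_into U \<phi>)"
  shows "smooth_map A B W f"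
  using assms unfolding smooth_map_def by auto

lemma smooth_mapD:
  assumes "smooth_map A B W f"
  shows "continuous_on W f"
    and "(U, \<phi>) \<in> A \<Longrightarrow> (V, \<psi>) \<in> B \<Longrightarrow>
      smooth_on (\<phi> ` (U \<inter> W \<inter> f -` V)) (\<psi> \<circ> f \<circ> inv_into U \<phi>)"
  using assms unfolding smooth_map_def by auto

lemma smooth_map_eucl:
  "smooth_map A eucl W f \<longleftrightarrow> continuous_on W f \<and> (\<forall>(U, \<phi>)\<in>A. smooth_on (\<phi> ` (U \<inter> W)) (f \<circ> inv_into U \<phi>))"
  by (simp add: smooth_map_def eucl_def)

lemma smooth_map_euclD:
  "smooth_map A eucl W f \<Longrightarrow> (U, \<phi>) \<in> A \<Longrightarrow> smooth_on (\<phi> ` (U \<inter> W)) (f \<circ> inv_into U \<phi>)"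
  unfolding smooth_map_eucl by blast

lemma smooth_map_eucl_local:
  assumes A: "smooth_atlas A"
    and loc: "\<And>x. x \<in> W \<Longrightarrow> \<exists>U \<phi> N. (U, \<phi>) \<in> A \<and> x \<in> U \<and> open N \<and> \<phi> x \<in> N \<and> N \<subseteq> \<phi> ` U \<and>
      smooth_on N (f \<circ> inv_into U \<phi>)"
  shows "smooth_map A eucl W f"
  unfolding smooth_map_eucl
proof (intro conjI ballI)
  have "isCont f x" if x: "x \<in> W" for x
  proof -
    obtain U \<phi> N where c: "(U, \<phi>) \<in> A" "x \<in> U" "open N" "\<phi> x \<in> N" "N \<subseteq> \<phi> ` U"
      "smooth_on N (f \<circ> inv_into U \<phi>)" using loc[OF x] by blast
    have "continuous_on (U \<inter> \<phi> -` N) \<phi>"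
      by (rule continuous_on_subset[OF smooth_atlas_chart(5)[OF A c(1)]]) auto
    then have "continuous_on (U \<inter> \<phi> -` N) (\<lambda>y. (f \<circ> inv_into U \<phi>) (\<phi> y))"
      by (rule continuous_on_compose2[OF smooth_on_continuous[OF c(6)]]) auto
    then have "continuous_on (U \<inter> \<phi> -` N) f"
      by (rule continuous_on_eq) (simp add: inv_into_f_f[OF smooth_atlas_chart(4)[OF A c(1)]])
    moreover have "open (U \<inter> \<phi> -` N)" by (rule chart_preimage_open[OF A c(1,3)])
    ultimately show ?thesis using c by (simp add: continuous_on_eq_continuous_at)
  qed
  then show "continuous_on W f" by (simp add: continuous_at_imp_continuous_on)
next
  fix d assume "d \<in> A"
  obtain V \<psi> where d: "d = (V, \<psi>)" "(V, \<psi>) \<in> A" using \<open>d \<in> A\<close> by (cases d) auto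
  have "smooth_on (\<psi> ` (V \<inter> W)) (f \<circ> inv_into V \<psi>)"
  proof (rule smooth_on_local)
    fix z assume "z \<in> \<psi> ` (V \<inter> W)"
    then obtain x where x: "x \<in> V" "x \<in> W" "z = \<psi> x" by auto
    obtain U \<phi> N where c: "(U, \<phi>) \<in> A" "x \<in> U" "open N" "\<phi> x \<in> N" "N \<subseteq> \<phi> ` U"
      "smooth_on N (f \<circ> inv_into U \<phi>)" using loc[OF x(2)] by blast
    let ?T = "\<psi> ` (V \<inter> (U \<inter> \<phi> -` N))"
    have T: "open ?T"
      using chart_preimage_open[OF A c(1,3)] smooth_atlas_chart(1)[OF A d(2)]
      by (intro chart_image_open[OF A d(2)]) auto
    note inj = smooth_atlas_chart(4)[OF A c(1)] smooth_atlas_chart(4)[OF A d(2)]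
    have "smooth_on ?T (\<phi> \<circ> inv_into V \<psi>)"
      by (rule smooth_on_subset[OF smooth_atlas_transition[OF A d(2) c(1)]]) auto
    then have "smooth_on ?T (\<lambda>z. (f \<circ> inv_into U \<phi>) ((\<phi> \<circ> inv_into V \<psi>) z))"
      by (intro smooth_on_compose[OF T _ _ c(6)]) (auto simp: inv_into_f_f[OF inj(2)] comp_def)
    then have "smooth_on ?T (f \<circ> inv_into V \<psi>)"
      by (rule smooth_on_cong[OF _ T]) (auto simp: inv_into_f_f[OF inj(1)] inv_into_f_f[OF inj(2)])
    then show "\<exists>T. open T \<and> z \<in> T \<and> smooth_on T (f \<circ> inv_into V \<psi>)"
      using T x c by blast
  qed
  then show "case d of (U, \<phi>) \<Rightarrow> smooth_on (\<phi> ` (U \<inter> W)) (f \<circ> inv_into U \<phi>)" by (simp add: d)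
qed

text \<open>Composition uses only that the charts of the middle atlas are injective with open domains
  covering the manifold, so that it applies to product atlases as well.\<close>

definition chart_cover :: "('m::topological_space, 'e::euclidean_space) atlas \<Rightarrow> bool" where
  "chart_cover A \<longleftrightarrow> (\<Union>(U, \<phi>)\<in>A. U) = UNIV \<and> (\<forall>(U, \<phi>)\<in>A. open U \<and> inj_on \<phi> U)"

lemma smooth_atlas_chart_cover: "smooth_atlas A \<Longrightarrow> chart_cover A"
proof -
  assume A: "smooth_atlas A"
  then have "(\<Union>(U, \<phi>)\<in>A. U) = UNIV" by (simp add: smooth_atlas_def)
  then show "chart_cover A"
    using smooth_atlas_chart(1,4)[OF A] by (auto simp: chart_cover_def)
qed

lemma chart_cover_eucl: "chart_cover eucl"
  by (simp add: chart_cover_def eucl_def)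

lemma chart_cover_prod:
  assumes "chart_cover A" "chart_cover B"
  shows "chart_cover (prod_atlas A B)"
proof -
  have "(x, y) \<in> (\<Union>(U, \<phi>)\<in>prod_atlas A B. U)" for x y
  proof -
    have "x \<in> (\<Union>(U, \<phi>)\<in>A. U)" "y \<in> (\<Union>(U, \<phi>)\<in>B. U)" using assms by (auto simp: chart_cover_def)
    then obtain U \<phi> V \<psi> where "(U, \<phi>) \<in> A" "x \<in> U" "(V, \<psi>) \<in> B" "y \<in> V" by auto
    then have "(U \<times> V, map_prod \<phi> \<psi>) \<in> prod_atlas A B" "(x, y) \<in> U \<times> V"
      unfolding prod_atlas_def by auto
    then show ?thesis by fast
  qed
  moreover have "open U \<and> inj_on \<phi> U" if "(U, \<phi>) \<in> prod_atlas A B" for U \<phi>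
    using that assms unfolding chart_cover_def prod_atlas_def
    by (fastforce intro: open_Times map_prod_inj_on)
  ultimately show ?thesis unfolding chart_cover_def by auto
qed

lemma smooth_map_compose:
  assumes A: "smooth_atlas A" and B: "chart_cover B" and C: "chart_cover C"
    and W: "open W" and f: "smooth_map A B W f" and g: "smooth_map B C W' g" and sub: "f ` W \<subseteq> W'"
  shows "smooth_map A C W (g \<circ> f)"
proof (rule smooth_mapI)
  have fc: "continuous_on W f" and gc: "continuous_on W' g"
    using f g by (auto simp: smooth_map_def)
  show gfc: "continuous_on W (g \<circ> f)"
    by (rule continuous_on_compose[OF fc continuous_on_subset[OF gc sub]])
  fix U \<phi> V \<psi> assume c: "(U, \<phi>) \<in> A" and d: "(V, \<psi>) \<in> C"
  note inj = smooth_atlas_chart(4)[OF A c]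
  have V: "open V" using C d by (auto simp: chart_cover_def)
  show "smooth_on (\<phi> ` (U \<inter> W \<inter> (g \<circ> f) -` V)) (\<psi> \<circ> (g \<circ> f) \<circ> inv_into U \<phi>)"
  proof (rule smooth_on_local)
    fix z assume "z \<in> \<phi> ` (U \<inter> W \<inter> (g \<circ> f) -` V)"
    then obtain x where x: "x \<in> U" "x \<in> W" "g (f x) \<in> V" "z = \<phi> x" by auto
    have "f x \<in> (\<Union>(U, \<phi>)\<in>B. U)" using B by (auto simp: chart_cover_def)
    then obtain Y \<zeta> where e: "(Y, \<zeta>) \<in> B" "f x \<in> Y" by auto
    have Y: "open Y" "inj_on \<zeta> Y" using B e by (auto simp: chart_cover_def)
    let ?N = "(W \<inter> f -` Y) \<inter> (W \<inter> (g \<circ> f) -` V)"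
    let ?T = "\<phi> ` (U \<inter> ?N)" and ?R = "\<zeta> ` (Y \<inter> W' \<inter> g -` V)"
    have "open ?N"
      by (intro open_Int continuous_open_preimage[OF fc W Y(1)] continuous_open_preimage[OF gfc W V])
    then have T: "open ?T"
      using smooth_atlas_chart(1)[OF A c] by (intro chart_image_open[OF A c]) auto
    have "smooth_on (\<phi> ` (U \<inter> W \<inter> f -` Y)) (\<zeta> \<circ> f \<circ> inv_into U \<phi>)"
      by (rule smooth_mapD(2)[OF f c e(1)])
    then have sf: "smooth_on ?T (\<zeta> \<circ> f \<circ> inv_into U \<phi>)"
      by (rule smooth_on_subset) auto
    have sg: "smooth_on ?R (\<psi> \<circ> g \<circ> inv_into Y \<zeta>)"
      by (rule smooth_mapD(2)[OF g e(1) d])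
    have "smooth_on ?T (\<lambda>z. (\<psi> \<circ> g \<circ> inv_into Y \<zeta>) ((\<zeta> \<circ> f \<circ> inv_into U \<phi>) z))"
      by (rule smooth_on_compose[OF T _ sf sg]) (use sub in \<open>auto simp: inv_into_f_f[OF inj]\<close>)
    then have "smooth_on ?T (\<psi> \<circ> (g \<circ> f) \<circ> inv_into U \<phi>)"
      by (rule smooth_on_cong[OF _ T]) (auto simp: inv_into_f_f[OF inj] inv_into_f_f[OF Y(2)])
    then show "\<exists>T. open T \<and> z \<in> T \<and> smooth_on T (\<psi> \<circ> (g \<circ> f) \<circ> inv_into U \<phi>)"
      using T x e by (intro exI[of _ ?T]) auto
  qed
qed

lemma Ck_on_Pair:
  assumes "open S" "Ck_on k S f" "Ck_on k S g"
  shows "Ck_on k S (\<lambda>x. (f x, g x))"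
proof -
  have "Ck_on k S (\<lambda>x. (f x, 0) + (0, g x))"
    by (intro Ck_on_add assms(1) Ck_on_bounded_linear[OF assms(1) _ assms(2), of "\<lambda>a. (a, 0)"]
        Ck_on_bounded_linear[OF assms(1) _ assms(3), of "\<lambda>a. (0, a)"]
        bounded_linear_Pair bounded_linear_ident bounded_linear_zero)
  then show ?thesis by simp
qed

lemma smooth_on_Pair:
  "open S \<Longrightarrow> smooth_on S f \<Longrightarrow> smooth_on S g \<Longrightarrow> smooth_on S (\<lambda>x. (f x, g x))"
  by (simp add: smooth_on_def Ck_on_Pair)

lemma smooth_map_Pair:
  assumes A: "smooth_atlas A" and B: "chart_cover B" and C: "chart_cover C" and W: "open W"
    and f: "smooth_map A B W f" and g: "smooth_map A C W g"
  shows "smooth_map A (prod_atlas B C) W (\<lambda>x. (f x, g x))"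
proof (rule smooth_mapI)
  have fc: "continuous_on W f" and gc: "continuous_on W g"
    using f g by (auto simp: smooth_map_def)
  then show "continuous_on W (\<lambda>x. (f x, g x))" by (rule continuous_on_Pair)
  fix U \<phi> VY \<psi>\<zeta> assume c: "(U, \<phi>) \<in> A" and "(VY, \<psi>\<zeta>) \<in> prod_atlas B C"
  then obtain V \<psi> Y \<zeta> where d: "VY = V \<times> Y" "\<psi>\<zeta> = map_prod \<psi> \<zeta>" "(V, \<psi>) \<in> B" "(Y, \<zeta>) \<in> C"
    unfolding prod_atlas_def by auto
  have VY: "open V" "open Y" using B C d by (auto simp: chart_cover_def)
  let ?N = "(W \<inter> f -` V) \<inter> (W \<inter> g -` Y)"
  let ?T = "\<phi> ` (U \<inter> ?N)"
  have "open ?N"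
    by (intro open_Int continuous_open_preimage[OF fc W VY(1)] continuous_open_preimage[OF gc W VY(2)])
  then have T: "open ?T"
    using smooth_atlas_chart(1)[OF A c] by (intro chart_image_open[OF A c]) auto
  have "smooth_on (\<phi> ` (U \<inter> W \<inter> f -` V)) (\<psi> \<circ> f \<circ> inv_into U \<phi>)"
    "smooth_on (\<phi> ` (U \<inter> W \<inter> g -` Y)) (\<zeta> \<circ> g \<circ> inv_into U \<phi>)"
    by (rule smooth_mapD(2)[OF f c d(3)], rule smooth_mapD(2)[OF g c d(4)])
  then have "smooth_on ?T (\<psi> \<circ> f \<circ> inv_into U \<phi>)" "smooth_on ?T (\<zeta> \<circ> g \<circ> inv_into U \<phi>)"
    by (auto elim!: smooth_on_subset)
  from smooth_on_Pair[OF T this]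
  have "smooth_on ?T (map_prod \<psi> \<zeta> \<circ> (\<lambda>x. (f x, g x)) \<circ> inv_into U \<phi>)"
    by (simp add: comp_def)
  moreover have "U \<inter> W \<inter> (\<lambda>x. (f x, g x)) -` (V \<times> Y) = U \<inter> ?N" by auto
  ultimately show "smooth_on (\<phi> ` (U \<inter> W \<inter> (\<lambda>x. (f x, g x)) -` VY)) (\<psi>\<zeta> \<circ> (\<lambda>x. (f x, g x)) \<circ> inv_into U \<phi>)"
    by (simp add: d)
qed

lemma smooth_map_subset: "smooth_map A B W f \<Longrightarrow> W' \<subseteq> W \<Longrightarrow> smooth_map A B W' f"
proof -
  assume f: "smooth_map A B W f" and W: "W' \<subseteq> W"
  have "smooth_on (\<phi> ` (U \<inter> W' \<inter> f -` V)) (\<psi> \<circ> f \<circ> inv_into U \<phi>)"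
    if "(U, \<phi>) \<in> A" "(V, \<psi>) \<in> B" for U \<phi> V \<psi>
  proof (rule smooth_on_subset)
    show "smooth_on (\<phi> ` (U \<inter> W \<inter> f -` V)) (\<psi> \<circ> f \<circ> inv_into U \<phi>)"
      using f that unfolding smooth_map_def by fast
  qed (use W in auto)
  then show "smooth_map A B W' f"
    using f W unfolding smooth_map_def by (auto intro: continuous_on_subset)
qed

lemma smooth_map_const:
  assumes "smooth_atlas A" "open W"
  shows "smooth_map A B W (\<lambda>x. c)"
proof (rule smooth_mapI)
  fix U \<phi> V \<psi> assume e: "(U, \<phi>) \<in> A"
  have "open (\<phi> ` (U \<inter> W \<inter> (\<lambda>x. c) -` V))"
    using smooth_atlas_chart(1)[OF assms(1) e] assms(2)
    by (intro chart_image_open[OF assms(1) e]) (auto simp: vimage_const)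
  then show "smooth_on (\<phi> ` (U \<inter> W \<inter> (\<lambda>x. c) -` V)) (\<psi> \<circ> (\<lambda>x. c) \<circ> inv_into U \<phi>)"
    by (simp add: comp_def smooth_on_const)
qed (rule continuous_on_const)

lemma smooth_map_cong:
  assumes A: "smooth_atlas A" and B: "chart_cover B" and W: "open W" and f: "smooth_map A B W f"
    and eq: "\<And>x. x \<in> W \<Longrightarrow> f x = g x"
  shows "smooth_map A B W g"
proof (rule smooth_mapI)
  have fc: "continuous_on W f" using f by (auto simp: smooth_map_def)
  then show "continuous_on W g" using eq by (rule continuous_on_eq)
  fix U \<phi> V \<psi> assume c: "(U, \<phi>) \<in> A" and d: "(V, \<psi>) \<in> B"
  have V: "open V" using B d by (auto simp: chart_cover_def)
  have eqs: "U \<inter> W \<inter> f -` V = U \<inter> W \<inter> g -` V" using eq by auto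
  have "open (W \<inter> f -` V)" using fc W V by (simp add: continuous_open_preimage)
  then have T: "open (\<phi> ` (U \<inter> W \<inter> f -` V))"
    using smooth_atlas_chart(1)[OF A c]
    by (intro chart_image_open[OF A c]) (auto simp: Int_assoc)
  have "smooth_on (\<phi> ` (U \<inter> W \<inter> f -` V)) (\<psi> \<circ> f \<circ> inv_into U \<phi>)"
    by (rule smooth_mapD(2)[OF f c d])
  then have "smooth_on (\<phi> ` (U \<inter> W \<inter> f -` V)) (\<psi> \<circ> g \<circ> inv_into U \<phi>)"
    by (rule smooth_on_cong[OF _ T]) (use eq in \<open>auto simp: inv_into_f_f[OF smooth_atlas_chart(4)[OF A c]]\<close>)
  then show "smooth_on (\<phi> ` (U \<inter> W \<inter> g -` V)) (\<psi> \<circ> g \<circ> inv_into U \<phi>)"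
    by (simp only: eqs)
qed

lemma smooth_atlas_eucl: "smooth_atlas (eucl :: ('e::euclidean_space, 'e) atlas)"
proof -
  have "inv_into UNIV id = (id :: 'e \<Rightarrow> 'e)" by (simp add: inv_id)
  then show ?thesis
    unfolding smooth_atlas_def eucl_def by (simp add: comp_def id_def homeomorphism_def smooth_on_identity)
qed

lemma smooth_map_chart:
  assumes A: "smooth_atlas A" and c: "(U, \<phi>) \<in> A"
  shows "smooth_map A eucl U \<phi>"
  unfolding smooth_map_eucl
proof (intro conjI ballI)
  fix d assume "d \<in> A"
  then obtain V \<psi> where d: "d = (V, \<psi>)" "(V, \<psi>) \<in> A" by (cases d) auto
  show "case d of (V, \<psi>) \<Rightarrow> smooth_on (\<psi> ` (V \<inter> U)) (\<phi> \<circ> inv_into V \<psi>)"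
    using smooth_atlas_transition[OF A d(2) c] by (simp add: d)
qed (rule smooth_atlas_chart(5)[OF A c])

lemma smooth_on_imp_smooth_map_eucl:
  assumes "open W" "smooth_on W g"
  shows "smooth_map (eucl :: ('e::euclidean_space, 'e) atlas) eucl W g"
  using assms smooth_on_continuous[OF assms(2)]
  by (simp add: smooth_map_def eucl_def inv_id comp_def)

lemma smooth_map_post:
  assumes A: "smooth_atlas A" and W: "open W" and f: "smooth_map A eucl W f"
    and g: "open T" "smooth_on T g" "f ` W \<subseteq> T"
  shows "smooth_map A eucl W (\<lambda>x. g (f x))"
  using smooth_map_compose[OF A chart_cover_eucl chart_cover_eucl W f
      smooth_on_imp_smooth_map_eucl[OF g(1,2)] g(3)]
  by (simp add: comp_def)

lemma smooth_map_union:
  assumes A: "smooth_atlas A" and "\<And>x. x \<in> W \<Longrightarrow> smooth_fun_at A x f"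
  shows "smooth_map A eucl W f"
proof (rule smooth_map_eucl_local[OF A])
  fix x assume "x \<in> W"
  then obtain V where V: "open V" "x \<in> V" "smooth_map A eucl V f"
    using assms(2) unfolding smooth_fun_at_def by blast
  obtain U \<phi> where c: "(U, \<phi>) \<in> A" "x \<in> U" by (rule smooth_atlas_cover[OF A])
  have "open (\<phi> ` (U \<inter> V))"
    using smooth_atlas_chart(1)[OF A c(1)] V by (intro chart_image_open[OF A c(1)]) auto
  then show "\<exists>U \<phi> N. (U, \<phi>) \<in> A \<and> x \<in> U \<and> open N \<and> \<phi> x \<in> N \<and> N \<subseteq> \<phi> ` U \<and> smooth_on N (f \<circ> inv_into U \<phi>)"
    using c V(2) smooth_map_euclD[OF V(3) c(1)] by fast
qed

lemma smooth_fun_at_chart: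
  assumes A: "smooth_atlas A" and f: "smooth_fun_at A x f" and c: "(U, \<phi>) \<in> A" "x \<in> U"
  obtains N where "open N" "\<phi> x \<in> N" "N \<subseteq> \<phi> ` U" "smooth_on N (f \<circ> inv_into U \<phi>)"
proof -
  obtain V where V: "open V" "x \<in> V" "smooth_map A eucl V f"
    using f unfolding smooth_fun_at_def by blast
  have "open (\<phi> ` (U \<inter> V))"
    using smooth_atlas_chart(1)[OF A c(1)] V by (intro chart_image_open[OF A c(1)]) auto
  then show ?thesis
    using that[of "\<phi> ` (U \<inter> V)"] c V(2) smooth_map_euclD[OF V(3) c(1)] by auto
qed

lemma smooth_fun_at_compose:
  assumes A: "smooth_atlas A" and B: "chart_cover B" and W: "open W" "x \<in> W" and f: "smooth_map A B W f"
    and h: "smooth_fun_at B (f x) h"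
  shows "smooth_fun_at A x (h \<circ> f)"
proof -
  obtain V where V: "open V" "f x \<in> V" "smooth_map B eucl V h"
    using h unfolding smooth_fun_at_def by blast
  have o: "open (W \<inter> f -` V)"
    using f W V by (auto simp: smooth_map_def intro!: continuous_open_preimage)
  have "smooth_map A eucl (W \<inter> f -` V) (h \<circ> f)"
    by (rule smooth_map_compose[OF A B chart_cover_eucl o smooth_map_subset[OF f] V(3)]) auto
  then show ?thesis unfolding smooth_fun_at_def using o W V by blast
qed

lemma smooth_fun_at_cong:
  assumes A: "smooth_atlas A" and "open W" "x \<in> W" "\<And>y. y \<in> W \<Longrightarrow> f y = g y" "smooth_fun_at A x f"
  shows "smooth_fun_at A x g"
proof -
  obtain V where V: "open V" "x \<in> V" "smooth_map A eucl V f"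
    using assms(5) unfolding smooth_fun_at_def by blast
  have "smooth_map A eucl (V \<inter> W) g"
    by (rule smooth_map_cong[OF A chart_cover_eucl _ smooth_map_subset[OF V(3)]]) (use V assms in auto)
  then show ?thesis unfolding smooth_fun_at_def using V assms(2,3) by blast
qed

lemma smooth_fun_at_cong_iff:
  assumes "smooth_atlas A" "open W" "x \<in> W" "\<And>y. y \<in> W \<Longrightarrow> f y = g y"
  shows "smooth_fun_at A x f \<longleftrightarrow> smooth_fun_at A x g"
  using smooth_fun_at_cong[OF assms(1-3), of f g] smooth_fun_at_cong[OF assms(1-3), of g f] assms(4)
  by auto

lemma smooth_map_id:
  assumes "smooth_atlas A" shows "smooth_map A A UNIV (\<lambda>x. x)"
proof (rule smooth_mapI)
  fix U \<phi> V \<psi> assume "(U, \<phi>) \<in> A" "(V, \<psi>) \<in> A"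
  then show "smooth_on (\<phi> ` (U \<inter> UNIV \<inter> (\<lambda>x. x) -` V)) (\<psi> \<circ> (\<lambda>x. x) \<circ> inv_into U \<phi>)"
    using smooth_atlas_transition[OF assms] by (simp add: comp_def)
qed (rule continuous_on_id)

lemma coord_vec_has_derivative:
  assumes A: "smooth_atlas A" and c: "(U, \<phi>) \<in> A" "x \<in> U" and f: "smooth_fun_at A x f"
  shows "((f \<circ> inv_into U \<phi>) has_derivative (\<lambda>v. coord_vec A (U, \<phi>) x v f)) (at (\<phi> x))"
proof -
  obtain N where "open N" "\<phi> x \<in> N" "N \<subseteq> \<phi> ` U" "smooth_on N (f \<circ> inv_into U \<phi>)"
    by (rule smooth_fun_at_chart[OF A f c])
  from smooth_on_has_derivative[OF this(4,2)] show ?thesis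
    using f by (simp add: coord_vec_def)
qed

lemma coord_vec_eqI:
  assumes "smooth_atlas A" "(U, \<phi>) \<in> A" "x \<in> U" "smooth_fun_at A x f"
    and "((f \<circ> inv_into U \<phi>) has_derivative D) (at (\<phi> x))"
  shows "coord_vec A (U, \<phi>) x v f = D v"
  using has_derivative_unique[OF coord_vec_has_derivative[OF assms(1-4)] assms(5)] by (rule fun_cong)

lemma coord_vec_linear:
  assumes A: "smooth_atlas A" and c: "(U, \<phi>) \<in> A" "x \<in> U"
  shows "coord_vec A (U, \<phi>) x (a *\<^sub>R v + b *\<^sub>R w)
    = (\<lambda>f. a * coord_vec A (U, \<phi>) x v f + b * coord_vec A (U, \<phi>) x w f)"
proof
  fix f
  show "coord_vec A (U, \<phi>) x (a *\<^sub>R v + b *\<^sub>R w) f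
    = a * coord_vec A (U, \<phi>) x v f + b * coord_vec A (U, \<phi>) x w f"
  proof (cases "smooth_fun_at A x f")
    case True
    note l = has_derivative_linear[OF coord_vec_has_derivative[OF A c True]]
    show ?thesis using linear_add[OF l] linear_scale[OF l] by simp
  qed (simp add: coord_vec_def)
qed

lemma smooth_fun_at_coordinate:
  assumes A: "smooth_atlas A" and c: "(U, \<phi>) \<in> A" "x \<in> U"
  shows "smooth_fun_at A x (\<lambda>y. \<phi> y \<bullet> b)"
proof -
  have "smooth_map A eucl U (\<lambda>y. \<phi> y \<bullet> b)"
    by (rule smooth_map_post[OF A smooth_atlas_chart(1)[OF A c(1)] smooth_map_chart[OF A c(1)] open_UNIV
          smooth_on_bounded_linear[OF smooth_on_identity open_UNIV bounded_linear_inner_left[of b]] subset_UNIV])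
  then show ?thesis using c smooth_atlas_chart(1)[OF A c(1)] unfolding smooth_fun_at_def by blast
qed

lemma coord_vec_coordinate:
  assumes A: "smooth_atlas A" and c: "(U, \<phi>) \<in> A" "x \<in> U"
  shows "coord_vec A (U, \<phi>) x v (\<lambda>y. \<phi> y \<bullet> b) = v \<bullet> b"
proof (rule coord_vec_eqI[OF A c smooth_fun_at_coordinate[OF A c]])
  have "((\<lambda>z. z \<bullet> b) has_derivative (\<lambda>v. v \<bullet> b)) (at (\<phi> x))"
    by (auto intro!: derivative_eq_intros)
  then show "((\<lambda>y. \<phi> y \<bullet> b) \<circ> inv_into U \<phi> has_derivative (\<lambda>v. v \<bullet> b)) (at (\<phi> x))"
    by (rule has_derivative_transform_within_open[OF _ smooth_atlas_chart(2)[OF A c(1)]])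
      (use c in \<open>auto simp: f_inv_into_f\<close>)
qed

lemma coord_vec_inj:
  assumes "smooth_atlas A" "(U, \<phi>) \<in> A" "x \<in> U" "coord_vec A (U, \<phi>) x v = coord_vec A (U, \<phi>) x w"
  shows "v = w"
proof (rule euclidean_eqI)
  fix b
  show "v \<bullet> b = w \<bullet> b"
    unfolding coord_vec_coordinate[OF assms(1-3), of v b, symmetric]
      coord_vec_coordinate[OF assms(1-3), of w b, symmetric] assms(4) ..
qed

lemma smooth_map_chart_derivative:
  assumes A: "smooth_atlas A" and B: "smooth_atlas B" and W: "open W" "x \<in> W" and f: "smooth_map A B W f"
    and c: "(U, \<phi>) \<in> A" "x \<in> U" and d: "(V, \<psi>) \<in> B" "f x \<in> V"
  shows "open (\<phi> ` (U \<inter> W \<inter> f -` V))" "\<phi> x \<in> \<phi> ` (U \<inter> W \<inter> f -` V)"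
    "smooth_on (\<phi> ` (U \<inter> W \<inter> f -` V)) (\<psi> \<circ> f \<circ> inv_into U \<phi>)"
proof -
  have "open (W \<inter> f -` V)"
    by (rule continuous_open_preimage[OF smooth_mapD(1)[OF f] W(1) smooth_atlas_chart(1)[OF B d(1)]])
  then show "open (\<phi> ` (U \<inter> W \<inter> f -` V))"
    using smooth_atlas_chart(1)[OF A c(1)] by (intro chart_image_open[OF A c(1)]) (auto simp: Int_assoc)
  show "\<phi> x \<in> \<phi> ` (U \<inter> W \<inter> f -` V)" using W c d by auto
  show "smooth_on (\<phi> ` (U \<inter> W \<inter> f -` V)) (\<psi> \<circ> f \<circ> inv_into U \<phi>)"
    by (rule smooth_mapD(2)[OF f c(1) d(1)])
qed

lemma pushforward_coord_vec:
  assumes A: "smooth_atlas A" and B: "smooth_atlas B" and W: "open W" "x \<in> W" and f: "smooth_map A B W f"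
    and c: "(U, \<phi>) \<in> A" "x \<in> U" and d: "(V, \<psi>) \<in> B" "f x \<in> V"
  shows "pushforward B f x (coord_vec A (U, \<phi>) x v)
    = coord_vec B (V, \<psi>) (f x) (frechet_derivative (\<psi> \<circ> f \<circ> inv_into U \<phi>) (at (\<phi> x)) v)"
proof
  fix h
  note F = smooth_map_chart_derivative[OF A B W f c d]
  show "pushforward B f x (coord_vec A (U, \<phi>) x v) h
    = coord_vec B (V, \<psi>) (f x) (frechet_derivative (\<psi> \<circ> f \<circ> inv_into U \<phi>) (at (\<phi> x)) v) h"
  proof (cases "smooth_fun_at B (f x) h")
    case True
    let ?F = "\<psi> \<circ> f \<circ> inv_into U \<phi>"
    have Fx: "?F (\<phi> x) = \<psi> (f x)"
      using c by (simp add: inv_into_f_f[OF smooth_atlas_chart(4)[OF A c(1)]])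
    have "(((h \<circ> inv_into V \<psi>) \<circ> ?F) has_derivative
        (\<lambda>v. coord_vec B (V, \<psi>) (f x) v h) \<circ> frechet_derivative ?F (at (\<phi> x))) (at (\<phi> x))"
      by (rule diff_chain_at[OF smooth_on_has_derivative[OF F(3,2)]])
        (use coord_vec_has_derivative[OF B d True] in \<open>simp add: Fx del: o_apply\<close>)
    then have "((h \<circ> f \<circ> inv_into U \<phi>) has_derivative
        (\<lambda>v. coord_vec B (V, \<psi>) (f x) v h) \<circ> frechet_derivative ?F (at (\<phi> x))) (at (\<phi> x))"
      by (rule has_derivative_transform_within_open[OF _ F(1,2)])
        (auto simp: inv_into_f_f[OF smooth_atlas_chart(4)[OF A c(1)]]
          inv_into_f_f[OF smooth_atlas_chart(4)[OF B d(1)]])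
    from coord_vec_eqI[OF A c smooth_fun_at_compose[OF A smooth_atlas_chart_cover[OF B] W f True] this]
    show ?thesis using True by (simp add: pushforward_def)
  qed (simp add: pushforward_def coord_vec_def)
qed

lemma pushforward_ident:
  assumes "v \<in> tangent_space A x"
  shows "pushforward A (\<lambda>y. y) x v = v"
  using assms by (auto simp: pushforward_def tangent_space_def coord_vec_def fun_eq_iff comp_def)

lemma tangent_space_chart:
  assumes A: "smooth_atlas A" and c: "(U, \<phi>) \<in> A" "x \<in> U"
  shows "tangent_space A x = range (coord_vec A (U, \<phi>) x)"
proof
  show "range (coord_vec A (U, \<phi>) x) \<subseteq> tangent_space A x"
    using c unfolding tangent_space_def by force
  show "tangent_space A x \<subseteq> range (coord_vec A (U, \<phi>) x)"
  proof
    fix w assume w: "w \<in> tangent_space A x"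
    then obtain d v where d: "w = coord_vec A d x v" "d \<in> A" "x \<in> fst d"
      unfolding tangent_space_def by blast
    obtain V \<psi> where V: "d = (V, \<psi>)" by (cases d)
    have "w = pushforward A (\<lambda>y. y) x w" by (rule pushforward_ident[OF w, symmetric])
    also have "\<dots> = coord_vec A (U, \<phi>) x (frechet_derivative (\<phi> \<circ> (\<lambda>y. y) \<circ> inv_into V \<psi>) (at (\<psi> x)) v)"
      unfolding d(1) V
      by (rule pushforward_coord_vec[OF A A open_UNIV _ smooth_map_id[OF A] _ _ c]) (use d V in auto)
    finally show "w \<in> range (coord_vec A (U, \<phi>) x)" by simp
  qed
qed

lemma tangent_vector_chart:
  assumes "smooth_atlas A" "v \<in> tangent_space A x"
  obtains U \<phi> a where "(U, \<phi>) \<in> A" "x \<in> U" "v = coord_vec A (U, \<phi>) x a"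
proof -
  obtain U \<phi> where "(U, \<phi>) \<in> A" "x \<in> U" by (rule smooth_atlas_cover[OF assms(1)])
  then show ?thesis using that assms tangent_space_chart[OF assms(1)] by blast
qed

lemma coord_vec_in_tangent_space:
  "(U, \<phi>) \<in> A \<Longrightarrow> x \<in> U \<Longrightarrow> coord_vec A (U, \<phi>) x v \<in> tangent_space A x"
  unfolding tangent_space_def by force

lemma tangent_space_linear:
  assumes A: "smooth_atlas A" and v: "v \<in> tangent_space A x" "w \<in> tangent_space A x"
  shows "(\<lambda>f. a * v f + b * w f) \<in> tangent_space A x"
proof -
  obtain U \<phi> where c: "(U, \<phi>) \<in> A" "x \<in> U" by (rule smooth_atlas_cover[OF A])
  then obtain a1 a2 where "v = coord_vec A (U, \<phi>) x a1" "w = coord_vec A (U, \<phi>) x a2"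
    using v tangent_space_chart[OF A c] by auto
  then show ?thesis
    using coord_vec_linear[OF A c, of a a1 b a2, symmetric] coord_vec_in_tangent_space[OF c] by simp
qed

lemma tangent_vector_not_smooth:
  "v \<in> tangent_space A x \<Longrightarrow> \<not> smooth_fun_at A x f \<Longrightarrow> v f = 0"
  by (auto simp: tangent_space_def coord_vec_def)

lemma tangent_vector_germ:
  assumes A: "smooth_atlas A" and v: "v \<in> tangent_space A x" and W: "open W" "x \<in> W"
    and eq: "\<And>y. y \<in> W \<Longrightarrow> f y = g y"
  shows "v f = v g"
proof -
  obtain U \<phi> a where c: "(U, \<phi>) \<in> A" "x \<in> U" "v = coord_vec A (U, \<phi>) x a"
    by (rule tangent_vector_chart[OF A v])
  show ?thesis
  proof (cases "smooth_fun_at A x f")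
    case True
    have g: "smooth_fun_at A x g" by (rule smooth_fun_at_cong[OF A W eq True])
    have o: "open (\<phi> ` (U \<inter> W))"
      using smooth_atlas_chart(1)[OF A c(1)] W by (intro chart_image_open[OF A c(1)]) auto
    have "((g \<circ> inv_into U \<phi>) has_derivative (\<lambda>v. coord_vec A (U, \<phi>) x v f)) (at (\<phi> x))"
      by (rule has_derivative_transform_within_open[OF coord_vec_has_derivative[OF A c(1,2) True] o])
        (use W c eq in \<open>auto simp: inv_into_f_f[OF smooth_atlas_chart(4)[OF A c(1)]]\<close>)
    from coord_vec_eqI[OF A c(1,2) g this, of a] show ?thesis by (simp add: c(3))
  next
    case False
    then have "\<not> smooth_fun_at A x g" using smooth_fun_at_cong_iff[OF A W eq] by simp
    with False show ?thesis using v by (simp add: tangent_vector_not_smooth)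
  qed
qed

lemma tangent_vector_const:
  assumes A: "smooth_atlas A" and v: "v \<in> tangent_space A x"
  shows "v (\<lambda>y. k) = 0"
proof -
  obtain U \<phi> a where c: "(U, \<phi>) \<in> A" "x \<in> U" "v = coord_vec A (U, \<phi>) x a"
    by (rule tangent_vector_chart[OF A v])
  have "smooth_fun_at A x (\<lambda>y. k)"
    using smooth_map_const[OF A open_UNIV] unfolding smooth_fun_at_def by blast
  from coord_vec_eqI[OF A c(1,2) this, of "\<lambda>v. 0"] show ?thesis
    by (simp add: c(3) comp_def)
qed

lemma pushforward_in_tangent_space:
  assumes A: "smooth_atlas A" and B: "smooth_atlas B" and W: "open W" "x \<in> W" and f: "smooth_map A B W f"
    and v: "v \<in> tangent_space A x"
  shows "pushforward B f x v \<in> tangent_space B (f x)"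
proof -
  obtain U \<phi> a where c: "(U, \<phi>) \<in> A" "x \<in> U" "v = coord_vec A (U, \<phi>) x a"
    by (rule tangent_vector_chart[OF A v])
  obtain V \<psi> where d: "(V, \<psi>) \<in> B" "f x \<in> V" by (rule smooth_atlas_cover[OF B])
  show ?thesis
    unfolding c(3) pushforward_coord_vec[OF A B W f c(1,2) d] by (rule coord_vec_in_tangent_space[OF d])
qed

lemma pushforward_linear:
  "pushforward B f x (\<lambda>h. a * v h + b * w h) = (\<lambda>h. a * pushforward B f x v h + b * pushforward B f x w h)"
  by (auto simp: pushforward_def)

lemma pushforward_compose:
  assumes B: "smooth_atlas B" and C: "smooth_atlas C" and W: "open W" "f x \<in> W"
    and g: "smooth_map B C W g"
  shows "pushforward C g (f x) (pushforward B f x v) = pushforward C (g \<circ> f) x v"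
  using smooth_fun_at_compose[OF B smooth_atlas_chart_cover[OF C] W g]
  by (auto simp: pushforward_def fun_eq_iff comp_assoc)

lemma pushforward_cong:
  assumes A: "smooth_atlas A" and v: "v \<in> tangent_space A x" and W: "open W" "x \<in> W"
    and eq: "\<And>y. y \<in> W \<Longrightarrow> f y = g y"
  shows "pushforward B f x v = pushforward B g x v"
  using tangent_vector_germ[OF A v W, of "h \<circ> f" "h \<circ> g" for h] eq[OF W(2)] eq
  by (auto simp: pushforward_def fun_eq_iff)

lemma vector_fieldI:
  assumes A: "smooth_atlas A" and W: "open W"
    and loc: "\<And>x. x \<in> W \<Longrightarrow> \<exists>U \<phi> N a. (U, \<phi>) \<in> A \<and> x \<in> U \<and> open N \<and> \<phi> x \<in> N \<and> N \<subseteq> \<phi> ` U \<and>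
      smooth_on N a \<and> (\<forall>z\<in>N. \<xi> (inv_into U \<phi> z) = coord_vec A (U, \<phi>) (inv_into U \<phi> z) (a z))"
  shows "vector_field A W \<xi>"
  unfolding vector_field_def
proof (intro conjI W ballI allI impI)
  fix x assume "x \<in> W"
  then obtain U \<phi> N a where c: "(U, \<phi>) \<in> A" "x \<in> U" "\<phi> x \<in> N"
    "\<forall>z\<in>N. \<xi> (inv_into U \<phi> z) = coord_vec A (U, \<phi>) (inv_into U \<phi> z) (a z)"
    using loc by meson
  then have "\<xi> x = coord_vec A (U, \<phi>) x (a (\<phi> x))"
    using inv_into_f_f[OF smooth_atlas_chart(4)[OF A c(1)] c(2)] by metis
  then show "\<xi> x \<in> tangent_space A x" using coord_vec_in_tangent_space[OF c(1,2)] by metis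
next
  fix V and f :: "'a \<Rightarrow> real"
  assume V: "open V \<and> V \<subseteq> W \<and> smooth_map A eucl V f"
  show "smooth_map A eucl V (\<lambda>y. \<xi> y f)"
  proof (rule smooth_map_eucl_local[OF A])
    fix x assume x: "x \<in> V"
    then obtain U \<phi> N a where c: "(U, \<phi>) \<in> A" "x \<in> U" "open N" "\<phi> x \<in> N" "N \<subseteq> \<phi> ` U" "smooth_on N a"
      and \<xi>: "\<forall>z\<in>N. \<xi> (inv_into U \<phi> z) = coord_vec A (U, \<phi>) (inv_into U \<phi> z) (a z)"
      using loc V by (meson subsetD)
    let ?N = "N \<inter> \<phi> ` (U \<inter> V)"
    have o: "open ?N"
      using smooth_atlas_chart(1)[OF A c(1)] V c(3) by (intro open_Int chart_image_open[OF A c(1)]) auto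
    have "smooth_on ?N (\<lambda>z. frechet_derivative (f \<circ> inv_into U \<phi>) (at z) (a z))"
    proof (rule smooth_on_directional[OF o])
      show "smooth_on ?N (f \<circ> inv_into U \<phi>)"
        by (rule smooth_on_subset[OF smooth_map_euclD[OF _ c(1)]]) (use V in auto)
      show "smooth_on ?N a" by (rule smooth_on_subset[OF c(6)]) auto
    qed
    then have "smooth_on ?N ((\<lambda>y. \<xi> y f) \<circ> inv_into U \<phi>)"
    proof (rule smooth_on_cong[OF _ o])
      fix z assume z: "z \<in> ?N"
      then obtain y where y: "y \<in> U" "y \<in> V" "z = \<phi> y" by auto
      have iz: "inv_into U \<phi> z = y" unfolding y(3) by (rule inv_into_f_f[OF smooth_atlas_chart(4)[OF A c(1)] y(1)])
      have "smooth_fun_at A y f" using y V unfolding smooth_fun_at_def by blast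
      then show "frechet_derivative (f \<circ> inv_into U \<phi>) (at z) (a z) = ((\<lambda>y. \<xi> y f) \<circ> inv_into U \<phi>) z"
        using \<xi>[rule_format, of z] z iz y(3) by (simp add: coord_vec_def)
    qed
    then show "\<exists>U \<phi> N. (U, \<phi>) \<in> A \<and> x \<in> U \<and> open N \<and> \<phi> x \<in> N \<and> N \<subseteq> \<phi> ` U \<and>
        smooth_on N ((\<lambda>y. \<xi> y f) \<circ> inv_into U \<phi>)"
      using c o x by (intro exI[of _ U] exI[of _ \<phi>] exI[of _ ?N]) auto
  qed
qed

lemma vector_field_coords:
  assumes A: "smooth_atlas A" and \<xi>: "vector_field A W \<xi>" and c: "(U, \<phi>) \<in> A"
  obtains a where "smooth_on (\<phi> ` (U \<inter> W)) a"
    "\<And>y. y \<in> U \<inter> W \<Longrightarrow> \<xi> y = coord_vec A (U, \<phi>) y (a (\<phi> y))"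
proof
  have W: "open W" using \<xi> by (simp add: vector_field_def)
  note U = smooth_atlas_chart[OF A c]
  have o: "open (\<phi> ` (U \<inter> W))" using U(1) W by (intro chart_image_open[OF A c]) auto
  let ?a = "\<lambda>z. \<Sum>b\<in>Basis. \<xi> (inv_into U \<phi> z) (\<lambda>y. \<phi> y \<bullet> b) *\<^sub>R b"
  show "smooth_on (\<phi> ` (U \<inter> W)) ?a"
  proof (intro smooth_on_sum o finite_Basis)
    fix b
    have "smooth_map A eucl U (\<lambda>y. \<phi> y \<bullet> b)"
      by (rule smooth_map_union[OF A smooth_fun_at_coordinate[OF A c]])
    then have "smooth_map A eucl (U \<inter> W) (\<lambda>y. \<phi> y \<bullet> b)" by (rule smooth_map_subset) auto
    then have "smooth_map A eucl (U \<inter> W) (\<lambda>y. \<xi> y (\<lambda>y. \<phi> y \<bullet> b))"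
      using \<xi> U(1) unfolding vector_field_def by blast
    from smooth_map_euclD[OF this c]
    have "smooth_on (\<phi> ` (U \<inter> W)) (\<lambda>z. \<xi> (inv_into U \<phi> z) (\<lambda>y. \<phi> y \<bullet> b))"
      by (simp add: comp_def)
    then show "smooth_on (\<phi> ` (U \<inter> W)) (\<lambda>z. \<xi> (inv_into U \<phi> z) (\<lambda>y. \<phi> y \<bullet> b) *\<^sub>R b)"
      by (rule smooth_on_bounded_linear[OF _ o bounded_linear_scaleR_left])
  qed
  fix y assume y: "y \<in> U \<inter> W"
  then have "\<xi> y \<in> tangent_space A y" using \<xi> by (auto simp: vector_field_def)
  then obtain v where v: "\<xi> y = coord_vec A (U, \<phi>) y v" using tangent_space_chart[OF A c] y by auto
  have "?a (\<phi> y) = v"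
    using y by (simp add: inv_into_f_f[OF U(4)] v coord_vec_coordinate[OF A c] euclidean_representation)
  then show "\<xi> y = coord_vec A (U, \<phi>) y (?a (\<phi> y))" using v by simp
qed

lemma vector_field_tangent: "vector_field A W \<xi> \<Longrightarrow> y \<in> W \<Longrightarrow> \<xi> y \<in> tangent_space A y"
  by (simp add: vector_field_def)

lemma vector_field_smooth_fun_at:
  assumes \<xi>: "vector_field A W \<xi>" and x: "x \<in> W" and f: "smooth_fun_at A x f"
  shows "smooth_fun_at A x (\<lambda>y. \<xi> y f)"
proof -
  obtain V where V: "open V" "x \<in> V" "smooth_map A eucl V f" using f unfolding smooth_fun_at_def by blast
  have W: "open W" using \<xi> by (simp add: vector_field_def)
  have "smooth_map A eucl (V \<inter> W) f" by (rule smooth_map_subset[OF V(3)]) auto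
  then have "smooth_map A eucl (V \<inter> W) (\<lambda>y. \<xi> y f)"
    using \<xi> V(1) W unfolding vector_field_def by blast
  then show ?thesis using V W x unfolding smooth_fun_at_def by blast
qed

lemma directional_has_derivative:
  fixes F :: "'a::euclidean_space \<Rightarrow> real"
  assumes N: "open N" "z \<in> N" and F: "smooth_on N F" and b: "smooth_on N b"
  shows "((\<lambda>z. frechet_derivative F (at z) (b z)) has_derivative
    (\<lambda>v. frechet_derivative F (at z) (frechet_derivative b (at z) v)
      + frechet_derivative (\<lambda>y. frechet_derivative F (at y) (b z)) (at z) v)) (at z)"
proof -
  let ?F = "\<lambda>z. frechet_derivative F (at z)" and ?b = "\<lambda>z. frechet_derivative b (at z)"
  let ?F2 = "\<lambda>e. frechet_derivative (\<lambda>y. ?F y e) (at z)"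
  have ex: "?F y w = (\<Sum>e\<in>Basis. (w \<bullet> e) *\<^sub>R ?F y e)" if "y \<in> N" for y w
    by (rule linear_euclidean_expand[OF has_derivative_linear[OF smooth_on_has_derivative[OF F that]]])
  have F2: "((\<lambda>y. ?F y e) has_derivative ?F2 e) (at z)" for e
    by (rule smooth_on_has_derivative[OF smooth_on_derivative[OF F] N(2)])
  have "((\<lambda>y. \<Sum>e\<in>Basis. (b y \<bullet> e) *\<^sub>R ?F y e) has_derivative
      (\<lambda>v. \<Sum>e\<in>Basis. (b z \<bullet> e) *\<^sub>R ?F2 e v + (?b z v \<bullet> e) *\<^sub>R ?F z e)) (at z)"
    by (intro has_derivative_sum has_derivative_scaleR F2 has_derivative_inner_left
        smooth_on_has_derivative[OF b N(2)])
  then have 1: "((\<lambda>y. ?F y (b y)) has_derivative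
      (\<lambda>v. \<Sum>e\<in>Basis. (b z \<bullet> e) *\<^sub>R ?F2 e v + (?b z v \<bullet> e) *\<^sub>R ?F z e)) (at z)"
    by (rule has_derivative_transform_within_open[OF _ N]) (rule ex[symmetric])
  have "((\<lambda>y. \<Sum>e\<in>Basis. (b z \<bullet> e) *\<^sub>R ?F y e) has_derivative
      (\<lambda>v. \<Sum>e\<in>Basis. (b z \<bullet> e) *\<^sub>R ?F2 e v)) (at z)"
    by (intro has_derivative_sum has_derivative_scaleR_right F2)
  then have "((\<lambda>y. ?F y (b z)) has_derivative (\<lambda>v. \<Sum>e\<in>Basis. (b z \<bullet> e) *\<^sub>R ?F2 e v)) (at z)"
    by (rule has_derivative_transform_within_open[OF _ N]) (rule ex[symmetric])
  from has_derivative_unique[OF this F2]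
  have 2: "?F2 (b z) v = (\<Sum>e\<in>Basis. (b z \<bullet> e) *\<^sub>R ?F2 e v)" for v by (simp add: fun_eq_iff)
  have "(\<Sum>e\<in>Basis. (b z \<bullet> e) *\<^sub>R ?F2 e v + (?b z v \<bullet> e) *\<^sub>R ?F z e) = ?F z (?b z v) + ?F2 (b z) v" for v
    unfolding 2 ex[OF N(2), of "?b z v"] by (simp add: sum.distrib)
  with 1 show ?thesis by simp
qed

text \<open>The second summand is symmetric under exchanging the two fields and cancels in the Lie bracket.\<close>

lemma vector_field_iterated:
  assumes A: "smooth_atlas A" and c: "(U, \<phi>) \<in> A" "x \<in> U" and \<xi>: "vector_field A W \<xi>" "x \<in> W"
    and \<eta>: "vector_field A W \<eta>" and f: "smooth_fun_at A x f"
    and b: "smooth_on (\<phi> ` (U \<inter> W)) b" "\<And>y. y \<in> U \<inter> W \<Longrightarrow> \<eta> y = coord_vec A (U, \<phi>) y (b (\<phi> y))"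
    and a: "\<xi> x = coord_vec A (U, \<phi>) x a"
  defines "F \<equiv> f \<circ> inv_into U \<phi>"
  shows "\<xi> x (\<lambda>y. \<eta> y f) = frechet_derivative F (at (\<phi> x)) (frechet_derivative b (at (\<phi> x)) a)
     + frechet_derivative (\<lambda>y. frechet_derivative F (at y) (b (\<phi> x))) (at (\<phi> x)) a"
proof -
  have W: "open W" using \<xi> by (simp add: vector_field_def)
  note inj = smooth_atlas_chart(4)[OF A c(1)]
  obtain V where V: "open V" "x \<in> V" "smooth_map A eucl V f" using f unfolding smooth_fun_at_def by blast
  let ?N = "\<phi> ` (U \<inter> (W \<inter> V))"
  have N: "open ?N" "\<phi> x \<in> ?N"
    using smooth_atlas_chart(1)[OF A c(1)] V W c \<xi>(2) by (auto intro!: chart_image_open[OF A c(1)])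
  have sF: "smooth_on ?N F"
    unfolding F_def by (rule smooth_on_subset[OF smooth_map_euclD[OF V(3) c(1)]]) auto
  have sb: "smooth_on ?N b" by (rule smooth_on_subset[OF b(1)]) auto
  have "((\<lambda>y. \<eta> y f) \<circ> inv_into U \<phi> has_derivative
     (\<lambda>v. frechet_derivative F (at (\<phi> x)) (frechet_derivative b (at (\<phi> x)) v)
      + frechet_derivative (\<lambda>y. frechet_derivative F (at y) (b (\<phi> x))) (at (\<phi> x)) v)) (at (\<phi> x))"
  proof (rule has_derivative_transform_within_open[OF directional_has_derivative[OF N sF sb] N])
    fix z assume "z \<in> ?N"
    then obtain y where y: "y \<in> U" "y \<in> W" "y \<in> V" "z = \<phi> y" by auto
    have "smooth_fun_at A y f" using y V unfolding smooth_fun_at_def by blast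
    then show "frechet_derivative F (at z) (b z) = ((\<lambda>y. \<eta> y f) \<circ> inv_into U \<phi>) z"
      using y b(2)[of y] by (simp add: inv_into_f_f[OF inj] coord_vec_def F_def)
  qed
  from coord_vec_eqI[OF A c vector_field_smooth_fun_at[OF \<eta> \<xi>(2) f] this]
  show ?thesis unfolding a .
qed

lemma lie_bracket_coords:
  assumes A: "smooth_atlas A" and c: "(U, \<phi>) \<in> A" "x \<in> U" and \<xi>: "vector_field A W \<xi>"
    and \<eta>: "vector_field A W \<eta>" and x: "x \<in> W"
    and a: "smooth_on (\<phi> ` (U \<inter> W)) a" "\<And>y. y \<in> U \<inter> W \<Longrightarrow> \<xi> y = coord_vec A (U, \<phi>) y (a (\<phi> y))"
    and b: "smooth_on (\<phi> ` (U \<inter> W)) b" "\<And>y. y \<in> U \<inter> W \<Longrightarrow> \<eta> y = coord_vec A (U, \<phi>) y (b (\<phi> y))"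
  shows "lie_bracket A \<xi> \<eta> x = coord_vec A (U, \<phi>) x
    (frechet_derivative b (at (\<phi> x)) (a (\<phi> x)) - frechet_derivative a (at (\<phi> x)) (b (\<phi> x)))"
proof
  fix f
  show "lie_bracket A \<xi> \<eta> x f = coord_vec A (U, \<phi>) x
    (frechet_derivative b (at (\<phi> x)) (a (\<phi> x)) - frechet_derivative a (at (\<phi> x)) (b (\<phi> x))) f"
  proof (cases "smooth_fun_at A x f")
    case True
    let ?F = "f \<circ> inv_into U \<phi>"
    obtain N where N: "open N" "\<phi> x \<in> N" "N \<subseteq> \<phi> ` U" "smooth_on N ?F"
      by (rule smooth_fun_at_chart[OF A True c])
    have xUW: "x \<in> U \<inter> W" using c x by simp
    have l: "linear (frechet_derivative ?F (at (\<phi> x)))"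
      by (rule has_derivative_linear[OF smooth_on_has_derivative[OF N(4,2)]])
    let ?z = "\<phi> x"
    have 1: "\<xi> x (\<lambda>y. \<eta> y f) = frechet_derivative ?F (at ?z) (frechet_derivative b (at ?z) (a ?z))
        + frechet_derivative (\<lambda>y. frechet_derivative ?F (at y) (b ?z)) (at ?z) (a ?z)"
      by (rule vector_field_iterated[OF A c \<xi> x \<eta> True b a(2)[OF xUW]])
    have 2: "\<eta> x (\<lambda>y. \<xi> y f) = frechet_derivative ?F (at ?z) (frechet_derivative a (at ?z) (b ?z))
        + frechet_derivative (\<lambda>y. frechet_derivative ?F (at y) (a ?z)) (at ?z) (b ?z)"
      by (rule vector_field_iterated[OF A c \<eta> x \<xi> True a b(2)[OF xUW]])
    have "lie_bracket A \<xi> \<eta> x f = \<xi> x (\<lambda>y. \<eta> y f) - \<eta> x (\<lambda>y. \<xi> y f)"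
      using True by (simp add: lie_bracket_def)
    also have "\<dots> = frechet_derivative ?F (at (\<phi> x)) (frechet_derivative b (at (\<phi> x)) (a (\<phi> x))
        - frechet_derivative a (at (\<phi> x)) (b (\<phi> x)))"
      unfolding 1 2 linear_diff[OF l] second_derivative_symmetric[OF N(1,2,4), of "b (\<phi> x)" "a (\<phi> x)"]
      by simp
    finally show ?thesis using True by (simp add: coord_vec_def)
  qed (simp add: lie_bracket_def coord_vec_def)
qed

lemma lie_bracket_vector_field:
  assumes A: "smooth_atlas A" and \<xi>: "vector_field A W \<xi>" and \<eta>: "vector_field A W \<eta>"
  shows "vector_field A W (lie_bracket A \<xi> \<eta>)"
proof (rule vector_fieldI[OF A])
  show W: "open W" using \<xi> by (simp add: vector_field_def)
  fix x assume x: "x \<in> W"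
  obtain U \<phi> where c: "(U, \<phi>) \<in> A" "x \<in> U" by (rule smooth_atlas_cover[OF A])
  obtain a where a: "smooth_on (\<phi> ` (U \<inter> W)) a" "\<And>y. y \<in> U \<inter> W \<Longrightarrow> \<xi> y = coord_vec A (U, \<phi>) y (a (\<phi> y))"
    by (rule vector_field_coords[OF A \<xi> c(1)], rule that)
  obtain b where b: "smooth_on (\<phi> ` (U \<inter> W)) b" "\<And>y. y \<in> U \<inter> W \<Longrightarrow> \<eta> y = coord_vec A (U, \<phi>) y (b (\<phi> y))"
    by (rule vector_field_coords[OF A \<eta> c(1)], rule that)
  let ?N = "\<phi> ` (U \<inter> W)"
  let ?e = "\<lambda>z. frechet_derivative b (at z) (a z) + - frechet_derivative a (at z) (b z)"
  have o: "open ?N" using smooth_atlas_chart(1)[OF A c(1)] W by (intro chart_image_open[OF A c(1)]) auto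
  have "smooth_on ?N ?e"
    by (intro smooth_on_add o smooth_on_directional a b
        smooth_on_bounded_linear[OF _ o bounded_linear_minus[OF bounded_linear_ident]])
  moreover have "\<forall>z\<in>?N. lie_bracket A \<xi> \<eta> (inv_into U \<phi> z) = coord_vec A (U, \<phi>) (inv_into U \<phi> z) (?e z)"
    using lie_bracket_coords[OF A c(1) _ \<xi> \<eta> _ a b]
    by (auto simp: inv_into_f_f[OF smooth_atlas_chart(4)[OF A c(1)]])
  ultimately show "\<exists>U \<phi> N a. (U, \<phi>) \<in> A \<and> x \<in> U \<and> open N \<and> \<phi> x \<in> N \<and> N \<subseteq> \<phi> ` U \<and> smooth_on N a \<and>
      (\<forall>z\<in>N. lie_bracket A \<xi> \<eta> (inv_into U \<phi> z) = coord_vec A (U, \<phi>) (inv_into U \<phi> z) (a z))"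
    using c x o by (intro exI[of _ U] exI[of _ \<phi>] exI[of _ ?N] exI[of _ ?e]) auto
qed

text \<open>Relatedness of \<open>\<xi>\<close> and \<open>\<xi>\<close>' means \<open>\<xi> (h \<circ> f) = (\<xi>' h) \<circ> f\<close>, and this identity can be iterated.\<close>

lemma lie_bracket_related:
  assumes A: "smooth_atlas A" and B: "smooth_atlas B" and W: "open W" "x \<in> W" and f: "smooth_map A B W f"
    and \<xi>: "vector_field A W \<xi>" and \<eta>: "vector_field A W \<eta>"
    and \<xi>': "vector_field B W' \<xi>'" and \<eta>': "vector_field B W' \<eta>'" and W': "f ` W \<subseteq> W'"
    and r: "\<And>y. y \<in> W \<Longrightarrow> pushforward B f y (\<xi> y) = \<xi>' (f y)" "\<And>y. y \<in> W \<Longrightarrow> pushforward B f y (\<eta> y) = \<eta>' (f y)"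
  shows "pushforward B f x (lie_bracket A \<xi> \<eta> x) = lie_bracket B \<xi>' \<eta>' (f x)"
proof
  fix h
  show "pushforward B f x (lie_bracket A \<xi> \<eta> x) h = lie_bracket B \<xi>' \<eta>' (f x) h"
  proof (cases "smooth_fun_at B (f x) h")
    case True
    have hf: "smooth_fun_at A x (h \<circ> f)"
      by (rule smooth_fun_at_compose[OF A smooth_atlas_chart_cover[OF B] W f True])
    obtain V where V: "open V" "f x \<in> V" "smooth_map B eucl V h" using True unfolding smooth_fun_at_def by blast
    have o: "open (W \<inter> f -` V)" by (rule continuous_open_preimage[OF smooth_mapD(1)[OF f] W(1) V(1)])
    have *: "\<xi> x (\<lambda>y. \<eta> y (h \<circ> f)) = \<xi>' (f x) (\<lambda>w. \<eta>' w h)"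
      if \<xi>: "vector_field A W \<xi>" and \<eta>': "vector_field B W' \<eta>'"
        and r: "\<And>y. y \<in> W \<Longrightarrow> pushforward B f y (\<xi> y) = \<xi>' (f y)" "\<And>y. y \<in> W \<Longrightarrow> pushforward B f y (\<eta> y) = \<eta>' (f y)"
      for \<xi> \<eta> \<xi>' \<eta>'
    proof -
      have "\<xi> x (\<lambda>y. \<eta> y (h \<circ> f)) = \<xi> x ((\<lambda>w. \<eta>' w h) \<circ> f)"
      proof (rule tangent_vector_germ[OF A vector_field_tangent[OF \<xi> W(2)] o])
        show "x \<in> W \<inter> f -` V" using W V by simp
        fix y assume y: "y \<in> W \<inter> f -` V"
        then have "smooth_fun_at B (f y) h" using V unfolding smooth_fun_at_def by blast
        then show "\<eta> y (h \<circ> f) = ((\<lambda>w. \<eta>' w h) \<circ> f) y" using r(2)[of y, symmetric] y by (simp add: pushforward_def)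
      qed
      also have "\<dots> = pushforward B f x (\<xi> x) (\<lambda>w. \<eta>' w h)"
        using vector_field_smooth_fun_at[OF \<eta>' _ True] W W' by (auto simp: pushforward_def)
      finally show ?thesis using r(1)[OF W(2)] by simp
    qed
    have "pushforward B f x (lie_bracket A \<xi> \<eta> x) h = \<xi> x (\<lambda>y. \<eta> y (h \<circ> f)) - \<eta> x (\<lambda>y. \<xi> y (h \<circ> f))"
      using True hf by (simp add: pushforward_def lie_bracket_def)
    also have "\<dots> = \<xi>' (f x) (\<lambda>w. \<eta>' w h) - \<eta>' (f x) (\<lambda>w. \<xi>' w h)"
      by (rule arg_cong2[of _ _ _ _ "(-)", OF *[OF \<xi> \<eta>' r] *[OF \<eta> \<xi>' r(2) r(1)]])
    finally show ?thesis using True by (simp add: lie_bracket_def)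
  qed (simp add: pushforward_def lie_bracket_def)
qed

lemma velocity_eq_pushforward:
  fixes G :: "'v::euclidean_space \<Rightarrow> 'm::{t2_space,second_countable_topology}" and A :: "('m, 'e::euclidean_space) atlas"
  assumes A: "smooth_atlas A" and N: "open N" "g 0 \<in> N" and G: "smooth_map eucl A N G"
    and g: "(g has_vector_derivative v) (at 0)"
  shows "velocity A (\<lambda>t. G (g t)) = pushforward A G (g 0) (coord_vec eucl (UNIV, id) (g 0) v)"
proof
  fix f
  show "velocity A (\<lambda>t. G (g t)) f = pushforward A G (g 0) (coord_vec eucl (UNIV, id) (g 0) v) f"
  proof (cases "smooth_fun_at A (G (g 0)) f")
    case True
    have c: "(UNIV, id) \<in> (eucl :: ('v, 'v) atlas)" by (simp add: eucl_def)
    have s: "smooth_fun_at eucl (g 0) (f \<circ> G)"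
      by (rule smooth_fun_at_compose[OF smooth_atlas_eucl smooth_atlas_chart_cover[OF A] N G True])
    have d: "((f \<circ> G) has_derivative (\<lambda>v. coord_vec eucl (UNIV, id) (g 0) v (f \<circ> G))) (at (g 0))"
      using coord_vec_has_derivative[OF smooth_atlas_eucl c UNIV_I s] by (simp add: inv_id)
    have "((\<lambda>t. (f \<circ> G) (g t)) has_derivative
        (\<lambda>t. coord_vec eucl (UNIV, id) (g 0) (t *\<^sub>R v) (f \<circ> G))) (at 0)"
      using has_derivative_compose[OF g[unfolded has_vector_derivative_def] d] .
    then have "((\<lambda>t. f (G (g t))) has_real_derivative coord_vec eucl (UNIV, id) (g 0) v (f \<circ> G)) (at 0)"
      using linear_scale[OF has_derivative_linear[OF d]]
      by (simp add: has_field_derivative_def mult_commute_abs)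
    then show ?thesis using True by (simp add: velocity_def pushforward_def DERIV_imp_deriv)
  qed (simp add: velocity_def pushforward_def)
qed

lemma smooth_map_sum:
  assumes "smooth_atlas A" "open W" "finite I" "\<And>i. i \<in> I \<Longrightarrow> smooth_map A eucl W (f i)"
  shows "smooth_map A eucl W (\<lambda>x. \<Sum>i\<in>I. f i x)"
  unfolding smooth_map_eucl
proof (intro conjI ballI)
  show "continuous_on W (\<lambda>x. \<Sum>i\<in>I. f i x)"
    using assms(4) by (intro continuous_on_sum) (auto simp: smooth_map_eucl)
  fix c assume "c \<in> A"
  then obtain U \<phi> where c: "c = (U, \<phi>)" "(U, \<phi>) \<in> A" by (cases c) auto
  have o: "open (\<phi> ` (U \<inter> W))"
    using smooth_atlas_chart(1)[OF assms(1) c(2)] assms(2) by (intro chart_image_open[OF assms(1) c(2)]) auto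
  have "smooth_on (\<phi> ` (U \<inter> W)) (\<lambda>z. \<Sum>i\<in>I. (f i \<circ> inv_into U \<phi>) z)"
    by (rule smooth_on_sum[OF o assms(3) smooth_map_euclD[OF assms(4) c(2)]])
  then show "case c of (U, \<phi>) \<Rightarrow> smooth_on (\<phi> ` (U \<inter> W)) ((\<lambda>x. \<Sum>i\<in>I. f i x) \<circ> inv_into U \<phi>)"
    by (simp add: c comp_def)
qed

lemma vector_field_subset:
  assumes "vector_field A W \<xi>" "open V" "V \<subseteq> W"
  shows "vector_field A V \<xi>"
  unfolding vector_field_def
proof (intro conjI ballI allI impI)
  fix Y and f :: "'a \<Rightarrow> real" assume "open Y \<and> Y \<subseteq> V \<and> smooth_map A eucl Y f"
  then have "open Y \<and> Y \<subseteq> W \<and> smooth_map A eucl Y f" using assms(3) by auto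
  then show "smooth_map A eucl Y (\<lambda>y. \<xi> y f)" using assms(1) unfolding vector_field_def by blast
qed (use assms in \<open>auto simp: vector_field_def\<close>)

lemma has_vector_derivative_transform_nhds:
  assumes "(f has_vector_derivative f') (at x)" "eventually (\<lambda>y. f y = g y) (nhds x)"
  shows "(g has_vector_derivative f') (at x)"
proof -
  obtain S where S: "open S" "x \<in> S" "\<And>y. y \<in> S \<Longrightarrow> f y = g y"
    using assms(2) unfolding eventually_nhds by blast
  show ?thesis
    using has_derivative_transform_within_open[OF assms(1)[unfolded has_vector_derivative_def] S(1,2)] S(3)
    unfolding has_vector_derivative_def by blast
qed

lemma velocity_cong:
  assumes "eventually (\<lambda>t. c t = d t) (nhds 0)"
  shows "velocity A c = velocity A d"
proof -
  have c0: "c 0 = d 0" using assms by (rule eventually_nhds_x_imp_x)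
  show ?thesis
  proof
    fix f
    have "deriv (\<lambda>t. f (c t)) 0 = deriv (\<lambda>t. f (d t)) 0"
      by (rule deriv_cong_ev) (use assms in \<open>auto elim: eventually_mono\<close>)
    then show "velocity A c f = velocity A d f" unfolding velocity_def c0 by simp
  qed
qed

section \<open>Complex matrices and the matrix exponential\<close>

lemma matrix_mult_scaleR_left: "(r *\<^sub>R A) ** B = r *\<^sub>R (A ** (B :: complex^'k^'k))"
  by (simp add: vec_eq_iff matrix_matrix_mult_def scaleR_sum_right)

lemma matrix_mult_scaleR_right: "A ** (r *\<^sub>R B) = r *\<^sub>R (A ** (B :: complex^'k^'k))"
  by (simp add: vec_eq_iff matrix_matrix_mult_def scaleR_sum_right)

lemma matrix_mult_add_left: "(A + B) ** C = A ** C + B ** (C :: complex^'k^'k)"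
  by (simp add: vec_eq_iff matrix_matrix_mult_def distrib_right sum.distrib)

lemma matrix_mult_add_right: "A ** (B + C) = A ** B + A ** (C :: complex^'k^'k)"
  by (simp add: vec_eq_iff matrix_matrix_mult_def distrib_left sum.distrib)

lemma matrix_mult_diff_left: "(A - B) ** C = A ** C - B ** (C :: complex^'k^'k)"
  by (simp add: vec_eq_iff matrix_matrix_mult_def left_diff_distrib sum_subtractf)

lemma matrix_mult_diff_right: "A ** (B - C) = A ** B - A ** (C :: complex^'k^'k)"
  by (simp add: vec_eq_iff matrix_matrix_mult_def right_diff_distrib sum_subtractf)

lemma matrix_mult_minus_left: "(- A) ** B = - (A ** (B :: complex^'k^'k))"
  by (simp add: vec_eq_iff matrix_matrix_mult_def sum_negf)

lemma matrix_mult_minus_right: "A ** (- B) = - (A ** (B :: complex^'k^'k))"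
  by (simp add: vec_eq_iff matrix_matrix_mult_def sum_negf)

lemma matrix_mult_zero: "0 ** A = (0 :: complex^'k^'k)" "A ** 0 = (0 :: complex^'k^'k)"
  by (simp_all add: vec_eq_iff matrix_matrix_mult_def)

lemmas matrix_mult_algebra = matrix_mult_scaleR_left matrix_mult_scaleR_right matrix_mult_add_left
  matrix_mult_add_right matrix_mult_diff_left matrix_mult_diff_right matrix_mult_minus_left
  matrix_mult_minus_right matrix_mult_zero matrix_mul_assoc

lemma bounded_bilinear_matrix_mult: "bounded_bilinear (\<lambda>(A :: complex^'k^'k) (B :: complex^'k^'k). A ** B)"
  unfolding bilinear_conv_bounded_bilinear[symmetric] bilinear_def
  by (auto intro!: linearI simp: matrix_mult_algebra)

lemma matrix_inv_eq:
  fixes A B :: "complex^'k^'k"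
  assumes "A ** B = mat 1"
  shows "matrix_inv A = B"
proof -
  have BA: "B ** A = mat 1" using assms by (simp add: matrix_left_right_inverse)
  have "\<exists>A'. A ** A' = mat 1 \<and> A' ** A = mat 1" using assms BA by blast
  then have "A ** matrix_inv A = mat 1 \<and> matrix_inv A ** A = mat 1"
    unfolding matrix_inv_def by (rule someI_ex)
  then have "matrix_inv A = matrix_inv A ** (A ** B)" by (simp add: assms)
  also have "\<dots> = B" using \<open>_ \<and> _\<close> by (simp add: matrix_mul_assoc)
  finally show ?thesis .
qed

lemma hadj_simps:
  fixes A B :: "complex^'k^'k"
  shows "hadj (A ** B) = hadj B ** hadj A" "hadj (A + B) = hadj A + hadj B" "hadj (r *\<^sub>R A) = r *\<^sub>R hadj A"
    "hadj (hadj A) = A" "hadj (mat 1 :: complex^'k^'k) = mat 1" "hadj (- A) = - hadj A" "hadj (A - B) = hadj A - hadj B"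
  by (simp_all add: vec_eq_iff hadj_def matrix_matrix_mult_def mat_def) (simp add: mult.commute)

lemma bounded_linear_hadj: "bounded_linear (hadj :: complex^'k^'k \<Rightarrow> _)"
  unfolding linear_conv_bounded_linear[symmetric] by (auto intro!: linearI simp: hadj_simps)

lemma constant_of_zero_vector_derivative:
  fixes f :: "real \<Rightarrow> 'a::real_normed_vector"
  assumes "\<And>t. (f has_vector_derivative 0) (at t)"
  shows "f s = f t"
proof -
  obtain c where "\<And>x. x \<in> UNIV \<Longrightarrow> f x = c"
    by (rule has_vector_derivative_zero_constant[OF convex_UNIV assms], rule that)
  then show ?thesis by simp
qed

definition mpow :: "complex^'k^'k \<Rightarrow> nat \<Rightarrow> complex^'k^'k" where
  "mpow A k = (((**) A) ^^ k) (mat 1)"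

lemma mpow_simps [simp]: "mpow A 0 = mat 1" "mpow A (Suc k) = A ** mpow A k"
  by (simp_all add: mpow_def)

lemma mpow_commute: "A ** mpow A k = mpow A k ** A"
  by (induction k) (simp_all add: matrix_mul_assoc)

lemma mpow_scaleR: "mpow (t *\<^sub>R A) k = t ^ k *\<^sub>R mpow A k"
  by (induction k) (simp_all add: matrix_mult_algebra mult.commute)

lemma norm_vec_nth_nth_le: "norm (A $ i $ j) \<le> norm (A :: complex^'k^'k)"
  using Finite_Cartesian_Product.norm_nth_le[of A i] Finite_Cartesian_Product.norm_nth_le[of "A $ i" j] by linarith

lemma mpow_norm_le:
  obtains C where "C > 0" "\<And>A k. norm (mpow A k) \<le> norm (mat 1 :: complex^'k^'k) * (C * norm (A :: complex^'k^'k)) ^ k"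
proof -
  obtain C where C: "C > 0" "\<And>(A :: complex^'k^'k) (B :: complex^'k^'k). norm (A ** B) \<le> norm A * norm B * C"
    using bounded_bilinear.pos_bounded[OF bounded_bilinear_matrix_mult] by blast
  have "norm (mpow A k) \<le> norm (mat 1 :: complex^'k^'k) * (C * norm A) ^ k" for A :: "complex^'k^'k" and k
  proof (induction k)
    case (Suc k)
    have "norm (mpow A (Suc k)) \<le> norm A * norm (mpow A k) * C" using C(2)[of A "mpow A k"] by simp
    also have "\<dots> \<le> norm A * (norm (mat 1 :: complex^'k^'k) * (C * norm A) ^ k) * C"
      using Suc C(1) by (intro mult_right_mono mult_left_mono) auto
    finally show ?case by (simp add: mult_ac)
  qed simp
  then show ?thesis using that C(1) by blast
qed

lemma mexp_summable: "summable (\<lambda>k. (1 / fact k) *\<^sub>R mpow (A :: complex^'k^'k) k)"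
proof -
  obtain C where C: "C > 0" "\<And>A k. norm (mpow A k) \<le> norm (mat 1 :: complex^'k^'k) * (C * norm (A :: complex^'k^'k)) ^ k"
    using mpow_norm_le by blast
  show ?thesis
  proof (rule summable_comparison_test)
    show "\<exists>N. \<forall>k\<ge>N. norm ((1 / fact k) *\<^sub>R mpow A k) \<le> norm (mat 1 :: complex^'k^'k) * (inverse (fact k) * (C * norm A) ^ k)"
    proof (intro exI allI impI)
      fix k
      have "norm ((1 / fact k) *\<^sub>R mpow A k) = inverse (fact k) * norm (mpow A k)" by (simp add: divide_inverse)
      also have "\<dots> \<le> inverse (fact k) * (norm (mat 1 :: complex^'k^'k) * (C * norm A) ^ k)"
        using C(2)[of A k] by (intro mult_left_mono) auto
      finally show "norm ((1 / fact k) *\<^sub>R mpow A k) \<le> norm (mat 1 :: complex^'k^'k) * (inverse (fact k) * (C * norm A) ^ k)"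
        by (simp add: mult_ac)
    qed
    show "summable (\<lambda>k. norm (mat 1 :: complex^'k^'k) * (inverse (fact k) * (C * norm A) ^ k))"
      by (intro summable_mult summable_exp)
  qed
qed

lemma mexp_entry_sums: "(\<lambda>k. (1 / fact k) *\<^sub>R (mpow A k $ i $ j)) sums (mexp (A :: complex^'k^'k) $ i $ j)"
proof -
  have "(\<lambda>k. (1 / fact k) *\<^sub>R mpow A k) sums mexp A"
    using summable_sums[OF mexp_summable[of A]] by (simp add: mexp_def mpow_def)
  from bounded_linear.sums[OF bounded_linear_compose[OF bounded_linear_vec_nth bounded_linear_vec_nth] this, of i j]
  show ?thesis by simp
qed

lemma mexp_zero: "mexp (0 :: complex^'k^'k) = mat 1"
proof -
  have "mpow (0 :: complex^'k^'k) k = (if k = 0 then mat 1 else 0)" for k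
    by (cases k) (simp_all add: matrix_mult_zero)
  then have "(1 / fact k) *\<^sub>R (mpow (0 :: complex^'k^'k) k $ i $ j) = (if k = 0 then mat 1 $ i $ j else 0)" for i j k
    by simp
  then have "(\<lambda>k. if k = 0 then mat 1 $ i $ j else 0) sums (mexp (0 :: complex^'k^'k) $ i $ j)" for i j
    using mexp_entry_sums[of "0 :: complex^'k^'k" i j] by (simp only:)
  from sums_unique2[OF this sums_single]
  have "mexp (0 :: complex^'k^'k) $ i $ j = mat 1 $ i $ j" for i j .
  then show ?thesis by (simp add: vec_eq_iff)
qed

lemma has_vector_derivative_vec:
  assumes "\<And>i. ((\<lambda>t. f t $ i) has_vector_derivative f' $ i) (at t)"
  shows "(f has_vector_derivative (f' :: 'a::euclidean_space^'k)) (at t)"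
  unfolding has_vector_derivative_def
proof (subst has_derivative_componentwise_within, rule ballI)
  fix b :: "'a^'k" assume "b \<in> Basis"
  then obtain i u where b: "b = axis i u" by (auto simp: Basis_vec_def)
  have "((\<lambda>t. f t $ i \<bullet> u) has_derivative (\<lambda>x. (x *\<^sub>R f' $ i) \<bullet> u)) (at t)"
    by (rule has_derivative_inner_left[OF assms[of i, unfolded has_vector_derivative_def]])
  then show "((\<lambda>t. f t \<bullet> b) has_derivative (\<lambda>x. (x *\<^sub>R f') \<bullet> b)) (at t)"
    by (simp add: b inner_axis)
qed

lemma mexp_has_vector_derivative:
  "((\<lambda>t. mexp (t *\<^sub>R A)) has_vector_derivative (A ** mexp (t *\<^sub>R (A :: complex^'k^'k)))) (at t)"
proof (intro has_vector_derivative_vec)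
  fix i j
  define c where "c = (\<lambda>k. mpow A k $ i $ j / fact k)"
  have e: "(1 / fact k) *\<^sub>R (mpow (t *\<^sub>R A) k $ i $ j) = (mpow A k $ i $ j / fact k) * of_real t ^ k" for k i j t
    unfolding mpow_scaleR by (simp, simp add: scaleR_conv_of_real[where 'a = complex] mult_ac)
  obtain C where C: "C > 0" "\<And>A k. norm (mpow A k) \<le> norm (mat 1 :: complex^'k^'k) * (C * norm (A :: complex^'k^'k)) ^ k"
    using mpow_norm_le by blast
  have sm: "summable (\<lambda>k. c k * z ^ k)" for z
  proof (rule summable_comparison_test)
    show "\<exists>N. \<forall>k\<ge>N. norm (c k * z ^ k) \<le> norm (mat 1 :: complex^'k^'k) * (inverse (fact k) * (C * norm A * norm z) ^ k)"
    proof (intro exI allI impI)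
      fix k
      have "norm (c k * z ^ k) \<le> norm (mpow A k) * (norm z ^ k / fact k)"
        using norm_vec_nth_nth_le[of "mpow A k" i j]
        by (simp add: c_def norm_mult norm_divide norm_power mult_right_mono divide_right_mono)
      also have "\<dots> \<le> (norm (mat 1 :: complex^'k^'k) * (C * norm A) ^ k) * (norm z ^ k / fact k)"
        using C(2)[of A k] by (intro mult_right_mono) auto
      finally show "norm (c k * z ^ k) \<le> norm (mat 1 :: complex^'k^'k) * (inverse (fact k) * (C * norm A * norm z) ^ k)"
        by (simp add: power_mult_distrib divide_inverse mult_ac)
    qed
    show "summable (\<lambda>k. norm (mat 1 :: complex^'k^'k) * (inverse (fact k) * (C * norm A * norm z) ^ k))"
      by (intro summable_mult summable_exp)
  qed
  have v: "mexp (t *\<^sub>R A) $ i $ j = (\<Sum>k. c k * of_real t ^ k)" for t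
    using sums_unique[OF mexp_entry_sums[of "t *\<^sub>R A" i j]] by (simp add: e c_def)
  have "diffs c k * of_real t ^ k = (\<Sum>l\<in>UNIV. A $ i $ l * ((1 / fact k) *\<^sub>R (mpow (t *\<^sub>R A) k $ l $ j)))" for k
  proof -
    have "diffs c k = (\<Sum>l\<in>UNIV. A $ i $ l * mpow A k $ l $ j) / fact k"
      by (simp add: diffs_def c_def matrix_matrix_mult_def field_simps del: of_nat_Suc)
    then show ?thesis unfolding e by (simp add: sum_divide_distrib sum_distrib_left mult_ac)
  qed
  moreover have "(\<lambda>k. \<Sum>l\<in>UNIV. A $ i $ l * ((1 / fact k) *\<^sub>R (mpow (t *\<^sub>R A) k $ l $ j))) sums
      (\<Sum>l\<in>UNIV. A $ i $ l * mexp (t *\<^sub>R A) $ l $ j)"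
    by (intro sums_sum sums_mult mexp_entry_sums)
  ultimately have d: "(\<Sum>k. diffs c k * of_real t ^ k) = (A ** mexp (t *\<^sub>R A)) $ i $ j"
    using sums_unique by (simp add: matrix_matrix_mult_def) force
  have "((\<lambda>x. \<Sum>k. c k * x ^ k) has_field_derivative (A ** mexp (t *\<^sub>R A)) $ i $ j) (at (of_real t))"
    using termdiffs_strong_converges_everywhere[OF sm, of "of_real t"] unfolding d .
  from has_vector_derivative_real_field[OF this]
  show "((\<lambda>t. mexp (t *\<^sub>R A) $ i $ j) has_vector_derivative (A ** mexp (t *\<^sub>R A)) $ i $ j) (at t)"
    unfolding v .
qed

lemma mexp_commute: "A ** mexp (t *\<^sub>R A) = mexp (t *\<^sub>R A) ** (A :: complex^'k^'k)"
proof -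
  have "(A ** mexp (t *\<^sub>R A)) $ i $ j = (mexp (t *\<^sub>R A) ** A) $ i $ j" for i j
  proof (rule sums_unique2)
    show "(\<lambda>k. \<Sum>l\<in>UNIV. A $ i $ l * ((1 / fact k) *\<^sub>R (mpow (t *\<^sub>R A) k $ l $ j))) sums (A ** mexp (t *\<^sub>R A)) $ i $ j"
      unfolding matrix_matrix_mult_def vec_lambda_beta by (intro sums_sum sums_mult mexp_entry_sums)
    have "(\<Sum>l\<in>UNIV. A $ i $ l * mpow (t *\<^sub>R A) k $ l $ j) = (\<Sum>l\<in>UNIV. mpow (t *\<^sub>R A) k $ i $ l * A $ l $ j)" for k
      using arg_cong[OF mpow_commute[of A k], of "\<lambda>M. t ^ k *\<^sub>R (M $ i $ j)"]
      by (simp add: matrix_matrix_mult_def mpow_scaleR scaleR_sum_right)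
    then have "(\<Sum>l\<in>UNIV. A $ i $ l * ((1 / fact k) *\<^sub>R (mpow (t *\<^sub>R A) k $ l $ j)))
        = (\<Sum>l\<in>UNIV. ((1 / fact k) *\<^sub>R (mpow (t *\<^sub>R A) k $ i $ l)) * A $ l $ j)" for k
      by (simp flip: scaleR_sum_right)
    moreover have "(\<lambda>k. \<Sum>l\<in>UNIV. ((1 / fact k) *\<^sub>R (mpow (t *\<^sub>R A) k $ i $ l)) * A $ l $ j) sums (mexp (t *\<^sub>R A) ** A) $ i $ j"
      unfolding matrix_matrix_mult_def vec_lambda_beta by (intro sums_sum sums_mult2 mexp_entry_sums)
    ultimately show "(\<lambda>k. \<Sum>l\<in>UNIV. A $ i $ l * ((1 / fact k) *\<^sub>R (mpow (t *\<^sub>R A) k $ l $ j))) sums (mexp (t *\<^sub>R A) ** A) $ i $ j"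
      by (simp only:)
  qed
  then show ?thesis by (simp add: vec_eq_iff)
qed

lemma matrix_mult_has_vector_derivative:
  fixes f g :: "real \<Rightarrow> complex^'k^'k"
  assumes "(f has_vector_derivative f') (at t)" "(g has_vector_derivative g') (at t)"
  shows "((\<lambda>t. f t ** g t) has_vector_derivative f t ** g' + f' ** g t) (at t)"
  by (rule bounded_bilinear.has_vector_derivative[OF bounded_bilinear_matrix_mult assms])

lemma mexp_minus_has_vector_derivative:
  "((\<lambda>t. mexp (- t *\<^sub>R A)) has_vector_derivative - (mexp (- t *\<^sub>R A) ** (A :: complex^'k^'k))) (at t)"
  using mexp_has_vector_derivative[of "- A" t] mexp_commute[of "- A" t] by (simp add: matrix_mult_algebra)

lemma mexp_shift_has_vector_derivative:
  "((\<lambda>t. mexp ((s + t) *\<^sub>R A)) has_vector_derivative (A ** mexp ((s + t) *\<^sub>R (A :: complex^'k^'k)))) (at t)"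
proof -
  have "((\<lambda>t. s + t) has_vector_derivative 1) (at t)"
    by (auto intro!: derivative_eq_intros)
  from vector_diff_chain_at[OF this mexp_has_vector_derivative] show ?thesis by (simp add: comp_def)
qed

text \<open>The left-hand side is constant in \<open>t\<close>, because its derivative vanishes. The inverse and the addition
  theorem of the exponential are special cases.\<close>

lemma mexp_add_aux: "mexp (- t *\<^sub>R A) ** mexp ((s + t) *\<^sub>R A) = mexp (s *\<^sub>R (A :: complex^'k^'k))"
proof -
  have "((\<lambda>t. mexp (- t *\<^sub>R A) ** mexp ((s + t) *\<^sub>R A)) has_vector_derivative 0) (at t)" for t
    using matrix_mult_has_vector_derivative[OF mexp_minus_has_vector_derivative[of A t] mexp_shift_has_vector_derivative[of s A t]]
    by (simp add: matrix_mult_algebra)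
  from constant_of_zero_vector_derivative[OF this, of t 0] show ?thesis by (simp add: mexp_zero)
qed

lemma mexp_inverse: "mexp (- t *\<^sub>R A) ** mexp (t *\<^sub>R A) = mat 1" "mexp (t *\<^sub>R A) ** mexp (- t *\<^sub>R (A :: complex^'k^'k)) = mat 1"
  using mexp_add_aux[of t A 0] mexp_add_aux[of "- t" A 0] by (simp_all add: mexp_zero)

lemma matrix_inv_mexp: "matrix_inv (mexp (t *\<^sub>R A)) = mexp (- t *\<^sub>R (A :: complex^'k^'k))"
  by (rule matrix_inv_eq[OF mexp_inverse(2)])

lemma mexp_add: "mexp ((s + t) *\<^sub>R A) = mexp (t *\<^sub>R A) ** mexp (s *\<^sub>R (A :: complex^'k^'k))"
proof -
  have "mexp (t *\<^sub>R A) ** (mexp (- t *\<^sub>R A) ** mexp ((s + t) *\<^sub>R A)) = mexp ((s + t) *\<^sub>R A)"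
    unfolding matrix_mul_assoc mexp_inverse(2) by simp
  then show ?thesis unfolding mexp_add_aux ..
qed

lemma permutes_moves_another:
  assumes "p permutes UNIV" "p \<noteq> id"
  shows "\<exists>j. j \<noteq> i \<and> p j \<noteq> j"
proof -
  obtain k where k: "p k \<noteq> k" using assms(2) by (auto simp: fun_eq_iff)
  have "p (p k) \<noteq> p k" using k by (simp add: inj_eq[OF permutes_inj[OF assms(1)]])
  then show ?thesis using k by metis
qed

text \<open>Every permutation other than the identity moves at least two indices, so its term in the Leibniz
  expansion has a double zero at the identity matrix.\<close>

lemma det_has_vector_derivative_at_one:
  fixes M :: "real \<Rightarrow> complex^'k^'k"
  assumes M0: "M t = mat 1" and M: "(M has_vector_derivative B) (at t)"
  shows "((\<lambda>t. det (M t)) has_vector_derivative trace B) (at t)"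
proof -
  have e: "((\<lambda>t. M t $ i $ j) has_derivative (\<lambda>h. h *\<^sub>R (B $ i $ j))) (at t)" for i j
    using bounded_linear.has_vector_derivative[OF bounded_linear_compose[OF bounded_linear_vec_nth bounded_linear_vec_nth] M, of i j]
    by (simp add: has_vector_derivative_def)
  let ?P = "{p. p permutes (UNIV :: 'k set)}"
  let ?D = "\<lambda>p h. \<Sum>i\<in>UNIV. h *\<^sub>R (B $ i $ p i) * (\<Prod>j\<in>UNIV - {i}. M t $ j $ p j)"
  have d: "((\<lambda>t. det (M t)) has_derivative (\<lambda>h. \<Sum>p\<in>?P. of_int (sign p) * ?D p h)) (at t)"
    unfolding det_def by (intro has_derivative_sum has_derivative_mult_right has_derivative_prod e)
  have z: "?D p h = 0" if p: "p \<in> ?P" "p \<noteq> id" for p h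
  proof (rule sum.neutral, rule ballI)
    fix i
    obtain j where "j \<noteq> i" "p j \<noteq> j" using permutes_moves_another[of p i] p by auto
    then have "(\<Prod>j\<in>UNIV - {i}. M t $ j $ p j) = 0" by (intro prod_zero bexI[of _ j]) (auto simp: M0 mat_def)
    then show "h *\<^sub>R (B $ i $ p i) * (\<Prod>j\<in>UNIV - {i}. M t $ j $ p j) = 0" by simp
  qed
  have i: "?D id h = h *\<^sub>R trace B" for h
    by (simp add: M0 mat_def trace_def scaleR_sum_right)
  have "(\<Sum>p\<in>?P. of_int (sign p) * ?D p h) = (\<Sum>p\<in>?P. if p = id then h *\<^sub>R trace B else 0)" for h
    by (rule sum.cong) (use z i in \<open>auto simp: sign_id\<close>)
  also have "\<dots> h = h *\<^sub>R trace B" for h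
    by (simp add: permutes_id finite_permutations)
  finally show ?thesis using d by (simp add: has_vector_derivative_def)
qed

section \<open>The group, its Lie algebra and the filtration\<close>

text \<open>The Hermitian form pairs the index \<open>i\<close> with \<open>flip i\<close>, with the sign \<open>eps p i\<close>.\<close>

fun flip :: "'n bidx \<Rightarrow> 'n bidx" where
  "flip BFst = BLst" | "flip BLst = BFst" | "flip (BMid k) = BMid k"

definition eps :: "nat \<Rightarrow> 'n::{finite,linorder} bidx \<Rightarrow> complex" where
  "eps p i = (case i of BMid k \<Rightarrow> sgn_entry p k | _ \<Rightarrow> 1)"

lemma flip_flip [simp]: "flip (flip i) = i"
  by (cases i) simp_all

lemma blk_flip [simp]: "blk (flip i) = 2 - blk i"
  by (cases i) simp_all

lemma blk_bounds: "0 \<le> blk i" "blk i \<le> 2"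
  by (cases i; simp)+

lemma eps_simps [simp]: "eps p (flip i) = eps p i" "cnj (eps p i) = eps p i" "eps p i * eps p i = 1"
  by (cases i; simp add: eps_def sgn_entry_def)+

lemma eps_cases: "eps p i = 1 \<or> eps p i = -1"
  by (cases i) (simp_all add: eps_def sgn_entry_def)

lemma hform_entry: "hform p $ i $ j = (if j = flip i then eps p i else 0)"
  by (cases i; cases j) (auto simp: hform_def eps_def)

lemma flip_eq_iff: "j = flip i \<longleftrightarrow> i = flip j"
  by auto

lemma hform_mult_left: "(hform p ** M) $ i $ j = eps p i * M $ flip i $ j"
proof -
  have "(hform p ** M) $ i $ j = (\<Sum>k\<in>UNIV. if k = flip i then eps p i * M $ k $ j else 0)"
    unfolding matrix_matrix_mult_def vec_lambda_beta hform_entry by (rule sum.cong) auto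
  then show ?thesis by simp
qed

lemma hform_mult_right: "(M ** hform p) $ i $ j = M $ i $ flip j * eps p j"
proof -
  have "(M ** hform p) $ i $ j = (\<Sum>k\<in>UNIV. if k = flip j then M $ i $ k * eps p j else 0)"
    unfolding matrix_matrix_mult_def vec_lambda_beta hform_entry
    by (rule sum.cong) (auto simp: flip_eq_iff[of j])
  then show ?thesis by simp
qed

lemma hadj_hform: "hadj (hform p) = hform p"
  by (auto simp: vec_eq_iff hadj_def hform_entry flip_eq_iff)

lemma hform_square: "hform p ** hform p = mat 1"
  by (simp add: vec_eq_iff hform_mult_left hform_entry mat_def)

text \<open>The filtration on all matrices. Unlike its restriction \<open>gfilt\<close> to \<open>\<gg>\<close>, it is compatible with products,
  which the exponential series requires.\<close>

definition filt :: "int \<Rightarrow> 'n::finite bmat \<Rightarrow> bool" where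
  "filt k A \<longleftrightarrow> (\<forall>i j. A $ i $ j \<noteq> 0 \<longrightarrow> blk j - blk i \<ge> k)"

lemma filtD: "filt k A \<Longrightarrow> blk j - blk i < k \<Longrightarrow> A $ i $ j = 0"
  unfolding filt_def by force

lemma filt_simps:
  "filt k A \<Longrightarrow> filt k B \<Longrightarrow> filt k (A + B)" "filt k A \<Longrightarrow> filt k B \<Longrightarrow> filt k (A - B)"
  "filt k A \<Longrightarrow> filt k (r *\<^sub>R A)" "filt k A \<Longrightarrow> filt k (- A)" "filt 0 (mat 1)" "filt k 0"
  unfolding filt_def by (auto simp: mat_def) (metis add.right_neutral diff_zero)+

lemma filt_mono: "filt k A \<Longrightarrow> l \<le> k \<Longrightarrow> filt l A"
  unfolding filt_def by force

lemma filt_mult: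
  assumes "filt k A" "filt l B"
  shows "filt (k + l) (A ** B)"
  unfolding filt_def
proof (intro allI impI)
  fix i j assume "(A ** B) $ i $ j \<noteq> 0"
  then obtain m where "A $ i $ m * B $ m $ j \<noteq> 0"
    unfolding matrix_matrix_mult_def vec_lambda_beta by (meson sum.neutral)
  then have "blk m - blk i \<ge> k" "blk j - blk m \<ge> l" using assms unfolding filt_def by auto
  then show "k + l \<le> blk j - blk i" by simp
qed

lemma filt_zero: "filt k A \<Longrightarrow> k > 2 \<Longrightarrow> A = 0"
proof -
  assume A: "filt k A" and k: "k > 2"
  have "A $ i $ j = 0" for i j
    by (rule filtD[OF A]) (use blk_bounds[of i] blk_bounds[of j] k in linarith)
  then show "A = 0" by (simp add: vec_eq_iff)
qed

lemma filt_trivial: "filt (-2) A"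
  unfolding filt_def
proof (intro allI impI)
  fix i j show "- 2 \<le> blk j - blk i" using blk_bounds[of i] blk_bounds[of j] by linarith
qed

lemma filt_trace: "filt 1 A \<Longrightarrow> trace A = 0"
  by (simp add: trace_def filtD[of 1])

lemma block_upper_iff_filt: "block_upper g \<longleftrightarrow> filt 0 g"
  unfolding block_upper_def filt_def by (meson diff_ge_0_iff_ge not_le)

lemma gfilt_iff: "X \<in> gfilt p k \<longleftrightarrow> X \<in> su p \<and> filt k X"
  by (simp add: gfilt_def filt_def)

lemma gfilt_su: "X \<in> gfilt p k \<Longrightarrow> X \<in> su p"
  by (simp add: gfilt_iff)

lemma gfilt_all: "gfilt p (-2) = su p"
  using filt_trivial by (auto simp: gfilt_iff)

lemma gfilt_mono: "X \<in> gfilt p k \<Longrightarrow> l \<le> k \<Longrightarrow> X \<in> gfilt p l"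
  by (auto simp: gfilt_iff intro: filt_mono)

lemma grad_gfilt: "X \<in> grad p k \<Longrightarrow> X \<in> gfilt p k"
  unfolding grad_def gfilt_def by auto

lemma su_iff: "X \<in> su p \<longleftrightarrow> hadj X ** hform p = - (hform p ** X) \<and> trace X = 0"
  by (auto simp: su_def eq_neg_iff_add_eq_0)

lemma trace_simps: "trace (A + B) = trace A + trace (B :: complex^'k^'k)" "trace (A - B) = trace A - trace (B :: complex^'k^'k)"
  "trace (r *\<^sub>R A) = r *\<^sub>R trace (A :: complex^'k^'k)" "trace (- A) = - trace (A :: complex^'k^'k)"
  by (simp_all add: trace_def sum.distrib sum_subtractf scaleR_sum_right sum_negf)

lemma hadj_zero: "hadj 0 = (0 :: complex^'k^'k)"
  by (simp add: vec_eq_iff hadj_def)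

lemma subspace_su: "subspace (su p :: 'n::{finite,linorder} bmat set)"
  unfolding su_def
proof (rule subspaceI)
  show "0 \<in> {X. hadj X ** hform p + hform p ** X = 0 \<and> trace X = 0}"
    by (simp add: hadj_zero matrix_mult_zero trace_def)
  fix X Y :: "'n bmat"
  assume X: "X \<in> {X. hadj X ** hform p + hform p ** X = 0 \<and> trace X = 0}"
  have "hadj (r *\<^sub>R X) ** hform p + hform p ** (r *\<^sub>R X) = r *\<^sub>R (hadj X ** hform p + hform p ** X)" for r
    by (simp add: hadj_simps matrix_mult_algebra scaleR_add_right)
  then show "r *\<^sub>R X \<in> {X. hadj X ** hform p + hform p ** X = 0 \<and> trace X = 0}" for r
    using X by (simp add: trace_simps)
  assume Y: "Y \<in> {X. hadj X ** hform p + hform p ** X = 0 \<and> trace X = 0}"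
  have "hadj (X + Y) ** hform p + hform p ** (X + Y)
      = (hadj X ** hform p + hform p ** X) + (hadj Y ** hform p + hform p ** Y)"
    by (simp add: hadj_simps matrix_mult_algebra)
  then show "X + Y \<in> {X. hadj X ** hform p + hform p ** X = 0 \<and> trace X = 0}"
    using X Y by (simp add: trace_simps)
qed

lemma subspace_gfilt: "subspace (gfilt p k)"
  by (rule subspaceI) (auto simp: gfilt_iff intro: filt_simps subspace_0[OF subspace_su]
      subspace_add[OF subspace_su] subspace_scale[OF subspace_su])

lemma mbracket_su:
  fixes X Y :: "'n::{finite,linorder} bmat"
  assumes "X \<in> su p" "Y \<in> su p"
  shows "mbracket X Y \<in> su p"
proof -
  have "hadj (A ** B) ** hform p = hform p ** (B ** A)" if "A \<in> su p" "B \<in> su p" for A B :: "'n bmat"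
  proof -
    have "hadj (A ** B) ** hform p = hadj B ** (hadj A ** hform p)" by (simp add: hadj_simps matrix_mul_assoc)
    also have "\<dots> = - (hadj B ** hform p) ** A" using that by (simp add: su_iff matrix_mult_algebra)
    also have "\<dots> = hform p ** (B ** A)" using that by (simp add: su_iff matrix_mul_assoc)
    finally show ?thesis .
  qed
  then have "hadj (X ** Y - Y ** X) ** hform p = - (hform p ** (X ** Y - Y ** X))"
    using assms by (simp only: hadj_simps(7) matrix_mult_diff_left matrix_mult_diff_right) simp
  moreover have "trace (X ** Y - Y ** X) = 0"
    by (simp add: trace_simps trace_mul_sym[of X Y])
  ultimately show ?thesis unfolding su_iff mbracket_def by blast
qed

lemma mbracket_gfilt:
  assumes "X \<in> gfilt p k" "Y \<in> gfilt p l"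
  shows "mbracket X Y \<in> gfilt p (k + l)"
proof -
  have "filt (k + l) (X ** Y)" "filt (l + k) (Y ** X)" using assms by (auto simp: gfilt_iff intro: filt_mult)
  then have "filt (k + l) (mbracket X Y)" unfolding mbracket_def by (intro filt_simps) (simp_all add: add.commute)
  then show ?thesis using assms by (simp add: gfilt_iff mbracket_su)
qed

text \<open>The determinant is left out because inverses and logarithms are governed by the Hermitian form alone.\<close>

definition preserves_hform :: "nat \<Rightarrow> 'n::{finite,linorder} bmat \<Rightarrow> bool" where
  "preserves_hform p g \<longleftrightarrow> hadj g ** hform p ** g = hform p"

lemma SU_iff: "g \<in> carrier (SU p) \<longleftrightarrow> preserves_hform p g \<and> det g = 1"
  by (simp add: SU_def preserves_hform_def)

lemma SU_mult [simp]: "g \<otimes>\<^bsub>SU p\<^esub> h = g ** h" and SU_one [simp]: "\<one>\<^bsub>SU p\<^esub> = mat 1"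
  by (simp_all add: SU_def)

text \<open>The adjoint of \<open>g\<close> with respect to the Hermitian form.\<close>

definition hinv :: "nat \<Rightarrow> 'n::{finite,linorder} bmat \<Rightarrow> 'n bmat" where
  "hinv p g = hform p ** hadj g ** hform p"

lemma hinv_inverse:
  assumes "preserves_hform p g"
  shows "hinv p g ** g = mat 1" "g ** hinv p g = mat 1" "matrix_inv g = hinv p g"
proof -
  have "hinv p g ** g = hform p ** (hadj g ** hform p ** g)" by (simp add: hinv_def matrix_mul_assoc)
  also have "\<dots> = mat 1" using assms by (simp add: preserves_hform_def hform_square)
  finally show *: "hinv p g ** g = mat 1" .
  then show **: "g ** hinv p g = mat 1" by (simp add: matrix_left_right_inverse)
  then show "matrix_inv g = hinv p g" by (rule matrix_inv_eq)
qed

lemma preserves_hform_inverse: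
  assumes "preserves_hform p g"
  shows "preserves_hform p (hinv p g)"
proof -
  have "hadj (hinv p g) ** hform p ** hinv p g = hadj (hinv p g) ** (hadj g ** hform p ** g) ** hinv p g"
    using assms by (simp add: preserves_hform_def)
  also have "\<dots> = hadj (g ** hinv p g) ** hform p ** (g ** hinv p g)"
    by (simp only: hadj_simps matrix_mul_assoc)
  also have "\<dots> = hform p" by (simp add: hinv_inverse(2)[OF assms] hadj_simps)
  finally show ?thesis by (simp add: preserves_hform_def)
qed

lemma preserves_hform_mult:
  assumes "preserves_hform p g" "preserves_hform p h"
  shows "preserves_hform p (g ** h)"
proof -
  have "hadj (g ** h) ** hform p ** (g ** h) = hadj h ** (hadj g ** hform p ** g) ** h"
    by (simp only: hadj_simps matrix_mul_assoc)
  then show ?thesis using assms by (simp add: preserves_hform_def)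
qed

lemma SU_inverse:
  assumes "g \<in> carrier (SU p)"
  shows "hinv p g \<in> carrier (SU p)"
proof -
  have "det (hinv p g) * det g = det (hinv p g ** g)" by (rule det_mul[symmetric])
  also have "\<dots> = 1" using hinv_inverse(1)[of p g] assms by (simp add: SU_iff)
  finally show ?thesis using assms preserves_hform_inverse[of p g] by (simp add: SU_iff)
qed

lemma group_SU: "group (SU p)"
proof (rule groupI)
  show "\<exists>y\<in>carrier (SU p). y \<otimes>\<^bsub>SU p\<^esub> x = \<one>\<^bsub>SU p\<^esub>" if "x \<in> carrier (SU p)" for x
    using that SU_inverse[OF that] hinv_inverse(1)[of p x] by (auto simp: SU_iff)
  show "\<one>\<^bsub>SU p\<^esub> \<in> carrier (SU p)"
    by (simp add: SU_iff preserves_hform_def hadj_simps)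
qed (auto simp: SU_iff preserves_hform_mult det_mul matrix_mul_assoc)

lemma hinv_filt:
  assumes "filt k g"
  shows "filt k (hinv p g)"
  unfolding filt_def
proof (intro allI impI)
  fix i j assume "hinv p g $ i $ j \<noteq> 0"
  then have "g $ flip j $ flip i \<noteq> 0"
    by (auto simp: hinv_def hform_mult_left hform_mult_right hadj_def)
  then show "k \<le> blk j - blk i" using assms unfolding filt_def by fastforce
qed

lemma Ptilde_iff: "g \<in> Ptilde p \<longleftrightarrow> preserves_hform p g \<and> det g = 1 \<and> filt 0 g"
  by (simp add: Ptilde_def SU_iff block_upper_iff_filt)

lemma Ptilde_mult: "g \<in> Ptilde p \<Longrightarrow> h \<in> Ptilde p \<Longrightarrow> g ** h \<in> Ptilde p"
  using filt_mult[of 0 g 0 h] by (simp add: Ptilde_iff preserves_hform_mult det_mul)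

lemma Ptilde_one: "mat 1 \<in> Ptilde p"
  by (simp add: Ptilde_iff preserves_hform_def hadj_simps filt_simps)

lemma Ptilde_matrix_inv:
  assumes "g \<in> Ptilde p"
  shows "matrix_inv g \<in> Ptilde p" "matrix_inv g ** g = mat 1" "g ** matrix_inv g = mat 1"
  using assms SU_inverse[of g p] hinv_inverse[of p g] hinv_filt[of 0 g p]
  by (auto simp: Ptilde_iff SU_iff)

lemma hadj_mult_hform: "preserves_hform p g \<Longrightarrow> hadj g ** hform p = hform p ** hinv p g"
  by (simp add: hinv_def matrix_mul_assoc hform_square)

lemma adjoint_su:
  assumes g: "preserves_hform p g" and X: "X \<in> su p"
  shows "g ** X ** hinv p g \<in> su p"
proof -
  have 1: "hadj g ** hform p = hform p ** hinv p g" by (rule hadj_mult_hform[OF g])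
  have 2: "hadj (hinv p g) ** hform p = hform p ** g"
    by (simp add: hinv_def hadj_simps hadj_hform hform_square flip: matrix_mul_assoc)
  have "hadj (g ** X ** hinv p g) ** hform p = hadj (hinv p g) ** hadj X ** (hadj g ** hform p)"
    by (simp add: hadj_simps matrix_mul_assoc)
  also have "\<dots> = hadj (hinv p g) ** (hadj X ** hform p) ** hinv p g"
    unfolding 1 by (simp add: matrix_mul_assoc)
  also have "\<dots> = - (hadj (hinv p g) ** hform p ** X ** hinv p g)"
    using X by (simp add: su_iff matrix_mult_algebra)
  also have "\<dots> = - (hform p ** (g ** X ** hinv p g))"
    unfolding 2 by (simp add: matrix_mul_assoc)
  finally have "hadj (g ** X ** hinv p g) ** hform p = - (hform p ** (g ** X ** hinv p g))" .
  moreover have "trace (g ** X ** hinv p g) = trace X"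
    using trace_mul_sym[of "g ** X" "hinv p g"] by (simp add: matrix_mul_assoc hinv_inverse(1)[OF g])
  ultimately show ?thesis using X by (simp add: su_iff)
qed

lemma adjoint_gfilt:
  assumes g: "g \<in> Ptilde p" and X: "X \<in> gfilt p k"
  shows "g ** X ** matrix_inv g \<in> gfilt p k" "matrix_inv g ** X ** g \<in> gfilt p k"
proof -
  have *: "h ** X ** matrix_inv h \<in> gfilt p k" if h: "h \<in> Ptilde p" for h
  proof -
    have f: "filt 0 h" "filt 0 (matrix_inv h)" using h Ptilde_matrix_inv(1)[OF h] by (auto simp: Ptilde_iff)
    have "filt k (h ** X ** matrix_inv h)"
      using filt_mult[OF filt_mult[OF f(1)] f(2), of k X] X by (simp add: gfilt_iff)
    moreover have "h ** X ** matrix_inv h \<in> su p"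
      using h X adjoint_su[of p h X] hinv_inverse(3)[of p h] by (simp add: Ptilde_iff gfilt_iff)
    ultimately show ?thesis by (simp add: gfilt_iff)
  qed
  show "g ** X ** matrix_inv g \<in> gfilt p k" by (rule *[OF g])
  have "matrix_inv (matrix_inv g) = g" by (rule matrix_inv_eq[OF Ptilde_matrix_inv(2)[OF g]])
  then show "matrix_inv g ** X ** g \<in> gfilt p k" using *[OF Ptilde_matrix_inv(1)[OF g]] by simp
qed

lemma centre_normal:
  fixes G (structure)
  assumes "group G"
  shows "centre G \<lhd> G"
proof -
  interpret group G by fact
  have "subgroup (centre G) G"
  proof (rule subgroupI)
    show "centre G \<noteq> {}" unfolding centre_def using one_closed by (auto intro!: exI[of _ "\<one>\<^bsub>G\<^esub>"])
    show "inv a \<in> centre G" if "a \<in> centre G" for a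
    proof -
      have a: "a \<in> carrier G" "\<And>g. g \<in> carrier G \<Longrightarrow> a \<otimes> g = g \<otimes> a" using that by (auto simp: centre_def)
      have "inv a \<otimes> g = g \<otimes> inv a" if g: "g \<in> carrier G" for g
      proof -
        have "inv a \<otimes> g = inv a \<otimes> (g \<otimes> a) \<otimes> inv a" using a(1) g by (simp add: m_assoc)
        also have "\<dots> = inv a \<otimes> (a \<otimes> g) \<otimes> inv a" using a g by simp
        also have "\<dots> = g \<otimes> inv a" using a(1) g by (simp flip: m_assoc)
        finally show ?thesis .
      qed
      then show ?thesis using a by (simp add: centre_def)
    qed
    show "a \<otimes> b \<in> centre G" if "a \<in> centre G" "b \<in> centre G" for a b
    proof -
      have a: "a \<in> carrier G" "\<And>g. g \<in> carrier G \<Longrightarrow> a \<otimes> g = g \<otimes> a"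
        and b: "b \<in> carrier G" "\<And>g. g \<in> carrier G \<Longrightarrow> b \<otimes> g = g \<otimes> b" using that by (auto simp: centre_def)
      have "a \<otimes> b \<otimes> g = g \<otimes> (a \<otimes> b)" if g: "g \<in> carrier G" for g
      proof -
        have "a \<otimes> b \<otimes> g = a \<otimes> (g \<otimes> b)" using a(1) b(1) g by (simp add: m_assoc b(2)[OF g])
        also have "\<dots> = a \<otimes> g \<otimes> b" using a(1) b(1) g by (simp add: m_assoc)
        also have "\<dots> = g \<otimes> a \<otimes> b" by (simp only: a(2)[OF g])
        also have "\<dots> = g \<otimes> (a \<otimes> b)" using a(1) b(1) g by (simp add: m_assoc)
        finally show ?thesis .
      qed
      then show ?thesis using a(1) b(1) by (simp add: centre_def)
    qed
  qed (auto simp: centre_def)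
  moreover have "x \<otimes> h \<otimes> inv x \<in> centre G" if "x \<in> carrier G" "h \<in> centre G" for x h
  proof -
    have h: "h \<in> carrier G" "h \<otimes> x = x \<otimes> h" using that by (auto simp: centre_def)
    have "x \<otimes> h \<otimes> inv x = h \<otimes> (x \<otimes> inv x)" using h that by (simp add: m_assoc flip: h(2))
    then show ?thesis using h that by simp
  qed
  ultimately show ?thesis unfolding normal_inv_iff by blast
qed

lemma Ptilde_SU: "g \<in> Ptilde p \<Longrightarrow> g \<in> carrier (SU p)"
  by (simp add: Ptilde_def)

lemma cls_mult:
  assumes "g \<in> Ptilde p" "h \<in> Ptilde p"
  shows "cls p g \<otimes>\<^bsub>PSU p\<^esub> cls p h = cls p (g ** h)"
  using normal.rcos_sum[OF centre_normal[OF group_SU] Ptilde_SU[OF assms(1)] Ptilde_SU[OF assms(2)]]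
  by (simp add: PSU_def FactGroup_def cls_def)

lemma cls_one: "cls p (mat 1) = \<one>\<^bsub>PSU p\<^esub>"
proof -
  interpret normal "centre (SU p)" "SU p" by (rule centre_normal[OF group_SU])
  show ?thesis using coset_mult_one[OF subset] by (simp add: PSU_def FactGroup_def cls_def)
qed

lemma cls_central:
  assumes "z \<in> centre (SU p)" "g \<in> carrier (SU p)"
  shows "cls p (z ** g) = cls p g"
proof -
  interpret normal "centre (SU p)" "SU p" by (rule centre_normal[OF group_SU])
  have "centre (SU p) #>\<^bsub>SU p\<^esub> (z \<otimes>\<^bsub>SU p\<^esub> g) = centre (SU p) #>\<^bsub>SU p\<^esub> z #>\<^bsub>SU p\<^esub> g"
    using assms subset by (intro coset_mult_assoc[symmetric]) auto
  also have "centre (SU p) #>\<^bsub>SU p\<^esub> z = centre (SU p)"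
    using assms(1) by (intro coset_join2) (auto simp: subgroup_axioms mem_carrier)
  finally show ?thesis by (simp add: cls_def)
qed

lemma Pgrp_cls: "g \<in> Ptilde p \<Longrightarrow> cls p g \<in> Pgrp p"
  by (simp add: Pgrp_def)

lemma mexp_preserves_hform:
  assumes A: "A \<in> su p"
  shows "preserves_hform p (mexp (t *\<^sub>R A))"
proof -
  let ?Y = "\<lambda>t. mexp (t *\<^sub>R A)"
  have "((\<lambda>t. hadj (?Y t) ** hform p ** ?Y t) has_vector_derivative 0) (at t)" for t
  proof -
    have Y: "(?Y has_vector_derivative A ** ?Y t) (at t)" by (rule mexp_has_vector_derivative)
    have "((\<lambda>t. hadj (?Y t) ** hform p) has_vector_derivative hadj (A ** ?Y t) ** hform p) (at t)"
      by (rule bounded_linear.has_vector_derivative[OF bounded_linear_compose[OF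
            bounded_bilinear.bounded_linear_left[OF bounded_bilinear_matrix_mult] bounded_linear_hadj] Y])
    from matrix_mult_has_vector_derivative[OF this Y]
    have "((\<lambda>t. hadj (?Y t) ** hform p ** ?Y t) has_vector_derivative
        hadj (?Y t) ** hform p ** (A ** ?Y t) + hadj (A ** ?Y t) ** hform p ** ?Y t) (at t)" .
    moreover have "hadj (A ** ?Y t) ** hform p ** ?Y t = hadj (?Y t) ** (hadj A ** hform p) ** ?Y t"
      by (simp add: hadj_simps matrix_mul_assoc)
    moreover have "\<dots> = - (hadj (?Y t) ** hform p ** (A ** ?Y t))"
      using A by (simp add: su_iff matrix_mult_algebra)
    ultimately show ?thesis by simp
  qed
  from constant_of_zero_vector_derivative[OF this, of t 0]
  show ?thesis by (simp add: preserves_hform_def mexp_zero hadj_simps)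
qed

lemma det_mexp:
  assumes "trace A = 0"
  shows "det (mexp (t *\<^sub>R (A :: complex^'k^'k))) = 1"
proof -
  have "((\<lambda>t. det (mexp (t *\<^sub>R A))) has_vector_derivative 0) (at s)" for s
  proof -
    have "((\<lambda>t. mexp ((- s + t) *\<^sub>R A)) has_vector_derivative A ** mexp ((- s + s) *\<^sub>R A)) (at s)"
      by (rule mexp_shift_has_vector_derivative)
    then have "((\<lambda>t. mexp ((- s + t) *\<^sub>R A)) has_vector_derivative A) (at s)" by (simp add: mexp_zero)
    from det_has_vector_derivative_at_one[OF _ this]
    have "((\<lambda>t. det (mexp ((- s + t) *\<^sub>R A))) has_vector_derivative 0) (at s)"
      by (simp add: mexp_zero assms)
    then have "((\<lambda>t. det (mexp ((- s + t) *\<^sub>R A)) * det (mexp (s *\<^sub>R A))) has_vector_derivative 0) (at s)"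
      using has_vector_derivative_mult_left[of _ 0 "at s" "det (mexp (s *\<^sub>R A))"] by simp
    moreover have "det (mexp ((- s + t) *\<^sub>R A)) * det (mexp (s *\<^sub>R A)) = det (mexp (t *\<^sub>R A))" for t
      using mexp_add[of s "- s + t" A] by (simp flip: det_mul)
    ultimately show ?thesis by simp
  qed
  from constant_of_zero_vector_derivative[OF this, of t 0] show ?thesis by (simp add: mexp_zero)
qed

lemma mpow_filt: "filt 0 A \<Longrightarrow> filt 0 (mpow A k)"
  by (induction k) (use filt_mult[of 0 A 0] in \<open>auto simp: filt_simps\<close>)

lemma mexp_filt:
  assumes "filt 0 A" shows "filt 0 (mexp A)"
  unfolding filt_def
proof (intro allI impI, rule ccontr)
  fix i j assume ne: "mexp A $ i $ j \<noteq> 0" and "\<not> 0 \<le> blk j - blk i"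
  then have "mpow A k $ i $ j = 0" for k using filtD[OF mpow_filt[OF assms, of k]] by simp
  then have "(\<lambda>k. 0) sums (mexp A $ i $ j)" using mexp_entry_sums[of A i j] by simp
  with ne show False using sums_unique2 sums_zero by metis
qed

lemma mexp_Ptilde:
  assumes "A \<in> gfilt p 0"
  shows "mexp (t *\<^sub>R A) \<in> Ptilde p"
  using assms mexp_preserves_hform[of A p t] det_mexp[of A t] mexp_filt[of "t *\<^sub>R A"]
  by (simp add: Ptilde_iff gfilt_iff su_iff filt_simps)

lemma mexp_nilpotent:
  fixes W :: "'n::{finite,linorder} bmat"
  assumes "filt 1 W"
  shows "mexp W = mat 1 + W + (1/2) *\<^sub>R (W ** W)"
proof -
  have "filt 2 (W ** W)" using filt_mult[OF assms assms] by simp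
  then have "filt 3 (W ** (W ** W))" using filt_mult[OF assms, of 2] by simp
  then have W3: "W ** (W ** W) = 0" by (rule filt_zero) simp
  have W: "mpow W k = 0" if "k \<ge> 3" for k
    using that
  proof (induction k rule: dec_induct)
    case base
    then show ?case by (simp add: numeral_3_eq_3 W3)
  qed (simp add: matrix_mult_zero)
  have "mexp W $ i $ j = (mat 1 + W + (1/2) *\<^sub>R (W ** W)) $ i $ j" for i j
  proof -
    have "(\<lambda>k. (1 / fact k) *\<^sub>R (mpow W k $ i $ j)) sums (\<Sum>k\<in>{0, 1, 2}. (1 / fact k) *\<^sub>R (mpow W k $ i $ j))"
    proof (rule sums_finite)
      fix k :: nat assume "k \<notin> {0, 1, 2}"
      then have "k \<ge> 3" by auto
      then show "(1 / fact k) *\<^sub>R (mpow W k $ i $ j) = 0" by (simp add: W)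
    qed simp
    from sums_unique2[OF mexp_entry_sums this] show ?thesis by (simp add: numeral_2_eq_2)
  qed
  then show ?thesis by (simp add: vec_eq_iff)
qed

text \<open>The logarithm of a unipotent matrix is \<open>N - N\<^sup>2/2\<close>. That it lies in the Lie algebra follows from
  comparing it with the logarithm of the inverse.\<close>

lemma unipotent_logarithm:
  fixes h :: "'n::{finite,linorder} bmat"
  assumes h: "preserves_hform p h" and N: "filt 1 (h - mat 1)"
  obtains W where "W \<in> gfilt p 1" "mexp W = h"
proof -
  define N where "N = h - mat 1"
  define W where "W = N - (1/2) *\<^sub>R (N ** N)"
  have N1: "filt 1 N" using assms by (simp add: N_def)
  have N2: "filt 2 (N ** N)" using filt_mult[OF N1 N1] by simp
  have "filt 3 (N ** N ** N)" using filt_mult[OF N2 N1] by simp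
  then have N3: "N ** N ** N = 0" by (rule filt_zero) simp
  have hN: "h = mat 1 + N" by (simp add: N_def)
  have "h ** (mat 1 - N + N ** N) = mat 1"
    by (simp add: hN matrix_mult_algebra N3)
  from matrix_inv_eq[OF this] have hi: "hinv p h = mat 1 - N + N ** N"
    using hinv_inverse(3)[OF h] by simp
  have "hinv p h = mat 1 + hform p ** hadj N ** hform p"
    by (simp add: hinv_def hN hadj_simps matrix_mult_algebra hform_square)
  with hi have hN': "hform p ** hadj N ** hform p = - N + N ** N" by simp
  have "hform p ** hadj (N ** N) ** hform p = hform p ** hadj N ** (hform p ** hform p) ** (hadj N ** hform p)"
    by (simp add: hform_square hadj_simps matrix_mul_assoc)
  also have "\<dots> = (hform p ** hadj N ** hform p) ** (hform p ** hadj N ** hform p)"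
    by (simp only: matrix_mul_assoc)
  also have "\<dots> = N ** N" unfolding hN' by (simp add: matrix_mult_algebra N3)
  finally have hNN: "hform p ** hadj (N ** N) ** hform p = N ** N" .
  have hW: "hform p ** hadj W ** hform p = - W"
    using hN' hNN by (simp add: W_def hadj_simps matrix_mult_algebra)
  have "hadj W ** hform p = hform p ** (hform p ** hadj W ** hform p)"
    by (simp add: matrix_mul_assoc hform_square)
  then have "hadj W ** hform p = - (hform p ** W)" by (simp add: hW matrix_mult_algebra)
  moreover have W1: "filt 1 W" unfolding W_def using N1 filt_mono[OF N2, of 1] by (intro filt_simps) auto
  ultimately have "W \<in> gfilt p 1" by (simp add: gfilt_iff su_iff filt_trace)
  moreover have "W ** W = N ** N" by (simp add: W_def matrix_mult_algebra N3)
  then have "mexp W = h" by (simp add: mexp_nilpotent[OF W1] hN) (simp add: W_def)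
  ultimately show ?thesis by (rule that)
qed

text \<open>The element of \<open>\<gg>\<^sub>-\<^sub>1\<close> with coordinates \<open>x \<in> \<complex>\<^sup>n\<close>.\<close>

definition gminus :: "nat \<Rightarrow> ('n::{finite,linorder} \<Rightarrow> complex) \<Rightarrow> 'n bmat" where
  "gminus p x = (\<chi> i j. case (i, j) of
      (BMid k, BFst) \<Rightarrow> x k
    | (BLst, BMid k) \<Rightarrow> - cnj (x k) * sgn_entry p k
    | _ \<Rightarrow> 0)"

lemma gminus_grad: "gminus p x \<in> grad p (-1)"
proof -
  have "gminus p x \<in> su p"
    unfolding su_iff_block_form by (simp add: gminus_def)
  moreover have "gminus p x $ i $ j \<noteq> 0 \<longrightarrow> blk j - blk i = -1" for i j
    by (cases i; cases j) (auto simp: gminus_def)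
  ultimately show ?thesis by (auto simp: grad_def)
qed

text \<open>An element of \<open>P\<close> acting trivially on \<open>\<gg>\<^sup>-\<^sup>1/\<pp>\<close> is scalar on each diagonal block, with the same
  scalar because it preserves the Hermitian form.\<close>

lemma trivial_action_decomposition:
  fixes h :: "'n::{finite,linorder} bmat"
  assumes h: "h \<in> Ptilde p"
    and triv: "\<And>X. X \<in> gfilt p (-1) \<Longrightarrow> h ** X ** matrix_inv h - X \<in> gfilt p 0"
  obtains z W where "z \<in> centre (SU p)" "W \<in> gfilt p 1" "h = z ** mexp W"
proof -
  have ph: "preserves_hform p h" "det h = 1" and fh: "filt 0 h" using h by (auto simp: Ptilde_iff)
  define a where "a = h $ BFst $ BFst"
  have low: "h $ BMid k $ BFst = 0" "h $ BLst $ BFst = 0" "h $ BLst $ BMid k = 0" for k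
    using filtD[OF fh] by auto
  have mid: "h $ BMid k $ BMid l = (if k = l then a else 0)" for k l
  proof -
    define x :: "'n \<Rightarrow> complex" where "x = (\<lambda>m. if m = l then 1 else 0)"
    define D where "D = h ** gminus p x ** matrix_inv h - gminus p x"
    have D: "D \<in> gfilt p 0" unfolding D_def by (rule triv[OF grad_gfilt[OF gminus_grad]])
    have "h ** gminus p x = (gminus p x + D) ** h"
      using Ptilde_matrix_inv(2)[OF h] by (simp add: D_def) (simp flip: matrix_mul_assoc)
    then have "(h ** gminus p x) $ BMid k $ BFst = ((gminus p x + D) ** h) $ BMid k $ BFst" by simp
    moreover have "(h ** gminus p x) $ BMid k $ BFst = (\<Sum>m\<in>UNIV. h $ BMid k $ BMid m * x m)"
      by (simp add: matrix_matrix_mult_def sum_bidx gminus_def)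
    moreover have "\<dots> = h $ BMid k $ BMid l" by (simp add: x_def if_distrib cong: if_cong)
    moreover have "D $ BMid k $ BFst = 0" using D filtD[of 0 D] by (simp add: gfilt_iff)
    then have "((gminus p x + D) ** h) $ BMid k $ BFst = x k * a"
      by (simp add: matrix_matrix_mult_def sum_bidx gminus_def low a_def)
    ultimately show ?thesis by (auto simp: x_def)
  qed
  have form: "(hadj h ** hform p ** h) $ i $ j = hform p $ i $ j" for i j
    using ph by (simp add: preserves_hform_def)
  have e: "(hadj h ** hform p ** h) $ i $ j = (\<Sum>m\<in>UNIV. cnj (h $ flip m $ i) * eps p m * h $ m $ j)" for i j
    unfolding matrix_matrix_mult_def[of "hadj h ** hform p"] vec_lambda_beta hform_mult_right
    by (simp add: hadj_def)
  obtain k :: 'n where True by blast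
  have "cnj a * eps p (BMid k) * a = eps p (BMid k)"
    using form[of "BMid k" "BMid k"] unfolding e
    by (simp add: sum_bidx low mid hform_entry if_distrib if_distribR cong: if_cong)
  then have aa: "cnj a * a = 1" using eps_cases[of p "BMid k"] by auto
  have "cnj a * h $ BLst $ BLst = 1"
    using form[of BFst BLst] unfolding e by (simp add: sum_bidx low hform_entry a_def eps_def)
  then have hL: "h $ BLst $ BLst = a" using aa by (metis mult_cancel_left mult_zero_left zero_neq_one)
  define h' where "h' = mat (cnj a) ** h"
  have scal: "(mat c ** M) $ i $ j = c * M $ i $ j" "(M ** mat c) $ i $ j = c * M $ i $ j" for c and M :: "'n bmat" and i j
    by (simp_all add: matrix_matrix_mult_def mat_def if_distrib if_distribR mult.commute cong: if_cong)
  have hh': "h = mat a ** h'"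
    using aa by (simp add: h'_def vec_eq_iff scal mult.assoc[symmetric] mult.commute[of a])
  have pa: "preserves_hform p (mat c :: 'n bmat)" if "cnj c * c = 1" for c
  proof -
    have hc: "hadj (mat c) = (mat (cnj c) :: 'n bmat)" by (auto simp: vec_eq_iff hadj_def mat_def)
    have "(hadj (mat c) ** hform p ** mat c) $ i $ j = hform p $ i $ j" for i j :: "'n bidx"
      unfolding hc scal using that by (simp add: mult.assoc[symmetric] mult.commute[of c])
    then show ?thesis by (simp add: preserves_hform_def vec_eq_iff)
  qed
  have ph': "preserves_hform p h'"
    unfolding h'_def by (rule preserves_hform_mult[OF pa ph(1)]) (use aa in \<open>simp add: mult.commute\<close>)
  have one: "mat 1 $ i $ j = (if i = j then 1 else (0 :: complex))" for i j :: "'n bidx"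
    by (simp add: mat_def)
  have "filt 1 (h' - mat 1)"
    unfolding filt_def
  proof (intro allI impI)
    fix i j assume "(h' - mat 1) $ i $ j \<noteq> 0"
    then show "1 \<le> blk j - blk i"
      using aa by (cases i; cases j) (auto simp: h'_def scal low mid hL a_def[symmetric] one split: if_splits)
  qed
  then obtain W where W: "W \<in> gfilt p 1" "mexp W = h'" by (rule unipotent_logarithm[OF ph'])
  have "det h' = 1" using W det_mexp[of W 1] by (simp add: gfilt_iff su_iff)
  then have "det (mat a :: 'n bmat) = 1" using ph(2) unfolding hh' by (simp add: det_mul)
  then have "(mat a :: 'n bmat) \<in> carrier (SU p)" using pa[OF aa] by (simp add: SU_iff)
  moreover have "mat a ** g = g ** mat a" for g :: "'n bmat" by (simp add: vec_eq_iff scal)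
  ultimately have "(mat a :: 'n bmat) \<in> centre (SU p)" by (simp add: centre_def)
  then show ?thesis using W hh' by (intro that[of "mat a" W]) auto
qed

section \<open>Lie algebra homology in degree two\<close>

definition val1 :: "('n::finite bmat \<times> 'n bmat) list \<Rightarrow> 'n bmat \<Rightarrow> 'n bmat" where
  "val1 c X = (\<Sum>(Z, A)\<leftarrow>c. killing Z X *\<^sub>R A)"

definition val2 :: "('n::finite bmat \<times> 'n bmat \<times> 'n bmat) list \<Rightarrow> 'n bmat \<Rightarrow> 'n bmat \<Rightarrow> 'n bmat" where
  "val2 c X Y = (\<Sum>(Z, W, A)\<leftarrow>c. (killing Z X * killing W Y - killing Z Y * killing W X) *\<^sub>R A)"

lemma form_val: "form1 p c X = (if X \<in> su p then val1 c X else 0)"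
  "form2 p d X Y = (if X \<in> su p \<and> Y \<in> su p then val2 d X Y else 0)"
  by (simp_all add: form1_def form2_def val1_def val2_def)

lemma val_simps [simp]:
  "val1 [] X = 0" "val1 ((Z, A) # c) X = killing Z X *\<^sub>R A + val1 c X"
  "val2 [] X Y = 0"
  "val2 ((Z, W, A) # d) X Y = (killing Z X * killing W Y - killing Z Y * killing W X) *\<^sub>R A + val2 d X Y"
  "val1 (c @ c') X = val1 c X + val1 c' X" "val2 (d @ d') X Y = val2 d X Y + val2 d' X Y"
  by (simp_all add: val1_def val2_def)

lemma killing_linear:
  "killing Z (X + Y) = killing Z X + killing Z Y" "killing Z (r *\<^sub>R X) = r * killing Z X"
  "killing Z (- X) = - killing Z X" "killing Z (X - Y) = killing Z X - killing Z Y"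
  "killing (- Z) X = - killing Z X"
  by (simp_all add: killing_def matrix_mult_algebra trace_simps algebra_simps)

lemma killing_invariant: "killing (mbracket W Z) X = - killing Z (mbracket W X)"
proof -
  have "trace (W ** Z ** X) = trace (Z ** X ** W)"
    using trace_mul_sym[of W "Z ** X"] by (simp add: matrix_mul_assoc)
  then show ?thesis
    by (simp add: killing_def mbracket_def matrix_mult_algebra trace_simps algebra_simps)
qed

lemma killing_conjugate:
  fixes g g' :: "'n::finite bmat"
  shows "killing (g ** Z ** g') X = killing Z (g' ** X ** g)"
  using trace_mul_sym[of g "Z ** g' ** X"] by (simp add: killing_def matrix_mul_assoc)

lemma killing_filt:
  assumes "filt k Z" "filt l X" "k + l \<ge> 1"
  shows "killing Z X = 0"
  using filt_trace[OF filt_mono[OF filt_mult[OF assms(1,2)] assms(3)]] by (simp add: killing_def)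

lemma mbracket_linear:
  "mbracket W (X + Y) = mbracket W X + mbracket W Y" "mbracket W (r *\<^sub>R X) = r *\<^sub>R mbracket W X"
  "mbracket W (- X) = - mbracket W X" "mbracket W (X - Y) = mbracket W X - mbracket W Y" "mbracket W 0 = 0"
  "mbracket (W + V) X = mbracket W X + mbracket V X" "mbracket (r *\<^sub>R W) X = r *\<^sub>R mbracket W X"
  "mbracket (- W) X = - mbracket W X" "mbracket (W - V) X = mbracket W X - mbracket V X"
  by (simp_all add: mbracket_def matrix_mult_algebra algebra_simps)

lemma bilinear_val2: "bilinear (val2 c)"
proof (induction c)
  case Nil
  then show ?case by (simp add: bilinear_def linear_iff)
next
  case (Cons t c)
  obtain Z W A where t: "t = (Z, W, A)" by (cases t) auto
  show ?case
    using Cons unfolding bilinear_def linear_iff t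
    by (simp add: killing_linear algebra_simps)
qed

text \<open>The action of \<open>W \<in> \<gg>\<close> on two-forms with values in \<open>\<gg>\<close>.\<close>

definition lact :: "'n::finite bmat \<Rightarrow> ('n bmat \<Rightarrow> 'n bmat \<Rightarrow> 'n bmat) \<Rightarrow> 'n bmat \<Rightarrow> 'n bmat \<Rightarrow> 'n bmat" where
  "lact W B X Y = mbracket W (B X Y) - B (mbracket W X) Y - B X (mbracket W Y)"

definition restrict_su :: "nat \<Rightarrow> ('n::{finite,linorder} bmat \<Rightarrow> 'n bmat \<Rightarrow> 'n bmat) \<Rightarrow> 'n bmat \<Rightarrow> 'n bmat \<Rightarrow> 'n bmat" where
  "restrict_su p B X Y = (if X \<in> su p \<and> Y \<in> su p then B X Y else 0)"

lemma form2_restrict: "form2 p c = restrict_su p (val2 c)"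
  by (simp add: fun_eq_iff form_val restrict_su_def)

definition wedge :: "'n bmat \<Rightarrow> ('n::finite bmat \<times> 'n bmat \<times> 'n bmat) list \<Rightarrow> ('n bmat \<times> 'n bmat \<times> 'n bmat \<times> 'n bmat) list" where
  "wedge W c = map (Pair W) c"

text \<open>Cartan's homotopy formula: up to sign, the action of \<open>W \<in> \<pp>\<^sub>+\<close> is the anticommutator of the
  differential with the exterior product by \<open>W\<close>. This is why \<open>\<pp>\<^sub>+\<close> acts trivially on homology.\<close>

lemma cartan_homotopy:
  "val2 (bd3 (wedge W c)) X Y = - lact W (val2 c) X Y
    - (killing W X *\<^sub>R val1 (bd2 c) Y - killing W Y *\<^sub>R val1 (bd2 c) X)"
proof (induction c)
  case Nil
  then show ?case by (simp add: wedge_def lact_def mbracket_linear)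
next
  case (Cons t c)
  obtain Z1 Z2 A where t: "t = (Z1, Z2, A)" by (cases t) auto
  have w: "bd3 (wedge W (t # c)) = bd3 [(W, Z1, Z2, A)] @ bd3 (wedge W c)"
    by (simp add: wedge_def t)
  have b: "bd2 (t # c) = bd2 [(Z1, Z2, A)] @ bd2 c" by (simp add: t)
  have l: "lact W (val2 (t # c)) X Y = lact W (val2 [(Z1, Z2, A)]) X Y + lact W (val2 c) X Y"
    by (simp add: lact_def t mbracket_linear)
  have "val2 (bd3 [(W, Z1, Z2, A)]) X Y = - lact W (val2 [(Z1, Z2, A)]) X Y
    - (killing W X *\<^sub>R val1 (bd2 [(Z1, Z2, A)]) Y - killing W Y *\<^sub>R val1 (bd2 [(Z1, Z2, A)]) X)"
    by (simp add: lact_def killing_invariant[of W] mbracket_linear algebra_simps)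
  then show ?case
    unfolding w b l val_simps(5,6) Cons.IH by (simp add: algebra_simps)
qed

lemma im_codiffI: "c \<in> chains3 p \<Longrightarrow> form2 p (bd3 c) \<in> im_codiff p"
  unfolding im_codiff_def by blast

lemma bd3_append: "bd3 (c @ d) = bd3 c @ bd3 d"
  by (induction c rule: bd3.induct) simp_all

lemma im_codiff_zero: "(\<lambda>X Y. 0) \<in> im_codiff p"
  unfolding im_codiff_def mem_Collect_eq
  by (rule exI[of _ "[]"]) (simp add: chains3_def fun_eq_iff form_val)

lemma im_codiff_add:
  assumes "\<psi> \<in> im_codiff p" "\<psi>' \<in> im_codiff p"
  shows "(\<lambda>X Y. \<psi> X Y + \<psi>' X Y) \<in> im_codiff p"
proof -
  obtain c d where c: "c \<in> chains3 p" "\<psi> = form2 p (bd3 c)" and d: "d \<in> chains3 p" "\<psi>' = form2 p (bd3 d)"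
    using assms unfolding im_codiff_def by blast
  have "(\<lambda>X Y. \<psi> X Y + \<psi>' X Y) = form2 p (bd3 (c @ d))"
    by (simp add: c d fun_eq_iff form_val bd3_append)
  moreover have "c @ d \<in> chains3 p" using c d by (simp add: chains3_def)
  ultimately show ?thesis using im_codiffI by metis
qed

lemma im_codiff_scale:
  assumes "\<psi> \<in> im_codiff p"
  shows "(\<lambda>X Y. r *\<^sub>R \<psi> X Y) \<in> im_codiff p"
proof -
  obtain c where c: "c \<in> chains3 p" "\<psi> = form2 p (bd3 c)" using assms unfolding im_codiff_def by blast
  let ?s = "map (\<lambda>(Z1, Z2, Z3, A). (Z1, Z2, Z3, r *\<^sub>R A))"
  have "val2 (bd3 (?s c)) X Y = r *\<^sub>R val2 (bd3 c) X Y" for X Y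
    by (induction c rule: bd3.induct) (simp_all add: mbracket_linear algebra_simps)
  then have "(\<lambda>X Y. r *\<^sub>R \<psi> X Y) = form2 p (bd3 (?s c))"
    by (simp add: c fun_eq_iff form_val)
  moreover have "?s c \<in> chains3 p"
    using c(1) subspace_scale[OF subspace_su] by (auto simp: chains3_def)
  ultimately show ?thesis using im_codiffI by metis
qed

text \<open>Conjugation of chains. It commutes with the differential, so the image of the differential is
  invariant under \<open>P\<close>.\<close>

definition conj3 where "conj3 g g' = map (\<lambda>(Z1, Z2, A). (g ** Z1 ** g', g ** Z2 ** g', g ** A ** (g' :: complex^'k^'k)))"
definition conj4 where "conj4 g g' = map (\<lambda>(Z1, Z2, Z3, A).
  (g ** Z1 ** g', g ** Z2 ** g', g ** Z3 ** g', g ** A ** (g' :: complex^'k^'k)))"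

lemma val2_conj: "val2 (conj3 g g' c) X Y = g ** val2 c (g' ** X ** g) (g' ** Y ** g) ** g'"
proof (induction c)
  case Nil
  then show ?case by (simp add: conj3_def matrix_mult_zero)
next
  case (Cons t c)
  obtain Z1 Z2 A where t: "t = (Z1, Z2, A)" by (cases t) auto
  have "val2 (conj3 g g' (t # c)) X Y = (killing Z1 (g' ** X ** g) * killing Z2 (g' ** Y ** g)
      - killing Z1 (g' ** Y ** g) * killing Z2 (g' ** X ** g)) *\<^sub>R (g ** A ** g') + val2 (conj3 g g' c) X Y"
    by (simp add: t conj3_def killing_conjugate)
  then show ?case
    unfolding Cons.IH t val_simps matrix_mult_add_left matrix_mult_add_right matrix_mult_scaleR_left matrix_mult_scaleR_right
    by simp
qed

lemma mbracket_conj: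
  fixes X Y g g' :: "complex^'k^'k"
  assumes "g' ** g = mat 1"
  shows "mbracket (g ** X ** g') (g ** Y ** g') = g ** mbracket X Y ** g'"
proof -
  have "(g ** X ** g') ** (g ** Y ** g') = g ** X ** (g' ** g) ** Y ** g'" for X Y :: "complex^'k^'k"
    by (simp only: matrix_mul_assoc)
  then have "(g ** X ** g') ** (g ** Y ** g') = g ** (X ** Y) ** g'" for X Y :: "complex^'k^'k"
    by (simp add: assms matrix_mul_assoc)
  then show ?thesis by (simp add: mbracket_def matrix_mult_diff_left matrix_mult_diff_right)
qed

lemma bd3_conj:
  assumes "g' ** g = mat 1"
  shows "bd3 (conj4 g g' c) = conj3 g g' (bd3 c)"
  by (induction c rule: bd3.induct)
    (simp_all add: conj4_def conj3_def mbracket_conj[OF assms] matrix_mult_minus_left matrix_mult_minus_right)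

text \<open>The action of \<open>P\<close> on two-forms with values in \<open>\<gg>\<close>.\<close>

definition cj :: "nat \<Rightarrow> 'n::{finite,linorder} bmat \<Rightarrow> ('n bmat \<Rightarrow> 'n bmat \<Rightarrow> 'n bmat) \<Rightarrow> 'n bmat \<Rightarrow> 'n bmat \<Rightarrow> 'n bmat" where
  "cj p g B = restrict_su p (\<lambda>X Y. g ** B (matrix_inv g ** X ** g) (matrix_inv g ** Y ** g) ** matrix_inv g)"

lemma cj_one:
  "cj p (mat 1) (restrict_su p B) = restrict_su p B" "cj p (mat 1) (form2 p c) = form2 p c"
  by (simp_all add: cj_def matrix_inv_eq form2_restrict) (simp_all add: fun_eq_iff restrict_su_def)

lemma adjoint_su_Ptilde:
  assumes "g \<in> Ptilde p" "X \<in> su p"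
  shows "g ** X ** matrix_inv g \<in> su p" "matrix_inv g ** X ** g \<in> su p"
  using adjoint_gfilt[OF assms(1), of X "-2"] assms(2) by (simp_all add: gfilt_all)

lemma im_codiff_conj:
  assumes g: "g \<in> Ptilde p" and "\<psi> \<in> im_codiff p"
  shows "cj p g \<psi> \<in> im_codiff p"
proof -
  obtain c where c: "c \<in> chains3 p" "\<psi> = form2 p (bd3 c)" using assms unfolding im_codiff_def by blast
  have "cj p g \<psi> = form2 p (bd3 (conj4 g (matrix_inv g) c))"
    unfolding bd3_conj[OF Ptilde_matrix_inv(2)[OF g]]
    by (auto simp: fun_eq_iff cj_def restrict_su_def form_val val2_conj c adjoint_su_Ptilde[OF g])
  moreover have "conj4 g (matrix_inv g) c \<in> chains3 p"
    using c(1) adjoint_gfilt(1)[OF g] adjoint_su_Ptilde(1)[OF g]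
    by (fastforce simp: chains3_def conj4_def)
  ultimately show ?thesis using im_codiffI by metis
qed

lemma ker_codiffE:
  assumes "\<kappa> \<in> ker_codiff p"
  obtains c where "c \<in> chains2 p" "\<kappa> = form2 p c" "\<And>X. X \<in> su p \<Longrightarrow> val1 (bd2 c) X = 0"
proof -
  obtain c where c: "c \<in> chains2 p" "\<kappa> = form2 p c" "form1 p (bd2 c) = (\<lambda>X. 0)"
    using assms unfolding ker_codiff_def by blast
  have "val1 (bd2 c) X = 0" if "X \<in> su p" for X
    using fun_cong[OF c(3), of X] that by (simp add: form_val)
  then show ?thesis using that c by blast
qed

lemma lact_restrict:
  assumes "W \<in> su p"
  shows "restrict_su p (lact W (restrict_su p B)) = restrict_su p (lact W B)"
  by (auto simp: fun_eq_iff restrict_su_def lact_def mbracket_su[OF assms])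

text \<open>On a cycle the second summand of the homotopy formula vanishes.\<close>

lemma lact_ker_in_im:
  assumes \<kappa>: "\<kappa> \<in> ker_codiff p" and W: "W \<in> gfilt p 1"
  shows "restrict_su p (lact W \<kappa>) \<in> im_codiff p"
proof -
  obtain c where c: "c \<in> chains2 p" "\<kappa> = form2 p c" "\<And>X. X \<in> su p \<Longrightarrow> val1 (bd2 c) X = 0"
    by (rule ker_codiffE[OF \<kappa>], rule that)
  have "restrict_su p (lact W \<kappa>) = restrict_su p (lact W (val2 c))"
    unfolding c(2) form2_restrict by (rule lact_restrict[OF gfilt_su[OF W]])
  also have "\<dots> = form2 p (bd3 (wedge (- W) c))"
    by (auto simp: fun_eq_iff restrict_su_def form_val cartan_homotopy c(3) lact_def mbracket_linear
        linear_neg[OF bilinear_val2[unfolded bilinear_def, THEN conjunct1, rule_format]]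
        linear_neg[OF bilinear_val2[unfolded bilinear_def, THEN conjunct2, rule_format]])
  also have "wedge (- W) c \<in> chains3 p"
    using c(1) W subspace_neg[OF subspace_gfilt] by (auto simp: chains3_def chains2_def wedge_def)
  then have "form2 p (bd3 (wedge (- W) c)) \<in> im_codiff p" by (rule im_codiffI)
  finally show ?thesis .
qed

text \<open>A two-form is determined by its values on the projections to \<open>\<gg>\<close> of the real basis of the
  space of matrices. Listing them embeds the forms in a Euclidean space, where the subspace
  \<open>im_codiff p\<close> is the common kernel of the inner products with vectors orthogonal to it.\<close>

definition suproj :: "nat \<Rightarrow> 'n::{finite,linorder} bmat \<Rightarrow> 'n bmat" where
  "suproj p = (SOME P. range P \<subseteq> su p \<and> linear P \<and> (\<forall>X\<in>su p. P X = X))"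

lemma suproj:
  fixes X :: "'n::{finite,linorder} bmat"
  shows "suproj p X \<in> su p" "linear (suproj p :: 'n bmat \<Rightarrow> 'n bmat)" "X \<in> su p \<Longrightarrow> suproj p X = X"
proof -
  have ex: "\<exists>P :: 'n bmat \<Rightarrow> 'n bmat. range P \<subseteq> su p \<and> linear P \<and> (\<forall>X\<in>su p. P X = X)"
    using real_vector.linear_exists_left_inverse_on[OF linear_id subspace_su inj_on_id] unfolding id_def .
  have "range (suproj p :: 'n bmat \<Rightarrow> 'n bmat) \<subseteq> su p \<and> linear (suproj p :: 'n bmat \<Rightarrow> 'n bmat) \<and>
      (\<forall>X :: 'n bmat\<in>su p. suproj p X = X)"
    unfolding suproj_def by (rule someI_ex[OF ex])
  note P = this
  have "suproj p X \<in> range (suproj p)" by (rule rangeI)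
  then show "suproj p X \<in> su p" by (rule subsetD[OF conjunct1[OF P]])
  show "linear (suproj p :: 'n bmat \<Rightarrow> 'n bmat)" by (rule conjunct1[OF conjunct2[OF P]])
  show "X \<in> su p \<Longrightarrow> suproj p X = X" by (rule bspec[OF conjunct2[OF conjunct2[OF P]]])
qed

definition mbasis :: "'n::finite bidx \<times> 'n bidx \<times> bool \<Rightarrow> 'n bmat" where
  "mbasis = (\<lambda>(i, j, b). axis i (axis j (if b then 1 else \<i>)))"

lemma Basis_mbasis: "b \<in> Basis \<Longrightarrow> \<exists>j. b = mbasis j"
proof -
  assume "b \<in> Basis"
  then obtain i j u where b: "b = axis i (axis j u)" "u \<in> Basis" by (auto simp: Basis_vec_def)
  then have "u = 1 \<or> u = \<i>" by (simp add: Basis_complex_def)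
  then have "b = mbasis (i, j, True) \<or> b = mbasis (i, j, False)"
    unfolding b(1) mbasis_def by (elim disjE) simp_all
  then show ?thesis by blast
qed

type_synonym 'n fvec = "'n bmat ^ (('n bidx \<times> 'n bidx \<times> bool) \<times> ('n bidx \<times> 'n bidx \<times> bool))"

definition enc :: "nat \<Rightarrow> ('n::{finite,linorder} bmat \<Rightarrow> 'n bmat \<Rightarrow> 'n bmat) \<Rightarrow> 'n fvec" where
  "enc p B = (\<chi> jk. B (suproj p (mbasis (fst jk))) (suproj p (mbasis (snd jk))))"

lemma enc_linear:
  "enc p (\<lambda>X Y. B X Y + C X Y) = enc p B + enc p C" "enc p (\<lambda>X Y. r *\<^sub>R B X Y) = r *\<^sub>R enc p B"
  "enc p (\<lambda>X Y. 0) = 0"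
  by (simp_all add: enc_def vec_eq_iff)

lemma enc_inj:
  assumes "enc p (form2 p c) = enc p (form2 p d)"
  shows "form2 p c = form2 p d"
proof -
  have bil: "bilinear (\<lambda>X Y. val2 c (suproj p X) (suproj p Y))" for c
    using bilinear_val2[of c] linear_compose[OF suproj(2)[of p]]
    unfolding bilinear_def by (auto simp: comp_def)
  have "(\<lambda>X Y. val2 c (suproj p X) (suproj p Y)) = (\<lambda>X Y. val2 d (suproj p X) (suproj p Y))"
  proof (rule bilinear_eq_stdbasis[OF bil bil])
    fix b b' :: "'a bmat" assume "b \<in> Basis" "b' \<in> Basis"
    then obtain j k where jk: "b = mbasis j" "b' = mbasis k" using Basis_mbasis by metis
    have "enc p (form2 p c) $ (j, k) = enc p (form2 p d) $ (j, k)" by (simp add: assms)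
    then show "val2 c (suproj p b) (suproj p b') = val2 d (suproj p b) (suproj p b')"
      by (simp add: enc_def jk form_val suproj(1))
  qed
  note eq = this
  have "val2 c X Y = val2 d X Y" if "X \<in> su p" "Y \<in> su p" for X Y
    using fun_cong[OF fun_cong[OF eq, of X], of Y] by (simp add: suproj(3) that)
  then show ?thesis by (simp add: fun_eq_iff form_val)
qed

definition annihilates :: "nat \<Rightarrow> 'n::{finite,linorder} fvec \<Rightarrow> bool" where
  "annihilates p y \<longleftrightarrow> (\<forall>\<psi>\<in>im_codiff p. enc p \<psi> \<bullet> y = 0)"

lemma im_codiff_separation:
  fixes c :: "('n::{finite,linorder} bmat \<times> 'n bmat \<times> 'n bmat) list"
  assumes "\<And>y. annihilates p y \<Longrightarrow> enc p (form2 p c) \<bullet> y = 0"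
  shows "form2 p c \<in> im_codiff p"
proof -
  let ?S = "enc p ` im_codiff p"
  have S: "subspace ?S"
  proof (rule subspaceI)
    show "0 \<in> ?S" using im_codiff_zero[of p] enc_linear(3)[of p] by (metis imageI)
    show "x + y \<in> ?S" if "x \<in> ?S" "y \<in> ?S" for x y
      using that im_codiff_add enc_linear(1)[symmetric] by (fastforce intro!: image_eqI)
    show "r *\<^sub>R x \<in> ?S" if "x \<in> ?S" for r x
      using that im_codiff_scale enc_linear(2)[symmetric] by (fastforce intro!: image_eqI)
  qed
  obtain y z where yz: "y \<in> span ?S" "\<And>w. w \<in> span ?S \<Longrightarrow> orthogonal z w" "enc p (form2 p c) = y + z"
    using orthogonal_subspace_decomp_exists[of ?S "enc p (form2 p c)"] by metis
  have sp: "span ?S = ?S" by (rule span_eq_iff[THEN iffD2, OF S])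
  have "annihilates p z"
    unfolding annihilates_def
  proof
    fix \<psi> :: "'n bmat \<Rightarrow> 'n bmat \<Rightarrow> 'n bmat" assume "\<psi> \<in> im_codiff p"
    then have "orthogonal z (enc p \<psi>)" by (intro yz(2) span_base imageI)
    then show "enc p \<psi> \<bullet> z = 0" by (simp add: orthogonal_def inner_commute)
  qed
  then have "(y + z) \<bullet> z = 0" using assms[of z] yz(3) by simp
  moreover have "z \<bullet> y = 0" using yz(2)[OF yz(1)] by (simp add: orthogonal_def)
  ultimately have "z \<bullet> z = 0" by (simp only: inner_add_left inner_commute[of y z] add_0)
  then have "z = 0" by simp
  then have "enc p (form2 p c) \<in> ?S" using yz(1,3) unfolding sp by simp
  then obtain d where "enc p (form2 p c) = enc p (form2 p (bd3 d))" "form2 p (bd3 d) \<in> im_codiff p"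
    unfolding im_codiff_def by blast
  then show ?thesis using enc_inj by metis
qed

text \<open>The action of \<open>\<gg>\<close> on bilinear maps is the derivative of the conjugation action.\<close>

lemma conjugate_has_vector_derivative:
  fixes A :: "complex^'k^'k"
  assumes B: "bilinear B"
  defines "g \<equiv> \<lambda>t. mexp (t *\<^sub>R A)" and "g' \<equiv> \<lambda>t. mexp (- t *\<^sub>R A)"
  shows "((\<lambda>t. g t ** B (g' t ** X ** g t) (g' t ** Y ** g t) ** g' t) has_vector_derivative
    g t ** (mbracket A (B (g' t ** X ** g t) (g' t ** Y ** g t))
      - B (mbracket A (g' t ** X ** g t)) (g' t ** Y ** g t)
      - B (g' t ** X ** g t) (mbracket A (g' t ** Y ** g t))) ** g' t) (at t)"
proof -
  have g: "(g has_vector_derivative A ** g t) (at t)"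
    unfolding g_def by (rule mexp_has_vector_derivative)
  have g': "(g' has_vector_derivative - (g' t ** A)) (at t)"
    unfolding g'_def by (rule mexp_minus_has_vector_derivative)
  have comm: "A ** g t = g t ** A" "g' t ** A = A ** g' t"
    using mexp_commute[of A t] mexp_commute[of A "- t"] by (simp_all add: g_def g'_def)
  have cx: "((\<lambda>t. g' t ** X ** g t) has_vector_derivative - mbracket A (g' t ** X ** g t)) (at t)" for X
  proof -
    have "((\<lambda>t. g' t ** X) has_vector_derivative - (g' t ** A) ** X) (at t)"
      by (rule bounded_linear.has_vector_derivative[OF
            bounded_bilinear.bounded_linear_left[OF bounded_bilinear_matrix_mult] g'])
    from matrix_mult_has_vector_derivative[OF this g] show ?thesis
      by (simp add: mbracket_def matrix_mult_algebra comm(2)) (simp add: comm(1) flip: matrix_mul_assoc)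
  qed
  have bb: "bounded_bilinear B" using B by (simp add: bilinear_conv_bounded_bilinear)
  let ?X = "g' t ** X ** g t" and ?Y = "g' t ** Y ** g t"
  have "((\<lambda>t. B (g' t ** X ** g t) (g' t ** Y ** g t)) has_vector_derivative
      B ?X (- mbracket A ?Y) + B (- mbracket A ?X) ?Y) (at t)"
    by (rule bounded_bilinear.has_vector_derivative[OF bb cx cx])
  from matrix_mult_has_vector_derivative[OF matrix_mult_has_vector_derivative[OF g this] g']
  show ?thesis
    by (rule has_vector_derivative_eq_rhs)
      (simp add: bounded_bilinear.minus_left[OF bb] bounded_bilinear.minus_right[OF bb]
        mbracket_def[of A "B ?X ?Y"] matrix_mult_algebra comm)
qed

lemma cj_has_real_derivative:
  fixes c :: "('n::{finite,linorder} bmat \<times> 'n bmat \<times> 'n bmat) list"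
  assumes A: "A \<in> gfilt p 0"
  shows "((\<lambda>t. enc p (cj p (mexp (t *\<^sub>R A)) (form2 p c)) \<bullet> y) has_real_derivative
    enc p (cj p (mexp (t *\<^sub>R A)) (restrict_su p (lact A (form2 p c)))) \<bullet> y) (at t)"
proof -
  note P = mexp_Ptilde[OF A]
  have Asu: "A \<in> su p" by (rule gfilt_su[OF A])
  have "((\<lambda>t. enc p (cj p (mexp (t *\<^sub>R A)) (form2 p c))) has_vector_derivative
    enc p (cj p (mexp (t *\<^sub>R A)) (restrict_su p (lact A (form2 p c))))) (at t)"
  proof (rule has_vector_derivative_vec)
    fix jk :: "('n bidx \<times> 'n bidx \<times> bool) \<times> ('n bidx \<times> 'n bidx \<times> bool)"
    let ?X = "suproj p (mbasis (fst jk))" and ?Y = "suproj p (mbasis (snd jk))"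
    have XY: "?X \<in> su p" "?Y \<in> su p" by (rule suproj(1))+
    have 1: "enc p (cj p (mexp (t *\<^sub>R A)) (form2 p c)) $ jk
      = mexp (t *\<^sub>R A) ** val2 c (mexp (- t *\<^sub>R A) ** ?X ** mexp (t *\<^sub>R A)) (mexp (- t *\<^sub>R A) ** ?Y ** mexp (t *\<^sub>R A)) ** mexp (- t *\<^sub>R A)" for t
      using adjoint_su_Ptilde(2)[OF P[of t] XY(1)] adjoint_su_Ptilde(2)[OF P[of t] XY(2)]
      by (simp add: enc_def cj_def restrict_su_def XY form_val matrix_inv_mexp)
    have 2: "enc p (cj p (mexp (t *\<^sub>R A)) (restrict_su p (lact A (form2 p c)))) $ jk
      = mexp (t *\<^sub>R A) ** (lact A (val2 c) (mexp (- t *\<^sub>R A) ** ?X ** mexp (t *\<^sub>R A)) (mexp (- t *\<^sub>R A) ** ?Y ** mexp (t *\<^sub>R A))) ** mexp (- t *\<^sub>R A)"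
      using adjoint_su_Ptilde(2)[OF P[of t] XY(1)] adjoint_su_Ptilde(2)[OF P[of t] XY(2)]
      unfolding form2_restrict lact_restrict[OF Asu]
      by (simp add: enc_def cj_def restrict_su_def XY matrix_inv_mexp)
    show "((\<lambda>t. enc p (cj p (mexp (t *\<^sub>R A)) (form2 p c)) $ jk) has_vector_derivative
      enc p (cj p (mexp (t *\<^sub>R A)) (restrict_su p (lact A (form2 p c)))) $ jk) (at t)"
      unfolding 1 2 lact_def by (rule conjugate_has_vector_derivative[OF bilinear_val2])
  qed
  from bounded_linear.has_vector_derivative[OF bounded_linear_inner_left this]
  show ?thesis by (simp add: has_real_derivative_iff_has_vector_derivative)
qed

text \<open>Along \<open>exp (t W)\<close> the derivative of the pairing is the pairing of \<open>y\<close> with a boundary.\<close>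

lemma cj_pplus:
  assumes \<kappa>: "\<kappa> \<in> ker_codiff p" and W: "W \<in> gfilt p 1" and y: "annihilates p y"
  shows "enc p (cj p (mexp W) \<kappa>) \<bullet> y = enc p \<kappa> \<bullet> y"
proof -
  obtain c where c: "\<kappa> = form2 p c" by (rule ker_codiffE[OF \<kappa>])
  have W0: "W \<in> gfilt p 0" by (rule gfilt_mono[OF W]) simp
  have "((\<lambda>t. enc p (cj p (mexp (t *\<^sub>R W)) \<kappa>) \<bullet> y) has_real_derivative 0) (at t)" for t
  proof -
    have "cj p (mexp (t *\<^sub>R W)) (restrict_su p (lact W \<kappa>)) \<in> im_codiff p"
      by (rule im_codiff_conj[OF mexp_Ptilde[OF W0] lact_ker_in_im[OF \<kappa> W]])
    then have "enc p (cj p (mexp (t *\<^sub>R W)) (restrict_su p (lact W \<kappa>))) \<bullet> y = 0"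
      using y unfolding annihilates_def by blast
    then show ?thesis using cj_has_real_derivative[OF W0, of c y t] unfolding c by simp
  qed
  then have "((\<lambda>t. enc p (cj p (mexp (t *\<^sub>R W)) \<kappa>) \<bullet> y) has_vector_derivative 0) (at t)" for t
    by (simp add: has_real_derivative_iff_has_vector_derivative)
  from constant_of_zero_vector_derivative[OF this, of 1 0]
  have "enc p (cj p (mexp W) \<kappa>) \<bullet> y = enc p (cj p (mat 1) \<kappa>) \<bullet> y" by (simp add: mexp_zero)
  moreover have "cj p (mat 1) \<kappa> = \<kappa>" by (simp add: c cj_one)
  ultimately show ?thesis by simp
qed

text \<open>The closedness condition on two-chains, read off in the entries of degree \<open>-1\<close>, expresses the
  entry of degree \<open>-2\<close> of the form on \<open>\<gg>\<^sub>-\<^sub>1 \<times> \<gg>\<^sub>-\<^sub>1\<close> through the vanishing vector \<open>obstruction c X\<close>.\<close>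

definition obstruction :: "('n::finite bmat \<times> 'n bmat \<times> 'n bmat) list \<Rightarrow> 'n bmat \<Rightarrow> 'n \<Rightarrow> complex" where
  "obstruction c X k = (\<Sum>(Z1, Z2, A)\<leftarrow>c. of_real (Im (A $ BLst $ BFst)) *
    (of_real (killing Z1 X) * Z2 $ BMid k $ BLst - of_real (killing Z2 X) * Z1 $ BMid k $ BLst))"

lemma killing_grad_minus_one:
  fixes Z Y :: "'n::{finite,linorder} bmat"
  assumes Z: "Z \<in> gfilt p 1" and Y: "Y \<in> grad p (-1)"
  shows "killing Z Y = 4 * real CARD('n bidx) * Re (\<Sum>k\<in>UNIV. Z $ BMid k $ BLst * Y $ BLst $ BMid k)"
proof -
  have Z0: "Z $ i $ j = 0" if "blk j - blk i < 1" for i j using Z that by (auto simp: gfilt_iff intro: filtD)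
  have Y0: "Y $ BLst $ BFst = 0" using Y by (force simp: grad_def)
  have "Z \<in> su p" "Y \<in> su p" using Z Y by (auto simp: gfilt_iff grad_def)
  then have ZY: "Z $ BMid k $ BLst * Y $ BLst $ BMid k = cnj (Z $ BFst $ BMid k * Y $ BMid k $ BFst)" for k
    unfolding su_iff_block_form by (simp add: sgn_entry_def)
  have "trace (Z ** Y) = (\<Sum>k\<in>UNIV. Z $ BFst $ BMid k * Y $ BMid k $ BFst) + (\<Sum>k\<in>UNIV. Z $ BMid k $ BLst * Y $ BLst $ BMid k)"
    by (simp add: trace_def matrix_matrix_mult_def sum_bidx Z0 Y0 sum.distrib)
  moreover have "Re (\<Sum>k\<in>UNIV. Z $ BMid k $ BLst * Y $ BLst $ BMid k) = Re (\<Sum>k\<in>UNIV. Z $ BFst $ BMid k * Y $ BMid k $ BFst)"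
    unfolding ZY by (simp flip: cnj_sum del: complex_cnj_mult)
  ultimately show ?thesis by (simp add: killing_def)
qed

lemma mbracket_entry_minus_one:
  assumes "filt 1 Z"
  shows "mbracket Z A $ BMid k $ BFst = Z $ BMid k $ BLst * A $ BLst $ BFst"
proof -
  have Z0: "Z $ i $ j = 0" if "blk j - blk i < 1" for i j using assms that by (rule filtD)
  show ?thesis by (simp add: mbracket_def matrix_matrix_mult_def sum_bidx Z0)
qed

lemma su_entry_minus_two: "A \<in> su p \<Longrightarrow> A $ BLst $ BFst = \<i> * of_real (Im (A $ BLst $ BFst))"
  unfolding su_iff_block_form by (simp add: complex_eq_iff)

lemma val1_bd2_entry:
  assumes "c \<in> chains2 p" and X: "X \<in> gfilt p (-1)"
  shows "val1 (bd2 c) X $ BMid k $ BFst = \<i> * obstruction c X k"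
  using assms(1)
proof (induction c)
  case Nil
  then show ?case by (simp add: obstruction_def)
next
  case (Cons t c)
  obtain Z1 Z2 A where t: "t = (Z1, Z2, A)" by (cases t) auto
  have c: "Z1 \<in> gfilt p 1" "Z2 \<in> gfilt p 1" "A \<in> su p" "c \<in> chains2 p"
    using Cons.prems by (auto simp: t chains2_def)
  have "filt 2 (mbracket Z1 Z2)" using mbracket_gfilt[OF c(1,2)] by (simp add: gfilt_iff)
  then have 0: "killing (mbracket Z1 Z2) X = 0"
    using X by (intro killing_filt[of 2 _ "-1"]) (auto simp: gfilt_iff)
  have f: "filt 1 Z1" "filt 1 Z2" using c by (auto simp: gfilt_iff)
  have "val1 (bd2 (t # c)) X $ BMid k $ BFst
    = - (killing Z2 X *\<^sub>R (Z1 $ BMid k $ BLst * A $ BLst $ BFst)) + killing Z1 X *\<^sub>R (Z2 $ BMid k $ BLst * A $ BLst $ BFst)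
      + val1 (bd2 c) X $ BMid k $ BFst"
    by (simp add: t 0 mbracket_entry_minus_one[OF f(1)] mbracket_entry_minus_one[OF f(2)])
  also have "\<dots> = \<i> * (of_real (Im (A $ BLst $ BFst)) *
    (of_real (killing Z1 X) * Z2 $ BMid k $ BLst - of_real (killing Z2 X) * Z1 $ BMid k $ BLst)) + \<i> * obstruction c X k"
    unfolding Cons.IH[OF c(4)] by (subst (1 2) su_entry_minus_two[OF c(3)]) (simp add: scaleR_conv_of_real algebra_simps)
  finally show ?case by (simp add: t obstruction_def algebra_simps)
qed

lemma val2_entry:
  fixes X Y :: "'n::{finite,linorder} bmat"
  assumes "c \<in> chains2 p" and X: "X \<in> grad p (-1)" and Y: "Y \<in> grad p (-1)"
  shows "val2 c X Y $ BLst $ BFst = \<i> * of_real (4 * real CARD('n bidx) * Re (\<Sum>k\<in>UNIV. obstruction c X k * Y $ BLst $ BMid k))"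
  using assms(1)
proof (induction c)
  case Nil
  then show ?case by (simp add: obstruction_def)
next
  case (Cons t c)
  obtain Z1 Z2 A where t: "t = (Z1, Z2, A)" by (cases t) auto
  have c: "Z1 \<in> gfilt p 1" "Z2 \<in> gfilt p 1" "A \<in> su p" "c \<in> chains2 p"
    using Cons.prems by (auto simp: t chains2_def)
  define a where "a = Im (A $ BLst $ BFst)"
  define N where "N = real CARD('n bidx)"
  define S where "S = (\<lambda>Z :: 'n bmat. \<Sum>k\<in>UNIV. Z $ BMid k $ BLst * Y $ BLst $ BMid k)"
  have k: "killing Z1 Y = 4 * N * Re (S Z1)" "killing Z2 Y = 4 * N * Re (S Z2)"
    unfolding N_def S_def by (rule killing_grad_minus_one[OF _ Y]; rule c)+
  have ob: "obstruction (t # c) X k = of_real a * (of_real (killing Z1 X) * Z2 $ BMid k $ BLst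
      - of_real (killing Z2 X) * Z1 $ BMid k $ BLst) + obstruction c X k" for k
    by (simp add: obstruction_def t a_def)
  have "(\<Sum>k\<in>UNIV. obstruction (t # c) X k * Y $ BLst $ BMid k)
    = of_real (a * killing Z1 X) * S Z2 - of_real (a * killing Z2 X) * S Z1 + (\<Sum>k\<in>UNIV. obstruction c X k * Y $ BLst $ BMid k)"
    unfolding S_def ob by (simp add: sum_distrib_left sum.distrib sum_subtractf algebra_simps)
  then have R: "Re (\<Sum>k\<in>UNIV. obstruction (t # c) X k * Y $ BLst $ BMid k)
    = a * killing Z1 X * Re (S Z2) - a * killing Z2 X * Re (S Z1) + Re (\<Sum>k\<in>UNIV. obstruction c X k * Y $ BLst $ BMid k)"
    by simp
  have A: "A $ BLst $ BFst = \<i> * of_real a" unfolding a_def by (rule su_entry_minus_two[OF c(3)])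
  have "val2 (t # c) X Y $ BLst $ BFst = (killing Z1 X * (4 * N * Re (S Z2)) - 4 * N * Re (S Z1) * killing Z2 X) *\<^sub>R (\<i> * of_real a)
      + \<i> * of_real (4 * N * Re (\<Sum>k\<in>UNIV. obstruction c X k * Y $ BLst $ BMid k))"
    using Cons.IH[OF c(4)] by (simp add: t k A N_def)
  then show ?case unfolding R N_def[symmetric]
    by (simp add: scaleR_conv_of_real algebra_simps)
qed

lemma ker_codiff_degree_zero:
  assumes c: "c \<in> chains2 p" "\<And>X. X \<in> su p \<Longrightarrow> val1 (bd2 c) X = 0"
    and X: "X \<in> grad p (-1)" and Y: "Y \<in> grad p (-1)"
  shows "val2 c X Y $ BLst $ BFst = 0"
proof -
  have "X \<in> su p" using X by (simp add: grad_def)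
  then have "obstruction c X k = 0" for k
    using val1_bd2_entry[OF c(1) grad_gfilt[OF X], of k] c(2) by simp
  then show ?thesis using val2_entry[OF c(1) X Y] by simp
qed

lemma val2_horizontal:
  assumes "c \<in> chains2 p" and D: "filt 0 D"
  shows "val2 c (X + D) Y = val2 c X Y" "val2 c X (Y + D) = val2 c X Y"
proof -
  have "val2 c (X + D) Y = val2 c X Y \<and> val2 c X (Y + D) = val2 c X Y"
    using assms(1)
  proof (induction c)
    case (Cons t c)
    obtain Z1 Z2 A where t: "t = (Z1, Z2, A)" by (cases t) auto
    have c: "filt 1 Z1" "filt 1 Z2" "c \<in> chains2 p"
      using Cons.prems by (auto simp: t chains2_def gfilt_iff)
    have "killing Z1 D = 0" "killing Z2 D = 0" using c D by (auto intro: killing_filt)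
    then show ?case using Cons.IH[OF c(3)] by (simp add: t killing_linear)
  qed simp
  then show "val2 c (X + D) Y = val2 c X Y" "val2 c X (Y + D) = val2 c X Y" by auto
qed

definition grading :: "'n::finite bmat" where
  "grading = (\<chi> i j. if i = j then of_int (1 - blk i) else 0)"

lemma grading_gfilt: "grading \<in> gfilt p 0"
proof -
  have "grading \<in> su p" unfolding su_iff_block_form by (simp add: grading_def)
  moreover have "filt 0 grading" by (auto simp: filt_def grading_def split: if_splits)
  ultimately show ?thesis by (simp add: gfilt_iff)
qed

lemma mexp_grading:
  "mexp (t *\<^sub>R grading) $ i $ j = (if i = j then of_real (exp (t * real_of_int (1 - blk i))) else 0)"
proof -
  let ?x = "t * real_of_int (1 - blk i)"
  have mp: "mpow (t *\<^sub>R grading) k $ i $ j = (if i = j then of_real ((t * real_of_int (1 - blk i)) ^ k) else 0)" for k i j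
  proof (induction k arbitrary: i)
    case (Suc k)
    have "mpow (t *\<^sub>R grading) (Suc k) $ i $ j
      = (\<Sum>l\<in>UNIV. if l = i then of_real (t * real_of_int (1 - blk i)) * mpow (t *\<^sub>R grading) k $ i $ j else 0)"
      unfolding mpow_simps matrix_matrix_mult_def vec_lambda_beta
      by (rule sum.cong) (auto simp: grading_def scaleR_conv_of_real[where 'a = complex])
    then show ?case by (simp add: Suc.IH)
  qed (simp add: mat_def)
  have "(\<lambda>k. (1 / fact k) *\<^sub>R (mpow (t *\<^sub>R grading) k $ i $ j)) sums (if i = j then of_real (exp ?x) else 0)"
  proof (cases "i = j")
    case True
    have "(\<lambda>k. of_real (?x ^ k /\<^sub>R fact k)) sums (of_real (exp ?x) :: complex)"
      by (intro sums_of_real exp_converges)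
    then show ?thesis using True by (simp add: mp scaleR_conv_of_real[where 'a = complex] divide_inverse)
  qed (simp add: mp)
  from sums_unique2[OF mexp_entry_sums this] show ?thesis .
qed

lemma grading_conjugate_entry:
  "(mexp (- t *\<^sub>R grading) ** X ** mexp (t *\<^sub>R grading)) $ i $ j
    = of_real (exp (- t * real_of_int (blk j - blk i))) * X $ i $ j"
proof -
  have l: "(mexp (t *\<^sub>R grading) ** M) $ i $ j = of_real (exp (t * real_of_int (1 - blk i))) * M $ i $ j" for t M i j
  proof -
    have "(mexp (t *\<^sub>R grading) ** M) $ i $ j
      = (\<Sum>l\<in>UNIV. if l = i then of_real (exp (t * real_of_int (1 - blk i))) * M $ i $ j else 0)"
      unfolding matrix_matrix_mult_def vec_lambda_beta mexp_grading by (rule sum.cong) auto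
    then show ?thesis by simp
  qed
  have r: "(M ** mexp (t *\<^sub>R grading)) $ i $ j = of_real (exp (t * real_of_int (1 - blk j))) * M $ i $ j" for t M i j
  proof -
    have "(M ** mexp (t *\<^sub>R grading)) $ i $ j
      = (\<Sum>l\<in>UNIV. if l = j then of_real (exp (t * real_of_int (1 - blk j))) * M $ i $ j else 0)"
      unfolding matrix_matrix_mult_def vec_lambda_beta mexp_grading by (rule sum.cong) auto
    then show ?thesis by simp
  qed
  have "exp (t * real_of_int (1 - blk j)) * exp (- t * real_of_int (1 - blk i)) = exp (- t * real_of_int (blk j - blk i))"
    by (simp add: algebra_simps flip: exp_add)
  then show ?thesis unfolding r l
    by (simp only: mult.assoc[symmetric] of_real_mult[symmetric])
qed

definition gproj :: "int \<Rightarrow> 'n::finite bmat \<Rightarrow> 'n bmat" where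
  "gproj k X = (\<chi> i j. if blk j - blk i = k then X $ i $ j else 0)"

lemma gproj_grad:
  assumes "X \<in> su p" "k \<noteq> 0"
  shows "gproj k X \<in> grad p k"
proof -
  have "gproj k X \<in> su p"
    using assms unfolding su_iff_block_form by (auto simp: gproj_def)
  then show ?thesis by (auto simp: grad_def gproj_def split: if_splits)
qed

text \<open>Conjugation by \<open>exp (t E)\<close>, with \<open>E\<close> the grading element, multiplies the component of
  homogeneity \<open>k\<close> of a form by \<open>exp (k t)\<close>. All homogeneities of a closed form are positive, so
  it contracts closed forms to zero as \<open>t \<rightarrow> -\<infinity>\<close>.\<close>

lemma cj_grading_tendsto_zero:
  fixes \<kappa> :: "'n::{finite,linorder} bmat \<Rightarrow> 'n bmat \<Rightarrow> 'n bmat"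
  assumes \<kappa>: "\<kappa> \<in> ker_codiff p"
  shows "((\<lambda>t. enc p (cj p (mexp (t *\<^sub>R grading)) \<kappa>)) \<longlongrightarrow> 0) at_bot"
proof (intro vec_tendstoI)
  fix jk :: "('n bidx \<times> 'n bidx \<times> bool) \<times> ('n bidx \<times> 'n bidx \<times> bool)" and i j :: "'n bidx"
  obtain c where c: "c \<in> chains2 p" "\<kappa> = form2 p c" "\<And>X. X \<in> su p \<Longrightarrow> val1 (bd2 c) X = 0"
    by (rule ker_codiffE[OF \<kappa>], rule that)
  let ?X = "suproj p (mbasis (fst jk))" and ?Y = "suproj p (mbasis (snd jk))"
  have XY: "?X \<in> su p" "?Y \<in> su p" by (rule suproj(1))+
  \<comment> \<open>modulo \<open>\<pp>\<close>, conjugation by \<open>exp (-t E)\<close> maps \<open>X\<close> to \<open>e\<^sup>t (X\<^sub>-\<^sub>1 + e\<^sup>t X\<^sub>-\<^sub>2)\<close>\<close>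
  define L where "L = (\<lambda>(X :: 'n bmat) s. gproj (-1) X + s *\<^sub>R gproj (-2) X)"
  have dec: "filt 0 (mexp (- t *\<^sub>R grading) ** X ** mexp (t *\<^sub>R grading) - exp t *\<^sub>R L X (exp t))" (is "filt 0 (?C - _)") for t X
    unfolding filt_def
  proof (intro allI impI)
    fix i j assume ne: "(?C - exp t *\<^sub>R L X (exp t)) $ i $ j \<noteq> 0"
    show "0 \<le> blk j - blk i"
    proof (rule ccontr)
      assume "\<not> 0 \<le> blk j - blk i"
      then consider "blk j - blk i = -1" | "blk j - blk i = -2" using blk_bounds[of i] blk_bounds[of j] by linarith
      then have "(?C - exp t *\<^sub>R L X (exp t)) $ i $ j = 0"
      proof cases
        case 1
        then show ?thesis
          unfolding vector_minus_component grading_conjugate_entry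
          by (simp add: L_def gproj_def scaleR_conv_of_real[where 'a = complex])
      next
        case 2
        have "exp (t * 2) = exp t * exp t" by (simp flip: exp_add)
        then show ?thesis using 2
          unfolding vector_minus_component grading_conjugate_entry
          by (simp add: L_def gproj_def scaleR_conv_of_real[where 'a = complex] mult.assoc)
      qed
      with ne show False by simp
    qed
  qed
  have val: "val2 c (mexp (- t *\<^sub>R grading) ** X ** mexp (t *\<^sub>R grading)) (mexp (- t *\<^sub>R grading) ** Y ** mexp (t *\<^sub>R grading))
      = (exp t * exp t) *\<^sub>R val2 c (L X (exp t)) (L Y (exp t))" for X Y t
  proof -
    have "val2 c (mexp (- t *\<^sub>R grading) ** X ** mexp (t *\<^sub>R grading)) (mexp (- t *\<^sub>R grading) ** Y ** mexp (t *\<^sub>R grading))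
      = val2 c (exp t *\<^sub>R L X (exp t)) (exp t *\<^sub>R L Y (exp t))"
      using val2_horizontal(1)[OF c(1) dec[of t X], of "exp t *\<^sub>R L X (exp t)"]
        val2_horizontal(2)[OF c(1) dec[of t Y], of _ "exp t *\<^sub>R L Y (exp t)"] by simp
    then show ?thesis
      using bilinear_val2[of c] by (simp add: bilinear_lmul bilinear_rmul)
  qed
  define N where "N = (\<lambda>s. val2 c (L ?X s) (L ?Y s) $ i $ j)"
  have entry: "enc p (cj p (mexp (t *\<^sub>R grading)) \<kappa>) $ jk $ i $ j
      = of_real (exp (t * real_of_int (2 + (blk j - blk i)))) * N (exp t)" for t
  proof -
    have P: "mexp (t *\<^sub>R grading) \<in> Ptilde p" by (rule mexp_Ptilde[OF grading_gfilt])
    have e: "enc p (cj p (mexp (t *\<^sub>R grading)) \<kappa>) $ jk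
      = mexp (- (- t) *\<^sub>R grading) ** ((exp t * exp t) *\<^sub>R val2 c (L ?X (exp t)) (L ?Y (exp t))) ** mexp (- t *\<^sub>R grading)"
      using adjoint_su_Ptilde(2)[OF P XY(1)] adjoint_su_Ptilde(2)[OF P XY(2)]
      by (simp add: enc_def cj_def restrict_su_def XY form_val c(2) matrix_inv_mexp flip: val)
    have "exp (- (- t) * real_of_int (blk j - blk i)) * (exp t * exp t) = exp (t * real_of_int (2 + (blk j - blk i)))"
      by (simp add: algebra_simps flip: exp_add)
    then show ?thesis
      unfolding e grading_conjugate_entry N_def vector_scaleR_component scaleR_conv_of_real[where 'a = complex]
      by (simp only: mult.assoc[symmetric] of_real_mult[symmetric])
  qed
  have "N s = val2 c (gproj (-1) ?X) (gproj (-1) ?Y) $ i $ j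
      + s *\<^sub>R ((val2 c (gproj (-1) ?X) (gproj (-2) ?Y) + val2 c (gproj (-2) ?X) (gproj (-1) ?Y)) $ i $ j)
      + (s * s) *\<^sub>R (val2 c (gproj (-2) ?X) (gproj (-2) ?Y) $ i $ j)" for s
    using bilinear_val2[of c]
    by (simp add: N_def L_def bilinear_ladd bilinear_radd bilinear_lmul bilinear_rmul algebra_simps)
  moreover have "((\<lambda>t. val2 c (gproj (-1) ?X) (gproj (-1) ?Y) $ i $ j
      + exp t *\<^sub>R ((val2 c (gproj (-1) ?X) (gproj (-2) ?Y) + val2 c (gproj (-2) ?X) (gproj (-1) ?Y)) $ i $ j)
      + (exp t * exp t) *\<^sub>R (val2 c (gproj (-2) ?X) (gproj (-2) ?Y) $ i $ j)) \<longlongrightarrow>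
      val2 c (gproj (-1) ?X) (gproj (-1) ?Y) $ i $ j
      + 0 *\<^sub>R ((val2 c (gproj (-1) ?X) (gproj (-2) ?Y) + val2 c (gproj (-2) ?X) (gproj (-1) ?Y)) $ i $ j)
      + (0 * 0) *\<^sub>R (val2 c (gproj (-2) ?X) (gproj (-2) ?Y) $ i $ j)) at_bot"
    by (intro tendsto_intros exp_at_bot)
  ultimately have Nlim: "((\<lambda>t. N (exp t)) \<longlongrightarrow> val2 c (gproj (-1) ?X) (gproj (-1) ?Y) $ i $ j) at_bot" by simp
  have "((\<lambda>t. of_real (exp (t * real_of_int (2 + (blk j - blk i)))) * N (exp t)) \<longlongrightarrow> 0) at_bot"
  \<comment> \<open>the only entry without a decaying factor is the one in degree \<open>-2\<close>, where the closedness condition enters\<close>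
  proof (cases "2 + (blk j - blk i) = 0")
    case True
    then have ij: "i = BLst" "j = BFst" by (cases i; cases j; simp)+
    have "val2 c (gproj (-1) ?X) (gproj (-1) ?Y) $ i $ j = 0"
      unfolding ij by (intro ker_codiff_degree_zero[OF c(1,3)] gproj_grad XY) auto
    with Nlim True show ?thesis by simp
  next
    case False
    then have pos: "real_of_int (2 + (blk j - blk i)) > 0" using blk_bounds[of i] blk_bounds[of j] by linarith
    have "filterlim (\<lambda>t. t * real_of_int (2 + (blk j - blk i))) at_bot at_bot"
      unfolding filterlim_at_bot
    proof
      fix Z :: real
      show "eventually (\<lambda>t. t * real_of_int (2 + (blk j - blk i)) \<le> Z) at_bot"
        using eventually_le_at_bot[of "Z / real_of_int (2 + (blk j - blk i))"]
        by eventually_elim (simp only: pos_le_divide_eq[OF pos])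
    qed
    then have "((\<lambda>t. exp (t * real_of_int (2 + (blk j - blk i)))) \<longlongrightarrow> 0) at_bot"
      by (rule filterlim_compose[OF exp_at_bot])
    then have "((\<lambda>t. of_real (exp (t * real_of_int (2 + (blk j - blk i)))) :: complex) \<longlongrightarrow> of_real 0) at_bot"
      by (rule tendsto_of_real)
    from tendsto_mult[OF this Nlim] show ?thesis by simp
  qed
  then show "((\<lambda>t. enc p (cj p (mexp (t *\<^sub>R grading)) \<kappa>) $ jk $ i $ j) \<longlongrightarrow> 0 $ jk $ i $ j) at_bot"
    unfolding entry by simp
qed

text \<open>Representing the action on chains keeps \<open>lact W \<kappa>\<close> within the forms to which the separation
  lemma applies.\<close>

definition lact_chain where
  "lact_chain W c = concat (map (\<lambda>(Z1, Z2, A). [(mbracket W Z1, Z2, A), (Z1, mbracket W Z2, A), (Z1, Z2, mbracket W A)]) c)"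

lemma lact_val2: "lact W (val2 c) = val2 (lact_chain W c)"
proof (intro ext)
  fix X Y
  show "lact W (val2 c) X Y = val2 (lact_chain W c) X Y"
  proof (induction c)
    case Nil
    then show ?case by (simp add: lact_def lact_chain_def mbracket_linear)
  next
    case (Cons t c)
    obtain Z1 Z2 A where t: "t = (Z1, Z2, A)" by (cases t) auto
    have "lact W (val2 (t # c)) X Y = lact W (val2 [t]) X Y + lact W (val2 c) X Y"
      by (simp add: lact_def t mbracket_linear)
    also have "lact W (val2 [t]) X Y = val2 (lact_chain W [t]) X Y"
      by (simp add: lact_def t lact_chain_def killing_invariant[of W] mbracket_linear algebra_simps)
    finally show ?case unfolding Cons.IH by (simp add: lact_chain_def t)
  qed
qed

text \<open>Modulo boundaries \<open>\<pp>\<^sub>+\<close> does not act, so the hypothesis says that the grading element annihilates the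
  homology class of \<open>\<kappa>\<close>. The class is then invariant under the flow \<open>exp (t E)\<close>, which contracts \<open>\<kappa>\<close> to
  zero.\<close>

lemma vanishing_criterion:
  fixes \<kappa> :: "'n::{finite,linorder} bmat \<Rightarrow> 'n bmat \<Rightarrow> 'n bmat"
  assumes \<kappa>: "\<kappa> \<in> ker_codiff p" and M: "M \<in> su p" "r \<noteq> 0" "M - r *\<^sub>R grading \<in> gfilt p 1"
    and ann: "\<And>y. annihilates p y \<Longrightarrow> enc p (restrict_su p (lact M \<kappa>)) \<bullet> y = 0"
  shows "\<kappa> \<in> im_codiff p"
proof -
  obtain c where c: "\<kappa> = form2 p c" by (rule ker_codiffE[OF \<kappa>])
  have gs: "grading \<in> su p" by (rule gfilt_su[OF grading_gfilt])
  have e: "restrict_su p (lact grading \<kappa>) = form2 p (lact_chain grading c)"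
    unfolding c form2_restrict lact_restrict[OF gs] lact_val2 ..
  have "lact M (val2 c) X Y = r *\<^sub>R lact grading (val2 c) X Y + lact (M - r *\<^sub>R grading) (val2 c) X Y" for X Y
    using bilinear_val2[of c]
    by (simp add: lact_def mbracket_linear bilinear_lsub bilinear_rsub bilinear_lmul bilinear_rmul algebra_simps)
  then have dec: "restrict_su p (lact M \<kappa>) = (\<lambda>X Y. r *\<^sub>R restrict_su p (lact grading \<kappa>) X Y
      + restrict_su p (lact (M - r *\<^sub>R grading) \<kappa>) X Y)"
    unfolding c form2_restrict lact_restrict[OF gs] lact_restrict[OF M(1)] lact_restrict[OF gfilt_su[OF M(3)]]
    by (simp add: fun_eq_iff restrict_su_def)
  have "form2 p (lact_chain grading c) \<in> im_codiff p"
  proof (rule im_codiff_separation)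
    fix y :: "'n fvec" assume y: "annihilates p y"
    then have "enc p (restrict_su p (lact (M - r *\<^sub>R grading) \<kappa>)) \<bullet> y = 0"
      using lact_ker_in_im[OF \<kappa> M(3)] by (simp add: annihilates_def)
    with ann[OF y] have "r * (enc p (restrict_su p (lact grading \<kappa>)) \<bullet> y) = 0"
      unfolding dec enc_linear by (simp add: inner_add_left)
    then show "enc p (form2 p (lact_chain grading c)) \<bullet> y = 0" using M(2) by (simp add: e)
  qed
  then have im: "restrict_su p (lact grading \<kappa>) \<in> im_codiff p" by (simp add: e)
  show ?thesis
    unfolding c
  proof (rule im_codiff_separation)
    fix y :: "'n fvec" assume y: "annihilates p y"
    define f where "f = (\<lambda>t. enc p (cj p (mexp (t *\<^sub>R grading)) \<kappa>) \<bullet> y)"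
    have "(f has_vector_derivative 0) (at t)" for t
    proof -
      have "cj p (mexp (t *\<^sub>R grading)) (restrict_su p (lact grading \<kappa>)) \<in> im_codiff p"
        by (rule im_codiff_conj[OF mexp_Ptilde[OF grading_gfilt] im])
      then have "enc p (cj p (mexp (t *\<^sub>R grading)) (restrict_su p (lact grading \<kappa>))) \<bullet> y = 0"
        using y by (simp add: annihilates_def)
      then show ?thesis
        using cj_has_real_derivative[OF grading_gfilt, of p c y t]
        by (simp add: f_def c has_real_derivative_iff_has_vector_derivative)
    qed
    then have f0: "f t = f 0" for t by (rule constant_of_zero_vector_derivative)
    have "(f \<longlongrightarrow> 0 \<bullet> y) at_bot"
      unfolding f_def by (intro tendsto_inner cj_grading_tendsto_zero[OF \<kappa>] tendsto_const)
    then have "((\<lambda>t :: real. f 0) \<longlongrightarrow> 0 \<bullet> y) at_bot"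
      by (rule Lim_transform_eventually[OF _ always_eventually[OF allI[OF f0]]])
    then have "f 0 = 0" by (simp add: tendsto_const_iff)
    moreover have "cj p (mat 1) \<kappa> = \<kappa>" by (simp add: c cj_one)
    ultimately show "enc p (form2 p c) \<bullet> y = 0" by (simp add: f_def mexp_zero flip: c)
  qed
qed

lemma coset_of_member:
  fixes \<kappa> :: "'n::{finite,linorder} bmat \<Rightarrow> 'n bmat \<Rightarrow> 'n bmat"
  assumes "\<kappa> \<in> im_codiff p"
  shows "{(\<lambda>X Y. \<kappa> X Y + \<psi> X Y) | \<psi>. \<psi> \<in> im_codiff p} = im_codiff p"
proof
  show "{(\<lambda>X Y. \<kappa> X Y + \<psi> X Y) | \<psi>. \<psi> \<in> im_codiff p} \<subseteq> im_codiff p"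
    using im_codiff_add[OF assms] by blast
  show "im_codiff p \<subseteq> {(\<lambda>X Y. \<kappa> X Y + \<psi> X Y) | \<psi>. \<psi> \<in> im_codiff p}"
  proof
    fix \<psi> :: "'n bmat \<Rightarrow> 'n bmat \<Rightarrow> 'n bmat" assume "\<psi> \<in> im_codiff p"
    from im_codiff_add[OF im_codiff_scale[OF assms, of "-1"] this]
    have "(\<lambda>X Y. (-1) *\<^sub>R \<kappa> X Y + \<psi> X Y) \<in> im_codiff p" .
    then show "\<psi> \<in> {(\<lambda>X Y. \<kappa> X Y + \<psi> X Y) | \<psi>. \<psi> \<in> im_codiff p}"
      by (intro CollectI exI[of _ "\<lambda>X Y. (-1) *\<^sub>R \<kappa> X Y + \<psi> X Y"] conjI) (simp_all add: fun_eq_iff)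
  qed
qed

section \<open>Choosing the test direction\<close>

text \<open>If the degree of \<open>W\<close> is at least \<open>k\<close> and that of \<open>X\<close> at least \<open>-k\<close>, only the first-order term of
  \<open>exp (ad W) X - X\<close> reaches degrees below \<open>k\<close>.\<close>

lemma bracket_degree_zero:
  fixes W X :: "'n::{finite,linorder} bmat"
  assumes W: "filt k W" and X: "filt (- k) X" and k: "k \<ge> 1"
  shows "filt k (mexp W ** X ** mexp (- W) - X - mbracket W X)"
proof -
  have W1: "filt 1 W" and W1': "filt 1 (- W)" using filt_mono[OF W k] by (auto intro: filt_simps)
  let ?N = "- W + (1/2) *\<^sub>R (W ** W)"
  have WW: "filt k (W ** W)" using filt_mono[OF filt_mult[OF W W], of k] k by simp
  have N: "filt k ?N" by (intro filt_simps W WW)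
  have h': "mexp (- W) = mat 1 + ?N"
    using mexp_nilpotent[OF W1'] by (simp add: matrix_mult_algebra)
  have id: "mexp W ** X ** mexp (- W) - X - mbracket W X
    = W ** X ** ?N + (1/2) *\<^sub>R (W ** W ** X + W ** W ** X ** ?N) + (1/2) *\<^sub>R (X ** W ** W)"
    unfolding h' mexp_nilpotent[OF W1] mbracket_def
    by (simp add: matrix_mult_algebra scaleR_add_right) (simp add: algebra_simps)
  have "filt k (W ** X ** ?N)" using filt_mult[OF filt_mult[OF W X] N] by simp
  moreover have WWX: "filt k (W ** W ** X)" using filt_mult[OF filt_mult[OF W W] X] by simp
  moreover have "filt k (W ** W ** X ** ?N)" using filt_mono[OF filt_mult[OF WWX N], of k] k by simp
  moreover have "filt k (X ** W ** W)" using filt_mult[OF filt_mult[OF X W] W] by simp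
  ultimately show ?thesis unfolding id by (intro filt_simps)
qed

text \<open>For a definite Hermitian form the bracket of \<open>Z \<in> \<gg>\<^sub>1\<close> with the dual vector \<open>Z\<^sup>* \<in> \<gg>\<^sub>-\<^sub>1\<close> is \<open>|Z|\<^sup>2\<close> times
  the grading element. If the component in \<open>\<gg>\<^sub>1\<close> is zero, a vector in \<open>\<gg>\<^sub>-\<^sub>2\<close> serves the same purpose.\<close>

lemma test_direction:
  fixes W :: "'n::{finite,linorder} bmat"
  assumes W: "W \<in> gfilt p 1" "W \<noteq> 0" and def: "\<And>(k :: 'n) (l :: 'n). sgn_entry p k = sgn_entry p l"
  obtains X r where "X \<in> su p" "r \<noteq> 0" "mexp W ** X ** mexp (- W) - X - r *\<^sub>R grading \<in> gfilt p 1"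
proof -
  have Wsu: "W \<in> su p" by (rule gfilt_su[OF W(1)])
  have W0: "W $ i $ j = 0" if "blk j - blk i < 1" for i j using W(1) that by (auto simp: gfilt_iff intro: filtD)
  have Wbf: "W $ BMid k $ BLst = - sgn_entry p k * cnj (W $ BFst $ BMid k)" "Re (W $ BFst $ BLst) = 0" for k
    using Wsu unfolding su_iff_block_form by auto
  have ss: "sgn_entry p k * sgn_entry p l = 1" for k l :: 'n
    using def[of k l] by (simp add: sgn_entry_def split: if_splits)
  have P: "mexp W \<in> Ptilde p" using mexp_Ptilde[OF gfilt_mono[OF W(1), of 0], of 1] by simp
  have mi: "matrix_inv (mexp W) = mexp (- W)" using matrix_inv_mexp[of 1 W] by simp
  have "\<exists>k X r. X \<in> su p \<and> r \<noteq> 0 \<and> filt k W \<and> filt (- k) X \<and> k \<ge> 1 \<and> filt 1 (mbracket W X - r *\<^sub>R grading)"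
  proof (cases "\<exists>k. W $ BFst $ BMid k \<noteq> 0")
    case True
    then obtain k where k: "W $ BFst $ BMid k \<noteq> 0" by blast
    define z where "z = (\<lambda>k. W $ BFst $ BMid k)"
    define X where "X = gminus p (\<lambda>k. cnj (z k))"
    define r where "r = (\<Sum>k\<in>UNIV. (cmod (z k))\<^sup>2)"
    have X: "X \<in> grad p (-1)" unfolding X_def by (rule gminus_grad)
    have r: "(\<Sum>k\<in>UNIV. z k * cnj (z k)) = of_real r"
      unfolding r_def of_real_sum complex_norm_square ..
    have "r > 0" unfolding r_def using k by (intro sum_pos2[of _ k]) (auto simp: z_def)
    have Xe: "X $ BMid k $ BFst = cnj (z k)" "X $ BLst $ BMid k = - z k * sgn_entry p k"
      "X $ BMid k $ BMid l = 0" "X $ BLst $ BFst = 0" for k l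
      by (simp_all add: X_def gminus_def)
    have Xe': "X $ BFst $ j = 0" "X $ i $ BLst = 0" for i j
      by (cases j; simp add: X_def gminus_def) (cases i; simp add: X_def gminus_def)
    have We: "W $ BFst $ BMid k = z k" "W $ BMid k $ BLst = - sgn_entry p k * cnj (z k)" for k
      using Wbf by (auto simp: z_def)
    have e: "mbracket W X $ i $ j = (\<Sum>l\<in>UNIV. W $ i $ l * X $ l $ j) - (\<Sum>l\<in>UNIV. X $ i $ l * W $ l $ j)" for i j
      by (simp add: mbracket_def matrix_matrix_mult_def)
    have g: "(r *\<^sub>R grading :: 'n bmat) $ i $ j = (if i = j then of_real (r * real_of_int (1 - blk i)) else 0)" for i j
      by (simp add: grading_def scaleR_conv_of_real[where 'a = complex])
    have s: "sgn_entry p k * a * (b * sgn_entry p l) = a * b" "sgn_entry p k * (sgn_entry p l * a) = a" for k l :: 'n and a b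
      using ss[of k l] by (simp_all add: mult_ac)
    have "filt 1 (mbracket W X - r *\<^sub>R grading)"
      unfolding filt_def
    proof (intro allI impI, rule ccontr)
      fix i j assume ne: "(mbracket W X - r *\<^sub>R grading) $ i $ j \<noteq> 0" and "\<not> 1 \<le> blk j - blk i"
      then have "blk j \<le> blk i" by simp
      then have "(mbracket W X - r *\<^sub>R grading) $ i $ j = 0"
        unfolding vector_minus_component e g
        by (cases i; cases j)
          (auto simp: sum_bidx W0 Xe Xe' We r s ss mult_ac sum_negf simp flip: r)
      with ne show False by simp
    qed
    then show ?thesis
      using X grad_gfilt[OF X] W(1) \<open>r > 0\<close>
      by (intro exI[of _ 1] exI[of _ X] exI[of _ r]) (auto simp: gfilt_iff grad_def)
  next
    case False
    then have z: "W $ BFst $ BMid k = 0" "W $ BMid k $ BLst = 0" for k using Wbf by auto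
    define X :: "'n bmat" where "X = (\<chi> i j. if i = BLst \<and> j = BFst then \<i> else 0)"
    define r where "r = - Im (W $ BFst $ BLst)"
    have only: "W $ i $ j = (if i = BFst \<and> j = BLst then - \<i> * of_real r else 0)" for i j
      using Wbf(2) by (cases i; cases j) (auto simp: z W0 r_def complex_eq_iff)
    have "r \<noteq> 0"
    proof
      assume "r = 0"
      then have "W $ i $ j = 0" for i j using only[of i j] by simp
      with W(2) show False by (simp add: vec_eq_iff)
    qed
    have X: "X \<in> su p" unfolding su_iff_block_form by (simp add: X_def)
    have f: "filt 2 W" "filt (-2) X" by (auto simp: filt_def only X_def split: if_splits)
    have "(mbracket W X - r *\<^sub>R grading) $ i $ j = 0" for i j
      by (cases i; cases j)
        (simp_all add: mbracket_def matrix_matrix_mult_def sum_bidx only X_def grading_def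
          scaleR_conv_of_real[where 'a = complex] complex_eq_iff)
    then have "filt 1 (mbracket W X - r *\<^sub>R grading)" by (simp add: filt_def)
    then show ?thesis
      using X f \<open>r \<noteq> 0\<close> by (intro exI[of _ 2] exI[of _ X] exI[of _ r]) auto
  qed
  then obtain k X r where X: "X \<in> su p" "r \<noteq> 0" "filt k W" "filt (- k) X" "k \<ge> 1" "filt 1 (mbracket W X - r *\<^sub>R grading)"
    by blast
  let ?D = "mexp W ** X ** mexp (- W) - X - r *\<^sub>R grading"
  have D: "?D = (mexp W ** X ** mexp (- W) - X - mbracket W X) + (mbracket W X - r *\<^sub>R grading)" by simp
  have "filt 1 ?D"
    unfolding D by (rule filt_simps(1)[OF filt_mono[OF bracket_degree_zero[OF X(3-5)] X(5)] X(6)])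
  moreover have "?D \<in> su p"
    using adjoint_su_Ptilde(1)[OF P X(1)] X(1) gfilt_su[OF grading_gfilt]
    by (intro subspace_diff[OF subspace_su] subspace_scale[OF subspace_su]) (simp_all add: mi)
  ultimately show ?thesis using that X by (simp add: gfilt_iff)
qed

lemma Jmodel_gminus: "Jmodel (gminus p x) = gminus p (\<lambda>k. \<i> * x k)"
  by (simp add: vec_eq_iff Jmodel_def gminus_def all_bidx)

definition unit_minus_two :: "'n::finite bmat" where
  "unit_minus_two = (\<chi> i j. if i = BLst \<and> j = BFst then - 2 * \<i> else 0)"

lemma unit_minus_two_su: "unit_minus_two \<in> su p"
  unfolding su_iff_block_form by (simp add: unit_minus_two_def)

text \<open>The value of the Levi form on a basis vector of \<open>\<gg>\<^sub>-\<^sub>1\<close>: its sign is the corresponding entry of \<open>\<I>\<close>.\<close>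

lemma bracket_Jmodel:
  fixes k :: "'n::{finite,linorder}"
  shows "mbracket (gminus p (\<lambda>m. if m = k then 1 else 0)) (Jmodel (gminus p (\<lambda>m. if m = k then 1 else 0)))
    = Re (sgn_entry p k) *\<^sub>R unit_minus_two"
proof -
  have r: "complex_of_real (Re (sgn_entry p k)) = sgn_entry p k" by (simp add: sgn_entry_def)
  show ?thesis
    unfolding Jmodel_gminus
    by (simp add: vec_eq_iff all_bidx mbracket_def matrix_matrix_mult_def sum_bidx gminus_def unit_minus_two_def
        scaleR_conv_of_real[where 'a = complex] r if_distrib if_distribR sgn_entry_def cong: if_cong)
qed

section \<open>Tangent vectors of the group, and two estimates\<close>

text \<open>The conditions that define the group are equations; their linearizations at the identity define \<open>\<pp>\<close>.\<close>

lemma Ptilde_tangent: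
  fixes M :: "real \<Rightarrow> 'n::{finite,linorder} bmat"
  assumes M: "(M has_vector_derivative B) (at 0)" and M0: "M 0 = mat 1"
    and ev: "eventually (\<lambda>t. M t \<in> Ptilde p) (nhds 0)"
  shows "B \<in> gfilt p 0"
proof -
  have "((\<lambda>t. hadj (M t) ** hform p) has_vector_derivative hadj B ** hform p) (at 0)"
    by (rule bounded_linear.has_vector_derivative[OF bounded_linear_compose[OF
          bounded_bilinear.bounded_linear_left[OF bounded_bilinear_matrix_mult] bounded_linear_hadj] M])
  from matrix_mult_has_vector_derivative[OF this M]
  have "((\<lambda>t. hadj (M t) ** hform p ** M t) has_vector_derivative hform p ** B + hadj B ** hform p) (at 0)"
    by (simp add: M0 hadj_simps)
  moreover have "((\<lambda>t. hadj (M t) ** hform p ** M t) has_vector_derivative 0) (at 0)"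
    by (rule has_vector_derivative_transform_nhds[OF has_vector_derivative_const[of "hform p"]])
      (use ev in \<open>auto simp: Ptilde_iff preserves_hform_def elim: eventually_mono\<close>)
  ultimately have 1: "hform p ** B + hadj B ** hform p = 0" by (rule vector_derivative_unique_at)
  have "((\<lambda>t. det (M t)) has_vector_derivative trace B) (at 0)"
    by (rule det_has_vector_derivative_at_one[OF M0 M])
  moreover have "((\<lambda>t. det (M t)) has_vector_derivative 0) (at 0)"
    by (rule has_vector_derivative_transform_nhds[OF has_vector_derivative_const[of 1]])
      (use ev in \<open>auto simp: Ptilde_iff elim: eventually_mono\<close>)
  ultimately have 2: "trace B = 0" by (rule vector_derivative_unique_at)
  have 3: "B $ i $ j = 0" if "blk j - blk i < 0" for i j
  proof -
    have "((\<lambda>t. M t $ i $ j) has_vector_derivative B $ i $ j) (at 0)"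
      using bounded_linear.has_vector_derivative[OF bounded_linear_compose[OF bounded_linear_vec_nth bounded_linear_vec_nth] M, of j i]
        bounded_linear.has_vector_derivative[OF bounded_linear_compose[OF bounded_linear_vec_nth bounded_linear_vec_nth] M, of i j]
      by simp
    moreover have "((\<lambda>t. M t $ i $ j) has_vector_derivative 0) (at 0)"
      by (rule has_vector_derivative_transform_nhds[OF has_vector_derivative_const[of 0]])
        (use ev that in \<open>auto simp: Ptilde_iff filtD elim!: eventually_mono\<close>)
    ultimately show ?thesis by (rule vector_derivative_unique_at)
  qed
  have "filt 0 B" unfolding filt_def using 3 by (meson not_le)
  then show ?thesis using 1 2 by (simp add: gfilt_iff su_def add.commute)
qed

text \<open>The function \<open>exp (-2 C t) * |g t|\<^sup>2\<close> is nonincreasing.\<close>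

lemma Gronwall_zero:
  fixes g :: "real \<Rightarrow> 'a::euclidean_space"
  assumes d: "\<And>t. 0 \<le> t \<Longrightarrow> t \<le> 1 \<Longrightarrow> (g has_vector_derivative g' t) (at t)"
    and b: "\<And>t. 0 \<le> t \<Longrightarrow> t \<le> 1 \<Longrightarrow> norm (g' t) \<le> C * norm (g t)" and g0: "g 0 = 0"
  shows "g 1 = 0"
proof -
  define h where "h = (\<lambda>t. exp (- (2 * C) * t) * (g t \<bullet> g t))"
  define h' where "h' = (\<lambda>t. exp (- (2 * C) * t) * (2 * (g t \<bullet> g' t) - 2 * C * (g t \<bullet> g t)))"
  have hd: "(h has_real_derivative h' t) (at t)" if "0 \<le> t" "t \<le> 1" for t
  proof -
    have "((\<lambda>t. g t \<bullet> g t) has_vector_derivative (g t \<bullet> g' t + g' t \<bullet> g t)) (at t)"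
      by (rule bounded_bilinear.has_vector_derivative[OF bounded_bilinear_inner d[OF that] d[OF that]])
    then have i: "((\<lambda>t. g t \<bullet> g t) has_real_derivative (g t \<bullet> g' t + g' t \<bullet> g t)) (at t)"
      by (simp add: has_real_derivative_iff_has_vector_derivative)
    have e: "((\<lambda>t. exp (- (2 * C) * t)) has_real_derivative exp (- (2 * C) * t) * (- (2 * C))) (at t)"
      by (auto intro!: derivative_eq_intros)
    show ?thesis unfolding h_def h'_def
      by (rule DERIV_cong[OF DERIV_mult[OF e i]]) (simp add: algebra_simps inner_commute)
  qed
  have h'0: "h' t \<le> 0" if "0 \<le> t" "t \<le> 1" for t
  proof -
    have "g t \<bullet> g' t \<le> norm (g t) * norm (g' t)" by (rule norm_cauchy_schwarz)
    also have "\<dots> \<le> norm (g t) * (C * norm (g t))" by (rule mult_left_mono[OF b[OF that]]) simp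
    also have "\<dots> = C * (g t \<bullet> g t)" by (simp add: dot_square_norm power2_eq_square)
    finally show ?thesis unfolding h'_def by (simp add: mult_le_0_iff)
  qed
  have "h 1 \<le> h 0"
    by (rule DERIV_nonpos_imp_nonincreasing[of 0 1]) (use hd h'0 in auto)
  then have "exp (- (2 * C)) * (g 1 \<bullet> g 1) \<le> 0" by (simp add: h_def g0)
  then have "g 1 \<bullet> g 1 \<le> 0" by (simp add: mult_le_0_iff)
  then have "g 1 \<bullet> g 1 = 0" by (rule order_antisym) (rule inner_ge_zero)
  then show ?thesis by simp
qed

lemma smooth_on_locally_Lipschitz:
  fixes f :: "'a::euclidean_space \<Rightarrow> 'b::euclidean_space"
  assumes f: "smooth_on S f" and S: "open S" "y0 \<in> S"
  obtains r C where "r > 0" "ball y0 r \<subseteq> S" "\<And>y z. y \<in> ball y0 r \<Longrightarrow> z \<in> ball y0 r \<Longrightarrow> norm (f y - f z) \<le> C * norm (y - z)"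
proof -
  let ?f' = "\<lambda>y. frechet_derivative f (at y)"
  define C where "C = (\<Sum>b\<in>Basis. norm (?f' y0 b) + 1)"
  have "eventually (\<lambda>y. \<forall>b\<in>Basis. dist (?f' y b) (?f' y0 b) < 1) (nhds y0)"
  proof (rule eventually_ball_finite)
    show "\<forall>b\<in>Basis. eventually (\<lambda>y. dist (?f' y b) (?f' y0 b) < 1) (nhds y0)"
    proof
      fix b :: 'a
      have "isCont (\<lambda>y. ?f' y b) y0"
        using smooth_on_continuous[OF smooth_on_derivative[OF f, of b]] S by (simp add: continuous_on_eq_continuous_at)
      then have "((\<lambda>y. ?f' y b) \<longlongrightarrow> ?f' y0 b) (nhds y0)"
        unfolding isCont_def tendsto_at_iff_tendsto_nhds[of "\<lambda>y. ?f' y b" y0] .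
      from tendstoD[OF this, of 1] show "eventually (\<lambda>y. dist (?f' y b) (?f' y0 b) < 1) (nhds y0)" by simp
    qed
  qed simp
  moreover have "eventually (\<lambda>y. y \<in> S) (nhds y0)" using S by (rule eventually_nhds_in_open)
  ultimately have "eventually (\<lambda>y. y \<in> S \<and> (\<forall>b\<in>Basis. dist (?f' y b) (?f' y0 b) < 1)) (nhds y0)"
    by eventually_elim auto
  then obtain r where r: "r > 0" "\<And>y. dist y y0 < r \<Longrightarrow> y \<in> S \<and> (\<forall>b\<in>Basis. dist (?f' y b) (?f' y0 b) < 1)"
    unfolding eventually_nhds_metric by blast
  have on: "onorm (?f' y) \<le> C" if "y \<in> ball y0 r" for y
  proof (rule onorm_le)
    fix v
    have y: "y \<in> S" "\<And>b. b \<in> Basis \<Longrightarrow> dist (?f' y b) (?f' y0 b) < 1" using r(2)[of y] that by (auto simp: dist_commute)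
    have l: "linear (?f' y)" by (rule has_derivative_linear[OF smooth_on_has_derivative[OF f y(1)]])
    have "norm (?f' y v) \<le> (\<Sum>b\<in>Basis. norm ((v \<bullet> b) *\<^sub>R ?f' y b))"
      by (subst linear_euclidean_expand[OF l]) (rule norm_sum)
    also have "\<dots> \<le> (\<Sum>b\<in>Basis. norm v * (norm (?f' y0 b) + 1))"
    proof (rule sum_mono)
      fix b :: 'a assume b: "b \<in> Basis"
      have "norm (?f' y b) \<le> norm (?f' y0 b) + 1"
        using y(2)[OF b] norm_triangle_sub[of "?f' y b" "?f' y0 b"] by (simp add: dist_norm)
      then show "norm ((v \<bullet> b) *\<^sub>R ?f' y b) \<le> norm v * (norm (?f' y0 b) + 1)"
        using Basis_le_norm[OF b, of v] by (simp add: mult_mono)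
    qed
    also have "\<dots> = C * norm v" by (simp add: C_def sum_distrib_left[symmetric] mult.commute)
    finally show "norm (?f' y v) \<le> C * norm v" .
  qed
  show ?thesis
  proof (rule that[OF r(1)])
    show "ball y0 r \<subseteq> S"
    proof
      fix y assume "y \<in> ball y0 r"
      then show "y \<in> S" using r(2)[of y] by (simp add: dist_commute)
    qed
    show "norm (f y - f z) \<le> C * norm (y - z)" if "y \<in> ball y0 r" "z \<in> ball y0 r" for y z
    proof (rule differentiable_bound[OF convex_ball _ on that])
      fix x assume "x \<in> ball y0 r"
      then have "x \<in> S" using r(2)[of x] by (simp add: dist_commute)
      then show "(f has_derivative ?f' x) (at x within ball y0 r)"
        by (rule has_derivative_at_withinI[OF smooth_on_has_derivative[OF f]])
    qed
  qed
qed

section \<open>Cartan geometries: constant fields, curvature and fundamental fields\<close>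

context
  fixes \<Gamma> :: "('m::{t2_space,second_countable_topology}, 'e::euclidean_space,
                'g::{t2_space,second_countable_topology}, 'f::euclidean_space,
                'n::{finite,linorder}) cartan_data" and p :: nat
  assumes PG: "parabolic_geometry p \<Gamma>"
begin

lemma atlases: "smooth_atlas (total_atlas \<Gamma>)" "smooth_atlas (base_atlas \<Gamma>)" "smooth_map (total_atlas \<Gamma>) (base_atlas \<Gamma>) UNIV (bproj \<Gamma>)"
  using PG unfolding parabolic_geometry_def principal_bundle_def by auto

lemma chart_covers: "chart_cover (total_atlas \<Gamma>)" "chart_cover (base_atlas \<Gamma>)"
  using atlases by (auto intro: smooth_atlas_chart_cover)

lemma ract_ract:
  assumes "g \<in> Ptilde p" "h \<in> Ptilde p"
  shows "ract \<Gamma> (ract \<Gamma> u (cls p g)) (cls p h) = ract \<Gamma> u (cls p (g ** h))"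
  using PG Pgrp_cls[OF assms(1)] Pgrp_cls[OF assms(2)] cls_mult[OF assms]
  unfolding parabolic_geometry_def principal_bundle_def by metis

lemma ract_one: "ract \<Gamma> u (cls p (mat 1)) = u"
  using PG cls_one unfolding parabolic_geometry_def principal_bundle_def by metis

lemma conn_facts:
  "vector_field (total_atlas \<Gamma>) W \<xi> \<Longrightarrow> smooth_map (total_atlas \<Gamma>) eucl W (\<lambda>u. conn \<Gamma> u (\<xi> u))"
  "linear_on_tangent (total_atlas \<Gamma>) u (conn \<Gamma> u)" "bij_betw (conn \<Gamma> u) (tangent_space (total_atlas \<Gamma>) u) (su p)"
  "g \<in> Ptilde p \<Longrightarrow> v \<in> tangent_space (total_atlas \<Gamma>) u \<Longrightarrow>
    conn \<Gamma> (ract \<Gamma> u (cls p g)) (pushforward (total_atlas \<Gamma>) (\<lambda>w. ract \<Gamma> w (cls p g)) u v) = matrix_inv g ** conn \<Gamma> u v ** g"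
  "A \<in> gfilt p 0 \<Longrightarrow> conn \<Gamma> u (velocity (total_atlas \<Gamma>) (\<lambda>t. ract \<Gamma> u (cls p (mexp (t *\<^sub>R A))))) = A"
  using PG unfolding parabolic_geometry_def cartan_connection_def by blast+

lemma conn_linear:
  assumes "v \<in> tangent_space (total_atlas \<Gamma>) u" "w \<in> tangent_space (total_atlas \<Gamma>) u"
  shows "conn \<Gamma> u (\<lambda>f. a * v f + b * w f) = a *\<^sub>R conn \<Gamma> u v + b *\<^sub>R conn \<Gamma> u w"
  using conn_facts(2)[of u] assms unfolding linear_on_tangent_def by blast

lemma conn_su: "v \<in> tangent_space (total_atlas \<Gamma>) u \<Longrightarrow> conn \<Gamma> u v \<in> su p"
  using conn_facts(3)[of u] by (auto simp: bij_betw_def)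

lemma conn_inj:
  "v \<in> tangent_space (total_atlas \<Gamma>) u \<Longrightarrow> w \<in> tangent_space (total_atlas \<Gamma>) u \<Longrightarrow> conn \<Gamma> u v = conn \<Gamma> u w \<Longrightarrow> v = w"
  using conn_facts(3)[of u] by (auto simp: bij_betw_def inj_on_def)

lemma const_field:
  assumes "X \<in> su p"
  shows "const_field \<Gamma> X u \<in> tangent_space (total_atlas \<Gamma>) u" "conn \<Gamma> u (const_field \<Gamma> X u) = X"
proof -
  have "X \<in> conn \<Gamma> u ` tangent_space (total_atlas \<Gamma>) u" using conn_facts(3)[of u] assms by (simp add: bij_betw_def)
  then show "const_field \<Gamma> X u \<in> tangent_space (total_atlas \<Gamma>) u" "conn \<Gamma> u (const_field \<Gamma> X u) = X"
    unfolding const_field_def by (rule inv_into_into, rule f_inv_into_f)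
qed

lemma const_field_eqI:
  assumes "v \<in> tangent_space (total_atlas \<Gamma>) u" "conn \<Gamma> u v = X"
  shows "const_field \<Gamma> X u = v"
proof -
  have "X \<in> su p" using conn_su[OF assms(1)] assms(2) by simp
  from const_field[OF this] show ?thesis using conn_inj assms by metis
qed

lemma const_field_linear:
  assumes "X \<in> su p" "Y \<in> su p"
  shows "const_field \<Gamma> (a *\<^sub>R X + b *\<^sub>R Y) u = (\<lambda>f. a * const_field \<Gamma> X u f + b * const_field \<Gamma> Y u f)"
  by (rule const_field_eqI)
    (simp_all add: tangent_space_linear[OF atlases(1)] conn_linear const_field assms)

lemma coordinate_field:
  assumes c: "(U, \<phi>) \<in> (total_atlas \<Gamma>)"
  shows "vector_field (total_atlas \<Gamma>) U (\<lambda>y. coord_vec (total_atlas \<Gamma>) (U, \<phi>) y v)"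
proof (rule vector_fieldI[OF atlases(1) smooth_atlas_chart(1)[OF atlases(1) c]])
  fix x assume x: "x \<in> U"
  note o = smooth_atlas_chart(2)[OF atlases(1) c]
  show "\<exists>U' \<phi>' N a. (U', \<phi>') \<in> (total_atlas \<Gamma>) \<and> x \<in> U' \<and> open N \<and> \<phi>' x \<in> N \<and> N \<subseteq> \<phi>' ` U' \<and> smooth_on N a \<and>
    (\<forall>z\<in>N. coord_vec (total_atlas \<Gamma>) (U, \<phi>) (inv_into U' \<phi>' z) v = coord_vec (total_atlas \<Gamma>) (U', \<phi>') (inv_into U' \<phi>' z) (a z))"
    using c x o smooth_on_const[OF o, of v]
    by (intro exI[of _ U] exI[of _ \<phi>] exI[of _ "\<phi> ` U"] exI[of _ "\<lambda>z. v"]) auto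
qed

text \<open>In a chart the Cartan connection is a smooth family of linear isomorphisms onto \<open>\<gg>\<close>, so the
  inverse family is smooth.\<close>

lemma const_field_chart:
  assumes c: "(U, \<phi>) \<in> (total_atlas \<Gamma>)"
  obtains a where "\<And>X. X \<in> su p \<Longrightarrow> smooth_on (\<phi> ` U) (a X)"
    "\<And>X y. X \<in> su p \<Longrightarrow> y \<in> U \<Longrightarrow> const_field \<Gamma> X y = coord_vec (total_atlas \<Gamma>) (U, \<phi>) y (a X (\<phi> y))"
proof -
  note ch = smooth_atlas_chart[OF atlases(1) c]
  have iv: "inv_into U \<phi> z \<in> U" "\<phi> (inv_into U \<phi> z) = z" if "z \<in> \<phi> ` U" for z
    using that by (auto intro: inv_into_into f_inv_into_f)
  define L where "L = (\<lambda>z v. conn \<Gamma> (inv_into U \<phi> z) (coord_vec (total_atlas \<Gamma>) (U, \<phi>) (inv_into U \<phi> z) v))"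
  define a where "a = (\<lambda>X z. inv_into UNIV (L z) X)"
  have tv: "coord_vec (total_atlas \<Gamma>) (U, \<phi>) (inv_into U \<phi> z) v \<in> tangent_space (total_atlas \<Gamma>) (inv_into U \<phi> z)" if "z \<in> \<phi> ` U" for z v
    by (rule coord_vec_in_tangent_space[OF c iv(1)[OF that]])
  have lin: "linear (L z)" if z: "z \<in> \<phi> ` U" for z
  proof (rule linearI)
    have *: "L z (r *\<^sub>R v + s *\<^sub>R w) = r *\<^sub>R L z v + s *\<^sub>R L z w" for r s v w
      unfolding L_def coord_vec_linear[OF atlases(1) c iv(1)[OF z]] by (rule conn_linear[OF tv[OF z] tv[OF z]])
    show "L z (v + w) = L z v + L z w" for v w using *[of 1 v 1 w] by simp
    show "L z (r *\<^sub>R v) = r *\<^sub>R L z v" for r v using *[of r v 0 v] by simp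
  qed
  have inj: "inj (L z)" if z: "z \<in> \<phi> ` U" for z
  proof (rule injI)
    fix v w assume "L z v = L z w"
    then have "coord_vec (total_atlas \<Gamma>) (U, \<phi>) (inv_into U \<phi> z) v = coord_vec (total_atlas \<Gamma>) (U, \<phi>) (inv_into U \<phi> z) w"
      unfolding L_def by (rule conn_inj[OF tv[OF z] tv[OF z]])
    then show "v = w" by (rule coord_vec_inj[OF atlases(1) c iv(1)[OF z]])
  qed
  have LV: "L z v \<in> su p" if "z \<in> \<phi> ` U" for z v
    unfolding L_def by (rule conn_su[OF tv[OF that]])
  have sm: "smooth_on (\<phi> ` U) (\<lambda>z. L z v)" for v
    using smooth_map_euclD[OF conn_facts(1)[OF coordinate_field[OF c, of v]] c]
    by (simp add: L_def comp_def)
  have ex: "\<exists>v. const_field \<Gamma> X (inv_into U \<phi> z) = coord_vec (total_atlas \<Gamma>) (U, \<phi>) (inv_into U \<phi> z) v \<and> L z v = X"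
    if X: "X \<in> su p" and z: "z \<in> \<phi> ` U" for X z
    using const_field[OF X, of "inv_into U \<phi> z"] tangent_space_chart[OF atlases(1) c iv(1)[OF z]]
    by (auto simp: L_def)
  have La: "L z (a X z) = X" if "X \<in> su p" "z \<in> \<phi> ` U" for X z
    unfolding a_def by (rule f_inv_into_f) (use ex[OF that] in auto)
  show ?thesis
  proof (rule that)
    show "smooth_on (\<phi> ` U) (a X)" if "X \<in> su p" for X
      by (rule smooth_on_inverse_family[OF ch(2) lin inj subspace_su LV sm La that])
    show "const_field \<Gamma> X y = coord_vec (total_atlas \<Gamma>) (U, \<phi>) y (a X (\<phi> y))" if X: "X \<in> su p" and y: "y \<in> U" for X y
    proof -
      have z: "\<phi> y \<in> \<phi> ` U" and i: "inv_into U \<phi> (\<phi> y) = y" using y ch(4) by auto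
      obtain v where v: "const_field \<Gamma> X y = coord_vec (total_atlas \<Gamma>) (U, \<phi>) y v" "L (\<phi> y) v = X" using ex[OF X z] i by auto
      have "L (\<phi> y) v = L (\<phi> y) (a X (\<phi> y))" using v(2) La[OF X z] by simp
      then have "v = a X (\<phi> y)" using inj[OF z] by (simp add: inj_eq)
      then show ?thesis using v(1) by simp
    qed
  qed
qed

lemma const_field_vector_field:
  assumes X: "X \<in> su p"
  shows "vector_field (total_atlas \<Gamma>) UNIV (const_field \<Gamma> X)"
proof (rule vector_fieldI[OF atlases(1) open_UNIV])
  fix x :: 'g
  obtain U \<phi> where c: "(U, \<phi>) \<in> (total_atlas \<Gamma>)" "x \<in> U" by (rule smooth_atlas_cover[OF atlases(1)])
  obtain a where a: "\<And>X. X \<in> su p \<Longrightarrow> smooth_on (\<phi> ` U) (a X)"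
    "\<And>X y. X \<in> su p \<Longrightarrow> y \<in> U \<Longrightarrow> const_field \<Gamma> X y = coord_vec (total_atlas \<Gamma>) (U, \<phi>) y (a X (\<phi> y))"
    by (rule const_field_chart[OF c(1)], rule that)
  have "const_field \<Gamma> X (inv_into U \<phi> z) = coord_vec (total_atlas \<Gamma>) (U, \<phi>) (inv_into U \<phi> z) (a X z)" if "z \<in> \<phi> ` U" for z
    using a(2)[OF X inv_into_into[OF that]] f_inv_into_f[OF that] by simp
  then show "\<exists>U \<phi> N a. (U, \<phi>) \<in> (total_atlas \<Gamma>) \<and> x \<in> U \<and> open N \<and> \<phi> x \<in> N \<and> N \<subseteq> \<phi> ` U \<and> smooth_on N a \<and>
      (\<forall>z\<in>N. const_field \<Gamma> X (inv_into U \<phi> z) = coord_vec (total_atlas \<Gamma>) (U, \<phi>) (inv_into U \<phi> z) (a z))"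
    using c a(1)[OF X] smooth_atlas_chart(2)[OF atlases(1) c(1)]
    by (intro exI[of _ U] exI[of _ \<phi>] exI[of _ "\<phi> ` U"] exI[of _ "a X"]) auto
qed

text \<open>The connection is constant on the fields involved, so of the exterior derivative only the bracket
  term remains.\<close>

lemma curvature_bracket:
  assumes X: "X \<in> su p" and Y: "Y \<in> su p"
  shows "curvature p \<Gamma> u X Y = mbracket X Y - conn \<Gamma> u (lie_bracket (total_atlas \<Gamma>) (const_field \<Gamma> X) (const_field \<Gamma> Y) u)"
proof -
  have "deriv_along (const_field \<Gamma> X u) (\<lambda>y. conn \<Gamma> y (const_field \<Gamma> Y y)) = 0" if "X \<in> su p" "Y \<in> su p" for X Y
    by (simp add: deriv_along_def const_field that tangent_vector_const[OF atlases(1) const_field(1)])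
  then show ?thesis by (simp add: curvature_def ext_deriv_def assms const_field)
qed

lemma bracket_vector_field:
  assumes "X \<in> su p" "Y \<in> su p"
  shows "vector_field (total_atlas \<Gamma>) UNIV (lie_bracket (total_atlas \<Gamma>) (const_field \<Gamma> X) (const_field \<Gamma> Y))"
  by (rule lie_bracket_vector_field[OF atlases(1) const_field_vector_field const_field_vector_field]; fact)

text \<open>By the bracket formula the curvature is the connection evaluated on a smooth vector field.\<close>

lemma curvature_smooth:
  "smooth_map (total_atlas \<Gamma>) eucl UNIV (\<lambda>u. enc p (curvature p \<Gamma> u) \<bullet> y)"
proof -
  have "smooth_map (total_atlas \<Gamma>) eucl UNIV (\<lambda>u. curvature p \<Gamma> u X Y \<bullet> w)" if X: "X \<in> su p" and Y: "Y \<in> su p" for X Y w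
  proof -
    have s: "smooth_on UNIV (\<lambda>z. (mbracket X Y + - z) \<bullet> w)"
      by (intro smooth_on_bounded_linear[OF _ open_UNIV bounded_linear_inner_left] smooth_on_add open_UNIV
          smooth_on_const smooth_on_bounded_linear[OF _ open_UNIV bounded_linear_minus[OF bounded_linear_ident]]
          smooth_on_identity)
    have "smooth_map (total_atlas \<Gamma>) eucl UNIV (\<lambda>u. (mbracket X Y + - conn \<Gamma> u (lie_bracket (total_atlas \<Gamma>) (const_field \<Gamma> X) (const_field \<Gamma> Y) u)) \<bullet> w)"
      by (rule smooth_map_post[OF atlases(1) open_UNIV conn_facts(1)[OF bracket_vector_field[OF X Y]] open_UNIV s]) simp
    then show ?thesis by (simp add: curvature_bracket[OF X Y])
  qed
  then have "smooth_map (total_atlas \<Gamma>) eucl UNIV (\<lambda>u. \<Sum>jk\<in>UNIV. enc p (curvature p \<Gamma> u) $ jk \<bullet> y $ jk)"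
    by (intro smooth_map_sum atlases open_UNIV) (simp_all add: enc_def suproj(1))
  then show ?thesis by (simp add: inner_vec_def)
qed

text \<open>This form covers right translations by \<open>g\<close> as well as, for \<open>g = 1\<close>, automorphisms.\<close>

lemma related_const_field:
  assumes V: "open V" "w \<in> V" and f: "smooth_map (total_atlas \<Gamma>) (total_atlas \<Gamma>) V f" and g: "g \<in> Ptilde p"
    and conn: "\<And>w v. w \<in> V \<Longrightarrow> v \<in> tangent_space (total_atlas \<Gamma>) w \<Longrightarrow>
      conn \<Gamma> (f w) (pushforward (total_atlas \<Gamma>) f w v) = matrix_inv g ** conn \<Gamma> w v ** g"
    and X: "X \<in> su p"
  shows "pushforward (total_atlas \<Gamma>) f w (const_field \<Gamma> X w) = const_field \<Gamma> (matrix_inv g ** X ** g) (f w)"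
proof (rule const_field_eqI[symmetric])
  show "pushforward (total_atlas \<Gamma>) f w (const_field \<Gamma> X w) \<in> tangent_space (total_atlas \<Gamma>) (f w)"
    by (rule pushforward_in_tangent_space[OF atlases(1) atlases(1) V f const_field(1)[OF X]])
  show "conn \<Gamma> (f w) (pushforward (total_atlas \<Gamma>) f w (const_field \<Gamma> X w)) = matrix_inv g ** X ** g"
    using conn[OF V(2) const_field(1)[OF X]] by (simp add: const_field(2)[OF X])
qed

lemma related_curvature:
  assumes V: "open V" "w \<in> V" and f: "smooth_map (total_atlas \<Gamma>) (total_atlas \<Gamma>) V f" and g: "g \<in> Ptilde p"
    and conn: "\<And>w v. w \<in> V \<Longrightarrow> v \<in> tangent_space (total_atlas \<Gamma>) w \<Longrightarrow>
      conn \<Gamma> (f w) (pushforward (total_atlas \<Gamma>) f w v) = matrix_inv g ** conn \<Gamma> w v ** g"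
  shows "curvature p \<Gamma> (f w) = cj p (matrix_inv g) (curvature p \<Gamma> w)"
proof -
  have ii: "matrix_inv (matrix_inv g) = g" by (rule matrix_inv_eq[OF Ptilde_matrix_inv(2)[OF g]])
  have *: "curvature p \<Gamma> (f w) (matrix_inv g ** X ** g) (matrix_inv g ** Y ** g) = matrix_inv g ** curvature p \<Gamma> w X Y ** g"
    if X: "X \<in> su p" and Y: "Y \<in> su p" for X Y
  proof -
    let ?X = "matrix_inv g ** X ** g" and ?Y = "matrix_inv g ** Y ** g"
    have X': "?X \<in> su p" "?Y \<in> su p" using adjoint_su_Ptilde(2)[OF g] X Y by auto
    have b: "pushforward (total_atlas \<Gamma>) f w (lie_bracket (total_atlas \<Gamma>) (const_field \<Gamma> X) (const_field \<Gamma> Y) w) = lie_bracket (total_atlas \<Gamma>) (const_field \<Gamma> ?X) (const_field \<Gamma> ?Y) (f w)"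
    proof (rule lie_bracket_related[OF atlases(1) atlases(1) V f])
      show "vector_field (total_atlas \<Gamma>) V (const_field \<Gamma> X)" "vector_field (total_atlas \<Gamma>) V (const_field \<Gamma> Y)"
        using vector_field_subset[OF const_field_vector_field] X Y V by auto
      show "vector_field (total_atlas \<Gamma>) UNIV (const_field \<Gamma> ?X)" "vector_field (total_atlas \<Gamma>) UNIV (const_field \<Gamma> ?Y)"
        using const_field_vector_field X' by auto
      show "pushforward (total_atlas \<Gamma>) f y (const_field \<Gamma> X y) = const_field \<Gamma> ?X (f y)" "pushforward (total_atlas \<Gamma>) f y (const_field \<Gamma> Y y) = const_field \<Gamma> ?Y (f y)" if "y \<in> V" for y
        using related_const_field[OF V(1) that f g conn] X Y by auto
    qed simp
    have t: "lie_bracket (total_atlas \<Gamma>) (const_field \<Gamma> X) (const_field \<Gamma> Y) w \<in> tangent_space (total_atlas \<Gamma>) w"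
      by (rule vector_field_tangent[OF bracket_vector_field[OF X Y]]) simp
    show ?thesis
      unfolding curvature_bracket[OF X' ] curvature_bracket[OF X Y] b[symmetric] conn[OF V(2) t]
        mbracket_conj[OF Ptilde_matrix_inv(3)[OF g]]
      by (simp only: matrix_mult_diff_left matrix_mult_diff_right)
  qed
  show ?thesis
  proof (intro ext)
    fix X Y
    show "curvature p \<Gamma> (f w) X Y = cj p (matrix_inv g) (curvature p \<Gamma> w) X Y"
    proof (cases "X \<in> su p \<and> Y \<in> su p")
      case True
      then have XY: "g ** X ** matrix_inv g \<in> su p" "g ** Y ** matrix_inv g \<in> su p"
        using adjoint_su_Ptilde(1)[OF g] by auto
      have c: "matrix_inv g ** (g ** X ** matrix_inv g) ** g = X" for X
      proof -
        have "matrix_inv g ** (g ** X ** matrix_inv g) ** g = (matrix_inv g ** g) ** X ** (matrix_inv g ** g)"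
          by (simp only: matrix_mul_assoc)
        then show ?thesis by (simp add: Ptilde_matrix_inv(2)[OF g])
      qed
      from *[OF XY] show ?thesis using True by (simp add: cj_def restrict_su_def ii c)
    next
      case False
      then show ?thesis by (auto simp: cj_def restrict_su_def curvature_def)
    qed
  qed
qed

text \<open>Local trivializations give smooth coordinates for the action: near \<open>u\<close> every point is
  \<open>\<tau> (y, cls \<gamma>)\<close> with smooth \<open>y\<close> and \<open>\<gamma>\<close>, and \<open>\<tau> (y, cls g)\<close> extends smoothly to matrices \<open>g\<close> outside
  the group.\<close>

lemma trivialization:
  obtains U \<tau> W \<gamma> where "open U" "bproj \<Gamma> u \<in> U" "open W" "u \<in> W" "\<And>w. w \<in> W \<Longrightarrow> bproj \<Gamma> w \<in> U"
    "smooth_map (total_atlas \<Gamma>) eucl W \<gamma>" "\<And>w. w \<in> W \<Longrightarrow> \<gamma> w \<in> Ptilde p" "\<And>w. w \<in> W \<Longrightarrow> \<tau> (bproj \<Gamma> w, cls p (\<gamma> w)) = w"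
    "\<And>y g h. y \<in> U \<Longrightarrow> g \<in> Ptilde p \<Longrightarrow> h \<in> Ptilde p \<Longrightarrow> ract \<Gamma> (\<tau> (y, cls p g)) (cls p h) = \<tau> (y, cls p (g ** h))"
    "\<And>y g. y \<in> U \<Longrightarrow> g \<in> Ptilde p \<Longrightarrow> bproj \<Gamma> (\<tau> (y, cls p g)) = y"
    "\<And>y g. y \<in> U \<Longrightarrow> g \<in> Ptilde p \<Longrightarrow> \<exists>N F. open N \<and> (y, g) \<in> N \<and> smooth_map (prod_atlas (base_atlas \<Gamma>) eucl) (total_atlas \<Gamma>) N F \<and>
      (\<forall>y g. (y, g) \<in> N \<longrightarrow> y \<in> U \<longrightarrow> g \<in> Ptilde p \<longrightarrow> F (y, g) = \<tau> (y, cls p g))"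
    "\<And>w. bproj \<Gamma> w \<in> U \<Longrightarrow> \<exists>g\<in>Ptilde p. w = \<tau> (bproj \<Gamma> w, cls p g)"
proof -
  obtain U \<tau> where U: "open U" "bproj \<Gamma> u \<in> U" and lt: "local_triv p \<Gamma> U \<tau>"
    using PG unfolding parabolic_geometry_def principal_bundle_def by blast
  obtain W \<gamma> where W: "open W" "u \<in> W" "smooth_map (total_atlas \<Gamma>) eucl W \<gamma>"
    "\<forall>w\<in>W \<inter> bproj \<Gamma> -` U. \<gamma> w \<in> Ptilde p \<and> \<tau> (bproj \<Gamma> w, cls p (\<gamma> w)) = w"
    using lt U(2) unfolding local_triv_def by blast
  have pc: "continuous_on UNIV (bproj \<Gamma>)" using smooth_mapD(1)[OF atlases(3)] .
  have o: "open (W \<inter> bproj \<Gamma> -` U)" using W(1) open_vimage[OF U(1) pc] by auto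
  show ?thesis
  proof (rule that[OF U o])
    show "u \<in> W \<inter> bproj \<Gamma> -` U" using W U by simp
    show "smooth_map (total_atlas \<Gamma>) eucl (W \<inter> bproj \<Gamma> -` U) \<gamma>" by (rule smooth_map_subset[OF W(3)]) auto
    fix y and g h :: "'n bmat" assume y: "y \<in> U" and g: "g \<in> Ptilde p"
    show "bproj \<Gamma> (\<tau> (y, cls p g)) = y" using lt y Pgrp_cls[OF g] unfolding local_triv_def by blast
    show "\<exists>N F. open N \<and> (y, g) \<in> N \<and> smooth_map (prod_atlas (base_atlas \<Gamma>) eucl) (total_atlas \<Gamma>) N F \<and>
      (\<forall>y g. (y, g) \<in> N \<longrightarrow> y \<in> U \<longrightarrow> g \<in> Ptilde p \<longrightarrow> F (y, g) = \<tau> (y, cls p g))"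
    proof -
      have "smooth_map_subset (prod_atlas (base_atlas \<Gamma>) eucl) (total_atlas \<Gamma>) (U \<times> Ptilde p) (\<lambda>(y, g). \<tau> (y, cls p g))"
        using lt unfolding local_triv_def by blast
      then obtain N F where "open N" "(y, g) \<in> N" "smooth_map (prod_atlas (base_atlas \<Gamma>) eucl) (total_atlas \<Gamma>) N F"
        "\<forall>z\<in>N \<inter> U \<times> Ptilde p. F z = (\<lambda>(y, g). \<tau> (y, cls p g)) z"
        unfolding smooth_map_subset_def using y g by blast
      then show ?thesis by (intro exI[of _ N] exI[of _ F]) auto
    qed
    assume h: "h \<in> Ptilde p"
    show "ract \<Gamma> (\<tau> (y, cls p g)) (cls p h) = \<tau> (y, cls p (g ** h))"
      using lt y Pgrp_cls[OF g] Pgrp_cls[OF h] cls_mult[OF g h] unfolding local_triv_def by metis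
  next
    fix w assume w: "bproj \<Gamma> w \<in> U"
    then have "w \<in> \<tau> ` (U \<times> Pgrp p)" using lt unfolding local_triv_def bij_betw_def by blast
    then obtain y g where yg: "y \<in> U" "g \<in> Ptilde p" "w = \<tau> (y, cls p g)" unfolding Pgrp_def by auto
    then have "bproj \<Gamma> w = y" using lt Pgrp_cls[OF yg(2)] unfolding local_triv_def by blast
    then show "\<exists>g\<in>Ptilde p. w = \<tau> (bproj \<Gamma> w, cls p g)" using yg by blast
  qed (use W(4) in auto)
qed

lemma ract_smooth:
  assumes g: "g \<in> Ptilde p"
  shows "\<exists>V. open V \<and> u \<in> V \<and> smooth_map (total_atlas \<Gamma>) (total_atlas \<Gamma>) V (\<lambda>w. ract \<Gamma> w (cls p g))"
proof -
  obtain U \<tau> W \<gamma> where T: "open U" "bproj \<Gamma> u \<in> U" "open W" "u \<in> W" "\<And>w. w \<in> W \<Longrightarrow> bproj \<Gamma> w \<in> U"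
    "smooth_map (total_atlas \<Gamma>) eucl W \<gamma>" "\<And>w. w \<in> W \<Longrightarrow> \<gamma> w \<in> Ptilde p" "\<And>w. w \<in> W \<Longrightarrow> \<tau> (bproj \<Gamma> w, cls p (\<gamma> w)) = w"
    "\<And>y g h. y \<in> U \<Longrightarrow> g \<in> Ptilde p \<Longrightarrow> h \<in> Ptilde p \<Longrightarrow> ract \<Gamma> (\<tau> (y, cls p g)) (cls p h) = \<tau> (y, cls p (g ** h))"
    "\<And>y g. y \<in> U \<Longrightarrow> g \<in> Ptilde p \<Longrightarrow> \<exists>N F. open N \<and> (y, g) \<in> N \<and> smooth_map (prod_atlas (base_atlas \<Gamma>) eucl) (total_atlas \<Gamma>) N F \<and>
      (\<forall>y g. (y, g) \<in> N \<longrightarrow> y \<in> U \<longrightarrow> g \<in> Ptilde p \<longrightarrow> F (y, g) = \<tau> (y, cls p g))"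
    by (rule trivialization[of u], rule that)
  obtain N F where N: "open N" "(bproj \<Gamma> u, \<gamma> u ** g) \<in> N" "smooth_map (prod_atlas (base_atlas \<Gamma>) eucl) (total_atlas \<Gamma>) N F"
    and F: "\<And>y g. (y, g) \<in> N \<Longrightarrow> y \<in> U \<Longrightarrow> g \<in> Ptilde p \<Longrightarrow> F (y, g) = \<tau> (y, cls p g)"
    using T(10)[OF T(2) Ptilde_mult[OF T(7)[OF T(4)] g]] by blast
  let ?k = "\<lambda>w. (bproj \<Gamma> w, \<gamma> w ** g)"
  have kg: "smooth_map (total_atlas \<Gamma>) eucl W (\<lambda>w. \<gamma> w ** g)"
    by (rule smooth_map_post[OF atlases(1) T(3,6) open_UNIV
          smooth_on_bounded_linear[OF smooth_on_identity open_UNIV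
            bounded_bilinear.bounded_linear_left[OF bounded_bilinear_matrix_mult]]]) simp
  have k: "smooth_map (total_atlas \<Gamma>) (prod_atlas (base_atlas \<Gamma>) eucl) W ?k"
    by (rule smooth_map_Pair[OF atlases(1) chart_covers(2) chart_cover_eucl T(3) smooth_map_subset[OF atlases(3)] kg]) simp
  let ?V = "W \<inter> ?k -` N"
  have V: "open ?V" by (rule continuous_open_preimage[OF smooth_mapD(1)[OF k] T(3) N(1)])
  have "smooth_map (total_atlas \<Gamma>) (total_atlas \<Gamma>) ?V (F \<circ> ?k)"
    by (rule smooth_map_compose[OF atlases(1) chart_cover_prod[OF chart_covers(2) chart_cover_eucl] chart_covers(1) V
          smooth_map_subset[OF k] N(3)]) auto
  then have "smooth_map (total_atlas \<Gamma>) (total_atlas \<Gamma>) ?V (\<lambda>w. ract \<Gamma> w (cls p g))"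
  proof (rule smooth_map_cong[OF atlases(1) chart_covers(1) V])
    fix w assume w: "w \<in> ?V"
    then have "F (?k w) = \<tau> (bproj \<Gamma> w, cls p (\<gamma> w ** g))"
      using F[of "bproj \<Gamma> w" "\<gamma> w ** g"] T(5,7) Ptilde_mult[OF _ g] by auto
    also have "\<dots> = ract \<Gamma> w (cls p g)"
      using T(9)[of "bproj \<Gamma> w" "\<gamma> w" g] w T(5,7,8) g by auto
    finally show "(F \<circ> ?k) w = ract \<Gamma> w (cls p g)" by simp
  qed
  then show ?thesis using V T(4) N(2) by (intro exI[of _ ?V]) auto
qed

lemma bproj_ract: "g \<in> Ptilde p \<Longrightarrow> bproj \<Gamma> (ract \<Gamma> u (cls p g)) = bproj \<Gamma> u"
proof -
  assume g: "g \<in> Ptilde p"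
  obtain U \<tau> W \<gamma> where T: "bproj \<Gamma> u \<in> U" "u \<in> W" "\<And>w. w \<in> W \<Longrightarrow> \<gamma> w \<in> Ptilde p"
    "\<And>w. w \<in> W \<Longrightarrow> \<tau> (bproj \<Gamma> w, cls p (\<gamma> w)) = w"
    "\<And>y g h. y \<in> U \<Longrightarrow> g \<in> Ptilde p \<Longrightarrow> h \<in> Ptilde p \<Longrightarrow> ract \<Gamma> (\<tau> (y, cls p g)) (cls p h) = \<tau> (y, cls p (g ** h))"
    "\<And>y g. y \<in> U \<Longrightarrow> g \<in> Ptilde p \<Longrightarrow> bproj \<Gamma> (\<tau> (y, cls p g)) = y"
    by (rule trivialization[of u], rule that)
  have "ract \<Gamma> u (cls p g) = \<tau> (bproj \<Gamma> u, cls p (\<gamma> u ** g))"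
    using T(5)[OF T(1) T(3)[OF T(2)] g] T(4)[OF T(2)] by simp
  then show ?thesis using T(6)[OF T(1) Ptilde_mult[OF T(3)[OF T(2)] g]] by simp
qed

lemma fibre_transitive:
  assumes "bproj \<Gamma> u = bproj \<Gamma> u'"
  obtains g where "g \<in> Ptilde p" "u' = ract \<Gamma> u (cls p g)"
proof -
  obtain U \<tau> W \<gamma> where T: "bproj \<Gamma> u \<in> U" "u \<in> W" "\<And>w. w \<in> W \<Longrightarrow> \<gamma> w \<in> Ptilde p"
    "\<And>w. w \<in> W \<Longrightarrow> \<tau> (bproj \<Gamma> w, cls p (\<gamma> w)) = w"
    "\<And>y g h. y \<in> U \<Longrightarrow> g \<in> Ptilde p \<Longrightarrow> h \<in> Ptilde p \<Longrightarrow> ract \<Gamma> (\<tau> (y, cls p g)) (cls p h) = \<tau> (y, cls p (g ** h))"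
    "\<And>w. bproj \<Gamma> w \<in> U \<Longrightarrow> \<exists>g\<in>Ptilde p. w = \<tau> (bproj \<Gamma> w, cls p g)"
    by (rule trivialization[of u], rule that)
  obtain g where g: "g \<in> Ptilde p" "u' = \<tau> (bproj \<Gamma> u, cls p g)" using T(1) T(6)[of u'] assms by auto
  have gu: "\<gamma> u \<in> Ptilde p" by (rule T(3)[OF T(2)])
  let ?h = "matrix_inv (\<gamma> u) ** g"
  have h: "?h \<in> Ptilde p" by (rule Ptilde_mult[OF Ptilde_matrix_inv(1)[OF gu] g(1)])
  have "ract \<Gamma> u (cls p ?h) = \<tau> (bproj \<Gamma> u, cls p (\<gamma> u ** ?h))"
    using T(5)[OF T(1) gu h] T(4)[OF T(2)] by simp
  also have "\<gamma> u ** ?h = g" by (simp add: matrix_mul_assoc Ptilde_matrix_inv(3)[OF gu])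
  finally show ?thesis using that[OF h] g(2) by simp
qed

lemma curvature_ract:
  assumes "g \<in> Ptilde p"
  shows "curvature p \<Gamma> (ract \<Gamma> u (cls p g)) = cj p (matrix_inv g) (curvature p \<Gamma> u)"
proof -
  obtain V where V: "open V" "u \<in> V" "smooth_map (total_atlas \<Gamma>) (total_atlas \<Gamma>) V (\<lambda>w. ract \<Gamma> w (cls p g))"
    using ract_smooth[OF assms] by blast
  show ?thesis by (rule related_curvature[OF V assms conn_facts(4)[OF assms]])
qed

lemma const_field_ract:
  assumes g: "g \<in> Ptilde p" and X: "X \<in> su p"
  shows "pushforward (total_atlas \<Gamma>) (\<lambda>w. ract \<Gamma> w (cls p g)) u (const_field \<Gamma> X u) = const_field \<Gamma> (matrix_inv g ** X ** g) (ract \<Gamma> u (cls p g))"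
proof -
  obtain V where V: "open V" "u \<in> V" "smooth_map (total_atlas \<Gamma>) (total_atlas \<Gamma>) V (\<lambda>w. ract \<Gamma> w (cls p g))"
    using ract_smooth[OF g] by blast
  show ?thesis by (rule related_const_field[OF V g conn_facts(4)[OF g] X])
qed

text \<open>A smooth extension of the orbit map of \<open>u\<close> from the group to a neighbourhood of the identity among
  all matrices.\<close>

lemma orbit_map:
  obtains N G where "open N" "mat 1 \<in> N" "smooth_map eucl (total_atlas \<Gamma>) N G"
    "\<And>g. g \<in> N \<Longrightarrow> g \<in> Ptilde p \<Longrightarrow> G g = ract \<Gamma> u (cls p g)"
proof -
  obtain U \<tau> W \<gamma> where T: "bproj \<Gamma> u \<in> U" "u \<in> W" "\<And>w. w \<in> W \<Longrightarrow> \<gamma> w \<in> Ptilde p"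
    "\<And>w. w \<in> W \<Longrightarrow> \<tau> (bproj \<Gamma> w, cls p (\<gamma> w)) = w"
    "\<And>y g h. y \<in> U \<Longrightarrow> g \<in> Ptilde p \<Longrightarrow> h \<in> Ptilde p \<Longrightarrow> ract \<Gamma> (\<tau> (y, cls p g)) (cls p h) = \<tau> (y, cls p (g ** h))"
    "\<And>y g. y \<in> U \<Longrightarrow> g \<in> Ptilde p \<Longrightarrow> \<exists>N F. open N \<and> (y, g) \<in> N \<and> smooth_map (prod_atlas (base_atlas \<Gamma>) eucl) (total_atlas \<Gamma>) N F \<and>
      (\<forall>y g. (y, g) \<in> N \<longrightarrow> y \<in> U \<longrightarrow> g \<in> Ptilde p \<longrightarrow> F (y, g) = \<tau> (y, cls p g))"
    by (rule trivialization[of u], rule that)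
  have gu: "\<gamma> u \<in> Ptilde p" by (rule T(3)[OF T(2)])
  obtain N F where N: "open N" "(bproj \<Gamma> u, \<gamma> u) \<in> N" "smooth_map (prod_atlas (base_atlas \<Gamma>) eucl) (total_atlas \<Gamma>) N F"
    and F: "\<And>y g. (y, g) \<in> N \<Longrightarrow> y \<in> U \<Longrightarrow> g \<in> Ptilde p \<Longrightarrow> F (y, g) = \<tau> (y, cls p g)"
    using T(6)[OF T(1) gu] by blast
  let ?k = "\<lambda>g :: 'n bmat. (bproj \<Gamma> u, \<gamma> u ** g)"
  have "smooth_on UNIV (\<lambda>g :: 'n bmat. \<gamma> u ** g)"
    by (rule smooth_on_bounded_linear[OF smooth_on_identity open_UNIV
          bounded_bilinear.bounded_linear_right[OF bounded_bilinear_matrix_mult]])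
  from smooth_on_imp_smooth_map_eucl[OF open_UNIV this]
  have kg: "smooth_map eucl eucl UNIV (\<lambda>g :: 'n bmat. \<gamma> u ** g)" .
  have k: "smooth_map eucl (prod_atlas (base_atlas \<Gamma>) eucl) UNIV ?k"
    by (rule smooth_map_Pair[OF smooth_atlas_eucl chart_covers(2) chart_cover_eucl open_UNIV
          smooth_map_const[OF smooth_atlas_eucl open_UNIV] kg])
  let ?V = "UNIV \<inter> ?k -` N"
  have V: "open ?V" by (rule continuous_open_preimage[OF smooth_mapD(1)[OF k] open_UNIV N(1)])
  have s: "smooth_map eucl (total_atlas \<Gamma>) ?V (F \<circ> ?k)"
    by (rule smooth_map_compose[OF smooth_atlas_eucl chart_cover_prod[OF chart_covers(2) chart_cover_eucl] chart_covers(1) V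
          smooth_map_subset[OF k] N(3)]) auto
  show ?thesis
  proof (rule that[OF V _ s])
    show "mat 1 \<in> ?V" using N(2) by simp
    fix g assume g: "g \<in> ?V" "g \<in> Ptilde p"
    have "F (bproj \<Gamma> u, \<gamma> u ** g) = \<tau> (bproj \<Gamma> u, cls p (\<gamma> u ** g))"
      using g by (intro F T(1) Ptilde_mult gu) auto
    also have "\<dots> = ract \<Gamma> u (cls p g)" using T(5)[OF T(1) gu g(2)] T(4)[OF T(2)] by simp
    finally show "(F \<circ> ?k) g = ract \<Gamma> u (cls p g)" by simp
  qed
qed

text \<open>The connection reproduces the generators of the action and is injective on tangent spaces; that the
  velocity is a tangent vector at all follows from the smooth extension of the orbit map.\<close>

lemma fundamental_field:
  assumes A: "A \<in> gfilt p 0"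
  shows "const_field \<Gamma> A u = velocity (total_atlas \<Gamma>) (\<lambda>t. ract \<Gamma> u (cls p (mexp (t *\<^sub>R A))))"
proof (rule const_field_eqI[OF _ conn_facts(5)[OF A]])
  obtain N G where N: "open N" "mat 1 \<in> N" "smooth_map eucl (total_atlas \<Gamma>) N G"
    and G: "\<And>g. g \<in> N \<Longrightarrow> g \<in> Ptilde p \<Longrightarrow> G g = ract \<Gamma> u (cls p g)"
    by (rule orbit_map[of u], rule that)
  let ?m = "\<lambda>t. mexp (t *\<^sub>R A)"
  have m: "(?m has_vector_derivative A ** ?m 0) (at 0)" by (rule mexp_has_vector_derivative)
  have m0: "?m 0 = mat 1" by (simp add: mexp_zero)
  have "(?m \<longlongrightarrow> ?m 0) (nhds 0)"
    using has_vector_derivative_continuous[OF m] unfolding isCont_def tendsto_at_iff_tendsto_nhds[of ?m 0] .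
  from topological_tendstoD[OF this N(1)] have "eventually (\<lambda>t. ?m t \<in> N) (nhds 0)" using N(2) m0 by simp
  then have ev: "eventually (\<lambda>t. ract \<Gamma> u (cls p (?m t)) = G (?m t)) (nhds 0)"
    by eventually_elim (simp add: G mexp_Ptilde[OF A])
  have "velocity (total_atlas \<Gamma>) (\<lambda>t. ract \<Gamma> u (cls p (?m t))) = velocity (total_atlas \<Gamma>) (\<lambda>t. G (?m t))"
    by (rule velocity_cong[OF ev])
  also have "\<dots> = pushforward (total_atlas \<Gamma>) G (?m 0) (coord_vec eucl (UNIV, id) (?m 0) (A ** ?m 0))"
    by (rule velocity_eq_pushforward[OF atlases(1) N(1) _ N(3) m]) (use N m0 in simp)
  also have "\<dots> \<in> tangent_space (total_atlas \<Gamma>) (G (?m 0))"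
    by (rule pushforward_in_tangent_space[OF smooth_atlas_eucl atlases(1) N(1) _ N(3)])
      (use N m0 in \<open>auto simp: eucl_def intro!: coord_vec_in_tangent_space\<close>)
  also have "G (?m 0) = u" unfolding m0 using G[OF N(2) Ptilde_one] by (simp add: ract_one)
  finally show "velocity (total_atlas \<Gamma>) (\<lambda>t. ract \<Gamma> u (cls p (?m t))) \<in> tangent_space (total_atlas \<Gamma>) u" .
qed

text \<open>Equivariance of the curvature turns derivatives along vertical constant fields into the
  algebraic action of \<open>\<pp>\<close>.\<close>

lemma fundamental_field_curvature:
  assumes A: "A \<in> gfilt p 0" and \<kappa>: "curvature p \<Gamma> u = form2 p c"
  shows "const_field \<Gamma> A u (\<lambda>w. enc p (curvature p \<Gamma> w) \<bullet> y) = - (enc p (restrict_su p (lact A (curvature p \<Gamma> u))) \<bullet> y)"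
proof -
  let ?F = "\<lambda>w. enc p (curvature p \<Gamma> w) \<bullet> y"
  have sm: "smooth_fun_at (total_atlas \<Gamma>) w ?F" for w
    using curvature_smooth unfolding smooth_fun_at_def by blast
  have nA: "- A \<in> gfilt p 0" by (rule subspace_neg[OF subspace_gfilt A])
  have F: "?F (ract \<Gamma> u (cls p (mexp (t *\<^sub>R A)))) = enc p (cj p (mexp (t *\<^sub>R (- A))) (form2 p c)) \<bullet> y" for t
    using curvature_ract[OF mexp_Ptilde[OF A], of u t] by (simp add: matrix_inv_mexp \<kappa>)
  have "((\<lambda>t. ?F (ract \<Gamma> u (cls p (mexp (t *\<^sub>R A))))) has_real_derivative
      enc p (cj p (mexp (0 *\<^sub>R (- A))) (restrict_su p (lact (- A) (form2 p c)))) \<bullet> y) (at 0)"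
    unfolding F by (rule cj_has_real_derivative[OF nA])
  then have "deriv (\<lambda>t. ?F (ract \<Gamma> u (cls p (mexp (t *\<^sub>R A))))) 0 = enc p (restrict_su p (lact (- A) (form2 p c))) \<bullet> y"
    by (simp add: DERIV_imp_deriv mexp_zero cj_one)
  also have "restrict_su p (lact (- A) (form2 p c)) = (\<lambda>X Y. (-1) *\<^sub>R restrict_su p (lact A (form2 p c)) X Y)"
    unfolding form2_restrict lact_restrict[OF gfilt_su[OF A]] lact_restrict[OF gfilt_su[OF nA]]
    using bilinear_val2[of c]
    by (simp add: fun_eq_iff restrict_su_def lact_def mbracket_linear bilinear_lneg bilinear_rneg)
  finally show ?thesis
    unfolding fundamental_field[OF A] velocity_def enc_linear using sm by (simp add: \<kappa>)
qed

text \<open>Differentiating \<open>w = \<tau> (\<pi> w, cls (\<gamma> w))\<close> along a vertical vector leaves only the derivative of \<open>\<gamma>\<close>,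
  which is tangent to the group, so the vector is tangent to an orbit of \<open>P\<close>.\<close>

lemma vertical_in_p:
  assumes v: "v \<in> tangent_space (total_atlas \<Gamma>) u" and ver: "pushforward (base_atlas \<Gamma>) (bproj \<Gamma>) u v = (\<lambda>f. 0)"
  shows "conn \<Gamma> u v \<in> gfilt p 0"
proof -
  obtain U \<tau> W \<gamma> where T: "bproj \<Gamma> u \<in> U" "open W" "u \<in> W" "\<And>w. w \<in> W \<Longrightarrow> bproj \<Gamma> w \<in> U"
    "smooth_map (total_atlas \<Gamma>) eucl W \<gamma>" "\<And>w. w \<in> W \<Longrightarrow> \<gamma> w \<in> Ptilde p"
    "\<And>w. w \<in> W \<Longrightarrow> \<tau> (bproj \<Gamma> w, cls p (\<gamma> w)) = w"
    "\<And>y g h. y \<in> U \<Longrightarrow> g \<in> Ptilde p \<Longrightarrow> h \<in> Ptilde p \<Longrightarrow> ract \<Gamma> (\<tau> (y, cls p g)) (cls p h) = \<tau> (y, cls p (g ** h))"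
    "\<And>y g. y \<in> U \<Longrightarrow> g \<in> Ptilde p \<Longrightarrow> \<exists>N F. open N \<and> (y, g) \<in> N \<and> smooth_map (prod_atlas (base_atlas \<Gamma>) eucl) (total_atlas \<Gamma>) N F \<and>
      (\<forall>y g. (y, g) \<in> N \<longrightarrow> y \<in> U \<longrightarrow> g \<in> Ptilde p \<longrightarrow> F (y, g) = \<tau> (y, cls p g))"
    by (rule trivialization[of u], rule that)
  let ?x = "bproj \<Gamma> u"
  define \<gamma>0 where "\<gamma>0 = \<gamma> u"
  have g0: "\<gamma>0 \<in> Ptilde p" unfolding \<gamma>0_def by (rule T(6)[OF T(3)])
  obtain N F where N: "open N" "(?x, \<gamma>0) \<in> N" "smooth_map (prod_atlas (base_atlas \<Gamma>) eucl) (total_atlas \<Gamma>) N F"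
    and F: "\<And>y g. (y, g) \<in> N \<Longrightarrow> y \<in> U \<Longrightarrow> g \<in> Ptilde p \<Longrightarrow> F (y, g) = \<tau> (y, cls p g)"
    using T(9)[OF T(1) g0] by blast
  have Fu: "F (?x, \<gamma>0) = u" using F[OF N(2) T(1) g0] T(7)[OF T(3)] by (simp add: \<gamma>0_def)
  obtain Uc \<phi> where c: "(Uc, \<phi>) \<in> (total_atlas \<Gamma>)" "u \<in> Uc" by (rule smooth_atlas_cover[OF atlases(1)])
  obtain Ub \<beta> where b: "(Ub, \<beta>) \<in> (base_atlas \<Gamma>)" "?x \<in> Ub" by (rule smooth_atlas_cover[OF atlases(2)])
  obtain a where a: "v = coord_vec (total_atlas \<Gamma>) (Uc, \<phi>) u a" using v tangent_space_chart[OF atlases(1) c] by auto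
  note cc = smooth_atlas_chart[OF atlases(1) c(1)] and bb = smooth_atlas_chart[OF atlases(2) b(1)]
  let ?z0 = "\<phi> u" and ?i = "inv_into Uc \<phi>"
  have iu: "?i ?z0 = u" by (rule inv_into_f_f[OF cc(4) c(2)])
  \<comment> \<open>the derivatives of the two components of the trivialization in the chart\<close>
  let ?P = "\<beta> \<circ> bproj \<Gamma> \<circ> ?i"
  have P: "(?P has_derivative frechet_derivative ?P (at ?z0)) (at ?z0)"
    using smooth_map_chart_derivative[OF atlases(1,2) open_UNIV _ atlases(3) c b] smooth_on_has_derivative by blast
  have "coord_vec (base_atlas \<Gamma>) (Ub, \<beta>) ?x (frechet_derivative ?P (at ?z0) a) = (\<lambda>f. 0)"
    using ver pushforward_coord_vec[OF atlases(1,2) open_UNIV _ atlases(3) c b] unfolding a by simp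
  moreover have "coord_vec (base_atlas \<Gamma>) (Ub, \<beta>) ?x 0 = (\<lambda>f. 0)"
    using coord_vec_linear[OF atlases(2) b, of 0 0 0 0] by simp
  ultimately have P0: "frechet_derivative ?P (at ?z0) a = 0"
    using coord_vec_inj[OF atlases(2) b] by metis
  have o: "open (\<phi> ` (Uc \<inter> W))" using cc(1) T(2) by (intro chart_image_open[OF atlases(1) c(1)]) auto
  have zW: "?z0 \<in> \<phi> ` (Uc \<inter> W)" using c T(3) by auto
  have G: "((\<gamma> \<circ> ?i) has_derivative frechet_derivative (\<gamma> \<circ> ?i) (at ?z0)) (at ?z0)"
    by (rule smooth_on_has_derivative[OF smooth_map_euclD[OF T(5) c(1)] zW])
  define B0 where "B0 = frechet_derivative (\<gamma> \<circ> ?i) (at ?z0) a"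
  define B where "B = matrix_inv \<gamma>0 ** B0"
  have gB: "\<gamma>0 ** B = B0" unfolding B_def by (simp add: matrix_mul_assoc Ptilde_matrix_inv(3)[OF g0])
  have line: "((\<lambda>t. ?z0 + t *\<^sub>R a) has_vector_derivative a) (at 0)"
    by (auto intro!: derivative_eq_intros)
  have chain: "((\<lambda>t. h (?z0 + t *\<^sub>R a)) has_vector_derivative D a) (at 0)"
    if "(h has_derivative D) (at ?z0)" for h :: "'f \<Rightarrow> 'x::real_normed_vector" and D
  proof -
    have "(h has_derivative D) (at (?z0 + 0 *\<^sub>R a))" using that by simp
    from has_derivative_compose[OF line[unfolded has_vector_derivative_def] this] show ?thesis
      unfolding has_vector_derivative_def by (simp add: linear_scale[OF has_derivative_linear[OF that]])
  qed
  have ev_line: "eventually (\<lambda>t. ?z0 + t *\<^sub>R a \<in> S) (nhds 0)" if "open S" "?z0 \<in> S" for S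
  proof -
    have "((\<lambda>t. ?z0 + t *\<^sub>R a) \<longlongrightarrow> ?z0 + 0 *\<^sub>R a) (nhds 0)" by (intro tendsto_intros filterlim_ident)
    from topological_tendstoD[OF this that(1)] that(2) show ?thesis by simp
  qed
  have Bp: "B \<in> gfilt p 0"
  proof (rule Ptilde_tangent)
    show "((\<lambda>t. matrix_inv \<gamma>0 ** (\<gamma> \<circ> ?i) (?z0 + t *\<^sub>R a)) has_vector_derivative B) (at 0)"
      unfolding B_def B0_def
      by (rule bounded_linear.has_vector_derivative[OF
            bounded_bilinear.bounded_linear_right[OF bounded_bilinear_matrix_mult] chain[OF G]])
    show "matrix_inv \<gamma>0 ** (\<gamma> \<circ> ?i) (?z0 + 0 *\<^sub>R a) = mat 1"
      using iu Ptilde_matrix_inv(2)[OF g0] by (simp add: \<gamma>0_def)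
    show "eventually (\<lambda>t. matrix_inv \<gamma>0 ** (\<gamma> \<circ> ?i) (?z0 + t *\<^sub>R a) \<in> Ptilde p) (nhds 0)"
      using ev_line[OF o zW]
    proof eventually_elim
      case (elim t)
      then obtain w where w: "w \<in> Uc" "w \<in> W" "?z0 + t *\<^sub>R a = \<phi> w" by auto
      then have "(\<gamma> \<circ> ?i) (?z0 + t *\<^sub>R a) = \<gamma> w" by (simp add: inv_into_f_f[OF cc(4)])
      then show ?case using Ptilde_mult[OF Ptilde_matrix_inv(1)[OF g0] T(6)[OF w(2)]] by simp
    qed
  qed
  \<comment> \<open>both vectors act on functions through the derivative of the extended trivialization\<close>
  let ?d = "map_prod \<beta> id" and ?UU = "Ub \<times> (UNIV :: 'n bmat set)"
  have d: "(?UU, ?d) \<in> prod_atlas (base_atlas \<Gamma>) eucl" using b(1) by (auto simp: prod_atlas_def eucl_def)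
  have dinj: "inj_on ?d ?UU" using map_prod_inj_on[OF bb(4), of id UNIV] by simp
  have di: "inv_into ?UU ?d (\<beta> y, g) = (y, g)" if "y \<in> Ub" for y g
    using inv_into_f_f[OF dinj, of "(y, g)"] that by simp
  let ?Fh = "\<phi> \<circ> F \<circ> inv_into ?UU ?d"
  have "(\<beta> ?x, \<gamma>0) \<in> ?d ` (?UU \<inter> N \<inter> F -` Uc)"
    using b(2) N(2) Fu c(2) by (intro image_eqI[of _ _ "(?x, \<gamma>0)"]) auto
  then have Fh: "(?Fh has_derivative frechet_derivative ?Fh (at (\<beta> ?x, \<gamma>0))) (at (\<beta> ?x, \<gamma>0))"
    by (rule smooth_on_has_derivative[OF smooth_mapD(2)[OF N(3) d c(1)]])
  have FF: "?Fh (\<beta> y, g) = \<phi> (F (y, g))" if "y \<in> Ub" for y g using di[OF that] by simp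
  have "const_field \<Gamma> B u = v"
  proof
    fix f
    show "const_field \<Gamma> B u f = v f"
    proof (cases "smooth_fun_at (total_atlas \<Gamma>) u f")
      case True
      let ?fh = "f \<circ> ?i"
      have fd: "(?fh has_derivative (\<lambda>v. coord_vec (total_atlas \<Gamma>) (Uc, \<phi>) u v f)) (at ?z0)"
        by (rule coord_vec_has_derivative[OF atlases(1) c True])
      have "?Fh (\<beta> ?x, \<gamma>0) = ?z0" using FF[OF b(2)] Fu by simp
      then have "(?fh has_derivative (\<lambda>v. coord_vec (total_atlas \<Gamma>) (Uc, \<phi>) u v f)) (at (?Fh (\<beta> ?x, \<gamma>0)))" using fd by simp
      from has_derivative_compose[OF Fh this]
      obtain DH where DH: "((\<lambda>z. ?fh (?Fh z)) has_derivative DH) (at (\<beta> ?x, \<gamma>0))" by blast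
      have H: "?fh (?Fh (\<beta> y, g)) = f (F (y, g))" if "y \<in> Ub" "F (y, g) \<in> Uc" for y g
        using FF[OF that(1)] inv_into_f_f[OF cc(4) that(2)] by (simp del: o_apply add: o_apply[of f ?i])
      have curve: "((\<lambda>t. ?fh (?Fh (k t))) has_vector_derivative DH (0, B0)) (at 0)"
        if "k 0 = (\<beta> ?x, \<gamma>0)" "(k has_vector_derivative (0, B0)) (at 0)" for k
      proof -
        have "((\<lambda>z. ?fh (?Fh z)) has_derivative DH) (at (k 0))" using DH that(1) by simp
        from has_derivative_compose[OF that(2)[unfolded has_vector_derivative_def] this] show ?thesis
          unfolding has_vector_derivative_def linear_scale[OF has_derivative_linear[OF DH]] .
      qed
      have 1: "v f = DH (0, B0)"
      proof -
        let ?k = "\<lambda>t. (?P (?z0 + t *\<^sub>R a), (\<gamma> \<circ> ?i) (?z0 + t *\<^sub>R a))"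
        have kd: "(?k has_vector_derivative (0, B0)) (at 0)"
          using has_vector_derivative_Pair[OF chain[OF P] chain[OF G]] unfolding P0 B0_def .
        have k0: "?k 0 = (\<beta> ?x, \<gamma>0)" by (simp add: iu \<gamma>0_def)
        let ?q = "\<lambda>w. (bproj \<Gamma> w, \<gamma> w)"
        have qc: "continuous_on W ?q"
          by (intro continuous_on_Pair smooth_mapD(1)[OF T(5)] continuous_on_subset[OF smooth_mapD(1)[OF atlases(3)]]) simp
        let ?Q = "Uc \<inter> (W \<inter> ?q -` (N \<inter> ?UU))"
        have "open ?Q"
          using continuous_open_preimage[OF qc T(2), of "N \<inter> ?UU"] N(1) bb(1) cc(1)
          by (simp add: open_Int open_Times)
        then have oQ: "open (\<phi> ` ?Q)" by (rule chart_image_open[OF atlases(1) c(1)]) auto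
        have zQ: "?z0 \<in> \<phi> ` ?Q" using c(2) T(3) N(2) b(2) by (auto simp: \<gamma>0_def)
        have "eventually (\<lambda>t. ?fh (?Fh (?k t)) = ?fh (?z0 + t *\<^sub>R a)) (nhds 0)"
          using ev_line[OF oQ zQ]
        proof eventually_elim
          case (elim t)
          then obtain w where w: "w \<in> Uc" "w \<in> W" "(bproj \<Gamma> w, \<gamma> w) \<in> N" "bproj \<Gamma> w \<in> Ub" "?z0 + t *\<^sub>R a = \<phi> w" by auto
          have iw: "?i (\<phi> w) = w" by (rule inv_into_f_f[OF cc(4) w(1)])
          have Fw: "F (bproj \<Gamma> w, \<gamma> w) = w" using F[OF w(3) T(4)[OF w(2)] T(6)[OF w(2)]] T(7)[OF w(2)] by simp
          have "?k t = (\<beta> (bproj \<Gamma> w), \<gamma> w)" unfolding w(5) by (simp add: iw)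
          then have "?fh (?Fh (?k t)) = f w" using H[OF w(4), of "\<gamma> w"] Fw w(1) by (simp only:)
          then show ?case unfolding w(5) by (simp add: iw)
        qed
        from has_vector_derivative_transform_nhds[OF curve[OF k0 kd] this]
        have "((\<lambda>t. ?fh (?z0 + t *\<^sub>R a)) has_vector_derivative DH (0, B0)) (at 0)" .
        from vector_derivative_unique_at[OF this chain[OF fd]] show ?thesis by (simp add: a)
      qed
      have 2: "const_field \<Gamma> B u f = DH (0, B0)"
      proof -
        let ?m = "\<lambda>t. mexp (t *\<^sub>R B)"
        let ?k = "\<lambda>t. (\<beta> ?x, \<gamma>0 ** ?m t)"
        have m: "(?m has_vector_derivative B ** ?m 0) (at 0)" by (rule mexp_has_vector_derivative)
        have gm: "((\<lambda>t. \<gamma>0 ** ?m t) has_vector_derivative B0) (at 0)"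
          using bounded_linear.has_vector_derivative[OF bounded_bilinear.bounded_linear_right[OF bounded_bilinear_matrix_mult] m, of \<gamma>0]
          by (simp add: mexp_zero gB)
        have kd: "(?k has_vector_derivative (0, B0)) (at 0)"
          by (rule has_vector_derivative_Pair[OF has_vector_derivative_const gm])
        have k0: "?k 0 = (\<beta> ?x, \<gamma>0)" by (simp add: mexp_zero)
        have oF: "open (N \<inter> F -` Uc)" by (rule continuous_open_preimage[OF smooth_mapD(1)[OF N(3)] N(1) cc(1)])
        have "((\<lambda>t. \<gamma>0 ** ?m t) \<longlongrightarrow> \<gamma>0 ** ?m 0) (nhds 0)"
          using has_vector_derivative_continuous[OF gm] unfolding isCont_def tendsto_at_iff_tendsto_nhds[of "\<lambda>t. \<gamma>0 ** ?m t" 0] .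
        then have "((\<lambda>t. (?x, \<gamma>0 ** ?m t)) \<longlongrightarrow> (?x, \<gamma>0 ** ?m 0)) (nhds 0)" by (intro tendsto_Pair tendsto_const)
        from topological_tendstoD[OF this oF]
        have "eventually (\<lambda>t. (?x, \<gamma>0 ** ?m t) \<in> N \<inter> F -` Uc) (nhds 0)" using N(2) Fu c(2) by (simp add: mexp_zero)
        then have "eventually (\<lambda>t. ?fh (?Fh (?k t)) = f (ract \<Gamma> u (cls p (?m t)))) (nhds 0)"
        proof eventually_elim
          case (elim t)
          then have e: "(?x, \<gamma>0 ** ?m t) \<in> N" "F (?x, \<gamma>0 ** ?m t) \<in> Uc" by auto
          have mt: "?m t \<in> Ptilde p" by (rule mexp_Ptilde[OF Bp])
          have "F (?x, \<gamma>0 ** ?m t) = \<tau> (?x, cls p (\<gamma>0 ** ?m t))" by (rule F[OF e(1) T(1) Ptilde_mult[OF g0 mt]])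
          also have "\<dots> = ract \<Gamma> u (cls p (?m t))"
            using T(8)[OF T(1) g0 mt] T(7)[OF T(3)] by (simp add: \<gamma>0_def)
          finally show ?case using H[OF b(2) e(2)] by (simp only:)
        qed
        from has_vector_derivative_transform_nhds[OF curve[OF k0 kd] this]
        have "((\<lambda>t. f (ract \<Gamma> u (cls p (?m t)))) has_real_derivative DH (0, B0)) (at 0)"
          by (simp add: has_real_derivative_iff_has_vector_derivative)
        moreover have "ract \<Gamma> u (cls p (?m 0)) = u" by (simp add: mexp_zero ract_one)
        ultimately show ?thesis
          using True by (simp add: fundamental_field[OF Bp] velocity_def DERIV_imp_deriv)
      qed
      show ?thesis using 1 2 by simp
    next
      case False
      then show ?thesis
        using tangent_vector_not_smooth[OF v] tangent_vector_not_smooth[OF const_field(1)[OF gfilt_su[OF Bp]]] by simp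
    qed
  qed
  then have "conn \<Gamma> u v = B" using const_field(2)[OF gfilt_su[OF Bp], of u] by simp
  then show ?thesis using Bp by simp
qed

section \<open>Frames and local automorphisms\<close>

lemma frame_tangent: "X \<in> su p \<Longrightarrow> frame \<Gamma> u X \<in> tangent_space (base_atlas \<Gamma>) (bproj \<Gamma> u)"
  unfolding frame_def by (rule pushforward_in_tangent_space[OF atlases(1,2) open_UNIV _ atlases(3) const_field(1)]) auto

lemma frame_linear:
  assumes "X \<in> su p" "Y \<in> su p"
  shows "frame \<Gamma> u (a *\<^sub>R X + b *\<^sub>R Y) = (\<lambda>f. a * frame \<Gamma> u X f + b * frame \<Gamma> u Y f)"
  unfolding frame_def const_field_linear[OF assms] by (rule pushforward_linear)

lemma frame_kernel:
  assumes "X \<in> su p" "frame \<Gamma> u X = (\<lambda>f. 0)"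
  shows "X \<in> gfilt p 0"
  using vertical_in_p[OF const_field(1)[OF assms(1)], of u] assms(2) const_field(2)[OF assms(1), of u] by (simp add: frame_def)

text \<open>The projection is invariant under right translations, which transform constant fields by the adjoint
  action.\<close>

lemma frame_ract:
  assumes g: "g \<in> Ptilde p" and X: "X \<in> su p"
  shows "frame \<Gamma> (ract \<Gamma> u (cls p g)) X = frame \<Gamma> u (g ** X ** matrix_inv g)"
proof -
  let ?X = "g ** X ** matrix_inv g" and ?R = "\<lambda>w. ract \<Gamma> w (cls p g)"
  have "matrix_inv g ** ?X ** g = (matrix_inv g ** g) ** X ** (matrix_inv g ** g)" by (simp only: matrix_mul_assoc)
  then have e: "matrix_inv g ** ?X ** g = X" by (simp add: Ptilde_matrix_inv(2)[OF g])
  have "const_field \<Gamma> X (?R u) = pushforward (total_atlas \<Gamma>) ?R u (const_field \<Gamma> ?X u)"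
    using const_field_ract[OF g adjoint_su_Ptilde(1)[OF g X], of u] unfolding e by simp
  then have "frame \<Gamma> (?R u) X = pushforward (base_atlas \<Gamma>) (bproj \<Gamma>) (?R u) (pushforward (total_atlas \<Gamma>) ?R u (const_field \<Gamma> ?X u))"
    by (simp add: frame_def)
  also have "\<dots> = pushforward (base_atlas \<Gamma>) (bproj \<Gamma> \<circ> ?R) u (const_field \<Gamma> ?X u)"
    by (rule pushforward_compose[OF atlases(1,2) open_UNIV UNIV_I atlases(3)])
  also have "bproj \<Gamma> \<circ> ?R = bproj \<Gamma>" using bproj_ract[OF g] by (simp add: fun_eq_iff)
  finally show ?thesis by (simp add: frame_def)
qed

lemma local_automorphismD:
  assumes "local_automorphism p \<Gamma> W s \<phi>" "open W"
  shows "open (bproj \<Gamma> -` W)" "smooth_map (total_atlas \<Gamma>) (total_atlas \<Gamma>) (bproj \<Gamma> -` W) \<phi>"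
    "\<And>u. bproj \<Gamma> u \<in> W \<Longrightarrow> bproj \<Gamma> (\<phi> u) = s (bproj \<Gamma> u)"
    "\<And>u v. bproj \<Gamma> u \<in> W \<Longrightarrow> v \<in> tangent_space (total_atlas \<Gamma>) u \<Longrightarrow> conn \<Gamma> (\<phi> u) (pushforward (total_atlas \<Gamma>) \<phi> u v) = conn \<Gamma> u v"
  using assms open_vimage[OF assms(2) smooth_mapD(1)[OF atlases(3)]]
  unfolding local_automorphism_def by auto

lemma automorphism_related:
  assumes \<phi>: "local_automorphism p \<Gamma> W s \<phi>" and W: "open W" and u: "bproj \<Gamma> u \<in> W"
  shows "X \<in> su p \<Longrightarrow> pushforward (total_atlas \<Gamma>) \<phi> u (const_field \<Gamma> X u) = const_field \<Gamma> X (\<phi> u)"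
    and "curvature p \<Gamma> (\<phi> u) = cj p (mat 1) (curvature p \<Gamma> u)"
proof -
  note D = local_automorphismD[OF \<phi> W]
  have i: "matrix_inv (mat 1) = (mat 1 :: 'n bmat)" by (simp add: matrix_inv_eq)
  have c: "conn \<Gamma> (\<phi> w) (pushforward (total_atlas \<Gamma>) \<phi> w v) = matrix_inv (mat 1) ** conn \<Gamma> w v ** mat 1"
    if "w \<in> bproj \<Gamma> -` W" "v \<in> tangent_space (total_atlas \<Gamma>) w" for w v
    using D(4)[of w v] that by (simp add: i)
  have u': "u \<in> bproj \<Gamma> -` W" using u by simp
  show "pushforward (total_atlas \<Gamma>) \<phi> u (const_field \<Gamma> X u) = const_field \<Gamma> X (\<phi> u)" if "X \<in> su p"
    using related_const_field[OF D(1) u' D(2) Ptilde_one c that] by (simp add: i)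
  show "curvature p \<Gamma> (\<phi> u) = cj p (mat 1) (curvature p \<Gamma> u)"
    using related_curvature[OF D(1) u' D(2) Ptilde_one c] by (simp add: i)
qed

lemma frame_automorphism:
  assumes \<phi>: "local_automorphism p \<Gamma> W s \<phi>" and s: "local_diffeo (base_atlas \<Gamma>) W s" and u: "bproj \<Gamma> u \<in> W" and X: "X \<in> su p"
  shows "frame \<Gamma> (\<phi> u) X = pushforward (base_atlas \<Gamma>) s (bproj \<Gamma> u) (frame \<Gamma> u X)"
proof -
  have W: "open W" "smooth_map (base_atlas \<Gamma>) (base_atlas \<Gamma>) W s" using s by (auto simp: local_diffeo_def)
  note D = local_automorphismD[OF \<phi> W(1)]
  have u': "u \<in> bproj \<Gamma> -` W" using u by simp
  have "frame \<Gamma> (\<phi> u) X = pushforward (base_atlas \<Gamma>) (bproj \<Gamma>) (\<phi> u) (pushforward (total_atlas \<Gamma>) \<phi> u (const_field \<Gamma> X u))"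
    by (simp add: frame_def automorphism_related(1)[OF \<phi> W(1) u X])
  also have "\<dots> = pushforward (base_atlas \<Gamma>) (bproj \<Gamma> \<circ> \<phi>) u (const_field \<Gamma> X u)"
    by (rule pushforward_compose[OF atlases(1,2) open_UNIV UNIV_I atlases(3)])
  also have "\<dots> = pushforward (base_atlas \<Gamma>) (s \<circ> bproj \<Gamma>) u (const_field \<Gamma> X u)"
    by (rule pushforward_cong[OF atlases(1) const_field(1)[OF X] D(1) u']) (simp add: D(3))
  also have "\<dots> = pushforward (base_atlas \<Gamma>) s (bproj \<Gamma> u) (frame \<Gamma> u X)"
    unfolding frame_def
    by (rule pushforward_compose[where f = "bproj \<Gamma>" and x = u, OF atlases(2,2) W(1) u W(2), symmetric])
  finally show ?thesis .
qed

text \<open>The section of the trivialization through \<open>u\<close> with constant group component.\<close>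

lemma local_section:
  obtains Q \<sigma> where "open Q" "bproj \<Gamma> u \<in> Q" "smooth_map (base_atlas \<Gamma>) (total_atlas \<Gamma>) Q \<sigma>" "\<sigma> (bproj \<Gamma> u) = u"
    "\<And>y. y \<in> Q \<Longrightarrow> bproj \<Gamma> (\<sigma> y) = y"
proof -
  obtain U W and \<tau> :: "'m \<times> 'n bmat set \<Rightarrow> 'g" and \<gamma> :: "'g \<Rightarrow> 'n bmat"
    where T: "open U" "bproj \<Gamma> u \<in> U" "u \<in> W" "\<And>w. w \<in> W \<Longrightarrow> \<gamma> w \<in> Ptilde p"
    "\<And>w. w \<in> W \<Longrightarrow> \<tau> (bproj \<Gamma> w, cls p (\<gamma> w)) = w"
    "\<And>y g. y \<in> U \<Longrightarrow> g \<in> Ptilde p \<Longrightarrow> bproj \<Gamma> (\<tau> (y, cls p g)) = y"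
    "\<And>y g. y \<in> U \<Longrightarrow> g \<in> Ptilde p \<Longrightarrow> \<exists>N F. open N \<and> (y, g) \<in> N \<and> smooth_map (prod_atlas (base_atlas \<Gamma>) eucl) (total_atlas \<Gamma>) N F \<and>
      (\<forall>y g. (y, g) \<in> N \<longrightarrow> y \<in> U \<longrightarrow> g \<in> Ptilde p \<longrightarrow> F (y, g) = \<tau> (y, cls p g))"
    by (rule trivialization[of u], rule that)
  have g: "\<gamma> u \<in> Ptilde p" by (rule T(4)[OF T(3)])
  obtain N F where N: "open N" "(bproj \<Gamma> u, \<gamma> u) \<in> N" "smooth_map (prod_atlas (base_atlas \<Gamma>) eucl) (total_atlas \<Gamma>) N F"
    and F: "\<And>y g. (y, g) \<in> N \<Longrightarrow> y \<in> U \<Longrightarrow> g \<in> Ptilde p \<Longrightarrow> F (y, g) = \<tau> (y, cls p g)"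
    using T(7)[OF T(2) g] by blast
  let ?k = "\<lambda>y. (y, \<gamma> u)"
  have k: "smooth_map (base_atlas \<Gamma>) (prod_atlas (base_atlas \<Gamma>) eucl) U ?k"
    by (rule smooth_map_Pair[OF atlases(2) chart_covers(2) chart_cover_eucl T(1) smooth_map_subset[OF smooth_map_id[OF atlases(2)]]
          smooth_map_const[OF atlases(2) T(1)]]) simp
  let ?Q = "U \<inter> ?k -` N"
  have Q: "open ?Q" by (rule continuous_open_preimage[OF smooth_mapD(1)[OF k] T(1) N(1)])
  show ?thesis
  proof (rule that[OF Q])
    show "bproj \<Gamma> u \<in> ?Q" using T(2) N(2) by simp
    show "smooth_map (base_atlas \<Gamma>) (total_atlas \<Gamma>) ?Q (F \<circ> ?k)"
      by (rule smooth_map_compose[OF atlases(2) chart_cover_prod[OF chart_covers(2) chart_cover_eucl] chart_covers(1) Q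
            smooth_map_subset[OF k] N(3)]) auto
    show "(F \<circ> ?k) (bproj \<Gamma> u) = u" using F[OF N(2) T(2) g] T(5)[OF T(3)] by simp
    fix y assume "y \<in> ?Q"
    then show "bproj \<Gamma> ((F \<circ> ?k) y) = y" using F[of y "\<gamma> u"] g T(6)[of y "\<gamma> u"] by simp
  qed
qed

text \<open>In charts, two automorphisms with the same value at \<open>u\<close> solve the same ordinary differential equation
  along every ray from \<open>u\<close>, hence agree near \<open>u\<close>.\<close>

lemma automorphism_rigid:
  assumes \<phi>1: "local_automorphism p \<Gamma> W1 s1 \<phi>1" "open W1" "bproj \<Gamma> u \<in> W1"
    and \<phi>2: "local_automorphism p \<Gamma> W2 s2 \<phi>2" "open W2" "bproj \<Gamma> u \<in> W2"
    and eq: "\<phi>1 u = \<phi>2 u"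
  shows "eventually (\<lambda>w. \<phi>1 w = \<phi>2 w) (nhds u)"
proof -
  obtain U \<phi> where c: "(U, \<phi>) \<in> (total_atlas \<Gamma>)" "u \<in> U" by (rule smooth_atlas_cover[OF atlases(1)])
  obtain V \<psi> where d: "(V, \<psi>) \<in> (total_atlas \<Gamma>)" "\<phi>1 u \<in> V" by (rule smooth_atlas_cover[OF atlases(1)])
  obtain a where a: "\<And>X. X \<in> su p \<Longrightarrow> smooth_on (\<psi> ` V) (a X)"
    "\<And>X y. X \<in> su p \<Longrightarrow> y \<in> V \<Longrightarrow> const_field \<Gamma> X y = coord_vec (total_atlas \<Gamma>) (V, \<psi>) y (a X (\<psi> y))"
    by (rule const_field_chart[OF d(1)], rule that)
  note cc = smooth_atlas_chart[OF atlases(1) c(1)] and dd = smooth_atlas_chart[OF atlases(1) d(1)]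
  let ?i = "inv_into U \<phi>"
  \<comment> \<open>the coordinate expression \<open>y\<close> of an automorphism satisfies \<open>Dy(z) v = a (L z v) (y z)\<close>, because both sides
    have the same value under the connection\<close>
  define L where "L = (\<lambda>z v. conn \<Gamma> (?i z) (coord_vec (total_atlas \<Gamma>) (U, \<phi>) (?i z) v))"
  have Lsu: "L z v \<in> su p" if "z \<in> \<phi> ` U" for z v
    unfolding L_def by (intro conn_su coord_vec_in_tangent_space[OF c(1)] inv_into_into that)
  have Lsm: "smooth_on (\<phi> ` U) (\<lambda>z. L z v)" for v
    using smooth_map_euclD[OF conn_facts(1)[OF coordinate_field[OF c(1), of v]] c(1)]
    by (simp add: L_def comp_def)
  obtain B where B: "B \<subseteq> su p" "pairwise orthogonal B" "\<And>x. x \<in> B \<Longrightarrow> norm x = 1"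
    "independent B" "span B = (su p :: 'n bmat set)"
    by (rule orthonormal_basis_subspace[OF subspace_su]) blast
  have fB: "finite B" using B(4) by (rule independent_imp_finite)
  \<comment> \<open>\<open>a X\<close> is linear in \<open>X\<close>, so Lipschitz constants for a basis of \<open>\<gg>\<close> suffice\<close>
  have aB: "a X (\<psi> y) = (\<Sum>b\<in>B. (X \<bullet> b) *\<^sub>R a b (\<psi> y))" if X: "X \<in> su p" and y: "y \<in> V" for X y
  proof -
    have lin: "const_field \<Gamma> (\<Sum>b\<in>B'. r b *\<^sub>R b) y = coord_vec (total_atlas \<Gamma>) (V, \<psi>) y (\<Sum>b\<in>B'. r b *\<^sub>R a b (\<psi> y))"
      if "finite B'" "B' \<subseteq> B" for B' r
      using that
    proof (induction B' rule: finite_induct)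
      case empty
      have "const_field \<Gamma> (0 *\<^sub>R 0 + 0 *\<^sub>R 0) y = (\<lambda>f. 0)"
        using const_field_linear[OF subspace_0[OF subspace_su] subspace_0[OF subspace_su], of 0 0 y] by simp
      moreover have "coord_vec (total_atlas \<Gamma>) (V, \<psi>) y (0 *\<^sub>R 0 + 0 *\<^sub>R 0) = (\<lambda>f. 0)"
        using coord_vec_linear[OF atlases(1) d(1) y, of 0 0 0 0] by simp
      ultimately show ?case by simp
    next
      case (insert b B')
      have b: "b \<in> su p" "(\<Sum>b\<in>B'. r b *\<^sub>R b) \<in> su p"
        using insert.prems B(1) by (auto intro!: subspace_sum[OF subspace_su] subspace_scale[OF subspace_su])
      have "const_field \<Gamma> (r b *\<^sub>R b + 1 *\<^sub>R (\<Sum>b\<in>B'. r b *\<^sub>R b)) y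
        = (\<lambda>f. r b * coord_vec (total_atlas \<Gamma>) (V, \<psi>) y (a b (\<psi> y)) f + 1 * coord_vec (total_atlas \<Gamma>) (V, \<psi>) y (\<Sum>b\<in>B'. r b *\<^sub>R a b (\<psi> y)) f)"
        using insert.IH insert.prems unfolding const_field_linear[OF b] a(2)[OF b(1) y] by simp
      also have "\<dots> = coord_vec (total_atlas \<Gamma>) (V, \<psi>) y (r b *\<^sub>R a b (\<psi> y) + 1 *\<^sub>R (\<Sum>b\<in>B'. r b *\<^sub>R a b (\<psi> y)))"
        by (rule coord_vec_linear[OF atlases(1) d(1) y, symmetric])
      finally show ?case using insert.hyps by simp
    qed
    have "(\<Sum>b\<in>B. (X \<bullet> b) *\<^sub>R b) = X"
      by (rule orthonormal_basis_expand[OF B(2,3) _ fB]) (simp_all add: B(5) X)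
    with lin[OF fB order_refl, of "\<lambda>b. X \<bullet> b"] a(2)[OF X y]
    have "coord_vec (total_atlas \<Gamma>) (V, \<psi>) y (a X (\<psi> y)) = coord_vec (total_atlas \<Gamma>) (V, \<psi>) y (\<Sum>b\<in>B. (X \<bullet> b) *\<^sub>R a b (\<psi> y))" by simp
    then show ?thesis by (rule coord_vec_inj[OF atlases(1) d(1) y])
  qed
  let ?y = "\<lambda>f. \<psi> \<circ> f \<circ> ?i"
  have loc: "\<exists>E. open E \<and> \<phi> u \<in> E \<and> E \<subseteq> \<phi> ` U \<and> (\<forall>z\<in>E. ?i z \<in> U \<and> f (?i z) \<in> V \<and>
      (\<forall>v. (?y f has_derivative frechet_derivative (?y f) (at z)) (at z) \<and>
        frechet_derivative (?y f) (at z) v = a (L z v) (?y f z)))"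
    if f: "local_automorphism p \<Gamma> W s f" "open W" "bproj \<Gamma> u \<in> W" "f u \<in> V" for W s f
  proof -
    note D = local_automorphismD[OF f(1,2)]
    let ?E = "\<phi> ` (U \<inter> (bproj \<Gamma> -` W) \<inter> f -` V)"
    have u': "u \<in> bproj \<Gamma> -` W" using f(3) by simp
    note E = smooth_map_chart_derivative[OF atlases(1,1) D(1) u' D(2) c d(1) f(4)]
    have "?i z \<in> U \<and> f (?i z) \<in> V \<and> (\<forall>v. (?y f has_derivative frechet_derivative (?y f) (at z)) (at z) \<and>
        frechet_derivative (?y f) (at z) v = a (L z v) (?y f z))" if z: "z \<in> ?E" for z
    proof -
      obtain w where w: "w \<in> U" "bproj \<Gamma> w \<in> W" "f w \<in> V" "z = \<phi> w" using z by auto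
      have iw: "?i z = w" unfolding w(4) by (rule inv_into_f_f[OF cc(4) w(1)])
      have w': "w \<in> bproj \<Gamma> -` W" using w(2) by simp
      have "frechet_derivative (?y f) (at z) v = a (L z v) (?y f z)" for v
      proof -
        let ?v = "coord_vec (total_atlas \<Gamma>) (U, \<phi>) w v"
        have t: "?v \<in> tangent_space (total_atlas \<Gamma>) w" by (rule coord_vec_in_tangent_space[OF c(1) w(1)])
        have Lv: "L z v = conn \<Gamma> w ?v" by (simp add: L_def iw)
        have "pushforward (total_atlas \<Gamma>) f w ?v = const_field \<Gamma> (L z v) (f w)"
          by (rule const_field_eqI[symmetric])
            (auto simp: D(4)[OF w(2) t] Lv intro: pushforward_in_tangent_space[OF atlases(1,1) D(1) w' D(2) t])
        also have "\<dots> = coord_vec (total_atlas \<Gamma>) (V, \<psi>) (f w) (a (L z v) (\<psi> (f w)))"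
          by (rule a(2)[OF _ w(3)]) (use Lsu w in auto)
        also have "pushforward (total_atlas \<Gamma>) f w ?v = coord_vec (total_atlas \<Gamma>) (V, \<psi>) (f w) (frechet_derivative (?y f) (at z) v)"
          unfolding w(4) by (rule pushforward_coord_vec[OF atlases(1,1) D(1) w' D(2) c(1) w(1) d(1) w(3)])
        finally show ?thesis using coord_vec_inj[OF atlases(1) d(1) w(3)] by (simp add: iw)
      qed
      then show ?thesis using smooth_on_has_derivative[OF E(3) z] w iw by simp
    qed
    then show ?thesis using E(1,2) by (intro exI[of _ ?E]) auto
  qed
  obtain E1 where E1: "open E1" "\<phi> u \<in> E1" "E1 \<subseteq> \<phi> ` U" "\<And>z. z \<in> E1 \<Longrightarrow> ?i z \<in> U \<and> \<phi>1 (?i z) \<in> V"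
    "\<And>z. z \<in> E1 \<Longrightarrow> (?y \<phi>1 has_derivative frechet_derivative (?y \<phi>1) (at z)) (at z)"
    "\<And>z v. z \<in> E1 \<Longrightarrow> frechet_derivative (?y \<phi>1) (at z) v = a (L z v) (?y \<phi>1 z)"
    using loc[OF \<phi>1 d(2)] by (metis (no_types, lifting))
  obtain E2 where E2: "open E2" "\<phi> u \<in> E2" "\<And>z. z \<in> E2 \<Longrightarrow> \<phi>2 (?i z) \<in> V"
    "\<And>z. z \<in> E2 \<Longrightarrow> (?y \<phi>2 has_derivative frechet_derivative (?y \<phi>2) (at z)) (at z)"
    "\<And>z v. z \<in> E2 \<Longrightarrow> frechet_derivative (?y \<phi>2) (at z) v = a (L z v) (?y \<phi>2 z)"
    using loc[OF \<phi>2] d(2) eq by (metis (no_types, lifting))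
  let ?z0 = "\<phi> u" and ?e = "\<psi> (\<phi>1 u)"
  have iu: "?i ?z0 = u" by (rule inv_into_f_f[OF cc(4) c(2)])
  have "\<forall>b\<in>B. \<exists>r C. r > 0 \<and> ball ?e r \<subseteq> \<psi> ` V \<and>
      (\<forall>y\<in>ball ?e r. \<forall>z\<in>ball ?e r. norm (a b y - a b z) \<le> C * norm (y - z))"
  proof
    fix b assume "b \<in> B"
    then have "b \<in> su p" using B(1) by blast
    from smooth_on_locally_Lipschitz[OF a(1)[OF this] dd(2)] d(2)
    show "\<exists>r C. r > 0 \<and> ball ?e r \<subseteq> \<psi> ` V \<and>
      (\<forall>y\<in>ball ?e r. \<forall>z\<in>ball ?e r. norm (a b y - a b z) \<le> C * norm (y - z))" by (metis imageI)
  qed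
  then obtain r C where rC: "\<And>b. b \<in> B \<Longrightarrow> r b > 0"
    "\<And>b y z. b \<in> B \<Longrightarrow> y \<in> ball ?e (r b) \<Longrightarrow> z \<in> ball ?e (r b) \<Longrightarrow> norm (a b y - a b z) \<le> C b * norm (y - z)"
    by (metis (no_types, lifting))
  define \<rho> where "\<rho> = Min (insert 1 (r ` B))"
  have \<rho>: "\<rho> > 0" "\<And>b. b \<in> B \<Longrightarrow> \<rho> \<le> r b" using rC(1) fB by (auto simp: \<rho>_def)
  have near: "eventually (\<lambda>z. ?y f z \<in> ball ?e \<rho>) (nhds ?z0)"
    if "(?y f has_derivative frechet_derivative (?y f) (at ?z0)) (at ?z0)" "f u = \<phi>1 u" for f
  proof -
    have "isCont (?y f) ?z0" using has_derivative_continuous[OF that(1)] .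
    then have "(?y f \<longlongrightarrow> ?y f ?z0) (nhds ?z0)" unfolding isCont_def tendsto_at_iff_tendsto_nhds[of "?y f" ?z0] .
    from topological_tendstoD[OF this open_ball, of ?e \<rho>] show ?thesis using that(2) iu \<rho>(1) by simp
  qed
  have "eventually (\<lambda>z. z \<in> E1 \<and> z \<in> E2 \<and> ?y \<phi>1 z \<in> ball ?e \<rho> \<and> ?y \<phi>2 z \<in> ball ?e \<rho>) (nhds ?z0)"
    using eventually_nhds_in_open[OF E1(1,2)] eventually_nhds_in_open[OF E2(1,2)]
      near[OF E1(5)[OF E1(2)] refl] near[OF E2(4)[OF E2(2)] eq[symmetric]]
    by eventually_elim auto
  then obtain R where R: "R > 0" "\<And>z. dist z ?z0 < R \<Longrightarrow> z \<in> E1 \<and> z \<in> E2 \<and> ?y \<phi>1 z \<in> ball ?e \<rho> \<and> ?y \<phi>2 z \<in> ball ?e \<rho>"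
    unfolding eventually_nhds_metric by blast
  have agree: "?y \<phi>1 z = ?y \<phi>2 z" if z: "dist z ?z0 < R" for z
  proof -
    define v where "v = z - ?z0"
    have ray: "dist (?z0 + t *\<^sub>R v) ?z0 < R" if "0 \<le> t" "t \<le> 1" for t
    proof -
      have "dist (?z0 + t *\<^sub>R v) ?z0 = t * norm v" using that by (simp add: dist_norm)
      also have "\<dots> \<le> norm v" using that by (simp add: mult_left_le_one_le)
      finally show ?thesis using z by (simp add: v_def dist_norm)
    qed
    let ?l = "\<lambda>t. ?z0 + t *\<^sub>R v"
    define g where "g = (\<lambda>t. ?y \<phi>1 (?l t) - ?y \<phi>2 (?l t))"
    define g' where "g' = (\<lambda>t. a (L (?l t) v) (?y \<phi>1 (?l t)) - a (L (?l t) v) (?y \<phi>2 (?l t)))"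
    have gd: "(g has_vector_derivative g' t) (at t)" if t: "0 \<le> t" "t \<le> 1" for t
    proof -
      note Rt = R(2)[OF ray[OF t]]
      have l: "(?l has_vector_derivative v) (at t)" by (auto intro!: derivative_eq_intros)
      have *: "((\<lambda>t. h (?l t)) has_vector_derivative D v) (at t)" if "(h has_derivative D) (at (?l t))" for h :: "'f \<Rightarrow> 'f" and D
        using has_derivative_compose[OF l[unfolded has_vector_derivative_def] that]
        unfolding has_vector_derivative_def by (simp add: linear_scale[OF has_derivative_linear[OF that]])
      have "(g has_vector_derivative (frechet_derivative (?y \<phi>1) (at (?l t)) v - frechet_derivative (?y \<phi>2) (at (?l t)) v)) (at t)"
        unfolding g_def using Rt by (intro has_vector_derivative_diff * E1(5) E2(4)) auto
      then show ?thesis using E1(6)[of "?l t" v] E2(5)[of "?l t" v] Rt by (simp only: g'_def)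
    qed
    have "continuous_on {0..1} (\<lambda>t. L (?l t) v)"
    proof (rule continuous_on_compose2[OF smooth_on_continuous[OF Lsm]])
      show "continuous_on {0..1} ?l" by (intro continuous_intros)
      show "?l ` {0..1} \<subseteq> \<phi> ` U" using R(2)[OF ray] E1(3) by auto
    qed
    then have "compact ((\<lambda>t. L (?l t) v) ` {0..1})" by (intro compact_continuous_image compact_Icc)
    from compact_imp_bounded[OF this] obtain K where K': "\<forall>X\<in>(\<lambda>t. L (?l t) v) ` {0..1}. norm X \<le> K"
      unfolding bounded_iff by blast
    have K: "norm (L (?l t) v) \<le> K" if "0 \<le> t" "t \<le> 1" for t
      using K' that by simp
    have K0: "K \<ge> 0" by (rule order_trans[OF norm_ge_zero K[of 0]]) simp_all
    have g'b: "norm (g' t) \<le> (\<Sum>b\<in>B. K * C b) * norm (g t)" if t: "0 \<le> t" "t \<le> 1" for t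
    proof -
      note Rt = R(2)[OF ray[OF t]]
      have zU: "?l t \<in> \<phi> ` U" using Rt E1(3) by auto
      let ?X = "L (?l t) v"
      have e1: "a ?X (?y \<phi>1 (?l t)) = (\<Sum>b\<in>B. (?X \<bullet> b) *\<^sub>R a b (?y \<phi>1 (?l t)))"
        unfolding o_apply by (rule aB[OF Lsu[OF zU]]) (use E1(4) Rt in blast)
      have e2: "a ?X (?y \<phi>2 (?l t)) = (\<Sum>b\<in>B. (?X \<bullet> b) *\<^sub>R a b (?y \<phi>2 (?l t)))"
        unfolding o_apply by (rule aB[OF Lsu[OF zU]]) (use E2(3) Rt in blast)
      have s: "g' t = (\<Sum>b\<in>B. (?X \<bullet> b) *\<^sub>R (a b (?y \<phi>1 (?l t)) - a b (?y \<phi>2 (?l t))))"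
        unfolding g'_def e1 e2 by (simp add: sum_subtractf scaleR_diff_right)
      have "norm (g' t) \<le> (\<Sum>b\<in>B. norm ((?X \<bullet> b) *\<^sub>R (a b (?y \<phi>1 (?l t)) - a b (?y \<phi>2 (?l t)))))"
        unfolding s by (rule norm_sum)
      also have "\<dots> \<le> (\<Sum>b\<in>B. K * C b * norm (g t))"
      proof (rule sum_mono)
        fix b assume b: "b \<in> B"
        have "?y \<phi>1 (?l t) \<in> ball ?e (r b)" "?y \<phi>2 (?l t) \<in> ball ?e (r b)"
          using Rt \<rho>(2)[OF b] by (auto simp del: o_apply)
        from rC(2)[OF b this] have n: "norm (a b (?y \<phi>1 (?l t)) - a b (?y \<phi>2 (?l t))) \<le> C b * norm (g t)"
          by (simp only: g_def)
        have "\<bar>?X \<bullet> b\<bar> \<le> norm ?X * norm b" by (rule Cauchy_Schwarz_ineq2)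
        then have "\<bar>?X \<bullet> b\<bar> \<le> K" using K[OF t] B(3)[OF b] by simp
        then have "\<bar>?X \<bullet> b\<bar> * norm (a b (?y \<phi>1 (?l t)) - a b (?y \<phi>2 (?l t))) \<le> K * (C b * norm (g t))"
          by (rule mult_mono[OF _ n K0 norm_ge_zero])
        then show "norm ((?X \<bullet> b) *\<^sub>R (a b (?y \<phi>1 (?l t)) - a b (?y \<phi>2 (?l t)))) \<le> K * C b * norm (g t)"
          by (simp only: norm_scaleR mult.assoc)
      qed
      also have "\<dots> = (\<Sum>b\<in>B. K * C b) * norm (g t)" by (simp only: sum_distrib_right)
      finally show ?thesis .
    qed
    have "g 0 = 0" by (simp add: g_def iu eq)
    from Gronwall_zero[OF gd g'b this] show ?thesis by (simp add: g_def v_def)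
  qed
  have o: "open (U \<inter> \<phi> -` ball ?z0 R)" by (rule chart_preimage_open[OF atlases(1) c(1) open_ball])
  show ?thesis
    unfolding eventually_nhds
  proof (intro exI[of _ "U \<inter> \<phi> -` ball ?z0 R"] conjI o ballI)
    show "u \<in> U \<inter> \<phi> -` ball ?z0 R" using c(2) R(1) by simp
    fix w assume "w \<in> U \<inter> \<phi> -` ball ?z0 R"
    then have w: "w \<in> U" "dist (\<phi> w) ?z0 < R" by (auto simp: dist_commute)
    have iw: "?i (\<phi> w) = w" by (rule inv_into_f_f[OF cc(4) w(1)])
    have "\<phi>1 w \<in> V" "\<phi>2 w \<in> V" using R(2)[OF w(2)] E1(4)[of "\<phi> w"] E2(3)[of "\<phi> w"] by (auto simp: iw)
    moreover have "\<psi> (\<phi>1 w) = \<psi> (\<phi>2 w)" using agree[OF w(2)] by (simp add: iw)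
    ultimately show "\<phi>1 w = \<phi>2 w" using dd(4) by (auto dest: inj_onD)
  qed
qed

lemma same_germ:
  assumes \<phi>1: "local_automorphism p \<Gamma> W1 s1 \<phi>1" "open W1" "bproj \<Gamma> u \<in> W1"
    and \<phi>2: "local_automorphism p \<Gamma> W2 s2 \<phi>2" "open W2" "bproj \<Gamma> u \<in> W2"
    and eq: "\<phi>1 u = \<phi>2 u"
  shows "same_germ_at (bproj \<Gamma> u) s1 s2"
proof -
  obtain Q \<sigma> where Q: "open Q" "bproj \<Gamma> u \<in> Q" "smooth_map (base_atlas \<Gamma>) (total_atlas \<Gamma>) Q \<sigma>" "\<sigma> (bproj \<Gamma> u) = u"
    "\<And>y. y \<in> Q \<Longrightarrow> bproj \<Gamma> (\<sigma> y) = y"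
    by (rule local_section[of u], rule that)
  obtain S where S: "open S" "u \<in> S" "\<And>w. w \<in> S \<Longrightarrow> \<phi>1 w = \<phi>2 w"
    using automorphism_rigid[OF assms] unfolding eventually_nhds by blast
  have o: "open ((Q \<inter> \<sigma> -` S) \<inter> W1 \<inter> W2)"
    using continuous_open_preimage[OF smooth_mapD(1)[OF Q(3)] Q(1) S(1)] \<phi>1(2) \<phi>2(2) by auto
  show ?thesis
    unfolding same_germ_at_def eventually_nhds
  proof (intro exI[of _ "(Q \<inter> \<sigma> -` S) \<inter> W1 \<inter> W2"] conjI o ballI)
    show "bproj \<Gamma> u \<in> (Q \<inter> \<sigma> -` S) \<inter> W1 \<inter> W2" using Q S \<phi>1(3) \<phi>2(3) by simp
    fix y assume "y \<in> (Q \<inter> \<sigma> -` S) \<inter> W1 \<inter> W2"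
    then have y: "y \<in> Q" "\<sigma> y \<in> S" "y \<in> W1" "y \<in> W2" by auto
    have p: "bproj \<Gamma> (\<sigma> y) = y" by (rule Q(5)[OF y(1)])
    show "s1 y = s2 y"
      using local_automorphismD(3)[OF \<phi>1(1,2), of "\<sigma> y"] local_automorphismD(3)[OF \<phi>2(1,2), of "\<sigma> y"] y p S(3)[OF y(2)]
      by simp
  qed
qed

section \<open>Definiteness, and two symmetries with different germs\<close>

lemma frame_vector_field:
  assumes Q: "open Q" and \<sigma>: "smooth_map (base_atlas \<Gamma>) (total_atlas \<Gamma>) Q \<sigma>"
    and sec: "\<And>y. y \<in> Q \<Longrightarrow> bproj \<Gamma> (\<sigma> y) = y" and X: "X \<in> su p"
  shows "vector_field (base_atlas \<Gamma>) Q (\<lambda>y. frame \<Gamma> (\<sigma> y) X)"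
  unfolding vector_field_def
proof (intro conjI ballI allI impI Q)
  fix y assume "y \<in> Q"
  then show "frame \<Gamma> (\<sigma> y) X \<in> tangent_space (base_atlas \<Gamma>) y"
    using frame_tangent[OF X, of "\<sigma> y"] sec by simp
next
  fix V and f :: "'m \<Rightarrow> real" assume V: "open V \<and> V \<subseteq> Q \<and> smooth_map (base_atlas \<Gamma>) eucl V f"
  let ?V = "bproj \<Gamma> -` V"
  have oV: "open ?V" by (rule open_vimage[OF _ smooth_mapD(1)[OF atlases(3)]]) (use V in blast)
  have "smooth_map (total_atlas \<Gamma>) eucl ?V (f \<circ> bproj \<Gamma>)"
    by (rule smooth_map_compose[OF atlases(1) chart_covers(2) chart_cover_eucl oV smooth_map_subset[OF atlases(3)], of V])
      (use V in auto)
  then have h: "smooth_map (total_atlas \<Gamma>) eucl ?V (\<lambda>w. const_field \<Gamma> X w (f \<circ> bproj \<Gamma>))"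
    using const_field_vector_field[OF X] oV unfolding vector_field_def by blast
  have oV': "open V" and \<sigma>V: "smooth_map (base_atlas \<Gamma>) (total_atlas \<Gamma>) V \<sigma>" and sub: "\<sigma> ` V \<subseteq> ?V"
    using V sec by (auto intro: smooth_map_subset[OF \<sigma>])
  have "smooth_map (base_atlas \<Gamma>) eucl V ((\<lambda>w. const_field \<Gamma> X w (f \<circ> bproj \<Gamma>)) \<circ> \<sigma>)"
    by (rule smooth_map_compose[OF atlases(2) chart_covers(1) chart_cover_eucl oV' \<sigma>V h sub])
  then show "smooth_map (base_atlas \<Gamma>) eucl V (\<lambda>y. frame \<Gamma> (\<sigma> y) X f)"
  proof (rule smooth_map_cong[OF atlases(2) chart_cover_eucl oV'])
    fix y assume y: "y \<in> V"
    then have "smooth_fun_at (base_atlas \<Gamma>) y f" using V unfolding smooth_fun_at_def by blast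
    moreover have "bproj \<Gamma> (\<sigma> y) = y" using y V sec by blast
    ultimately show "((\<lambda>w. const_field \<Gamma> X w (f \<circ> bproj \<Gamma>)) \<circ> \<sigma>) y = frame \<Gamma> (\<sigma> y) X f"
      by (simp add: frame_def pushforward_def)
  qed
qed

lemma frame_contact:
  "X \<in> gfilt p (-1) \<Longrightarrow> frame \<Gamma> u X \<in> contact p \<Gamma> (bproj \<Gamma> u)"
  unfolding contact_def by blast

text \<open>The fields \<open>y \<mapsto> frame \<Gamma> (\<sigma> y) X\<close> along a local section \<open>\<sigma>\<close> extend the given vectors. Without such
  extensions the conditions on the Levi bracket could hold vacuously.\<close>

lemma levi_exists:
  assumes X: "X \<in> gfilt p (-1)" and Y: "Y \<in> gfilt p (-1)"
  obtains z where "levi p \<Gamma> (bproj \<Gamma> u) (frame \<Gamma> u X) (frame \<Gamma> u Y) z"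
proof -
  obtain Q \<sigma> where Q: "open Q" "bproj \<Gamma> u \<in> Q" "smooth_map (base_atlas \<Gamma>) (total_atlas \<Gamma>) Q \<sigma>" "\<sigma> (bproj \<Gamma> u) = u"
    "\<And>y. y \<in> Q \<Longrightarrow> bproj \<Gamma> (\<sigma> y) = y"
    by (rule local_section[of u], rule that)
  have c: "frame \<Gamma> (\<sigma> y) Z \<in> contact p \<Gamma> y" if "y \<in> Q" "Z \<in> gfilt p (-1)" for y Z
    using frame_contact[OF that(2), of "\<sigma> y"] Q(5)[OF that(1)] by simp
  let ?\<xi> = "\<lambda>Z y. frame \<Gamma> (\<sigma> y) Z"
  have "levi p \<Gamma> (bproj \<Gamma> u) (frame \<Gamma> u X) (frame \<Gamma> u Y) (lie_bracket (base_atlas \<Gamma>) (?\<xi> X) (?\<xi> Y) (bproj \<Gamma> u))"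
    unfolding levi_def
    by (rule exI[of _ Q], rule exI[of _ "?\<xi> X"], rule exI[of _ "?\<xi> Y"])
      (use Q c X Y in \<open>simp add: frame_vector_field[OF Q(1,3,5) gfilt_su[OF X]] frame_vector_field[OF Q(1,3,5) gfilt_su[OF Y]]\<close>)
  then show ?thesis by (rule that)
qed

text \<open>For a regular geometry the Levi bracket is the bracket of \<open>\<gg>\<^sub>-\<close>. Its value on the \<open>m\<close>-th basis vector
  \<open>X\<close> and \<open>J X\<close> is the \<open>m\<close>-th diagonal entry of \<open>\<I>\<close> times a fixed element of \<open>\<gg>\<^sub>-\<^sub>2\<close>, so strict
  pseudoconvexity makes all entries equal.\<close>

lemma definite_form:
  fixes k l :: 'n
  assumes reg: "regular_geometry p \<Gamma>" and spc: "strictly_pseudoconvex p \<Gamma>"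
  shows "sgn_entry p k = sgn_entry p l"
proof -
  obtain u :: 'g where True by simp
  let ?x = "bproj \<Gamma> u"
  obtain \<theta> :: "'m tvec \<Rightarrow> real" where lin: "linear_on_tangent (base_atlas \<Gamma>) ?x \<theta>"
    and ker: "{v \<in> tangent_space (base_atlas \<Gamma>) ?x. \<theta> v = 0} = contact p \<Gamma> ?x"
    and pos: "\<And>X z. X \<in> grad p (-1) \<Longrightarrow> X \<noteq> 0 \<Longrightarrow> levi p \<Gamma> ?x (frame \<Gamma> u X) (frame \<Gamma> u (Jmodel X)) z \<Longrightarrow> \<theta> z > 0"
  proof -
    from spc obtain \<theta> :: "'m tvec \<Rightarrow> real" where \<theta>: "linear_on_tangent (base_atlas \<Gamma>) ?x \<theta> \<and>
      {v \<in> tangent_space (base_atlas \<Gamma>) ?x. \<theta> v = 0} = contact p \<Gamma> ?x \<and>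
      (\<forall>v X z. bproj \<Gamma> v = ?x \<and> X \<in> grad p (-1) \<and> X \<noteq> 0 \<and>
        levi p \<Gamma> ?x (frame \<Gamma> v X) (frame \<Gamma> v (Jmodel X)) z \<longrightarrow> \<theta> z > 0)"
      unfolding strictly_pseudoconvex_def by (blast dest: spec[of _ ?x])
    show thesis by (rule that[of \<theta>]) (use \<theta> in simp_all)
  qed
  define t where "t = \<theta> (frame \<Gamma> u unit_minus_two)"
  have "Re (sgn_entry p m) * t > 0" for m :: 'n
  proof -
    define X :: "'n bmat" where "X = gminus p (\<lambda>k. if k = m then 1 else 0)"
    have X: "X \<in> grad p (-1)" unfolding X_def by (rule gminus_grad)
    have JX: "Jmodel X \<in> grad p (-1)" unfolding X_def Jmodel_gminus by (rule gminus_grad)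
    have "X $ BMid m $ BFst \<noteq> 0" by (simp add: X_def gminus_def)
    then have nz: "X \<noteq> 0" by auto
    obtain z where z: "levi p \<Gamma> ?x (frame \<Gamma> u X) (frame \<Gamma> u (Jmodel X)) z"
      by (rule levi_exists[OF grad_gfilt[OF X] grad_gfilt[OF JX]])
    obtain V where V: "V \<in> gfilt p (-1)" "z = frame \<Gamma> u (mbracket X (Jmodel X) + V)"
      using reg X JX z unfolding regular_geometry_def by blast
    have "z = frame \<Gamma> u (Re (sgn_entry p m) *\<^sub>R unit_minus_two + 1 *\<^sub>R V)"
      unfolding V(2) X_def bracket_Jmodel by simp
    also have "\<dots> = (\<lambda>f. Re (sgn_entry p m) * frame \<Gamma> u unit_minus_two f + 1 * frame \<Gamma> u V f)"
      by (rule frame_linear[OF unit_minus_two_su gfilt_su[OF V(1)]])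
    finally have "\<theta> z = Re (sgn_entry p m) *\<^sub>R \<theta> (frame \<Gamma> u unit_minus_two) + 1 *\<^sub>R \<theta> (frame \<Gamma> u V)"
      using lin frame_tangent[OF unit_minus_two_su, of u] frame_tangent[OF gfilt_su[OF V(1)], of u]
      unfolding linear_on_tangent_def by blast
    moreover have "\<theta> (frame \<Gamma> u V) = 0" using frame_contact[OF V(1), of u] ker by blast
    ultimately show ?thesis using pos[OF X nz z] by (simp add: t_def)
  qed
  from this[of k] this[of l] show ?thesis by (auto simp: sgn_entry_def split: if_splits)
qed

text \<open>In the frame \<open>u\<close> the differential of the symmetry on the contact distribution is the adjoint action of
  the group element that relates \<open>\<phi> u\<close> to \<open>u\<close>.\<close>

lemma symmetry_frame:
  assumes s: "symmetry_at p \<Gamma> (bproj \<Gamma> u) W s" and \<phi>: "local_automorphism p \<Gamma> W s \<phi>"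
  obtains g where "g \<in> Ptilde p" "\<phi> u = ract \<Gamma> u (cls p g)"
    "\<And>X. X \<in> gfilt p (-1) \<Longrightarrow> frame \<Gamma> u (g ** X ** matrix_inv g) = (\<lambda>f. - frame \<Gamma> u X f)"
proof -
  have d: "local_diffeo (base_atlas \<Gamma>) W s" "bproj \<Gamma> u \<in> W" "s (bproj \<Gamma> u) = bproj \<Gamma> u"
    and neg: "\<And>v. v \<in> contact p \<Gamma> (bproj \<Gamma> u) \<Longrightarrow> pushforward (base_atlas \<Gamma>) s (bproj \<Gamma> u) v = (\<lambda>f. - v f)"
    using s unfolding symmetry_at_def by auto
  have W: "open W" using d(1) by (simp add: local_diffeo_def)
  have "bproj \<Gamma> u = bproj \<Gamma> (\<phi> u)" using local_automorphismD(3)[OF \<phi> W d(2)] d(3) by simp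
  then obtain g where g: "g \<in> Ptilde p" "\<phi> u = ract \<Gamma> u (cls p g)" by (rule fibre_transitive)
  show ?thesis
  proof (rule that[OF g])
    fix X :: "'n bmat" assume X: "X \<in> gfilt p (-1)"
    have "frame \<Gamma> u (g ** X ** matrix_inv g) = frame \<Gamma> (\<phi> u) X"
      unfolding g(2) by (rule frame_ract[OF g(1) gfilt_su[OF X], symmetric])
    also have "\<dots> = (\<lambda>f. - frame \<Gamma> u X f)"
      unfolding frame_automorphism[OF \<phi> d(1,2) gfilt_su[OF X]] by (rule neg[OF frame_contact[OF X]])
    finally show "frame \<Gamma> u (g ** X ** matrix_inv g) = (\<lambda>f. - frame \<Gamma> u X f)" .
  qed
qed

text \<open>Both group elements act by \<open>-1\<close> on \<open>\<gg>\<^sup>-\<^sup>1/\<pp>\<close>, so their quotient acts trivially and comes from \<open>\<pp>\<^sub>+\<close>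
  up to the centre. By rigidity the automorphisms differ already at \<open>u\<close>.\<close>

lemma two_symmetries_translation:
  assumes s1: "symmetry_at p \<Gamma> (bproj \<Gamma> u) W1 s1" and \<phi>1: "local_automorphism p \<Gamma> W1 s1 \<phi>1"
    and s2: "symmetry_at p \<Gamma> (bproj \<Gamma> u) W2 s2" and \<phi>2: "local_automorphism p \<Gamma> W2 s2 \<phi>2"
    and diff: "\<not> same_germ_at (bproj \<Gamma> u) s1 s2"
  obtains W where "W \<in> gfilt p 1" "W \<noteq> 0" "\<phi>2 u = ract \<Gamma> (\<phi>1 u) (cls p (mexp W))"
proof -
  obtain g1 where g1: "g1 \<in> Ptilde p" "\<phi>1 u = ract \<Gamma> u (cls p g1)"
    "\<And>X. X \<in> gfilt p (-1) \<Longrightarrow> frame \<Gamma> u (g1 ** X ** matrix_inv g1) = (\<lambda>f. - frame \<Gamma> u X f)"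
    by (rule symmetry_frame[OF s1 \<phi>1], rule that)
  obtain g2 where g2: "g2 \<in> Ptilde p" "\<phi>2 u = ract \<Gamma> u (cls p g2)"
    "\<And>X. X \<in> gfilt p (-1) \<Longrightarrow> frame \<Gamma> u (g2 ** X ** matrix_inv g2) = (\<lambda>f. - frame \<Gamma> u X f)"
    by (rule symmetry_frame[OF s2 \<phi>2], rule that)
  note i1 = Ptilde_matrix_inv[OF g1(1)] and i2 = Ptilde_matrix_inv[OF g2(1)]
  define h where "h = matrix_inv g1 ** g2"
  have h: "h \<in> Ptilde p" unfolding h_def by (rule Ptilde_mult[OF i1(1) g2(1)])
  have "(matrix_inv g1 ** g2) ** (matrix_inv g2 ** g1) = matrix_inv g1 ** (g2 ** matrix_inv g2) ** g1"
    "(matrix_inv g2 ** g1) ** (matrix_inv g1 ** g2) = matrix_inv g2 ** (g1 ** matrix_inv g1) ** g2"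
    by (simp_all only: matrix_mul_assoc)
  then have hi: "matrix_inv h = matrix_inv g2 ** g1"
    unfolding h_def by (intro matrix_inv_eq) (simp_all add: i1 i2)
  have triv: "h ** X ** matrix_inv h - X \<in> gfilt p 0" if X: "X \<in> gfilt p (-1)" for X
  proof -
    let ?A1 = "g1 ** X ** matrix_inv g1" and ?A2 = "g2 ** X ** matrix_inv g2"
    have A: "?A1 \<in> su p" "?A2 \<in> su p"
      using adjoint_gfilt(1)[OF g1(1) X] adjoint_gfilt(1)[OF g2(1) X] gfilt_su by blast+
    have D: "1 *\<^sub>R ?A2 + (-1) *\<^sub>R ?A1 \<in> su p"
      by (intro subspace_add[OF subspace_su] subspace_scale[OF subspace_su] A)
    have "frame \<Gamma> u (1 *\<^sub>R ?A2 + (-1) *\<^sub>R ?A1) = (\<lambda>f. 0)"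
      unfolding frame_linear[OF A(2,1)] g1(3)[OF X] g2(3)[OF X] by simp
    from frame_kernel[OF D this] have "?A2 - ?A1 \<in> gfilt p 0" by simp
    then have "matrix_inv g1 ** (?A2 - ?A1) ** g1 \<in> gfilt p 0" by (rule adjoint_gfilt(2)[OF g1(1)])
    also have "matrix_inv g1 ** (?A2 - ?A1) ** g1 = h ** X ** matrix_inv h - (matrix_inv g1 ** g1) ** X ** (matrix_inv g1 ** g1)"
      unfolding hi unfolding h_def by (simp only: matrix_mult_diff_left matrix_mult_diff_right matrix_mul_assoc)
    finally show ?thesis by (simp add: i1)
  qed
  obtain z W where zW: "z \<in> centre (SU p)" "W \<in> gfilt p 1" "h = z ** mexp W"
    by (rule trivial_action_decomposition[OF h triv], assumption, rule that)
  have m: "mexp W \<in> Ptilde p" using mexp_Ptilde[of W p 1] gfilt_mono[OF zW(2), of 0] by simp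
  have "g1 ** h = (g1 ** matrix_inv g1) ** g2" unfolding h_def by (simp only: matrix_mul_assoc)
  then have "g2 = g1 ** h" by (simp add: i1)
  then have "\<phi>2 u = ract \<Gamma> (ract \<Gamma> u (cls p g1)) (cls p h)"
    using ract_ract[OF g1(1) h, of u] g2(2) by simp
  also have "\<dots> = ract \<Gamma> (\<phi>1 u) (cls p (mexp W))"
    unfolding zW(3) cls_central[OF zW(1) Ptilde_SU[OF m]] g1(2) ..
  finally have e: "\<phi>2 u = ract \<Gamma> (\<phi>1 u) (cls p (mexp W))" .
  have "W \<noteq> 0"
  proof
    assume "W = 0"
    then have "mexp W = mat 1" using mexp_zero by simp
    then have "\<phi>1 u = \<phi>2 u" using e by (simp add: ract_one)
    moreover have "open W1" "bproj \<Gamma> u \<in> W1" "open W2" "bproj \<Gamma> u \<in> W2"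
      using s1 s2 by (auto simp: symmetry_at_def local_diffeo_def)
    ultimately show False using same_germ[OF \<phi>1 _ _ \<phi>2] diff by blast
  qed
  then show ?thesis by (rule that[OF zW(2) _ e])
qed

lemma curvature_automorphism:
  assumes norm: "normal_geometry p \<Gamma>" and \<phi>: "local_automorphism p \<Gamma> W s \<phi>" and W: "open W" "bproj \<Gamma> u \<in> W"
  shows "curvature p \<Gamma> (\<phi> u) = curvature p \<Gamma> u"
proof -
  have "curvature p \<Gamma> u \<in> ker_codiff p" using norm by (simp add: normal_geometry_def)
  then obtain c where "curvature p \<Gamma> u = form2 p c" by (rule ker_codiffE)
  then show ?thesis using automorphism_related(2)[OF \<phi> W] by (simp add: cj_one)
qed

lemma curvature_derivative_automorphism:
  fixes y :: "'n fvec"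
  assumes norm: "normal_geometry p \<Gamma>" and \<phi>: "local_automorphism p \<Gamma> W s \<phi>" and W: "open W" "bproj \<Gamma> u \<in> W"
    and X: "X \<in> su p"
  defines "F \<equiv> \<lambda>w. enc p (curvature p \<Gamma> w) \<bullet> y"
  shows "const_field \<Gamma> X (\<phi> u) F = const_field \<Gamma> X u F"
proof -
  have sm: "smooth_fun_at (total_atlas \<Gamma>) w F" for w
    using curvature_smooth unfolding smooth_fun_at_def F_def by blast
  have "const_field \<Gamma> X (\<phi> u) F = const_field \<Gamma> X u (F \<circ> \<phi>)"
    unfolding automorphism_related(1)[OF \<phi> W X, symmetric] by (simp add: pushforward_def sm)
  also have "\<dots> = const_field \<Gamma> X u F"
    by (rule tangent_vector_germ[OF atlases(1) const_field(1)[OF X] local_automorphismD(1)[OF \<phi> W(1)]])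
      (use W in \<open>simp_all add: F_def curvature_automorphism[OF norm \<phi> W(1)]\<close>)
  finally show ?thesis .
qed

text \<open>Right translation by \<open>exp W\<close> changes the curvature only by boundaries, to which \<open>y\<close> is blind, but it
  transforms the constant fields by \<open>Ad (exp W)\<close>.\<close>

lemma curvature_derivative_pplus:
  fixes y :: "'n fvec"
  assumes norm: "normal_geometry p \<Gamma>" and W: "W \<in> gfilt p 1" and y: "annihilates p y" and X: "X \<in> su p"
  defines "F \<equiv> \<lambda>w. enc p (curvature p \<Gamma> w) \<bullet> y"
  shows "const_field \<Gamma> X (ract \<Gamma> u (cls p (mexp W))) F = const_field \<Gamma> (mexp W ** X ** mexp (- W)) u F"
proof -
  let ?m = "mexp W" and ?R = "\<lambda>w. ract \<Gamma> w (cls p (mexp W))"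
  have m: "?m \<in> Ptilde p" using mexp_Ptilde[of W p 1] gfilt_mono[OF W, of 0] by simp
  have mi: "matrix_inv ?m = mexp (- W)" using matrix_inv_mexp[of 1 W] by simp
  note i = Ptilde_matrix_inv[OF m]
  have sm: "smooth_fun_at (total_atlas \<Gamma>) w F" for w
    using curvature_smooth unfolding smooth_fun_at_def F_def by blast
  have FR: "F \<circ> ?R = F"
  proof
    fix w
    have "curvature p \<Gamma> w \<in> ker_codiff p" using norm by (simp add: normal_geometry_def)
    from cj_pplus[OF this subspace_neg[OF subspace_gfilt W] y]
    show "(F \<circ> ?R) w = F w" by (simp add: F_def curvature_ract[OF m] mi)
  qed
  have "matrix_inv ?m ** (?m ** X ** matrix_inv ?m) ** ?m = (matrix_inv ?m ** ?m) ** X ** (matrix_inv ?m ** ?m)"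
    by (simp only: matrix_mul_assoc)
  then have "matrix_inv ?m ** (?m ** X ** matrix_inv ?m) ** ?m = X" by (simp add: i)
  then have "const_field \<Gamma> X (?R u) F = pushforward (total_atlas \<Gamma>) ?R u (const_field \<Gamma> (?m ** X ** mexp (- W)) u) F"
    using const_field_ract[OF m adjoint_su_Ptilde(1)[OF m X], of u] by (simp only: mi)
  also have "\<dots> = const_field \<Gamma> (?m ** X ** mexp (- W)) u (F \<circ> ?R)" by (simp add: pushforward_def sm)
  finally show ?thesis unfolding FR .
qed

end

theorem mainTheorem6:
  fixes \<Gamma> :: "('m::{t2_space,second_countable_topology}, 'e::euclidean_space,
                'g::{t2_space,second_countable_topology}, 'f::euclidean_space,
                'n::{finite,linorder}) cartan_data"
    and p :: nat and x :: 'm and W1 W2 :: "'m set" and s1 s2 :: "'m \<Rightarrow> 'm"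
  assumes "p \<le> CARD('n)"
    and "parabolic_geometry p \<Gamma>"
    and "regular_geometry p \<Gamma>"
    and "normal_geometry p \<Gamma>"
    and "strictly_pseudoconvex p \<Gamma>"
    and "symmetric_geometry p \<Gamma>"
    and "symmetry_at p \<Gamma> x W1 s1" and "involutive_at x s1"
    and "symmetry_at p \<Gamma> x W2 s2" and "involutive_at x s2"
    and "\<not> same_germ_at x s1 s2"
  shows "harmonic_curvature_vanishes_at p \<Gamma> x"
  unfolding harmonic_curvature_vanishes_at_def
proof (intro allI impI)
  fix u assume u: "bproj \<Gamma> u = x"
  note PG = assms(2) and norm = assms(4) and s1 = assms(7)[folded u] and s2 = assms(9)[folded u]
  obtain \<phi>1 where \<phi>1: "local_automorphism p \<Gamma> W1 s1 \<phi>1" using s1 by (auto simp: symmetry_at_def)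
  obtain \<phi>2 where \<phi>2: "local_automorphism p \<Gamma> W2 s2 \<phi>2" using s2 by (auto simp: symmetry_at_def)
  have W: "open W1" "bproj \<Gamma> u \<in> W1" "open W2" "bproj \<Gamma> u \<in> W2"
    using s1 s2 by (auto simp: symmetry_at_def local_diffeo_def)
  obtain W where W': "W \<in> gfilt p 1" "W \<noteq> 0" "\<phi>2 u = ract \<Gamma> (\<phi>1 u) (cls p (mexp W))"
    by (rule two_symmetries_translation[OF PG s1 \<phi>1 s2 \<phi>2]) (use assms(11) u in auto)
  obtain X r where X: "X \<in> su p" "r \<noteq> 0" "mexp W ** X ** mexp (- W) - X - r *\<^sub>R grading \<in> gfilt p 1"
    by (rule test_direction[OF W'(1,2) definite_form[OF PG assms(3,5)]], rule that)
  define Y where "Y = mexp W ** X ** mexp (- W)"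
  define M where "M = Y - X"
  have Mg: "M - r *\<^sub>R grading \<in> gfilt p 1" using X(3) by (simp add: M_def Y_def)
  have "(M - r *\<^sub>R grading) + r *\<^sub>R grading \<in> gfilt p 0"
    by (intro subspace_add[OF subspace_gfilt] subspace_scale[OF subspace_gfilt] grading_gfilt gfilt_mono[OF Mg]) simp
  then have M: "M \<in> gfilt p 0" by simp
  have "Y = M + X" by (simp add: M_def)
  then have Y: "Y \<in> su p" using subspace_add[OF subspace_su gfilt_su[OF M] X(1)] by simp
  let ?\<kappa> = "curvature p \<Gamma>" and ?u = "\<phi>1 u"
  have ker: "?\<kappa> w \<in> ker_codiff p" for w using norm by (simp add: normal_geometry_def)
  have "?\<kappa> ?u \<in> im_codiff p"
  proof (rule vanishing_criterion[OF ker gfilt_su[OF M] X(2) Mg])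
    fix y :: "'n fvec" assume y: "annihilates p y"
    let ?F = "\<lambda>w. enc p (?\<kappa> w) \<bullet> y"
    have "const_field \<Gamma> Y ?u ?F = const_field \<Gamma> X (\<phi>2 u) ?F"
      unfolding W'(3) Y_def by (rule curvature_derivative_pplus[OF PG norm W'(1) y X(1), symmetric])
    also have "\<dots> = const_field \<Gamma> X u ?F"
      by (rule curvature_derivative_automorphism[OF PG norm \<phi>2 W(3,4) X(1)])
    also have "\<dots> = const_field \<Gamma> X ?u ?F"
      by (rule curvature_derivative_automorphism[OF PG norm \<phi>1 W(1,2) X(1), symmetric])
    finally have "const_field \<Gamma> (1 *\<^sub>R Y + (-1) *\<^sub>R X) ?u ?F = 0"
      unfolding const_field_linear[OF PG Y X(1)] by simp
    then have d: "const_field \<Gamma> M ?u ?F = 0" by (simp add: M_def)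
    obtain c where c: "?\<kappa> ?u = form2 p c" by (rule ker_codiffE[OF ker])
    from fundamental_field_curvature[OF PG M c, of y] d
    show "enc p (restrict_su p (lact M (?\<kappa> ?u))) \<bullet> y = 0" by simp
  qed
  then have "?\<kappa> u \<in> im_codiff p" using curvature_automorphism[OF PG norm \<phi>1 W(1,2)] by simp
  then show "harmonic_curvature p \<Gamma> u = im_codiff p" unfolding harmonic_curvature_def by (rule coset_of_member)
qed

end
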